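(* Let $\mathscr{J}$ be a system of arities in a symmetric monoidal closed category $\mathscr{V}$ such that $\mathscr{V}_0$ has pullbacks, let $\mathscr{C}$ be a $\mathscr{J}$-admissible $\mathscr{V}$-category, and let $A$ be an algebra in $\mathscr{C}$. Then: (1) $A$ is balanced if and only if $A$ is commutative, contracommutative, and saturated. (2) $A^\perp$ is balanced if and only if $A$ is commutative and contracommutative.
   Context: Base setting. $\mathscr{V}$ is a symmetric monoidal closed category with unit object $I$ and underlying ordinary category $\mathscr{V}_0$. By universe enlargement, $\mathscr{V}$ is a full subcategory of a symmetric monoidal closed category $\mathscr{V}'$ that is complete and cocomplete relative to a universe in which everything considered is small, with $\mathscr{V}\hookrightarrow\mathscr{V}'$ preserving all limits that exist in $\mathscr{V}$; $\mathscr{V}$-functor categories exist as $\mathscr{V}'$-categories. A system of arities is a fully faithful symmetric strong monoidal $\mathscr{V}$-functor $\mathscr{J}\to\mathscr{V}$, written as the inclusion of a full sub-$\mathscr{V}$-category containing $I$ and closed under $\otimes$ ($\mathscr{J}$ need not be small). A $\mathscr{J}$-cotensor in a $\mathscr{V}$-category is a cotensor $[J,C]$ with $J\in\mathrm{ob}\,\mathscr{J}$; $\mathscr{V}$-categories with $\mathscr{J}$-cotensors are equipped with designated ones, with $[I,C]=C$ (and identity counit). A $\mathscr{J}$-theory is a $\mathscr{V}$-category $\mathscr{T}$ equipped with an identity-on-objects $\mathscr{V}$-functor $\tau:\mathscr{J}^{\mathrm{op}}\to\mathscr{T}$ that preserves $\mathscr{J}$-cotensors; equivalently, $\mathrm{ob}\,\mathscr{T}=\mathrm{ob}\,\mathscr{J}$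 and each object $J$ is equipped with a morphism $J\to\mathscr{T}(J,I)$ exhibiting $J$ as a cotensor $[J,I]$ in $\mathscr{T}$, which for $J=I$ is the identity on $I$. A morphism of $\mathscr{J}$-theories is a $\mathscr{V}$-functor commuting with the structure $\mathscr{V}$-functors $\tau$. For a $\mathscr{V}$-category $\mathscr{C}$ with $\mathscr{J}$-cotensors, a $\mathscr{T}$-algebra in $\mathscr{C}$ is a $\mathscr{V}$-functor $A:\mathscr{T}\to\mathscr{C}$ preserving $\mathscr{J}$-cotensors; its carrier is $|A|=A(I)$. $\mathscr{T}\text{-}\mathrm{Alg}(\mathscr{C})$ is the full sub-$\mathscr{V}'$-category of $[\mathscr{T},\mathscr{C}]$ on the $\mathscr{T}$-algebras; for a morphism $f$ in it, $|f|=f_I$. $\mathscr{C}$ is $\mathscr{J}$-admissible if it has $\mathscr{J}$-cotensors and for every $\mathscr{J}$-theory $\mathscr{T}$ the ends defining the hom-objects of $\mathscr{T}\text{-}\mathrm{Alg}(\mathscr{C})$ exist in $\mathscr{V}$ (so it is a $\mathscr{V}$-category). $\mathscr{J}$-cotensors in $\mathscr{T}\text{-}\mathrm{Alg}(\mathscr{C})$ are pointwise, with designated ones chosen so that evaluation at $I$ sends them to the designated ones in $\mathscr{C}$. Algebras and commutants. An algebra in $\mathscr{C}$ is a pair $(\mathscr{T},A)$ (also written $A$) with $\mathscr{T}$ a $\mathscr{J}$-theory and $A$ a $\mathscr{T}$-algebra in $\mathscr{C}$. For an object $C$ of $\mathscr{C}$, $\mathrm{Alg}(C)$ is the category of algebras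 with carrier $C$, where a morphism $(M,f):(\mathscr{T},A)\to(\mathscr{U},B)$ consists of a morphism of $\mathscr{J}$-theories $M:\mathscr{T}\to\mathscr{U}$ and an isomorphism $f:A\to BM$ of $\mathscr{T}$-algebras with $|f|=1_C$. The commutant of $(\mathscr{T},A)$ is the algebra $A^\perp=(\mathscr{T}^\perp_A,A^\perp)$, where $\mathscr{T}^\perp_A$ is the $\mathscr{J}$-theory with $\mathscr{T}^\perp_A(J,K)=\mathscr{T}\text{-}\mathrm{Alg}(\mathscr{C})([J,A],[K,A])$ ($J,K\in\mathrm{ob}\,\mathscr{J}$), with composition and identities as in $\mathscr{T}\text{-}\mathrm{Alg}(\mathscr{C})$ and structure morphisms $J\to\mathscr{T}\text{-}\mathrm{Alg}(\mathscr{C})([J,A],A)$ the cotensor counits, and $A^\perp:\mathscr{T}^\perp_A\to\mathscr{C}$ is the algebra on $|A|$ given by $J\mapsto[J,|A|]$ and on homs by evaluation at $I$. Given algebras $A,B$ on $C$, $A$ commutes with $B$ if there is a (necessarily unique) morphism $B\to A^\perp$ in $\mathrm{Alg}(C)$. An algebra $A$ with carrier $C$ is commutative if $A$ commutes with itself; contracommutative if $A^\perp$ is commutative; saturated if the unique morphism $A\to A^{\perp\perp}$ in $\mathrm{Alg}(C)$ is an isomorphism (equivalently, $A\cong A^{\perp\perp}$ in $\mathrm{Alg}(C)$); balanced if $A\cong A^\perp$ in $\mathrm{Alg}(C)$. *)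

theory Defs
  imports Main "HOL-Library.FuncSet"
begin

section \<open>Ordinary categories\<close>

record ('o, 'm) cat =
  obj :: "'o set"
  arr :: "'m set"
  src :: "'m \<Rightarrow> 'o"
  tgt :: "'m \<Rightarrow> 'o"
  idm :: "'o \<Rightarrow> 'm"
  cmp :: "'m \<Rightarrow> 'm \<Rightarrow> 'm"  (infixl "\<cdot>\<index>" 70)

definition homs :: "('o, 'm, 'z) cat_scheme \<Rightarrow> 'o \<Rightarrow> 'o \<Rightarrow> 'm set" where
  "homs K a b = {f \<in> arr K. src K f = a \<and> tgt K f = b}"

definition inverse_arrows :: "('o, 'm, 'z) cat_scheme \<Rightarrow> 'm \<Rightarrow> 'm \<Rightarrow> bool" where
  "inverse_arrows K f g \<longleftrightarrow>
     g \<in> homs K (tgt K f) (src K f) \<and>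
     g \<cdot>\<^bsub>K\<^esub> f = idm K (src K f) \<and> f \<cdot>\<^bsub>K\<^esub> g = idm K (tgt K f)"

definition iso_arrow :: "('o, 'm, 'z) cat_scheme \<Rightarrow> 'm \<Rightarrow> bool" where
  "iso_arrow K f \<longleftrightarrow> f \<in> arr K \<and> (\<exists>g. inverse_arrows K f g)"

definition inv_arrow :: "('o, 'm, 'z) cat_scheme \<Rightarrow> 'm \<Rightarrow> 'm" where
  "inv_arrow K f = (THE g. inverse_arrows K f g)"

definition isomorphic :: "('o, 'm, 'z) cat_scheme \<Rightarrow> 'o \<Rightarrow> 'o \<Rightarrow> bool" where
  "isomorphic K a b \<longleftrightarrow> (\<exists>f \<in> homs K a b. iso_arrow K f)"

definition is_pullback :: "('o, 'm, 'z) cat_scheme \<Rightarrow> 'm \<Rightarrow> 'm \<Rightarrow> 'm \<Rightarrow> 'm \<Rightarrow> bool" where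
  "is_pullback K f g p q \<longleftrightarrow>
     p \<in> arr K \<and> q \<in> arr K \<and> src K p = src K q \<and>
     tgt K p = src K f \<and> tgt K q = src K g \<and> f \<cdot>\<^bsub>K\<^esub> p = g \<cdot>\<^bsub>K\<^esub> q \<and>
     (\<forall>h \<in> arr K. \<forall>k \<in> arr K.
        src K h = src K k \<and> tgt K h = src K f \<and> tgt K k = src K g \<and> f \<cdot>\<^bsub>K\<^esub> h = g \<cdot>\<^bsub>K\<^esub> k \<longrightarrow>
        (\<exists>!u. u \<in> homs K (src K h) (src K p) \<and> p \<cdot>\<^bsub>K\<^esub> u = h \<and> q \<cdot>\<^bsub>K\<^esub> u = k))"

definition has_pullbacks :: "('o, 'm, 'z) cat_scheme \<Rightarrow> bool" where
  "has_pullbacks K \<longleftrightarrow>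
     (\<forall>f \<in> arr K. \<forall>g \<in> arr K. tgt K f = tgt K g \<longrightarrow> (\<exists>p q. is_pullback K f g p q))"

locale category =
  fixes V :: "('o, 'm, 'z) cat_scheme" (structure)
  assumes src_obj: "f \<in> arr V \<Longrightarrow> src V f \<in> obj V"
    and tgt_obj: "f \<in> arr V \<Longrightarrow> tgt V f \<in> obj V"
    and idm_hom: "a \<in> obj V \<Longrightarrow> idm V a \<in> homs V a a"
    and cmp_hom: "\<lbrakk>f \<in> homs V a b; g \<in> homs V b c\<rbrakk> \<Longrightarrow> g \<cdot> f \<in> homs V a c"
    and cmp_assoc: "\<lbrakk>f \<in> homs V a b; g \<in> homs V b c; h \<in> homs V c d\<rbrakk> \<Longrightarrow> (h \<cdot> g) \<cdot> f = h \<cdot> (g \<cdot> f)"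
    and cmp_idm_left: "f \<in> homs V a b \<Longrightarrow> idm V b \<cdot> f = f"
    and cmp_idm_right: "f \<in> homs V a b \<Longrightarrow> f \<cdot> idm V a = f"


section \<open>Symmetric monoidal closed categories\<close>

record ('o, 'm) smc = "('o, 'm) cat" +
  ten :: "'o \<Rightarrow> 'o \<Rightarrow> 'o"  (infixl "\<otimes>\<index>" 75)
  tenm :: "'m \<Rightarrow> 'm \<Rightarrow> 'm"  (infixl "\<otimes>\<^sub>m\<index>" 75)
  unit_obj :: "'o"  ("\<one>\<index>")
  assoc :: "'o \<Rightarrow> 'o \<Rightarrow> 'o \<Rightarrow> 'm"
  lunit :: "'o \<Rightarrow> 'm"
  runit :: "'o \<Rightarrow> 'm"
  symm :: "'o \<Rightarrow> 'o \<Rightarrow> 'm"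
  ihom :: "'o \<Rightarrow> 'o \<Rightarrow> 'o"
  ev :: "'o \<Rightarrow> 'o \<Rightarrow> 'm"

locale sym_monoidal_closed = category V
  for V :: "('o, 'm) smc" (structure) +
  assumes ten_obj: "\<lbrakk>a \<in> obj V; b \<in> obj V\<rbrakk> \<Longrightarrow> a \<otimes> b \<in> obj V"
    and tenm_hom: "\<lbrakk>f \<in> homs V a b; g \<in> homs V c d\<rbrakk> \<Longrightarrow> f \<otimes>\<^sub>m g \<in> homs V (a \<otimes> c) (b \<otimes> d)"
    and tenm_idm: "\<lbrakk>a \<in> obj V; b \<in> obj V\<rbrakk> \<Longrightarrow> idm V a \<otimes>\<^sub>m idm V b = idm V (a \<otimes> b)"
    and tenm_cmp: "\<lbrakk>f \<in> homs V a b; f' \<in> homs V b c; g \<in> homs V a' b'; g' \<in> homs V b' c'\<rbrakk> \<Longrightarrow>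
          (f' \<cdot> f) \<otimes>\<^sub>m (g' \<cdot> g) = (f' \<otimes>\<^sub>m g') \<cdot> (f \<otimes>\<^sub>m g)"
    and unit_obj: "\<one> \<in> obj V"
    and assoc_hom: "\<lbrakk>a \<in> obj V; b \<in> obj V; c \<in> obj V\<rbrakk> \<Longrightarrow>
          assoc V a b c \<in> homs V ((a \<otimes> b) \<otimes> c) (a \<otimes> (b \<otimes> c))"
    and assoc_iso: "\<lbrakk>a \<in> obj V; b \<in> obj V; c \<in> obj V\<rbrakk> \<Longrightarrow> iso_arrow V (assoc V a b c)"
    and assoc_natural: "\<lbrakk>f \<in> homs V a a'; g \<in> homs V b b'; h \<in> homs V c c'\<rbrakk> \<Longrightarrow>
          assoc V a' b' c' \<cdot> ((f \<otimes>\<^sub>m g) \<otimes>\<^sub>m h) = (f \<otimes>\<^sub>m (g \<otimes>\<^sub>m h)) \<cdot> assoc V a b c"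
    and lunit_hom: "a \<in> obj V \<Longrightarrow> lunit V a \<in> homs V (\<one> \<otimes> a) a"
    and lunit_iso: "a \<in> obj V \<Longrightarrow> iso_arrow V (lunit V a)"
    and lunit_natural: "f \<in> homs V a b \<Longrightarrow> lunit V b \<cdot> (idm V \<one> \<otimes>\<^sub>m f) = f \<cdot> lunit V a"
    and runit_hom: "a \<in> obj V \<Longrightarrow> runit V a \<in> homs V (a \<otimes> \<one>) a"
    and runit_iso: "a \<in> obj V \<Longrightarrow> iso_arrow V (runit V a)"
    and runit_natural: "f \<in> homs V a b \<Longrightarrow> runit V b \<cdot> (f \<otimes>\<^sub>m idm V \<one>) = f \<cdot> runit V a"
    and pentagon: "\<lbrakk>a \<in> obj V; b \<in> obj V; c \<in> obj V; d \<in> obj V\<rbrakk> \<Longrightarrow>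
          assoc V a b (c \<otimes> d) \<cdot> assoc V (a \<otimes> b) c d =
          (idm V a \<otimes>\<^sub>m assoc V b c d) \<cdot> assoc V a (b \<otimes> c) d \<cdot> (assoc V a b c \<otimes>\<^sub>m idm V d)"
    and triangle: "\<lbrakk>a \<in> obj V; b \<in> obj V\<rbrakk> \<Longrightarrow>
          (idm V a \<otimes>\<^sub>m lunit V b) \<cdot> assoc V a \<one> b = runit V a \<otimes>\<^sub>m idm V b"
    and symm_hom: "\<lbrakk>a \<in> obj V; b \<in> obj V\<rbrakk> \<Longrightarrow> symm V a b \<in> homs V (a \<otimes> b) (b \<otimes> a)"
    and symm_natural: "\<lbrakk>f \<in> homs V a a'; g \<in> homs V b b'\<rbrakk> \<Longrightarrow>
          symm V a' b' \<cdot> (f \<otimes>\<^sub>m g) = (g \<otimes>\<^sub>m f) \<cdot> symm V a b"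
    and symm_symm: "\<lbrakk>a \<in> obj V; b \<in> obj V\<rbrakk> \<Longrightarrow> symm V b a \<cdot> symm V a b = idm V (a \<otimes> b)"
    and hexagon: "\<lbrakk>a \<in> obj V; b \<in> obj V; c \<in> obj V\<rbrakk> \<Longrightarrow>
          assoc V b c a \<cdot> symm V a (b \<otimes> c) \<cdot> assoc V a b c =
          (idm V b \<otimes>\<^sub>m symm V a c) \<cdot> assoc V b a c \<cdot> (symm V a b \<otimes>\<^sub>m idm V c)"
    and symm_unit: "a \<in> obj V \<Longrightarrow> lunit V a \<cdot> symm V a \<one> = runit V a"
    and ihom_obj: "\<lbrakk>a \<in> obj V; b \<in> obj V\<rbrakk> \<Longrightarrow> ihom V a b \<in> obj V"
    and ev_hom: "\<lbrakk>a \<in> obj V; b \<in> obj V\<rbrakk> \<Longrightarrow> ev V a b \<in> homs V (ihom V a b \<otimes> a) b"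
    and ev_universal: "\<lbrakk>a \<in> obj V; b \<in> obj V; w \<in> obj V; f \<in> homs V (w \<otimes> a) b\<rbrakk> \<Longrightarrow>
          \<exists>!g. g \<in> homs V w (ihom V a b) \<and> ev V a b \<cdot> (g \<otimes>\<^sub>m idm V a) = f"


section \<open>Enriched categories and functors\<close>

record ('c, 'o, 'm) vcat =
  vob :: "'c set"
  vhom :: "'c \<Rightarrow> 'c \<Rightarrow> 'o"
  vid :: "'c \<Rightarrow> 'm"
  vcomp :: "'c \<Rightarrow> 'c \<Rightarrow> 'c \<Rightarrow> 'm"

record ('a, 'b, 'm) vfun =
  fobj :: "'a \<Rightarrow> 'b"
  fhom :: "'a \<Rightarrow> 'a \<Rightarrow> 'm"

text \<open>Functors take the value \<open>undefined\<close> outside their domain, so that equality of records is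
  equality of functors.\<close>

definition mk_vfun ::
    "'a set \<Rightarrow> ('a \<Rightarrow> 'b) \<Rightarrow> ('a \<Rightarrow> 'a \<Rightarrow> 'm) \<Rightarrow> ('a, 'b, 'm) vfun" where
  "mk_vfun S f h =
     \<lparr>fobj = (\<lambda>X \<in> S. f X), fhom = (\<lambda>X Y. if X \<in> S \<and> Y \<in> S then h X Y else undefined)\<rparr>"

text \<open>Designated cotensors \<open>[J,X]\<close> (\<open>cot J X\<close>) with counits \<open>J \<rightarrow> C([J,X],X)\<close> (\<open>cotu J X\<close>).\<close>

record ('c, 'o, 'm) cvcat = "('c, 'o, 'm) vcat" +
  cot :: "'o \<Rightarrow> 'c \<Rightarrow> 'c"
  cotu :: "'o \<Rightarrow> 'c \<Rightarrow> 'm"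

record ('o, 'm) jtheory = "('o, 'o, 'm) vcat" +
  tau :: "('o, 'o, 'm) vfun"

context sym_monoidal_closed
begin

definition curry_arr :: "'o \<Rightarrow> 'o \<Rightarrow> 'o \<Rightarrow> 'm \<Rightarrow> 'm" where
  "curry_arr w a b f = (THE g. g \<in> homs V w (ihom V a b) \<and> ev V a b \<cdot> (g \<otimes>\<^sub>m idm V a) = f)"

definition vcategory :: "('c, 'o, 'm, 'z) vcat_scheme \<Rightarrow> bool" where
  "vcategory C \<longleftrightarrow>
     (\<forall>X \<in> vob C. \<forall>Y \<in> vob C. vhom C X Y \<in> obj V) \<and>
     (\<forall>X \<in> vob C. vid C X \<in> homs V \<one> (vhom C X X)) \<and>
     (\<forall>X \<in> vob C. \<forall>Y \<in> vob C. \<forall>Z \<in> vob C.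
        vcomp C X Y Z \<in> homs V (vhom C Y Z \<otimes> vhom C X Y) (vhom C X Z)) \<and>
     (\<forall>W \<in> vob C. \<forall>X \<in> vob C. \<forall>Y \<in> vob C. \<forall>Z \<in> vob C.
        vcomp C W X Z \<cdot> (vcomp C X Y Z \<otimes>\<^sub>m idm V (vhom C W X)) =
        vcomp C W Y Z \<cdot> (idm V (vhom C Y Z) \<otimes>\<^sub>m vcomp C W X Y)
          \<cdot> assoc V (vhom C Y Z) (vhom C X Y) (vhom C W X)) \<and>
     (\<forall>X \<in> vob C. \<forall>Y \<in> vob C.
        vcomp C X Y Y \<cdot> (vid C Y \<otimes>\<^sub>m idm V (vhom C X Y)) = lunit V (vhom C X Y) \<and>
        vcomp C X X Y \<cdot> (idm V (vhom C X Y) \<otimes>\<^sub>m vid C X) = runit V (vhom C X Y))"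

definition vfunctor ::
    "('a, 'o, 'm, 'y) vcat_scheme \<Rightarrow> ('b, 'o, 'm, 'z) vcat_scheme \<Rightarrow> ('a, 'b, 'm) vfun \<Rightarrow> bool" where
  "vfunctor A B F \<longleftrightarrow>
     fobj F \<in> vob A \<rightarrow>\<^sub>E vob B \<and>
     (\<forall>X Y. X \<notin> vob A \<or> Y \<notin> vob A \<longrightarrow> fhom F X Y = undefined) \<and>
     (\<forall>X \<in> vob A. \<forall>Y \<in> vob A. fhom F X Y \<in> homs V (vhom A X Y) (vhom B (fobj F X) (fobj F Y))) \<and>
     (\<forall>X \<in> vob A. fhom F X X \<cdot> vid A X = vid B (fobj F X)) \<and>
     (\<forall>X \<in> vob A. \<forall>Y \<in> vob A. \<forall>Z \<in> vob A.
        fhom F X Z \<cdot> vcomp A X Y Z =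
        vcomp B (fobj F X) (fobj F Y) (fobj F Z) \<cdot> (fhom F Y Z \<otimes>\<^sub>m fhom F X Y))"

definition vfun_id :: "('a, 'o, 'm, 'z) vcat_scheme \<Rightarrow> ('a, 'a, 'm) vfun" where
  "vfun_id A = mk_vfun (vob A) (\<lambda>X. X) (\<lambda>X Y. idm V (vhom A X Y))"

definition vfun_comp ::
    "('a, 'o, 'm, 'z) vcat_scheme \<Rightarrow> ('b, 'c, 'm) vfun \<Rightarrow> ('a, 'b, 'm) vfun \<Rightarrow> ('a, 'c, 'm) vfun" where
  "vfun_comp A G F =
     mk_vfun (vob A) (\<lambda>X. fobj G (fobj F X)) (\<lambda>X Y. fhom G (fobj F X) (fobj F Y) \<cdot> fhom F X Y)"

definition self_vcat :: "('o, 'o, 'm) vcat" where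
  "self_vcat =
     \<lparr>vob = obj V, vhom = ihom V,
      vid = (\<lambda>a. curry_arr \<one> a a (lunit V a)),
      vcomp = (\<lambda>a b c. curry_arr (ihom V b c \<otimes> ihom V a b) a c
                 (ev V b c \<cdot> (idm V (ihom V b c) \<otimes>\<^sub>m ev V a b) \<cdot> assoc V (ihom V b c) (ihom V a b) a))\<rparr>"

definition full_subvcat :: "('c, 'o, 'm) vcat \<Rightarrow> 'c set \<Rightarrow> ('c, 'o, 'm) vcat" where
  "full_subvcat C S = C\<lparr>vob := S\<rparr>"

definition op_vcat :: "('c, 'o, 'm) vcat \<Rightarrow> ('c, 'o, 'm) vcat" where
  "op_vcat C =
     \<lparr>vob = vob C, vhom = (\<lambda>X Y. vhom C Y X), vid = vid C,
      vcomp = (\<lambda>X Y Z. vcomp C Z Y X \<cdot> symm V (vhom C Z Y) (vhom C Y X))\<rparr>"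

text \<open>Composition and inverses in the underlying ordinary category of \<open>C\<close>, whose arrows
  \<open>X \<rightarrow> Y\<close> are the arrows \<open>I \<rightarrow> C(X,Y)\<close> of \<open>V\<close>.\<close>

definition ucomp :: "('c, 'o, 'm, 'z) vcat_scheme \<Rightarrow> 'c \<Rightarrow> 'c \<Rightarrow> 'c \<Rightarrow> 'm \<Rightarrow> 'm \<Rightarrow> 'm" where
  "ucomp C X Y Z g f = vcomp C X Y Z \<cdot> (g \<otimes>\<^sub>m f) \<cdot> inv_arrow V (lunit V \<one>)"

subsection \<open>Cotensors\<close>

text \<open>The canonical arrow \<open>C(Y,P) \<rightarrow> [J, C(Y,X)]\<close> induced by \<open>\<gamma> : J \<rightarrow> C(P,X)\<close>.\<close>

definition cotensor_comparison ::
    "('c, 'o, 'm, 'z) vcat_scheme \<Rightarrow> 'o \<Rightarrow> 'c \<Rightarrow> 'c \<Rightarrow> 'm \<Rightarrow> 'c \<Rightarrow> 'm" where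
  "cotensor_comparison C J X P \<gamma> Y =
     curry_arr (vhom C Y P) J (vhom C Y X)
       (vcomp C Y P X \<cdot> (\<gamma> \<otimes>\<^sub>m idm V (vhom C Y P)) \<cdot> symm V (vhom C Y P) J)"

definition is_cotensor ::
    "('c, 'o, 'm, 'z) vcat_scheme \<Rightarrow> 'o \<Rightarrow> 'c \<Rightarrow> 'c \<Rightarrow> 'm \<Rightarrow> bool" where
  "is_cotensor C J X P \<gamma> \<longleftrightarrow>
     J \<in> obj V \<and> X \<in> vob C \<and> P \<in> vob C \<and> \<gamma> \<in> homs V J (vhom C P X) \<and>
     (\<forall>Y \<in> vob C. iso_arrow V (cotensor_comparison C J X P \<gamma> Y))"

text \<open>The arrow \<open>W \<rightarrow> C(Y,P)\<close> corresponding to \<open>f : W \<otimes> J \<rightarrow> C(Y,X)\<close> when \<open>\<gamma>\<close> exhibits \<open>P\<close> as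
  the cotensor \<open>[J,X]\<close>.\<close>

definition cotensor_lift ::
    "('c, 'o, 'm, 'z) vcat_scheme \<Rightarrow> 'o \<Rightarrow> 'c \<Rightarrow> 'c \<Rightarrow> 'm \<Rightarrow> 'c \<Rightarrow> 'o \<Rightarrow> 'm \<Rightarrow> 'm" where
  "cotensor_lift C J X P \<gamma> Y W f =
     inv_arrow V (cotensor_comparison C J X P \<gamma> Y) \<cdot> curry_arr W J (vhom C Y X) f"

definition preserves_cotensors ::
    "'o set \<Rightarrow> ('a, 'o, 'm, 'y) vcat_scheme \<Rightarrow> ('b, 'o, 'm, 'z) vcat_scheme \<Rightarrow> ('a, 'b, 'm) vfun \<Rightarrow> bool"
  where
  "preserves_cotensors \<J> A B F \<longleftrightarrow>
     (\<forall>J \<in> \<J>. \<forall>X P \<gamma>. is_cotensor A J X P \<gamma> \<longrightarrow>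
        is_cotensor B J (fobj F X) (fobj F P) (fhom F P X \<cdot> \<gamma>))"

text \<open>The action \<open>C(X,Y) \<rightarrow> C([J,X],[J,Y])\<close> of the functor \<open>[J,-]\<close> given by the designated
  cotensors.\<close>

definition cot_hom :: "('c, 'o, 'm, 'z) cvcat_scheme \<Rightarrow> 'o \<Rightarrow> 'c \<Rightarrow> 'c \<Rightarrow> 'm" where
  "cot_hom C J X Y =
     cotensor_lift C J Y (cot C J Y) (cotu C J Y) (cot C J X) (vhom C X Y)
       (vcomp C (cot C J X) X Y \<cdot> (idm V (vhom C X Y) \<otimes>\<^sub>m cotu C J X))"

definition has_designated_cotensors :: "'o set \<Rightarrow> ('c, 'o, 'm, 'z) cvcat_scheme \<Rightarrow> bool" where
  "has_designated_cotensors \<J> C \<longleftrightarrow>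
     (\<forall>J \<in> \<J>. \<forall>X \<in> vob C. is_cotensor C J X (cot C J X) (cotu C J X)) \<and>
     (\<forall>X \<in> vob C. cot C \<one> X = X \<and> cotu C \<one> X = vid C X)"

subsection \<open>Natural families and ends\<close>

text \<open>\<open>\<alpha>\<close> is an extraordinarily \<open>V\<close>-natural family \<open>\<alpha>\<^sub>X : E \<rightarrow> C(FX,GX)\<close>.  The condition is the
  transpose, under the adjunction between tensor and internal hom, of the usual one, the
  equality of two arrows \<open>T(X,Y) \<rightarrow> [E, C(FX,GY)]\<close>.\<close>

definition vnat_family ::
    "('a, 'o, 'm, 'y) vcat_scheme \<Rightarrow> ('c, 'o, 'm, 'z) vcat_scheme \<Rightarrow>
     ('a, 'c, 'm) vfun \<Rightarrow> ('a, 'c, 'm) vfun \<Rightarrow> 'o \<Rightarrow> ('a \<Rightarrow> 'm) \<Rightarrow> bool" where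
  "vnat_family T C F G E \<alpha> \<longleftrightarrow>
     (\<forall>X \<in> vob T. \<alpha> X \<in> homs V E (vhom C (fobj F X) (fobj G X))) \<and>
     (\<forall>X \<in> vob T. \<forall>Y \<in> vob T.
        vcomp C (fobj F X) (fobj F Y) (fobj G Y) \<cdot> (\<alpha> Y \<otimes>\<^sub>m fhom F X Y) =
        vcomp C (fobj F X) (fobj G X) (fobj G Y) \<cdot> (fhom G X Y \<otimes>\<^sub>m \<alpha> X) \<cdot> symm V E (vhom T X Y))"

text \<open>\<open>(E,\<pi>)\<close> is an end of \<open>C(F-,G-)\<close>, i.e. a hom-object from \<open>F\<close> to \<open>G\<close> of the functor
  category.\<close>

definition is_hom_end ::
    "('a, 'o, 'm, 'y) vcat_scheme \<Rightarrow> ('c, 'o, 'm, 'z) vcat_scheme \<Rightarrow>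
     ('a, 'c, 'm) vfun \<Rightarrow> ('a, 'c, 'm) vfun \<Rightarrow> 'o \<times> ('a \<Rightarrow> 'm) \<Rightarrow> bool" where
  "is_hom_end T C F G = (\<lambda>(E, \<pi>).
     E \<in> obj V \<and> vnat_family T C F G E \<pi> \<and>
     (\<forall>W \<in> obj V. \<forall>\<alpha>. vnat_family T C F G W \<alpha> \<longrightarrow>
        (\<exists>!u. u \<in> homs V W E \<and> (\<forall>X \<in> vob T. \<pi> X \<cdot> u = \<alpha> X))))"

definition hom_end ::
    "('a, 'o, 'm, 'y) vcat_scheme \<Rightarrow> ('c, 'o, 'm, 'z) vcat_scheme \<Rightarrow>
     ('a, 'c, 'm) vfun \<Rightarrow> ('a, 'c, 'm) vfun \<Rightarrow> 'o \<times> ('a \<Rightarrow> 'm)" where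
  "hom_end T C F G = (SOME e. is_hom_end T C F G e)"

definition end_obj ::
    "('a, 'o, 'm, 'y) vcat_scheme \<Rightarrow> ('c, 'o, 'm, 'z) vcat_scheme \<Rightarrow>
     ('a, 'c, 'm) vfun \<Rightarrow> ('a, 'c, 'm) vfun \<Rightarrow> 'o" where
  "end_obj T C F G = fst (hom_end T C F G)"

definition end_proj ::
    "('a, 'o, 'm, 'y) vcat_scheme \<Rightarrow> ('c, 'o, 'm, 'z) vcat_scheme \<Rightarrow>
     ('a, 'c, 'm) vfun \<Rightarrow> ('a, 'c, 'm) vfun \<Rightarrow> 'a \<Rightarrow> 'm" where
  "end_proj T C F G = snd (hom_end T C F G)"

definition end_lift ::
    "('a, 'o, 'm, 'y) vcat_scheme \<Rightarrow> ('c, 'o, 'm, 'z) vcat_scheme \<Rightarrow>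
     ('a, 'c, 'm) vfun \<Rightarrow> ('a, 'c, 'm) vfun \<Rightarrow> 'o \<Rightarrow> ('a \<Rightarrow> 'm) \<Rightarrow> 'm" where
  "end_lift T C F G W \<alpha> =
     (THE u. u \<in> homs V W (end_obj T C F G) \<and> (\<forall>X \<in> vob T. end_proj T C F G X \<cdot> u = \<alpha> X))"

text \<open>Natural transformations are natural families with vertex \<open>I\<close>.\<close>

definition vnat_trans ::
    "('a, 'o, 'm, 'y) vcat_scheme \<Rightarrow> ('c, 'o, 'm, 'z) vcat_scheme \<Rightarrow>
     ('a, 'c, 'm) vfun \<Rightarrow> ('a, 'c, 'm) vfun \<Rightarrow> ('a \<Rightarrow> 'm) \<Rightarrow> bool" where
  "vnat_trans T C F G \<alpha> \<longleftrightarrow> \<alpha> \<in> extensional (vob T) \<and> vnat_family T C F G \<one> \<alpha>"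

definition vnat_iso ::
    "('a, 'o, 'm, 'y) vcat_scheme \<Rightarrow> ('c, 'o, 'm, 'z) vcat_scheme \<Rightarrow>
     ('a, 'c, 'm) vfun \<Rightarrow> ('a, 'c, 'm) vfun \<Rightarrow> ('a \<Rightarrow> 'm) \<Rightarrow> bool" where
  "vnat_iso T C F G \<alpha> \<longleftrightarrow>
     vnat_trans T C F G \<alpha> \<and>
     (\<exists>\<beta>. vnat_trans T C G F \<beta> \<and>
        (\<forall>X \<in> vob T.
           ucomp C (fobj F X) (fobj G X) (fobj F X) (\<beta> X) (\<alpha> X) = vid C (fobj F X) \<and>
           ucomp C (fobj G X) (fobj F X) (fobj G X) (\<alpha> X) (\<beta> X) = vid C (fobj G X)))"

end


section \<open>Theories and algebras for a system of arities\<close>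

text \<open>A system of arities is given by the object set \<open>\<J>\<close> of a full sub-\<open>V\<close>-category of \<open>V\<close>.\<close>

locale arity_system = sym_monoidal_closed V
  for V :: "('o, 'm) smc" (structure) +
  fixes \<J> :: "'o set"
  assumes arities_subset: "\<J> \<subseteq> obj V"
    and unit_arity: "\<one> \<in> \<J>"
    and ten_arity: "\<lbrakk>J \<in> \<J>; K \<in> \<J>\<rbrakk> \<Longrightarrow> J \<otimes> K \<in> \<J>"
begin

definition arity_op :: "('o, 'o, 'm) vcat" where
  "arity_op = op_vcat (full_subvcat self_vcat \<J>)"

definition theory_ok :: "('o, 'm) jtheory \<Rightarrow> bool" where
  "theory_ok T \<longleftrightarrow>
     vcategory T \<and> vob T = \<J> \<and>
     vfunctor arity_op T (tau T) \<and> (\<forall>J \<in> \<J>. fobj (tau T) J = J) \<and>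
     preserves_cotensors \<J> arity_op T (tau T)"

definition theory_mor ::
    "('o, 'm) jtheory \<Rightarrow> ('o, 'm) jtheory \<Rightarrow> ('o, 'o, 'm) vfun \<Rightarrow> bool" where
  "theory_mor T U M \<longleftrightarrow> vfunctor T U M \<and> vfun_comp arity_op M (tau T) = tau U"

text \<open>The theory on \<open>U\<close> determined by arrows \<open>\<gamma>\<^sub>J : J \<rightarrow> U(J,I)\<close> exhibiting each \<open>J\<close> as the cotensor
  \<open>[J,I]\<close>: the arrow \<open>[K,J] \<rightarrow> U(J,K)\<close> is induced by
  \<open>[K,J] \<otimes> K \<rightarrow> J \<rightarrow> U(J,I)\<close>, i.e. evaluation followed by \<open>\<gamma>\<^sub>J\<close>.\<close>

definition theory_of_counits :: "('o, 'o, 'm) vcat \<Rightarrow> ('o \<Rightarrow> 'm) \<Rightarrow> ('o, 'm) jtheory" where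
  "theory_of_counits U \<gamma> =
     \<lparr>vob = vob U, vhom = vhom U, vid = vid U, vcomp = vcomp U,
      tau = mk_vfun \<J> (\<lambda>J. J)
        (\<lambda>J K. cotensor_lift U K \<one> K (\<gamma> K) J (ihom V K J) (\<gamma> J \<cdot> ev V K J))\<rparr>"

definition algebra_ok ::
    "('o, 'm) jtheory \<Rightarrow> ('c, 'o, 'm) cvcat \<Rightarrow> ('o, 'c, 'm) vfun \<Rightarrow> bool" where
  "algebra_ok T C A \<longleftrightarrow> vfunctor T C A \<and> preserves_cotensors \<J> T C A"

definition admissible :: "('c, 'o, 'm) cvcat \<Rightarrow> bool" where
  "admissible C \<longleftrightarrow>
     vcategory C \<and> has_designated_cotensors \<J> C \<and>
     (\<forall>T A B. theory_ok T \<and> algebra_ok T C A \<and> algebra_ok T C B \<longrightarrow>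
        (\<exists>e. is_hom_end T C A B e))"

text \<open>The category of \<open>T\<close>-algebras in \<open>C\<close>, with the pointwise designated cotensors.\<close>

definition alg_vcat ::
    "('o, 'm) jtheory \<Rightarrow> ('c, 'o, 'm) cvcat \<Rightarrow> (('o, 'c, 'm) vfun, 'o, 'm) cvcat" where
  "alg_vcat T C =
     \<lparr>vob = {A. algebra_ok T C A},
      vhom = (\<lambda>A B. end_obj T C A B),
      vid = (\<lambda>A. end_lift T C A A \<one> (\<lambda>L. vid C (fobj A L))),
      vcomp = (\<lambda>A B D. end_lift T C A D (end_obj T C B D \<otimes> end_obj T C A B)
        (\<lambda>L. vcomp C (fobj A L) (fobj B L) (fobj D L)
               \<cdot> (end_proj T C B D L \<otimes>\<^sub>m end_proj T C A B L))),
      cot = (\<lambda>J A. mk_vfun (vob T) (\<lambda>L. cot C J (fobj A L))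
        (\<lambda>K L. cot_hom C J (fobj A K) (fobj A L) \<cdot> fhom A K L)),
      cotu = (\<lambda>J A. end_lift T C
        (mk_vfun (vob T) (\<lambda>L. cot C J (fobj A L))
          (\<lambda>K L. cot_hom C J (fobj A K) (fobj A L) \<cdot> fhom A K L))
        A J (\<lambda>L. cotu C J (fobj A L)))\<rparr>"

end


section \<open>The categories Alg(X) and commutants\<close>

type_synonym ('o, 'c, 'm) alg = "('o, 'm) jtheory \<times> ('o, 'c, 'm) vfun"

text \<open>Arrows of \<open>Alg(X)\<close> are stored together with their source and target.\<close>

type_synonym ('o, 'c, 'm) alg_arrow =
  "('o, 'c, 'm) alg \<times> ('o, 'c, 'm) alg \<times> ('o, 'o, 'm) vfun \<times> ('o \<Rightarrow> 'm)"

context arity_system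
begin

definition is_algebra :: "('c, 'o, 'm) cvcat \<Rightarrow> ('o, 'c, 'm) alg \<Rightarrow> bool" where
  "is_algebra C = (\<lambda>(T, A). theory_ok T \<and> algebra_ok T C A)"

definition carrier_obj :: "('o, 'c, 'm) alg \<Rightarrow> 'c" where
  "carrier_obj = (\<lambda>(T, A). fobj A \<one>)"

definition Alg :: "('c, 'o, 'm) cvcat \<Rightarrow> 'c \<Rightarrow> (('o, 'c, 'm) alg, ('o, 'c, 'm) alg_arrow) cat" where
  "Alg C X =
     \<lparr>obj = {\<A>. is_algebra C \<A> \<and> carrier_obj \<A> = X},
      arr = {((T, A), (U, B), M, f) | T A U B M f.
               is_algebra C (T, A) \<and> carrier_obj (T, A) = X \<and>
               is_algebra C (U, B) \<and> carrier_obj (U, B) = X \<and>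
               theory_mor T U M \<and> vnat_iso T C A (vfun_comp T B M) f \<and> f \<one> = vid C X},
      src = (\<lambda>(\<A>, \<B>, M, f). \<A>),
      tgt = (\<lambda>(\<A>, \<B>, M, f). \<B>),
      idm = (\<lambda>(T, A). ((T, A), (T, A), vfun_id T, (\<lambda>J \<in> \<J>. vid C (fobj A J)))),
      cmp = (\<lambda>((U, B), (W, D), N, g) ((T, A), _, M, f).
        ((T, A), (W, D), vfun_comp T N M,
         (\<lambda>J \<in> \<J>. ucomp C (fobj A J) (fobj B (fobj M J)) (fobj D (fobj N (fobj M J)))
                   (g (fobj M J)) (f J))))\<rparr>"

definition commutant_vcat :: "('c, 'o, 'm) cvcat \<Rightarrow> ('o, 'c, 'm) alg \<Rightarrow> ('o, 'o, 'm) vcat" where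
  "commutant_vcat C = (\<lambda>(T, A). let Q = alg_vcat T C; p = (\<lambda>J. cot Q J A) in
     \<lparr>vob = \<J>,
      vhom = (\<lambda>J K. vhom Q (p J) (p K)),
      vid = (\<lambda>J. vid Q (p J)),
      vcomp = (\<lambda>J K L. vcomp Q (p J) (p K) (p L))\<rparr>)"

text \<open>The counits \<open>J \<rightarrow> T-Alg(C)([J,A],A)\<close> are arrows \<open>J \<rightarrow> T-Alg(C)([J,A],[I,A])\<close> since
  \<open>[I,A] = A\<close>.\<close>

definition commutant_theory :: "('c, 'o, 'm) cvcat \<Rightarrow> ('o, 'c, 'm) alg \<Rightarrow> ('o, 'm) jtheory" where
  "commutant_theory C = (\<lambda>(T, A).
     theory_of_counits (commutant_vcat C (T, A)) (\<lambda>J. cotu (alg_vcat T C) J A))"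

definition commutant :: "('c, 'o, 'm) cvcat \<Rightarrow> ('o, 'c, 'm) alg \<Rightarrow> ('o, 'c, 'm) alg" where
  "commutant C = (\<lambda>(T, A).
     (commutant_theory C (T, A),
      mk_vfun \<J> (\<lambda>J. cot C J (fobj A \<one>))
        (\<lambda>J K. end_proj T C (cot (alg_vcat T C) J A) (cot (alg_vcat T C) K A) \<one>)))"

definition commutes :: "('c, 'o, 'm) cvcat \<Rightarrow> ('o, 'c, 'm) alg \<Rightarrow> ('o, 'c, 'm) alg \<Rightarrow> bool" where
  "commutes C \<A> \<B> \<longleftrightarrow> homs (Alg C (carrier_obj \<A>)) \<B> (commutant C \<A>) \<noteq> {}"

definition commutative :: "('c, 'o, 'm) cvcat \<Rightarrow> ('o, 'c, 'm) alg \<Rightarrow> bool" where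
  "commutative C \<A> \<longleftrightarrow> commutes C \<A> \<A>"

definition contracommutative :: "('c, 'o, 'm) cvcat \<Rightarrow> ('o, 'c, 'm) alg \<Rightarrow> bool" where
  "contracommutative C \<A> \<longleftrightarrow> commutative C (commutant C \<A>)"

definition saturated :: "('c, 'o, 'm) cvcat \<Rightarrow> ('o, 'c, 'm) alg \<Rightarrow> bool" where
  "saturated C \<A> \<longleftrightarrow>
     (\<exists>m. homs (Alg C (carrier_obj \<A>)) \<A> (commutant C (commutant C \<A>)) = {m} \<and>
          iso_arrow (Alg C (carrier_obj \<A>)) m)"

definition balanced :: "('c, 'o, 'm) cvcat \<Rightarrow> ('o, 'c, 'm) alg \<Rightarrow> bool" where
  "balanced C \<A> \<longleftrightarrow> isomorphic (Alg C (carrier_obj \<A>)) \<A> (commutant C \<A>)"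

end

end

theory Submission
  imports Defs
begin

text \<open>Arrows of \<open>Alg(C)\<close> into a commutant are unique, because evaluation at \<open>I\<close> is monic on algebra
  morphisms and an algebra morphism that is the identity on carriers is determined by the cotensor
  counits.  An arrow from \<open>B\<close> to the commutant of \<open>A\<close> exists iff each operation \<open>J \<rightarrow> I\<close> of \<open>A\<close>
  commutes with each operation \<open>L \<rightarrow> I\<close> of \<open>B\<close>, and this condition is visibly symmetric in \<open>A\<close>
  and \<open>B\<close>.  So the commutant is a symmetric Galois connection, and both equivalences follow formally
  from this, with uniqueness providing the isomorphisms.\<close>

section \<open>Coherence in symmetric monoidal categories\<close>

text \<open>Nothing here has elements: homs are objects of V, associativity holds up to an
  associator and naturality up to a symmetry. Calculations are therefore done with arrows W
  \<rightarrow> C(X,Y) of arbitrary grade W, and a composite is tested on a further arrow at its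
  right end, so that exchanging two operations costs the single map \<open>swp\<close>. A cotensor
  counit enters as a bijection between arrows of grade W into P and arrows of grade J \<otimes> W
  into X. This explains why operations into I suffice: in a theory each K is the cotensor [K,I], so
  an operation J \<rightarrow> K of grade W is the same thing as an operation J \<rightarrow> I of
  grade K \<otimes> W. Commutation is not expressed by an isomorphism between [J,[L,C]] and
  [L,[J,C]], whose coherence would have to be carried along. Instead a matrix, its transpose and
  their images under the operations are variables tied together by counit equations; exchanging the
  two algebras is then a relabelling, and actual values are supplied only where the condition is
  applied.\<close>

lemma in_homs [simp]: "f \<in> homs K a b \<longleftrightarrow> f \<in> arr K \<and> src K f = a \<and> tgt K f = b"
  by (auto simp: homs_def)

section \<open>Composition and isomorphisms in an ordinary category\<close>

context category
begin

declare src_obj [simp] tgt_obj [simp]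

lemma idm_typing [simp]:
  assumes "a \<in> obj V"
  shows "idm V a \<in> arr V" "src V (idm V a) = a" "tgt V (idm V a) = a"
  using idm_hom[OF assms] by auto

lemma cmp_typing [simp]:
  assumes "f \<in> arr V" "g \<in> arr V" "src V g = tgt V f"
  shows "g \<cdot> f \<in> arr V" "src V (g \<cdot> f) = src V f" "tgt V (g \<cdot> f) = tgt V g"
  using cmp_hom[of f "src V f" "tgt V f" g "tgt V g"] assms by auto

lemma cmp_assoc' [simp]:
  assumes "f \<in> arr V" "g \<in> arr V" "h \<in> arr V" "src V g = tgt V f" "src V h = tgt V g"
  shows "(h \<cdot> g) \<cdot> f = h \<cdot> (g \<cdot> f)"
  using cmp_assoc[of f "src V f" "tgt V f" g "tgt V g" h "tgt V h"] assms by auto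

lemma idm_left [simp]: "\<lbrakk>f \<in> arr V; tgt V f = b\<rbrakk> \<Longrightarrow> idm V b \<cdot> f = f"
  using cmp_idm_left[of f "src V f" b] by auto

lemma idm_right [simp]: "\<lbrakk>f \<in> arr V; src V f = a\<rbrakk> \<Longrightarrow> f \<cdot> idm V a = f"
  using cmp_idm_right[of f a "tgt V f"] by auto

lemma inverse_arrows_unique:
  assumes f: "f \<in> arr V" and g: "inverse_arrows V f g" and h: "inverse_arrows V f h"
  shows "g = h"
proof -
  have "(h \<cdot> f) \<cdot> g = h \<cdot> (f \<cdot> g)"
    by (rule cmp_assoc') (use f g h in \<open>auto simp: inverse_arrows_def\<close>)
  then show ?thesis using f g h by (simp add: inverse_arrows_def)
qed

lemma inv_arrow_eqI:
  assumes "f \<in> arr V" "inverse_arrows V f g"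
  shows "inv_arrow V f = g"
  unfolding inv_arrow_def using assms inverse_arrows_unique by blast

lemma inverse_arrows_inv_arrow: "iso_arrow V f \<Longrightarrow> inverse_arrows V f (inv_arrow V f)"
  unfolding iso_arrow_def using inv_arrow_eqI by blast

lemma inv_arrow [simp]:
  assumes "iso_arrow V f"
  shows "inv_arrow V f \<in> arr V" "src V (inv_arrow V f) = tgt V f" "tgt V (inv_arrow V f) = src V f"
    "inv_arrow V f \<cdot> f = idm V (src V f)" "f \<cdot> inv_arrow V f = idm V (tgt V f)"
  using inverse_arrows_inv_arrow[OF assms] assms by (auto simp: inverse_arrows_def iso_arrow_def)

lemma iso_arrow_arr: "iso_arrow V f \<Longrightarrow> f \<in> arr V"
  by (simp add: iso_arrow_def)

lemma inv_arrow_cancel [simp]: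
  assumes iso: "iso_arrow V f" and g: "g \<in> arr V"
  shows "tgt V g = src V f \<Longrightarrow> inv_arrow V f \<cdot> (f \<cdot> g) = g"
    and "tgt V g = tgt V f \<Longrightarrow> f \<cdot> (inv_arrow V f \<cdot> g) = g"
proof -
  note f = iso_arrow_arr[OF iso]
  show "inv_arrow V f \<cdot> (f \<cdot> g) = g" if "tgt V g = src V f"
  proof -
    have "inv_arrow V f \<cdot> (f \<cdot> g) = (inv_arrow V f \<cdot> f) \<cdot> g"
      using iso f g that by (intro cmp_assoc'[symmetric]) auto
    then show ?thesis using iso f g that by simp
  qed
  show "f \<cdot> (inv_arrow V f \<cdot> g) = g" if "tgt V g = tgt V f"
  proof -
    have "f \<cdot> (inv_arrow V f \<cdot> g) = (f \<cdot> inv_arrow V f) \<cdot> g"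
      using iso f g that by (intro cmp_assoc'[symmetric]) auto
    then show ?thesis using iso f g that by simp
  qed
qed

lemma iso_cancel_left:
  assumes "iso_arrow V k" "f \<in> arr V" "g \<in> arr V" "tgt V f = src V k" "tgt V g = src V k" "k \<cdot> f = k \<cdot> g"
  shows "f = g"
  by (metis assms inv_arrow_cancel(1))

lemma iso_cancel_right:
  assumes "iso_arrow V k" "f \<in> arr V" "g \<in> arr V" "src V f = tgt V k" "src V g = tgt V k" "f \<cdot> k = g \<cdot> k"
  shows "f = g"
proof -
  note k = iso_arrow_arr[OF assms(1)]
  have "f \<cdot> (k \<cdot> inv_arrow V k) = (f \<cdot> k) \<cdot> inv_arrow V k"
    by (rule cmp_assoc'[symmetric]) (use assms k in auto)
  also have "\<dots> = g \<cdot> (k \<cdot> inv_arrow V k)"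
    unfolding assms(6) by (rule cmp_assoc') (use assms k in auto)
  finally show ?thesis using assms by simp
qed

lemma iso_arrowI:
  assumes "f \<in> homs V a b" "g \<in> homs V b a" "g \<cdot> f = idm V a" "f \<cdot> g = idm V b"
  shows "iso_arrow V f"
  using assms by (auto simp: iso_arrow_def inverse_arrows_def)

lemma iso_inv_arrow [simp]: "iso_arrow V f \<Longrightarrow> iso_arrow V (inv_arrow V f)"
  by (rule iso_arrowI[of _ "tgt V f" "src V f" f]) (auto simp: iso_arrow_arr)

lemma iso_cmp [simp]:
  assumes "iso_arrow V f" "iso_arrow V g" "src V g = tgt V f"
  shows "iso_arrow V (g \<cdot> f)"
  by (rule iso_arrowI[of _ "src V f" "tgt V g" "inv_arrow V f \<cdot> inv_arrow V g"])
    (use assms in \<open>auto simp: iso_arrow_arr\<close>)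

text \<open>The Yoneda argument: solving \<open>k \<cdot> g = idm V b\<close> gives a right inverse,
  and uniqueness at the test object a forces it to be a left inverse. It turns the invertibility in
  the definition of a cotensor into unique existence of factorizations.\<close>

lemma iso_arrow_iff_bij:
  assumes k: "k \<in> homs V a b"
  shows "iso_arrow V k \<longleftrightarrow> (\<forall>w \<in> obj V. \<forall>f \<in> homs V w b. \<exists>!g. g \<in> homs V w a \<and> k \<cdot> g = f)"
proof
  assume iso: "iso_arrow V k"
  show "\<forall>w \<in> obj V. \<forall>f \<in> homs V w b. \<exists>!g. g \<in> homs V w a \<and> k \<cdot> g = f"
  proof (intro ballI)
    fix w f assume f: "f \<in> homs V w b"
    show "\<exists>!g. g \<in> homs V w a \<and> k \<cdot> g = f"
    proof (rule ex1I)
      show "inv_arrow V k \<cdot> f \<in> homs V w a \<and> k \<cdot> (inv_arrow V k \<cdot> f) = f" using k iso f by simp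
    next
      fix g assume g: "g \<in> homs V w a \<and> k \<cdot> g = f"
      then have "inv_arrow V k \<cdot> (k \<cdot> g) = g" using k iso by (intro inv_arrow_cancel) auto
      then show "g = inv_arrow V k \<cdot> f" using g by simp
    qed
  qed
next
  assume R: "\<forall>w \<in> obj V. \<forall>f \<in> homs V w b. \<exists>!g. g \<in> homs V w a \<and> k \<cdot> g = f"
  have ab: "a \<in> obj V" "b \<in> obj V" using k by auto
  then obtain g where g: "g \<in> homs V b a" "k \<cdot> g = idm V b" using R[rule_format, of b "idm V b"] by auto
  have "\<exists>!h. h \<in> homs V a a \<and> k \<cdot> h = k" using R[rule_format, of a k] k ab by auto
  moreover have "g \<cdot> k \<in> homs V a a" "k \<cdot> (g \<cdot> k) = k"
    using g k ab cmp_assoc'[of k g k] by (auto simp del: cmp_assoc')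
  moreover have "idm V a \<in> homs V a a" "k \<cdot> idm V a = k" using k ab by auto
  ultimately have "g \<cdot> k = idm V a" by blast
  then show "iso_arrow V k" using iso_arrowI[OF k g(1)] g(2) by blast
qed

end

section \<open>Functoriality of the tensor product and coherence of the structure maps\<close>

context sym_monoidal_closed
begin

declare ten_obj [simp] unit_obj [simp] ihom_obj [simp] tenm_idm [simp]

lemma tenm_typing [simp]:
  assumes "f \<in> arr V" "g \<in> arr V"
  shows "f \<otimes>\<^sub>m g \<in> arr V" "src V (f \<otimes>\<^sub>m g) = src V f \<otimes> src V g" "tgt V (f \<otimes>\<^sub>m g) = tgt V f \<otimes> tgt V g"
  using tenm_hom[of f "src V f" "tgt V f" g "src V g" "tgt V g"] assms by auto

lemma interchange [simp]:
  assumes "f \<in> arr V" "f' \<in> arr V" "g \<in> arr V" "g' \<in> arr V" "src V f' = tgt V f" "src V g' = tgt V g"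
  shows "(f' \<otimes>\<^sub>m g') \<cdot> (f \<otimes>\<^sub>m g) = (f' \<cdot> f) \<otimes>\<^sub>m (g' \<cdot> g)"
  using tenm_cmp[of f "src V f" "tgt V f" f' "tgt V f'" g "src V g" "tgt V g" g' "tgt V g'"] assms by auto

text \<open>Composites are kept nested to the right, so a law for a composite of two maps is also
  needed with a further map behind it; \<open>symm_symm2\<close>, \<open>pentagon1\<close> and
  \<open>swp_swp2\<close> exist for the same reason.\<close>

lemma interchange2 [simp]:
  assumes "f \<in> arr V" "f' \<in> arr V" "g \<in> arr V" "g' \<in> arr V" "src V f' = tgt V f" "src V g' = tgt V g"
    "h \<in> arr V" "tgt V h = src V f \<otimes> src V g"
  shows "(f' \<otimes>\<^sub>m g') \<cdot> ((f \<otimes>\<^sub>m g) \<cdot> h) = ((f' \<cdot> f) \<otimes>\<^sub>m (g' \<cdot> g)) \<cdot> h"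
  using assms cmp_assoc'[of h "f \<otimes>\<^sub>m g" "f' \<otimes>\<^sub>m g'"] by (simp del: cmp_assoc')

lemma iso_tenm [simp]:
  assumes "iso_arrow V f" "iso_arrow V g"
  shows "iso_arrow V (f \<otimes>\<^sub>m g)"
  using assms by (intro iso_arrowI[of _ "src V f \<otimes> src V g" "tgt V f \<otimes> tgt V g" "inv_arrow V f \<otimes>\<^sub>m inv_arrow V g"])
    (auto simp: iso_arrow_arr)

lemma iso_idm [simp]: "a \<in> obj V \<Longrightarrow> iso_arrow V (idm V a)"
  by (intro iso_arrowI[of _ a a "idm V a"]) auto

abbreviation ai where "ai a b c \<equiv> inv_arrow V (assoc V a b c)"
abbreviation li where "li a \<equiv> inv_arrow V (lunit V a)"
abbreviation ri where "ri a \<equiv> inv_arrow V (runit V a)"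

declare assoc_iso [simp] lunit_iso [simp] runit_iso [simp] symm_symm [simp]

lemma structure_typing [simp]:
  shows "\<lbrakk>a \<in> obj V; b \<in> obj V; c \<in> obj V\<rbrakk> \<Longrightarrow> assoc V a b c \<in> arr V"
    "\<lbrakk>a \<in> obj V; b \<in> obj V; c \<in> obj V\<rbrakk> \<Longrightarrow> src V (assoc V a b c) = (a \<otimes> b) \<otimes> c"
    "\<lbrakk>a \<in> obj V; b \<in> obj V; c \<in> obj V\<rbrakk> \<Longrightarrow> tgt V (assoc V a b c) = a \<otimes> (b \<otimes> c)"
    "a \<in> obj V \<Longrightarrow> lunit V a \<in> arr V" "a \<in> obj V \<Longrightarrow> src V (lunit V a) = \<one> \<otimes> a"
    "a \<in> obj V \<Longrightarrow> tgt V (lunit V a) = a"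
    "a \<in> obj V \<Longrightarrow> runit V a \<in> arr V" "a \<in> obj V \<Longrightarrow> src V (runit V a) = a \<otimes> \<one>"
    "a \<in> obj V \<Longrightarrow> tgt V (runit V a) = a"
    "\<lbrakk>a \<in> obj V; b \<in> obj V\<rbrakk> \<Longrightarrow> symm V a b \<in> arr V"
    "\<lbrakk>a \<in> obj V; b \<in> obj V\<rbrakk> \<Longrightarrow> src V (symm V a b) = a \<otimes> b"
    "\<lbrakk>a \<in> obj V; b \<in> obj V\<rbrakk> \<Longrightarrow> tgt V (symm V a b) = b \<otimes> a"
    "\<lbrakk>a \<in> obj V; b \<in> obj V\<rbrakk> \<Longrightarrow> ev V a b \<in> arr V"
    "\<lbrakk>a \<in> obj V; b \<in> obj V\<rbrakk> \<Longrightarrow> src V (ev V a b) = ihom V a b \<otimes> a"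
    "\<lbrakk>a \<in> obj V; b \<in> obj V\<rbrakk> \<Longrightarrow> tgt V (ev V a b) = b"
  using assoc_hom lunit_hom runit_hom symm_hom ev_hom by auto

lemma symm_symm2 [simp]:
  "\<lbrakk>a \<in> obj V; b \<in> obj V; f \<in> arr V; tgt V f = a \<otimes> b\<rbrakk> \<Longrightarrow> symm V b a \<cdot> (symm V a b \<cdot> f) = f"
  using cmp_assoc'[of f "symm V a b" "symm V b a"] by (simp del: cmp_assoc')

lemma iso_symm [simp]: "\<lbrakk>a \<in> obj V; b \<in> obj V\<rbrakk> \<Longrightarrow> iso_arrow V (symm V a b)"
  by (intro iso_arrowI[of _ "a \<otimes> b" "b \<otimes> a" "symm V b a"]) auto

lemma assoc_nat:
  "\<lbrakk>f \<in> arr V; g \<in> arr V; h \<in> arr V; src V f = a; src V g = b; src V h = c; tgt V f = a'; tgt V g = b'; tgt V h = c'\<rbrakk> \<Longrightarrow>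
   assoc V a' b' c' \<cdot> ((f \<otimes>\<^sub>m g) \<otimes>\<^sub>m h) = (f \<otimes>\<^sub>m (g \<otimes>\<^sub>m h)) \<cdot> assoc V a b c"
  using assoc_natural by auto

lemma symm_nat:
  "\<lbrakk>f \<in> arr V; g \<in> arr V; src V f = a; src V g = b; tgt V f = a'; tgt V g = b'\<rbrakk> \<Longrightarrow>
   symm V a' b' \<cdot> (f \<otimes>\<^sub>m g) = (g \<otimes>\<^sub>m f) \<cdot> symm V a b"
  using symm_natural by auto

lemma lunit_nat: "\<lbrakk>f \<in> arr V; src V f = a; tgt V f = b\<rbrakk> \<Longrightarrow> lunit V b \<cdot> (idm V \<one> \<otimes>\<^sub>m f) = f \<cdot> lunit V a"
  using lunit_natural by auto

lemma runit_nat: "\<lbrakk>f \<in> arr V; src V f = a; tgt V f = b\<rbrakk> \<Longrightarrow> runit V b \<cdot> (f \<otimes>\<^sub>m idm V \<one>) = f \<cdot> runit V a"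
  using runit_natural by auto

text \<open>Naturality of the unitors conjugates a map tensored with I to the map itself. Thus a
  unit law may be proved after tensoring with I, where pentagon and triangle apply.\<close>

lemma unit_tenm_cancel:
  assumes "f \<in> arr V" "g \<in> arr V" "src V f = src V g" "tgt V f = tgt V g"
  shows "idm V \<one> \<otimes>\<^sub>m f = idm V \<one> \<otimes>\<^sub>m g \<Longrightarrow> f = g"
    and "f \<otimes>\<^sub>m idm V \<one> = g \<otimes>\<^sub>m idm V \<one> \<Longrightarrow> f = g"
proof -
  assume "idm V \<one> \<otimes>\<^sub>m f = idm V \<one> \<otimes>\<^sub>m g"
  then have "f \<cdot> lunit V (src V f) = g \<cdot> lunit V (src V f)"
    using assms lunit_nat[of f "src V f" "tgt V f"] lunit_nat[of g "src V f" "tgt V f"] by simp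
  then show "f = g" by (rule iso_cancel_right[rotated -1]) (use assms in auto)
next
  assume "f \<otimes>\<^sub>m idm V \<one> = g \<otimes>\<^sub>m idm V \<one>"
  then have "f \<cdot> runit V (src V f) = g \<cdot> runit V (src V f)"
    using assms runit_nat[of f "src V f" "tgt V f"] runit_nat[of g "src V f" "tgt V f"] by simp
  then show "f = g" by (rule iso_cancel_right[rotated -1]) (use assms in auto)
qed

lemma pentagon1:
  assumes "a \<in> obj V" "b \<in> obj V" "c \<in> obj V" "d \<in> obj V" "h \<in> arr V" "tgt V h = ((a \<otimes> b) \<otimes> c) \<otimes> d"
  shows "assoc V a b (c \<otimes> d) \<cdot> (assoc V (a \<otimes> b) c d \<cdot> h) =
    (idm V a \<otimes>\<^sub>m assoc V b c d) \<cdot> (assoc V a (b \<otimes> c) d \<cdot> ((assoc V a b c \<otimes>\<^sub>m idm V d) \<cdot> h))"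
proof -
  have "(assoc V a b (c \<otimes> d) \<cdot> assoc V (a \<otimes> b) c d) \<cdot> h = ((idm V a \<otimes>\<^sub>m assoc V b c d) \<cdot> assoc V a (b \<otimes> c) d \<cdot> (assoc V a b c \<otimes>\<^sub>m idm V d)) \<cdot> h"
    using pentagon[of a b c d] assms by (simp del: cmp_assoc')
  then show ?thesis using assms by simp
qed

lemma pentagon0:
  assumes "a \<in> obj V" "b \<in> obj V" "c \<in> obj V" "d \<in> obj V"
  shows "assoc V a b (c \<otimes> d) \<cdot> assoc V (a \<otimes> b) c d =
    (idm V a \<otimes>\<^sub>m assoc V b c d) \<cdot> (assoc V a (b \<otimes> c) d \<cdot> (assoc V a b c \<otimes>\<^sub>m idm V d))"
  using pentagon[of a b c d] assms by simp

text \<open>The axioms contain only the triangle with the unit in the middle. The pentagon at (I, I,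
  a, b), together with two triangles, gives the equation tensored with I on the left, and this I is
  then cancelled.\<close>

lemma lunit_ten:
  assumes a: "a \<in> obj V" and b: "b \<in> obj V"
  shows "lunit V (a \<otimes> b) \<cdot> assoc V \<one> a b = lunit V a \<otimes>\<^sub>m idm V b"
proof -
  let ?I = "idm V \<one>"
  let ?k = "assoc V \<one> (\<one> \<otimes> a) b \<cdot> (assoc V \<one> \<one> a \<otimes>\<^sub>m idm V b)"
  have "(?I \<otimes>\<^sub>m (lunit V (a \<otimes> b) \<cdot> assoc V \<one> a b)) \<cdot> ?k
      = (?I \<otimes>\<^sub>m lunit V (a \<otimes> b)) \<cdot> ((?I \<otimes>\<^sub>m assoc V \<one> a b) \<cdot> ?k)" using a b by simp
  also have "\<dots> = (?I \<otimes>\<^sub>m lunit V (a \<otimes> b)) \<cdot> (assoc V \<one> \<one> (a \<otimes> b) \<cdot> assoc V (\<one> \<otimes> \<one>) a b)"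
    using pentagon0[of \<one> \<one> a b] a b by simp
  also have "\<dots> = ((?I \<otimes>\<^sub>m lunit V (a \<otimes> b)) \<cdot> assoc V \<one> \<one> (a \<otimes> b)) \<cdot> assoc V (\<one> \<otimes> \<one>) a b"
    using a b by simp
  also have "\<dots> = (runit V \<one> \<otimes>\<^sub>m (idm V a \<otimes>\<^sub>m idm V b)) \<cdot> assoc V (\<one> \<otimes> \<one>) a b"
    using triangle[of \<one> "a \<otimes> b"] a b by simp
  also have "\<dots> = assoc V \<one> a b \<cdot> ((runit V \<one> \<otimes>\<^sub>m idm V a) \<otimes>\<^sub>m idm V b)"
    by (rule assoc_nat[symmetric]) (use a b in auto)
  also have "\<dots> = assoc V \<one> a b \<cdot> (((?I \<otimes>\<^sub>m lunit V a) \<cdot> assoc V \<one> \<one> a) \<otimes>\<^sub>m idm V b)"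
    using triangle[of \<one> a] a b by simp
  also have "\<dots> = (assoc V \<one> a b \<cdot> ((?I \<otimes>\<^sub>m lunit V a) \<otimes>\<^sub>m idm V b)) \<cdot> (assoc V \<one> \<one> a \<otimes>\<^sub>m idm V b)"
    using a b by simp
  also have "\<dots> = ((?I \<otimes>\<^sub>m (lunit V a \<otimes>\<^sub>m idm V b)) \<cdot> assoc V \<one> (\<one> \<otimes> a) b) \<cdot> (assoc V \<one> \<one> a \<otimes>\<^sub>m idm V b)"
    using a b assoc_nat[of ?I "lunit V a" "idm V b" \<one> "\<one> \<otimes> a" b \<one> a b] by simp
  also have "\<dots> = (?I \<otimes>\<^sub>m (lunit V a \<otimes>\<^sub>m idm V b)) \<cdot> ?k" using a b by simp
  finally have *: "(?I \<otimes>\<^sub>m (lunit V (a \<otimes> b) \<cdot> assoc V \<one> a b)) \<cdot> ?k = (?I \<otimes>\<^sub>m (lunit V a \<otimes>\<^sub>m idm V b)) \<cdot> ?k" .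
  have "(?I \<otimes>\<^sub>m (lunit V (a \<otimes> b) \<cdot> assoc V \<one> a b)) \<cdot> assoc V \<one> (\<one> \<otimes> a) b = (?I \<otimes>\<^sub>m (lunit V a \<otimes>\<^sub>m idm V b)) \<cdot> assoc V \<one> (\<one> \<otimes> a) b"
    by (rule iso_cancel_right[of "assoc V \<one> \<one> a \<otimes>\<^sub>m idm V b"]) (use a b * in auto)
  then have "?I \<otimes>\<^sub>m (lunit V (a \<otimes> b) \<cdot> assoc V \<one> a b) = ?I \<otimes>\<^sub>m (lunit V a \<otimes>\<^sub>m idm V b)"
    by (rule iso_cancel_right[rotated -1]) (use a b in auto)
  then show ?thesis by (rule unit_tenm_cancel(1)[rotated -1]) (use a b in auto)
qed

text \<open>The mirror image of the previous argument: the pentagon at (a, b, I, I), with the extra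
  I on the right.\<close>

lemma runit_ten:
  assumes a: "a \<in> obj V" and b: "b \<in> obj V"
  shows "(idm V a \<otimes>\<^sub>m runit V b) \<cdot> assoc V a b \<one> = runit V (a \<otimes> b)"
proof -
  let ?I = "idm V \<one>"
  have "assoc V a b \<one> \<cdot> (runit V (a \<otimes> b) \<otimes>\<^sub>m ?I)
      = assoc V a b \<one> \<cdot> ((idm V (a \<otimes> b) \<otimes>\<^sub>m lunit V \<one>) \<cdot> assoc V (a \<otimes> b) \<one> \<one>)"
    using triangle[of "a \<otimes> b" \<one>] a b by simp
  also have "\<dots> = (assoc V a b \<one> \<cdot> ((idm V a \<otimes>\<^sub>m idm V b) \<otimes>\<^sub>m lunit V \<one>)) \<cdot> assoc V (a \<otimes> b) \<one> \<one>"
    using a b by simp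
  also have "\<dots> = ((idm V a \<otimes>\<^sub>m (idm V b \<otimes>\<^sub>m lunit V \<one>)) \<cdot> assoc V a b (\<one> \<otimes> \<one>)) \<cdot> assoc V (a \<otimes> b) \<one> \<one>"
    using a b assoc_nat[of "idm V a" "idm V b" "lunit V \<one>" a b "\<one> \<otimes> \<one>" a b \<one>] by simp
  also have "\<dots> = (idm V a \<otimes>\<^sub>m (idm V b \<otimes>\<^sub>m lunit V \<one>)) \<cdot> (assoc V a b (\<one> \<otimes> \<one>) \<cdot> assoc V (a \<otimes> b) \<one> \<one>)"
    using a b by simp
  also have "\<dots> = (idm V a \<otimes>\<^sub>m ((idm V b \<otimes>\<^sub>m lunit V \<one>) \<cdot> assoc V b \<one> \<one>)) \<cdot> (assoc V a (b \<otimes> \<one>) \<one> \<cdot> (assoc V a b \<one> \<otimes>\<^sub>m ?I))"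
    using a b by (simp add: pentagon0)
  also have "\<dots> = (idm V a \<otimes>\<^sub>m (runit V b \<otimes>\<^sub>m ?I)) \<cdot> (assoc V a (b \<otimes> \<one>) \<one> \<cdot> (assoc V a b \<one> \<otimes>\<^sub>m ?I))"
    using a b by (simp add: triangle)
  also have "\<dots> = ((idm V a \<otimes>\<^sub>m (runit V b \<otimes>\<^sub>m ?I)) \<cdot> assoc V a (b \<otimes> \<one>) \<one>) \<cdot> (assoc V a b \<one> \<otimes>\<^sub>m ?I)"
    using a b by simp
  also have "\<dots> = (assoc V a b \<one> \<cdot> ((idm V a \<otimes>\<^sub>m runit V b) \<otimes>\<^sub>m ?I)) \<cdot> (assoc V a b \<one> \<otimes>\<^sub>m ?I)"
    using a b assoc_nat[of "idm V a" "runit V b" ?I a "b \<otimes> \<one>" \<one> a b \<one>] by simp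
  also have "\<dots> = assoc V a b \<one> \<cdot> (((idm V a \<otimes>\<^sub>m runit V b) \<cdot> assoc V a b \<one>) \<otimes>\<^sub>m ?I)"
    using a b by simp
  finally have "runit V (a \<otimes> b) \<otimes>\<^sub>m ?I = ((idm V a \<otimes>\<^sub>m runit V b) \<cdot> assoc V a b \<one>) \<otimes>\<^sub>m ?I"
    by (rule iso_cancel_left[rotated -1]) (use a b in auto)
  then show ?thesis by (rule unit_tenm_cancel(2)[rotated -1, symmetric]) (use a b in auto)
qed

text \<open>Naturality of the left unitor along itself identifies
  \<open>lunit V (\<one> \<otimes> \<one>)\<close> with the tensor of I and the unitor. Then
  \<open>lunit_ten\<close> and the triangle at (I, I) have equal left hand sides.\<close>

lemma lunit_eq_runit: "lunit V \<one> = runit V \<one>"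
proof -
  have "lunit V \<one> \<cdot> lunit V (\<one> \<otimes> \<one>) = lunit V \<one> \<cdot> (idm V \<one> \<otimes>\<^sub>m lunit V \<one>)"
    using lunit_nat[of "lunit V \<one>" "\<one> \<otimes> \<one>" \<one>] by simp
  then have *: "lunit V (\<one> \<otimes> \<one>) = idm V \<one> \<otimes>\<^sub>m lunit V \<one>"
    by (rule iso_cancel_left[rotated -1]) auto
  have "lunit V \<one> \<otimes>\<^sub>m idm V \<one> = runit V \<one> \<otimes>\<^sub>m idm V \<one>"
    using lunit_ten[of \<one> \<one>] triangle[of \<one> \<one>] * by simp
  then show ?thesis by (rule unit_tenm_cancel(2)[rotated -1]) auto
qed

text \<open>The exchange used when two operations act on an already built generalized element.\<close>

definition swp :: "'o \<Rightarrow> 'o \<Rightarrow> 'o \<Rightarrow> 'm" where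
  "swp a b q = assoc V b a q \<cdot> ((symm V a b \<otimes>\<^sub>m idm V q) \<cdot> ai a b q)"

lemma swp_typing [simp]:
  assumes "a \<in> obj V" "b \<in> obj V" "q \<in> obj V"
  shows "swp a b q \<in> arr V" "src V (swp a b q) = a \<otimes> (b \<otimes> q)" "tgt V (swp a b q) = b \<otimes> (a \<otimes> q)"
  using assms by (auto simp: swp_def)

lemma swp_swp [simp]:
  assumes "a \<in> obj V" "b \<in> obj V" "q \<in> obj V"
  shows "swp b a q \<cdot> swp a b q = idm V (a \<otimes> (b \<otimes> q))"
  using assms by (simp add: swp_def)

lemma swp_swp2 [simp]:
  assumes "a \<in> obj V" "b \<in> obj V" "q \<in> obj V" "h \<in> arr V" "tgt V h = a \<otimes> (b \<otimes> q)"
  shows "swp b a q \<cdot> (swp a b q \<cdot> h) = h"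
  using assms cmp_assoc'[of h "swp a b q" "swp b a q"] by (simp del: cmp_assoc')

lemma iso_swp [simp]: "\<lbrakk>a \<in> obj V; b \<in> obj V; q \<in> obj V\<rbrakk> \<Longrightarrow> iso_arrow V (swp a b q)"
  by (intro iso_arrowI[of _ "a \<otimes> (b \<otimes> q)" "b \<otimes> (a \<otimes> q)" "swp b a q"]) auto

lemma ai_nat:
  assumes "f \<in> arr V" "g \<in> arr V" "h \<in> arr V" "src V f = a" "src V g = b" "src V h = c"
    "tgt V f = a'" "tgt V g = b'" "tgt V h = c'"
  shows "ai a' b' c' \<cdot> (f \<otimes>\<^sub>m (g \<otimes>\<^sub>m h)) = ((f \<otimes>\<^sub>m g) \<otimes>\<^sub>m h) \<cdot> ai a b c"
proof -
  have o: "a \<in> obj V" "b \<in> obj V" "c \<in> obj V" "a' \<in> obj V" "b' \<in> obj V" "c' \<in> obj V" using assms by auto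
  have "assoc V a' b' c' \<cdot> (((f \<otimes>\<^sub>m g) \<otimes>\<^sub>m h) \<cdot> ai a b c) = (assoc V a' b' c' \<cdot> ((f \<otimes>\<^sub>m g) \<otimes>\<^sub>m h)) \<cdot> ai a b c"
    using assms o by simp
  also have "\<dots> = f \<otimes>\<^sub>m (g \<otimes>\<^sub>m h)" using assms o by (simp add: assoc_nat)
  finally have "ai a' b' c' \<cdot> (f \<otimes>\<^sub>m (g \<otimes>\<^sub>m h)) = ai a' b' c' \<cdot> (assoc V a' b' c' \<cdot> (((f \<otimes>\<^sub>m g) \<otimes>\<^sub>m h) \<cdot> ai a b c))" by simp
  then show ?thesis using assms o by simp
qed

lemma swp_nat:
  assumes "f \<in> arr V" "g \<in> arr V" "h \<in> arr V" "src V f = a" "src V g = b" "src V h = c"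
    "tgt V f = a'" "tgt V g = b'" "tgt V h = c'"
  shows "swp a' b' c' \<cdot> (f \<otimes>\<^sub>m (g \<otimes>\<^sub>m h)) = (g \<otimes>\<^sub>m (f \<otimes>\<^sub>m h)) \<cdot> swp a b c"
proof -
  have o: "a \<in> obj V" "b \<in> obj V" "c \<in> obj V" "a' \<in> obj V" "b' \<in> obj V" "c' \<in> obj V" using assms by auto
  have "swp a' b' c' \<cdot> (f \<otimes>\<^sub>m (g \<otimes>\<^sub>m h)) = assoc V b' a' c' \<cdot> ((symm V a' b' \<otimes>\<^sub>m idm V c') \<cdot> (ai a' b' c' \<cdot> (f \<otimes>\<^sub>m (g \<otimes>\<^sub>m h))))"
    using assms o by (simp add: swp_def)
  also have "\<dots> = assoc V b' a' c' \<cdot> (((symm V a' b' \<cdot> (f \<otimes>\<^sub>m g)) \<otimes>\<^sub>m h) \<cdot> ai a b c)"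
    using assms o by (simp add: ai_nat)
  also have "\<dots> = (assoc V b' a' c' \<cdot> ((g \<otimes>\<^sub>m f) \<otimes>\<^sub>m h)) \<cdot> ((symm V a b \<otimes>\<^sub>m idm V c) \<cdot> ai a b c)"
    using assms o by (simp add: symm_nat)
  also have "\<dots> = (g \<otimes>\<^sub>m (f \<otimes>\<^sub>m h)) \<cdot> swp a b c"
    using assms o assoc_nat[of g f h b a c b' a' c'] by (simp add: swp_def)
  finally show ?thesis .
qed

text \<open>By \<open>symm_unit\<close> the symmetry with I turns one unitor into the other, after
  which the triangle and \<open>lunit_ten\<close> apply. This equation is what makes identities a
  natural family of grade I.\<close>

lemma swp_unit:
  assumes "w \<in> obj V" "q \<in> obj V"
  shows "(idm V w \<otimes>\<^sub>m lunit V q) \<cdot> swp \<one> w q = lunit V (w \<otimes> q)"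
proof -
  have s: "runit V w \<cdot> symm V \<one> w = lunit V w"
    using assms symm_unit[of w, symmetric] by simp
  have "(idm V w \<otimes>\<^sub>m lunit V q) \<cdot> swp \<one> w q = ((idm V w \<otimes>\<^sub>m lunit V q) \<cdot> assoc V w \<one> q) \<cdot> ((symm V \<one> w \<otimes>\<^sub>m idm V q) \<cdot> ai \<one> w q)"
    using assms by (simp add: swp_def)
  also have "\<dots> = ((runit V w \<cdot> symm V \<one> w) \<otimes>\<^sub>m idm V q) \<cdot> ai \<one> w q" using assms by (simp add: triangle)
  also have "\<dots> = (lunit V (w \<otimes> q) \<cdot> assoc V \<one> w q) \<cdot> ai \<one> w q" unfolding s using lunit_ten assms by simp
  also have "\<dots> = lunit V (w \<otimes> q)" using assms by simp
  finally show ?thesis .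
qed

lemma swp_unit':
  assumes "w \<in> obj V" "q \<in> obj V"
  shows "lunit V (w \<otimes> q) \<cdot> swp w \<one> q = idm V w \<otimes>\<^sub>m lunit V q"
  using assms by (simp add: swp_unit[symmetric])

text \<open>A test arrow that is an identity has grade I and so puts I in the place of q. The lemma
  translates the exchange form of naturality back into the square with the plain symmetry.\<close>

lemma swp_symm:
  assumes "a \<in> obj V" "b \<in> obj V"
  shows "(idm V b \<otimes>\<^sub>m runit V a) \<cdot> swp a b \<one> = symm V a b \<cdot> (idm V a \<otimes>\<^sub>m runit V b)"
proof -
  have "(idm V b \<otimes>\<^sub>m runit V a) \<cdot> swp a b \<one> = ((idm V b \<otimes>\<^sub>m runit V a) \<cdot> assoc V b a \<one>) \<cdot> ((symm V a b \<otimes>\<^sub>m idm V \<one>) \<cdot> ai a b \<one>)"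
    using assms by (simp add: swp_def)
  also have "\<dots> = (runit V (b \<otimes> a) \<cdot> (symm V a b \<otimes>\<^sub>m idm V \<one>)) \<cdot> ai a b \<one>"
    using assms by (simp add: runit_ten)
  also have "\<dots> = symm V a b \<cdot> (runit V (a \<otimes> b) \<cdot> ai a b \<one>)"
    using assms by (simp add: runit_nat)
  also have "\<dots> = symm V a b \<cdot> (((idm V a \<otimes>\<^sub>m runit V b) \<cdot> assoc V a b \<one>) \<cdot> ai a b \<one>)"
    using assms by (simp only: runit_ten)
  also have "\<dots> = symm V a b \<cdot> (idm V a \<otimes>\<^sub>m runit V b)"
    using assms by simp
  finally show ?thesis .
qed

text \<open>The hexagon tensored with q, with pentagons to rebracket. In use it says that a family
  commuting with two composable arrows commutes with their composite.\<close>

lemma swp_ten: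
  assumes a: "a \<in> obj V" and b: "b \<in> obj V" and d: "d \<in> obj V" and q: "q \<in> obj V"
  shows "assoc V b d (a \<otimes> q) \<cdot> swp a (b \<otimes> d) q =
    (idm V b \<otimes>\<^sub>m swp a d q) \<cdot> (swp a b (d \<otimes> q) \<cdot> (idm V a \<otimes>\<^sub>m assoc V b d q))"
proof -
  note o = a b d q
  let ?q = "idm V q"
  have hex: "assoc V b d a \<cdot> (symm V a (b \<otimes> d) \<cdot> assoc V a b d)
    = (idm V b \<otimes>\<^sub>m symm V a d) \<cdot> (assoc V b a d \<cdot> (symm V a b \<otimes>\<^sub>m idm V d))"
    using hexagon[of a b d] o by simp
  \<comment> \<open>An invertible rebracketing of ((a \<otimes> b) \<otimes> d) \<otimes> q; after
    precomposing it the hexagon appears literally as a factor tensored with q.\<close>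
  let ?k = "assoc V a (b \<otimes> d) q \<cdot> (assoc V a b d \<otimes>\<^sub>m ?q)"
  have "(assoc V b d (a \<otimes> q) \<cdot> swp a (b \<otimes> d) q) \<cdot> ?k
     = assoc V b d (a \<otimes> q) \<cdot> (assoc V (b \<otimes> d) a q \<cdot> ((symm V a (b \<otimes> d) \<cdot> assoc V a b d) \<otimes>\<^sub>m ?q))"
    using o by (simp add: swp_def)
  also have "\<dots> = (idm V b \<otimes>\<^sub>m assoc V d a q) \<cdot> (assoc V b (d \<otimes> a) q \<cdot> ((assoc V b d a \<cdot> (symm V a (b \<otimes> d) \<cdot> assoc V a b d)) \<otimes>\<^sub>m ?q))"
    using o by (simp add: pentagon1)
  also have "\<dots> = (idm V b \<otimes>\<^sub>m assoc V d a q) \<cdot> ((assoc V b (d \<otimes> a) q \<cdot> ((idm V b \<otimes>\<^sub>m symm V a d) \<otimes>\<^sub>m ?q)) \<cdot> ((assoc V b a d \<otimes>\<^sub>m ?q) \<cdot> ((symm V a b \<otimes>\<^sub>m idm V d) \<otimes>\<^sub>m ?q)))"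
    unfolding hex using o by simp
  also have "\<dots> = (idm V b \<otimes>\<^sub>m (assoc V d a q \<cdot> (symm V a d \<otimes>\<^sub>m ?q))) \<cdot> (assoc V b (a \<otimes> d) q \<cdot> ((assoc V b a d \<otimes>\<^sub>m ?q) \<cdot> ((symm V a b \<otimes>\<^sub>m idm V d) \<otimes>\<^sub>m ?q)))"
    using o assoc_nat[of "idm V b" "symm V a d" ?q b "a \<otimes> d" q b "d \<otimes> a" q] by simp
  also have "\<dots> = (idm V b \<otimes>\<^sub>m swp a d q) \<cdot> ((idm V b \<otimes>\<^sub>m assoc V a d q) \<cdot> (assoc V b (a \<otimes> d) q \<cdot> ((assoc V b a d \<otimes>\<^sub>m ?q) \<cdot> ((symm V a b \<otimes>\<^sub>m idm V d) \<otimes>\<^sub>m ?q))))"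
    using o by (simp add: swp_def)
  also have "\<dots> = (idm V b \<otimes>\<^sub>m swp a d q) \<cdot> (assoc V b a (d \<otimes> q) \<cdot> (assoc V (b \<otimes> a) d q \<cdot> ((symm V a b \<otimes>\<^sub>m idm V d) \<otimes>\<^sub>m ?q)))"
    using o by (subst pentagon1) auto
  also have "\<dots> = (idm V b \<otimes>\<^sub>m swp a d q) \<cdot> (assoc V b a (d \<otimes> q) \<cdot> ((symm V a b \<otimes>\<^sub>m idm V (d \<otimes> q)) \<cdot> assoc V (a \<otimes> b) d q))"
    using o assoc_nat[of "symm V a b" "idm V d" ?q "a \<otimes> b" d q "b \<otimes> a" d q] by simp
  also have "\<dots> = (idm V b \<otimes>\<^sub>m swp a d q) \<cdot> (swp a b (d \<otimes> q) \<cdot> (assoc V a b (d \<otimes> q) \<cdot> assoc V (a \<otimes> b) d q))"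
    using o by (simp add: swp_def)
  also have "\<dots> = ((idm V b \<otimes>\<^sub>m swp a d q) \<cdot> (swp a b (d \<otimes> q) \<cdot> (idm V a \<otimes>\<^sub>m assoc V b d q))) \<cdot> ?k"
    using o by (simp add: pentagon0)
  finally show ?thesis
    by (rule iso_cancel_right[rotated -1]) (use o in auto)
qed

text \<open>Inverting \<open>swp_ten\<close> gives the case in which the pair is moved past the
  single factor. It is needed when two natural families are composed.\<close>

lemma swp_ten':
  assumes a: "a \<in> obj V" and b: "b \<in> obj V" and d: "d \<in> obj V" and q: "q \<in> obj V"
  shows "(idm V a \<otimes>\<^sub>m assoc V b d q) \<cdot> swp (b \<otimes> d) a q =
     swp b a (d \<otimes> q) \<cdot> ((idm V b \<otimes>\<^sub>m swp d a q) \<cdot> assoc V b d (a \<otimes> q))"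
proof -
  note o = a b d q
  have "swp b a (d \<otimes> q) \<cdot> ((idm V b \<otimes>\<^sub>m swp d a q) \<cdot> (assoc V b d (a \<otimes> q) \<cdot> (swp a (b \<otimes> d) q \<cdot> swp (b \<otimes> d) a q)))
    = swp b a (d \<otimes> q) \<cdot> ((idm V b \<otimes>\<^sub>m swp d a q) \<cdot> ((assoc V b d (a \<otimes> q) \<cdot> swp a (b \<otimes> d) q) \<cdot> swp (b \<otimes> d) a q))"
    using o by simp
  also have "\<dots> = (idm V a \<otimes>\<^sub>m assoc V b d q) \<cdot> swp (b \<otimes> d) a q"
    unfolding swp_ten[OF a b d q] using o by simp
  finally show ?thesis using o by simp
qed

end

section \<open>Generalized elements of enriched categories\<close>

context sym_monoidal_closed
begin

text \<open>An arrow \<open>f : W \<rightarrow> C(X,Y)\<close> of \<open>V\<close> is regarded as an arrow \<open>X \<rightarrow> Y\<close> of grade \<open>W\<close>; the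
  composite \<open>gc C X Y Z g f\<close> of arrows of grades \<open>W'\<close> and \<open>W\<close> has grade \<open>W' \<otimes> W\<close>.  Composites are kept nested to
  the right, so that associators hardly occur.\<close>

definition el :: "('c, 'o, 'm, 'z) vcat_scheme \<Rightarrow> 'o \<Rightarrow> 'c \<Rightarrow> 'c \<Rightarrow> 'm set" where
  "el C W X Y = {f \<in> homs V W (vhom C X Y). vcategory C \<and> X \<in> vob C \<and> Y \<in> vob C}"

definition gc :: "('c, 'o, 'm, 'z) vcat_scheme \<Rightarrow> 'c \<Rightarrow> 'c \<Rightarrow> 'c \<Rightarrow> 'm \<Rightarrow> 'm \<Rightarrow> 'm" where
  "gc C X Y Z g f = vcomp C X Y Z \<cdot> (g \<otimes>\<^sub>m f)"

lemma el_iff [simp]: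
  "f \<in> el C W X Y \<longleftrightarrow> vcategory C \<and> X \<in> vob C \<and> Y \<in> vob C \<and> f \<in> arr V \<and> src V f = W \<and> tgt V f = vhom C X Y"
  by (auto simp: el_def)

lemma vhom_obj [simp]: "\<lbrakk>vcategory C; X \<in> vob C; Y \<in> vob C\<rbrakk> \<Longrightarrow> vhom C X Y \<in> obj V"
  by (simp add: vcategory_def)

lemma vid_typing [simp]:
  assumes "vcategory C" "X \<in> vob C"
  shows "vid C X \<in> arr V" "src V (vid C X) = \<one>" "tgt V (vid C X) = vhom C X X"
  using assms unfolding vcategory_def in_homs by blast+

lemma vcomp_typing [simp]:
  assumes "vcategory C" "X \<in> vob C" "Y \<in> vob C" "Z \<in> vob C"
  shows "vcomp C X Y Z \<in> arr V" "src V (vcomp C X Y Z) = vhom C Y Z \<otimes> vhom C X Y"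
    "tgt V (vcomp C X Y Z) = vhom C X Z"
  using assms unfolding vcategory_def in_homs by blast+

lemma gc_typing [simp]:
  assumes "vcategory C" "X \<in> vob C" "Y \<in> vob C" "Z \<in> vob C"
    "g \<in> arr V" "tgt V g = vhom C Y Z" "f \<in> arr V" "tgt V f = vhom C X Y"
  shows "gc C X Y Z g f \<in> arr V" "src V (gc C X Y Z g f) = src V g \<otimes> src V f"
    "tgt V (gc C X Y Z g f) = vhom C X Z"
  using assms by (auto simp: gc_def)

text \<open>Here and in \<open>gc_cmp_right\<close> changes of grade are moved out to the right, so
  that two composites can be compared in C first and by their coherence maps afterwards.\<close>

lemma gc_cmp_left [simp]:
  assumes "vcategory C" "X \<in> vob C" "Y \<in> vob C" "Z \<in> vob C"
    "g \<in> arr V" "tgt V g = vhom C Y Z" "f \<in> arr V" "tgt V f = vhom C X Y" "u \<in> arr V" "tgt V u = src V g"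
  shows "gc C X Y Z (g \<cdot> u) f = gc C X Y Z g f \<cdot> (u \<otimes>\<^sub>m idm V (src V f))"
  using assms by (simp add: gc_def)

lemma gc_cmp_right [simp]:
  assumes "vcategory C" "X \<in> vob C" "Y \<in> vob C" "Z \<in> vob C"
    "g \<in> arr V" "tgt V g = vhom C Y Z" "f \<in> arr V" "tgt V f = vhom C X Y" "u \<in> arr V" "tgt V u = src V f"
  shows "gc C X Y Z g (f \<cdot> u) = gc C X Y Z g f \<cdot> (idm V (src V g) \<otimes>\<^sub>m u)"
  using assms by (simp add: gc_def)

lemma gc_assoc [simp]:
  assumes C: "vcategory C" "W \<in> vob C" "X \<in> vob C" "Y \<in> vob C" "Z \<in> vob C"
    and h: "h \<in> arr V" "tgt V h = vhom C Y Z" and g: "g \<in> arr V" "tgt V g = vhom C X Y"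
    and f: "f \<in> arr V" "tgt V f = vhom C W X"
  shows "gc C W X Z (gc C X Y Z h g) f =
    gc C W Y Z h (gc C W X Y g f) \<cdot> assoc V (src V h) (src V g) (src V f)"
proof -
  have a: "vcomp C W X Z \<cdot> (vcomp C X Y Z \<otimes>\<^sub>m idm V (vhom C W X)) =
      vcomp C W Y Z \<cdot> (idm V (vhom C Y Z) \<otimes>\<^sub>m vcomp C W X Y) \<cdot> assoc V (vhom C Y Z) (vhom C X Y) (vhom C W X)"
    using C unfolding vcategory_def by blast
  have "gc C W X Z (gc C X Y Z h g) f =
      (vcomp C W X Z \<cdot> (vcomp C X Y Z \<otimes>\<^sub>m idm V (vhom C W X))) \<cdot> ((h \<otimes>\<^sub>m g) \<otimes>\<^sub>m f)"
    using assms by (simp add: gc_def)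
  also have "\<dots> = vcomp C W Y Z \<cdot> ((idm V (vhom C Y Z) \<otimes>\<^sub>m vcomp C W X Y) \<cdot>
      (assoc V (vhom C Y Z) (vhom C X Y) (vhom C W X) \<cdot> ((h \<otimes>\<^sub>m g) \<otimes>\<^sub>m f)))"
    unfolding a using assms by simp
  also have "\<dots> = gc C W Y Z h (gc C W X Y g f) \<cdot> assoc V (src V h) (src V g) (src V f)"
    using assms by (simp add: gc_def assoc_nat[of h g f "src V h" "src V g" "src V f"])
  finally show ?thesis .
qed

lemma gc_assoc_left:
  assumes "vcategory C" "W \<in> vob C" "X \<in> vob C" "Y \<in> vob C" "Z \<in> vob C"
    "h \<in> arr V" "tgt V h = vhom C Y Z" "g \<in> arr V" "tgt V g = vhom C X Y" "f \<in> arr V" "tgt V f = vhom C W X"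
  shows "gc C W Y Z h (gc C W X Y g f) =
    gc C W X Z (gc C X Y Z h g) f \<cdot> ai (src V h) (src V g) (src V f)"
  using assms by simp

lemma gc_vid_left [simp]:
  assumes "vcategory C" "X \<in> vob C" "Y \<in> vob C" "f \<in> arr V" "tgt V f = vhom C X Y"
  shows "gc C X Y Y (vid C Y) f = f \<cdot> lunit V (src V f)"
proof -
  have "vcomp C X Y Y \<cdot> (vid C Y \<otimes>\<^sub>m idm V (vhom C X Y)) = lunit V (vhom C X Y)"
    using assms(1-3) unfolding vcategory_def by blast
  then have "gc C X Y Y (vid C Y) f = lunit V (vhom C X Y) \<cdot> (idm V \<one> \<otimes>\<^sub>m f)"
    using assms cmp_assoc'[of "idm V \<one> \<otimes>\<^sub>m f" "vid C Y \<otimes>\<^sub>m idm V (vhom C X Y)" "vcomp C X Y Y"]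
    by (simp add: gc_def)
  then show ?thesis using assms lunit_nat[of f "src V f"] by simp
qed

lemma gc_vid_right [simp]:
  assumes "vcategory C" "X \<in> vob C" "Y \<in> vob C" "f \<in> arr V" "tgt V f = vhom C X Y"
  shows "gc C X X Y f (vid C X) = f \<cdot> runit V (src V f)"
proof -
  have "vcomp C X X Y \<cdot> (idm V (vhom C X Y) \<otimes>\<^sub>m vid C X) = runit V (vhom C X Y)"
    using assms(1-3) unfolding vcategory_def by blast
  then have "gc C X X Y f (vid C X) = runit V (vhom C X Y) \<cdot> (f \<otimes>\<^sub>m idm V \<one>)"
    using assms cmp_assoc'[of "f \<otimes>\<^sub>m idm V \<one>" "idm V (vhom C X Y) \<otimes>\<^sub>m vid C X" "vcomp C X X Y"]
    by (simp add: gc_def)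
  then show ?thesis using assms runit_nat[of f "src V f"] by simp
qed

text \<open>Testing on the identity is enough, since it only inserts the invertible right unitor.
  Equations known for all test arrows x can so be turned into equations of arrows.\<close>

lemma gc_eqI:
  assumes "f \<in> el C W X Y" "g \<in> el C W X Y" "gc C X X Y f (vid C X) = gc C X X Y g (vid C X)"
  shows "f = g"
  by (rule iso_cancel_right[of "runit V W"]) (use assms in auto)

subsection \<open>Postcomposition with ordinary arrows\<close>

text \<open>An arrow f of grade I is an ordinary arrow. Removing this I from the grade of the
  composite makes the action of f preserve grades and be strictly associative, see
  \<open>lact_lact\<close>.\<close>

definition lact :: "('c, 'o, 'm, 'z) vcat_scheme \<Rightarrow> 'c \<Rightarrow> 'c \<Rightarrow> 'c \<Rightarrow> 'm \<Rightarrow> 'm \<Rightarrow> 'm" where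
  "lact C X Y Z f x = gc C X Y Z f x \<cdot> li (src V x)"

lemma lact_typing [simp]:
  assumes "vcategory C" "X \<in> vob C" "Y \<in> vob C" "Z \<in> vob C"
    "f \<in> arr V" "src V f = \<one>" "tgt V f = vhom C Y Z" "x \<in> arr V" "tgt V x = vhom C X Y"
  shows "lact C X Y Z f x \<in> arr V" "src V (lact C X Y Z f x) = src V x" "tgt V (lact C X Y Z f x) = vhom C X Z"
  using assms by (auto simp: lact_def)

lemma li_nat: "\<lbrakk>f \<in> arr V; src V f = a; tgt V f = b\<rbrakk> \<Longrightarrow> li b \<cdot> f = (idm V \<one> \<otimes>\<^sub>m f) \<cdot> li a"
proof -
  assume f: "f \<in> arr V" "src V f = a" "tgt V f = b"
  then have o: "a \<in> obj V" "b \<in> obj V" by auto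
  have "lunit V b \<cdot> ((idm V \<one> \<otimes>\<^sub>m f) \<cdot> li a) = (lunit V b \<cdot> (idm V \<one> \<otimes>\<^sub>m f)) \<cdot> li a"
    by (rule cmp_assoc'[symmetric]) (use f o in auto)
  also have "\<dots> = f" using f o by (simp add: lunit_nat)
  finally have "li b \<cdot> f = li b \<cdot> (lunit V b \<cdot> ((idm V \<one> \<otimes>\<^sub>m f) \<cdot> li a))" by simp
  then show ?thesis using f o by simp
qed

lemma lact_vid [simp]:
  assumes "vcategory C" "X \<in> vob C" "Y \<in> vob C" "x \<in> arr V" "tgt V x = vhom C X Y"
  shows "lact C X Y Y (vid C Y) x = x"
  using assms by (simp add: lact_def)

lemma lact_vid_right [simp]:
  assumes "vcategory C" "X \<in> vob C" "Y \<in> vob C" "x \<in> arr V" "src V x = \<one>" "tgt V x = vhom C X Y"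
  shows "lact C X X Y x (vid C X) = x"
  using assms lunit_eq_runit by (simp add: lact_def)

lemma lact_cmp [simp]:
  assumes "vcategory C" "X \<in> vob C" "Y \<in> vob C" "Z \<in> vob C"
    "f \<in> arr V" "src V f = \<one>" "tgt V f = vhom C Y Z" "x \<in> arr V" "tgt V x = vhom C X Y"
    "u \<in> arr V" "tgt V u = src V x"
  shows "lact C X Y Z f (x \<cdot> u) = lact C X Y Z f x \<cdot> u"
  using assms by (simp add: lact_def li_nat[of u "src V u"])

text \<open>The associator with I in front is absorbed by \<open>lunit_ten\<close>, so no coherence
  map survives.\<close>

lemma lact_gc:
  assumes "vcategory C" "W \<in> vob C" "X \<in> vob C" "Y \<in> vob C" "Z \<in> vob C"
    "f \<in> arr V" "src V f = \<one>" "tgt V f = vhom C Y Z" "g \<in> arr V" "tgt V g = vhom C X Y"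
    "x \<in> arr V" "tgt V x = vhom C W X"
  shows "gc C W X Z (lact C X Y Z f g) x = lact C W Y Z f (gc C W X Y g x)"
proof -
  have o: "src V g \<in> obj V" "src V x \<in> obj V" using assms by auto
  have "lunit V (src V g \<otimes> src V x) \<cdot> (assoc V \<one> (src V g) (src V x) \<cdot> (li (src V g) \<otimes>\<^sub>m idm V (src V x)))
     = (lunit V (src V g \<otimes> src V x) \<cdot> assoc V \<one> (src V g) (src V x)) \<cdot> (li (src V g) \<otimes>\<^sub>m idm V (src V x))"
    using o by simp
  also have "\<dots> = idm V (src V g \<otimes> src V x)" using o by (simp only: lunit_ten) simp
  finally have "li (src V g \<otimes> src V x) \<cdot> (lunit V (src V g \<otimes> src V x) \<cdot> (assoc V \<one> (src V g) (src V x) \<cdot> (li (src V g) \<otimes>\<^sub>m idm V (src V x))))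
     = li (src V g \<otimes> src V x)" using o by simp
  then have "assoc V \<one> (src V g) (src V x) \<cdot> (li (src V g) \<otimes>\<^sub>m idm V (src V x)) = li (src V g \<otimes> src V x)"
    using o by simp
  then show ?thesis using assms by (simp add: lact_def)
qed

lemma ucomp_lact:
  assumes "vcategory C" "X \<in> vob C" "Y \<in> vob C" "Z \<in> vob C"
    "f \<in> arr V" "src V f = \<one>" "tgt V f = vhom C X Y" "g \<in> arr V" "src V g = \<one>" "tgt V g = vhom C Y Z"
  shows "ucomp C X Y Z g f = lact C X Y Z g f"
  using assms by (simp add: ucomp_def lact_def gc_def)

lemma lact_lact [simp]:
  assumes "vcategory C" "W \<in> vob C" "X \<in> vob C" "Y \<in> vob C" "Z \<in> vob C"
    "f \<in> arr V" "src V f = \<one>" "tgt V f = vhom C Y Z" "g \<in> arr V" "src V g = \<one>" "tgt V g = vhom C X Y"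
    "x \<in> arr V" "tgt V x = vhom C W X"
  shows "lact C W X Z (lact C X Y Z f g) x = lact C W Y Z f (lact C W X Y g x)"
  unfolding lact_def[of C W X Z] using assms li_nat[of "li (src V x)" "src V x" "\<one> \<otimes> src V x"]
  by (simp add: lact_gc) (simp add: lact_def)

subsection \<open>Enriched functors on generalized elements\<close>

text \<open>A constant of its own, so that t under F remains an element to which functoriality
  applies, and is not split off as a change of grade by \<open>gc_cmp_left\<close> and
  \<open>gc_cmp_right\<close>.\<close>

definition fm :: "('a, 'b, 'm) vfun \<Rightarrow> 'a \<Rightarrow> 'a \<Rightarrow> 'm \<Rightarrow> 'm" where
  "fm F X Y t = fhom F X Y \<cdot> t"

lemma vfunctor_obj [simp]: "\<lbrakk>vfunctor A B F; X \<in> vob A\<rbrakk> \<Longrightarrow> fobj F X \<in> vob B"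
  unfolding vfunctor_def by blast

lemma vfunctor_hom [simp]:
  assumes "vfunctor A B F" "X \<in> vob A" "Y \<in> vob A"
  shows "fhom F X Y \<in> arr V" "src V (fhom F X Y) = vhom A X Y" "tgt V (fhom F X Y) = vhom B (fobj F X) (fobj F Y)"
  using assms unfolding vfunctor_def in_homs by blast+

lemma fm_typing [simp]:
  assumes "vfunctor A B F" "X \<in> vob A" "Y \<in> vob A" "t \<in> arr V" "tgt V t = vhom A X Y"
  shows "fm F X Y t \<in> arr V" "src V (fm F X Y t) = src V t" "tgt V (fm F X Y t) = vhom B (fobj F X) (fobj F Y)"
  using assms by (auto simp: fm_def)

lemma fm_idm [simp]:
  assumes "vfunctor A B F" "X \<in> vob A" "Y \<in> vob A"
  shows "fm F X Y (idm V (vhom A X Y)) = fhom F X Y"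
  using assms by (simp add: fm_def)

lemma fm_cmp:
  assumes "vfunctor A B F" "X \<in> vob A" "Y \<in> vob A" "t \<in> arr V" "tgt V t = vhom A X Y" "u \<in> arr V" "tgt V u = src V t"
  shows "fm F X Y (t \<cdot> u) = fm F X Y t \<cdot> u"
  using assms by (simp add: fm_def)

lemma fm_vid:
  assumes "vfunctor A B F" "X \<in> vob A"
  shows "fm F X X (vid A X) = vid B (fobj F X)"
  using assms unfolding fm_def vfunctor_def by blast

lemma fm_gc:
  assumes A: "vcategory A" and B: "vcategory B" and F: "vfunctor A B F"
    and o: "X \<in> vob A" "Y \<in> vob A" "Z \<in> vob A"
    and g: "g \<in> arr V" "tgt V g = vhom A Y Z" and f: "f \<in> arr V" "tgt V f = vhom A X Y"
  shows "fm F X Z (gc A X Y Z g f) = gc B (fobj F X) (fobj F Y) (fobj F Z) (fm F Y Z g) (fm F X Y f)"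
proof -
  have e: "fhom F X Z \<cdot> vcomp A X Y Z =
        vcomp B (fobj F X) (fobj F Y) (fobj F Z) \<cdot> (fhom F Y Z \<otimes>\<^sub>m fhom F X Y)"
    using F o unfolding vfunctor_def by blast
  have "fm F X Z (gc A X Y Z g f) = (fhom F X Z \<cdot> vcomp A X Y Z) \<cdot> (g \<otimes>\<^sub>m f)"
    using assms by (simp add: fm_def gc_def)
  also have "\<dots> = gc B (fobj F X) (fobj F Y) (fobj F Z) (fm F Y Z g) (fm F X Y f)"
    unfolding e using assms by (simp add: fm_def gc_def)
  finally show ?thesis .
qed

text \<open>The composition axiom is the equation at the universal elements, the identities of the
  two hom objects. Phrasing it for elements keeps all later verifications in terms of
  \<open>gc\<close>.\<close>

lemma vfunctorI:
  assumes A: "vcategory A" and B: "vcategory B"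
    and ob: "fobj F \<in> vob A \<rightarrow>\<^sub>E vob B"
    and ext: "\<And>X Y. X \<notin> vob A \<or> Y \<notin> vob A \<Longrightarrow> fhom F X Y = undefined"
    and hm: "\<And>X Y. \<lbrakk>X \<in> vob A; Y \<in> vob A\<rbrakk> \<Longrightarrow> fhom F X Y \<in> homs V (vhom A X Y) (vhom B (fobj F X) (fobj F Y))"
    and id: "\<And>X. X \<in> vob A \<Longrightarrow> fhom F X X \<cdot> vid A X = vid B (fobj F X)"
    and gc: "\<And>X Y Z g f. \<lbrakk>g \<in> el A (vhom A Y Z) Y Z; f \<in> el A (vhom A X Y) X Y\<rbrakk> \<Longrightarrow>
        fm F X Z (gc A X Y Z g f) = gc B (fobj F X) (fobj F Y) (fobj F Z) (fm F Y Z g) (fm F X Y f)"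
  shows "vfunctor A B F"
proof -
  have "fhom F X Z \<cdot> vcomp A X Y Z =
        vcomp B (fobj F X) (fobj F Y) (fobj F Z) \<cdot> (fhom F Y Z \<otimes>\<^sub>m fhom F X Y)"
    if o: "X \<in> vob A" "Y \<in> vob A" "Z \<in> vob A" for X Y Z
  proof -
    have "fhom F X Z \<in> homs V (vhom A X Z) (vhom B (fobj F X) (fobj F Z))"
      "fhom F Y Z \<in> homs V (vhom A Y Z) (vhom B (fobj F Y) (fobj F Z))"
      "fhom F X Y \<in> homs V (vhom A X Y) (vhom B (fobj F X) (fobj F Y))"
      using hm o by auto
    then show ?thesis
      using gc[of "idm V (vhom A Y Z)" Y Z "idm V (vhom A X Y)" X] o A B by (simp add: fm_def gc_def)
  qed
  then show ?thesis unfolding vfunctor_def using assms by blast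
qed

subsection \<open>Cotensors on generalized elements\<close>

lemma curry_arr:
  assumes "a \<in> obj V" "b \<in> obj V" "w \<in> obj V" "f \<in> arr V" "src V f = w \<otimes> a" "tgt V f = b"
  shows "curry_arr w a b f \<in> arr V" "src V (curry_arr w a b f) = w" "tgt V (curry_arr w a b f) = ihom V a b"
    "ev V a b \<cdot> (curry_arr w a b f \<otimes>\<^sub>m idm V a) = f"
  using theI'[OF ev_universal[of a b w f]] assms unfolding curry_arr_def by auto

lemma curry_eqI:
  assumes "a \<in> obj V" "b \<in> obj V" "g \<in> arr V" "h \<in> arr V" "src V g = src V h"
    "tgt V g = ihom V a b" "tgt V h = ihom V a b"
    "ev V a b \<cdot> (g \<otimes>\<^sub>m idm V a) = ev V a b \<cdot> (h \<otimes>\<^sub>m idm V a)"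
  shows "g = h"
proof -
  have "\<exists>!k. k \<in> homs V (src V h) (ihom V a b) \<and> ev V a b \<cdot> (k \<otimes>\<^sub>m idm V a) = ev V a b \<cdot> (h \<otimes>\<^sub>m idm V a)"
    by (rule ev_universal) (use assms in auto)
  then show ?thesis using assms by auto
qed

lemma cotensor_comparison:
  assumes "vcategory C" "J \<in> obj V" "\<gamma> \<in> el C J P X" "Y \<in> vob C"
  shows "cotensor_comparison C J X P \<gamma> Y \<in> arr V"
    "src V (cotensor_comparison C J X P \<gamma> Y) = vhom C Y P"
    "tgt V (cotensor_comparison C J X P \<gamma> Y) = ihom V J (vhom C Y X)"
    "\<lbrakk>g \<in> arr V; tgt V g = vhom C Y P\<rbrakk> \<Longrightarrow> ev V J (vhom C Y X) \<cdot> ((cotensor_comparison C J X P \<gamma> Y \<cdot> g) \<otimes>\<^sub>m idm V J)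
       = gc C Y P X \<gamma> g \<cdot> symm V (src V g) J"
proof -
  let ?f = "vcomp C Y P X \<cdot> (\<gamma> \<otimes>\<^sub>m idm V (vhom C Y P)) \<cdot> symm V (vhom C Y P) J"
  let ?k = "cotensor_comparison C J X P \<gamma> Y"
  note c = curry_arr[of J "vhom C Y X" "vhom C Y P" ?f, folded cotensor_comparison_def]
  show t: "?k \<in> arr V" "src V ?k = vhom C Y P" "tgt V ?k = ihom V J (vhom C Y X)"
    using c(1-3) assms by auto
  have e: "ev V J (vhom C Y X) \<cdot> (?k \<otimes>\<^sub>m idm V J) = ?f" using c(4) assms by auto
  assume g: "g \<in> arr V" "tgt V g = vhom C Y P"
  then have "ev V J (vhom C Y X) \<cdot> ((?k \<cdot> g) \<otimes>\<^sub>m idm V J) = (ev V J (vhom C Y X) \<cdot> (?k \<otimes>\<^sub>m idm V J)) \<cdot> (g \<otimes>\<^sub>m idm V J)"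
    using t assms by simp
  also have "\<dots> = gc C Y P X \<gamma> g \<cdot> symm V (src V g) J"
    unfolding e using assms g by (simp add: gc_def symm_nat[of g "idm V J" "src V g" J])
  finally show "ev V J (vhom C Y X) \<cdot> ((?k \<cdot> g) \<otimes>\<^sub>m idm V J) = gc C Y P X \<gamma> g \<cdot> symm V (src V g) J" .
qed

text \<open>Currying turns invertibility of the comparison arrow, read through
  \<open>iso_arrow_iff_bij\<close>, into unique factorization through the counit. The grade is J
  \<otimes> W in this order because the counit is applied last; the symmetry inside
  \<open>cotensor_comparison\<close> accounts for the change.\<close>

lemma is_cotensor_iff:
  assumes C: "vcategory C"
  shows "is_cotensor C J X P \<gamma> \<longleftrightarrow> J \<in> obj V \<and> \<gamma> \<in> el C J P X \<and>
    (\<forall>Y \<in> vob C. \<forall>W \<in> obj V. \<forall>f \<in> homs V (J \<otimes> W) (vhom C Y X).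
       \<exists>!g. g \<in> homs V W (vhom C Y P) \<and> gc C Y P X \<gamma> g = f)"
proof (cases "J \<in> obj V \<and> \<gamma> \<in> el C J P X")
  case True
  then have J: "J \<in> obj V" and \<gamma>: "\<gamma> \<in> el C J P X" by auto
  have "iso_arrow V (cotensor_comparison C J X P \<gamma> Y) \<longleftrightarrow>
     (\<forall>W \<in> obj V. \<forall>f \<in> homs V (J \<otimes> W) (vhom C Y X). \<exists>!g. g \<in> homs V W (vhom C Y P) \<and> gc C Y P X \<gamma> g = f)"
    (is "?L \<longleftrightarrow> ?R") if Y: "Y \<in> vob C" for Y
  proof -
    let ?k = "cotensor_comparison C J X P \<gamma> Y" and ?e = "ev V J (vhom C Y X)"
    have XP: "X \<in> vob C" "P \<in> vob C" using \<gamma> by auto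
    note k = cotensor_comparison[OF C J \<gamma> Y]
    \<comment> \<open>The two equations are transposes of each other, so unique solvability can be
      moved between them.\<close>
    have iff: "?k \<cdot> g = h \<longleftrightarrow> gc C Y P X \<gamma> g = (?e \<cdot> (h \<otimes>\<^sub>m idm V J)) \<cdot> symm V J W"
      if g: "g \<in> homs V W (vhom C Y P)" and h: "h \<in> homs V W (ihom V J (vhom C Y X))" for g h W
    proof
      have W: "W \<in> obj V" using g by auto
      show "gc C Y P X \<gamma> g = (?e \<cdot> (h \<otimes>\<^sub>m idm V J)) \<cdot> symm V J W" if "?k \<cdot> g = h"
        using k(4)[of g] that g h J \<gamma> XP Y C W by simp
      assume a: "gc C Y P X \<gamma> g = (?e \<cdot> (h \<otimes>\<^sub>m idm V J)) \<cdot> symm V J W"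
      show "?k \<cdot> g = h"
      proof (rule curry_eqI[of J "vhom C Y X"])
        have "?e \<cdot> ((?k \<cdot> g) \<otimes>\<^sub>m idm V J) = ((?e \<cdot> (h \<otimes>\<^sub>m idm V J)) \<cdot> symm V J W) \<cdot> symm V W J"
          using k(4)[of g] a g by simp
        also have "\<dots> = ?e \<cdot> (h \<otimes>\<^sub>m idm V J)" using g h J W XP Y C by simp
        finally show "?e \<cdot> ((?k \<cdot> g) \<otimes>\<^sub>m idm V J) = ?e \<cdot> (h \<otimes>\<^sub>m idm V J)" .
      qed (use J Y XP C g h k in auto)
    qed
    show ?thesis
    proof
      assume iso: ?L
      show ?R
      proof (intro ballI)
        fix W f assume W: "W \<in> obj V" and f: "f \<in> homs V (J \<otimes> W) (vhom C Y X)"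
        let ?h = "curry_arr W J (vhom C Y X) (f \<cdot> symm V W J)"
        note h = curry_arr[of J "vhom C Y X" W "f \<cdot> symm V W J"]
        have h': "?h \<in> homs V W (ihom V J (vhom C Y X))" using h f W J XP Y C by simp
        have "\<exists>!g. g \<in> homs V W (vhom C Y P) \<and> ?k \<cdot> g = ?h"
          using iso iso_arrow_iff_bij[of ?k "vhom C Y P"] k h' W by auto
        moreover have "?k \<cdot> g = ?h \<longleftrightarrow> gc C Y P X \<gamma> g = f" if "g \<in> homs V W (vhom C Y P)" for g
          unfolding iff[OF that h'] using h f W J XP Y C by simp
        ultimately show "\<exists>!g. g \<in> homs V W (vhom C Y P) \<and> gc C Y P X \<gamma> g = f" by metis
      qed
    next
      assume R: ?R
      show ?L
      proof (rule iso_arrow_iff_bij[THEN iffD2, of _ "vhom C Y P" "ihom V J (vhom C Y X)"])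
        show "\<forall>W \<in> obj V. \<forall>h \<in> homs V W (ihom V J (vhom C Y X)). \<exists>!g. g \<in> homs V W (vhom C Y P) \<and> ?k \<cdot> g = h"
        proof (intro ballI)
          fix W h assume W: "W \<in> obj V" and h: "h \<in> homs V W (ihom V J (vhom C Y X))"
          let ?f = "(?e \<cdot> (h \<otimes>\<^sub>m idm V J)) \<cdot> symm V J W"
          have "?f \<in> homs V (J \<otimes> W) (vhom C Y X)" using h W J XP Y C by simp
          then have "\<exists>!g. g \<in> homs V W (vhom C Y P) \<and> gc C Y P X \<gamma> g = ?f" using R W by blast
          then show "\<exists>!g. g \<in> homs V W (vhom C Y P) \<and> ?k \<cdot> g = h" using iff h by metis
        qed
      qed (use k in simp)
    qed
  qed
  then show ?thesis using True C by (auto simp: is_cotensor_def)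
qed (use C in \<open>auto simp: is_cotensor_def\<close>)

text \<open>The factorization through the counit. \<open>cotensor_lift\<close> takes arrows of grade
  W \<otimes> J, whereas composing with the counit produces grade J \<otimes> W, hence the
  symmetry.\<close>

definition cfac :: "('c, 'o, 'm, 'z) vcat_scheme \<Rightarrow> 'o \<Rightarrow> 'c \<Rightarrow> 'c \<Rightarrow> 'm \<Rightarrow> 'c \<Rightarrow> 'o \<Rightarrow> 'm \<Rightarrow> 'm" where
  "cfac C J X P \<gamma> Y W f = cotensor_lift C J X P \<gamma> Y W (f \<cdot> symm V W J)"

lemma cotensor_lift:
  assumes C: "vcategory C" and \<gamma>: "is_cotensor C J X P \<gamma>" and Y: "Y \<in> vob C" and W: "W \<in> obj V"
    and f: "f \<in> arr V" "src V f = W \<otimes> J" "tgt V f = vhom C Y X"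
  shows "cotensor_lift C J X P \<gamma> Y W f \<in> arr V" "src V (cotensor_lift C J X P \<gamma> Y W f) = W"
    "tgt V (cotensor_lift C J X P \<gamma> Y W f) = vhom C Y P"
    "gc C Y P X \<gamma> (cotensor_lift C J X P \<gamma> Y W f) = f \<cdot> symm V J W"
proof -
  let ?k = "cotensor_comparison C J X P \<gamma> Y" and ?h = "curry_arr W J (vhom C Y X) f"
  let ?l = "cotensor_lift C J X P \<gamma> Y W f"
  have g: "J \<in> obj V" "\<gamma> \<in> el C J P X" using \<gamma> is_cotensor_iff[OF C] by blast+
  have iso: "iso_arrow V ?k" using \<gamma> Y by (simp add: is_cotensor_def)
  note k = cotensor_comparison[OF C g Y]
  have XP: "X \<in> vob C" "P \<in> vob C" using g by auto
  note h = curry_arr[of J "vhom C Y X" W f]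
  show t: "?l \<in> arr V" "src V ?l = W" "tgt V ?l = vhom C Y P"
    unfolding cotensor_lift_def using h k iso f g XP C W Y by auto
  have "?k \<cdot> ?l = ?h" unfolding cotensor_lift_def using h k iso f g XP C W Y by simp
  then have "gc C Y P X \<gamma> ?l \<cdot> symm V W J = f" using k(4)[of ?l] t h f g XP C W Y by simp
  then have "(gc C Y P X \<gamma> ?l \<cdot> symm V W J) \<cdot> symm V J W = f \<cdot> symm V J W" by simp
  then show "gc C Y P X \<gamma> ?l = f \<cdot> symm V J W" using t f g XP C W Y by simp
qed

lemma cfac:
  assumes C: "vcategory C" and \<gamma>: "is_cotensor C J X P \<gamma>" and Y: "Y \<in> vob C" and W: "W \<in> obj V"
    and f: "f \<in> arr V" "src V f = J \<otimes> W" "tgt V f = vhom C Y X"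
  shows "cfac C J X P \<gamma> Y W f \<in> arr V" "src V (cfac C J X P \<gamma> Y W f) = W"
    "tgt V (cfac C J X P \<gamma> Y W f) = vhom C Y P"
    "gc C Y P X \<gamma> (cfac C J X P \<gamma> Y W f) = f"
proof -
  have J: "J \<in> obj V" using \<gamma> by (simp add: is_cotensor_def)
  note l = cotensor_lift[OF C \<gamma> Y W, of "f \<cdot> symm V W J", folded cfac_def]
  show "cfac C J X P \<gamma> Y W f \<in> arr V" "src V (cfac C J X P \<gamma> Y W f) = W"
    "tgt V (cfac C J X P \<gamma> Y W f) = vhom C Y P"
    "gc C Y P X \<gamma> (cfac C J X P \<gamma> Y W f) = f" using l f J W by auto
qed

lemma is_cotensorD:
  assumes "is_cotensor C J X P \<gamma>"
  shows "J \<in> obj V" "X \<in> vob C" "P \<in> vob C" "\<gamma> \<in> arr V" "src V \<gamma> = J" "tgt V \<gamma> = vhom C P X"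
  using assms by (auto simp: is_cotensor_def)

lemma cot_cancel:
  assumes C: "vcategory C" and \<gamma>: "is_cotensor C J X P \<gamma>" and Y: "Y \<in> vob C"
    and f: "f \<in> arr V" "tgt V f = vhom C Y P" and g: "g \<in> arr V" "tgt V g = vhom C Y P" "src V f = src V g"
    and e: "gc C Y P X \<gamma> f = gc C Y P X \<gamma> g"
  shows "f = g"
proof -
  note d = is_cotensorD[OF \<gamma>]
  have "\<exists>!h. h \<in> homs V (src V g) (vhom C Y P) \<and> gc C Y P X \<gamma> h = gc C Y P X \<gamma> g"
    using \<gamma> unfolding is_cotensor_iff[OF C] using C d Y g by auto
  then show ?thesis using e f g by auto
qed

lemma is_cotensorI:
  assumes C: "vcategory C" and t: "J \<in> obj V" "\<gamma> \<in> el C J P X"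
    and ex: "\<And>Y W f. \<lbrakk>Y \<in> vob C; W \<in> obj V; f \<in> homs V (J \<otimes> W) (vhom C Y X)\<rbrakk> \<Longrightarrow>
       \<exists>g. g \<in> homs V W (vhom C Y P) \<and> gc C Y P X \<gamma> g = f"
    and un: "\<And>Y W g h. \<lbrakk>Y \<in> vob C; W \<in> obj V; g \<in> homs V W (vhom C Y P); h \<in> homs V W (vhom C Y P);
       gc C Y P X \<gamma> g = gc C Y P X \<gamma> h\<rbrakk> \<Longrightarrow> g = h"
  shows "is_cotensor C J X P \<gamma>"
  unfolding is_cotensor_iff[OF C]
proof (intro conjI ballI t)
  fix Y W f assume a: "Y \<in> vob C" "W \<in> obj V" "f \<in> homs V (J \<otimes> W) (vhom C Y X)"
  show "\<exists>!g. g \<in> homs V W (vhom C Y P) \<and> gc C Y P X \<gamma> g = f"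
    using ex[OF a] un[OF a(1,2)] by metis
qed

text \<open>Factor through \<gamma> with J \<otimes> W as the grade, and the result through
  \<delta>. So [J,[L,X]] is [L \<otimes> J, X]; closure of the arities under the tensor product
  enters through this fact.\<close>

lemma cot_compose:
  assumes C: "vcategory C" and \<gamma>: "is_cotensor C L X K \<gamma>" and \<delta>: "is_cotensor C J K P \<delta>"
  shows "is_cotensor C (L \<otimes> J) X P (gc C P K X \<gamma> \<delta>)"
proof (rule is_cotensorI[OF C])
  note d = is_cotensorD[OF \<gamma>] is_cotensorD[OF \<delta>]
  show "L \<otimes> J \<in> obj V" "gc C P K X \<gamma> \<delta> \<in> el C (L \<otimes> J) P X" using d C by auto
  fix Y W assume Y: "Y \<in> vob C" and W: "W \<in> obj V"
  show "\<exists>g. g \<in> homs V W (vhom C Y P) \<and> gc C Y P X (gc C P K X \<gamma> \<delta>) g = f"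
    if f: "f \<in> homs V ((L \<otimes> J) \<otimes> W) (vhom C Y X)" for f
  proof -
    let ?g = "cfac C L X K \<gamma> Y (J \<otimes> W) (f \<cdot> ai L J W)"
    let ?h = "cfac C J K P \<delta> Y W ?g"
    have g: "?g \<in> homs V (J \<otimes> W) (vhom C Y K)" "gc C Y K X \<gamma> ?g = f \<cdot> ai L J W"
      using cfac[OF C \<gamma> Y, of "J \<otimes> W" "f \<cdot> ai L J W"] f d W by auto
    have "?h \<in> homs V W (vhom C Y P)" "gc C Y P K \<delta> ?h = ?g"
      using cfac[OF C \<delta> Y W, of ?g] g by auto
    then show ?thesis using f d C Y W g by (intro exI[of _ ?h]) simp
  qed
  show "g = h" if a: "g \<in> homs V W (vhom C Y P)" "h \<in> homs V W (vhom C Y P)"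
    and e: "gc C Y P X (gc C P K X \<gamma> \<delta>) g = gc C Y P X (gc C P K X \<gamma> \<delta>) h" for g h
  proof (rule cot_cancel[OF C \<delta> Y])
    show "gc C Y P K \<delta> g = gc C Y P K \<delta> h"
    proof (rule cot_cancel[OF C \<gamma> Y])
      show "gc C Y K X \<gamma> (gc C Y P K \<delta> g) = gc C Y K X \<gamma> (gc C Y P K \<delta> h)"
        by (rule iso_cancel_right[of "assoc V L J W"]) (use e a d Y W C in auto)
    qed (use a d Y W C in auto)
  qed (use a in auto)
qed

text \<open>A factorization through the composite counit is also one through \<delta>, because
  composing with \<gamma> is injective. This is the cancellation law that accompanies
  \<open>cot_compose\<close>.\<close>

lemma cot_factor:
  assumes C: "vcategory C" and \<gamma>: "is_cotensor C L X K \<gamma>" and \<delta>: "\<delta> \<in> el C J P K" "J \<in> obj V"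
    and \<epsilon>: "is_cotensor C (L \<otimes> J) X P (gc C P K X \<gamma> \<delta>)"
  shows "is_cotensor C J K P \<delta>"
proof (rule is_cotensorI[OF C])
  note d = is_cotensorD[OF \<gamma>] \<delta>
  fix Y W assume Y: "Y \<in> vob C" and W: "W \<in> obj V"
  show "\<exists>g. g \<in> homs V W (vhom C Y P) \<and> gc C Y P K \<delta> g = f"
    if f: "f \<in> homs V (J \<otimes> W) (vhom C Y K)" for f
  proof -
    let ?g = "cfac C (L \<otimes> J) X P (gc C P K X \<gamma> \<delta>) Y W (gc C Y K X \<gamma> f \<cdot> assoc V L J W)"
    have g: "?g \<in> homs V W (vhom C Y P)" "gc C Y P X (gc C P K X \<gamma> \<delta>) ?g = gc C Y K X \<gamma> f \<cdot> assoc V L J W"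
      using cfac[OF C \<epsilon> Y W, of "gc C Y K X \<gamma> f \<cdot> assoc V L J W"] f d W Y C by auto
    have "gc C Y P K \<delta> ?g = f"
    proof (rule cot_cancel[OF C \<gamma> Y])
      show "gc C Y K X \<gamma> (gc C Y P K \<delta> ?g) = gc C Y K X \<gamma> f"
        by (rule iso_cancel_right[of "assoc V L J W"]) (use g f d Y W C in auto)
    qed (use g f d Y W C in auto)
    then show ?thesis using g by blast
  qed
  show "g = h" if a: "g \<in> homs V W (vhom C Y P)" "h \<in> homs V W (vhom C Y P)"
    and e: "gc C Y P K \<delta> g = gc C Y P K \<delta> h" for g h
    by (rule cot_cancel[OF C \<epsilon> Y]) (use a e d Y W C in auto)
qed (use \<delta> in auto)

text \<open>Here h is the ordinary arrow through which \<gamma> factors by way of \<delta>. The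
  right unitor in the assumption comes from the grade I of h, and the triangle trades it for the
  left unitor hidden in \<open>lact\<close>.\<close>

lemma gc_lact_factor:
  assumes C: "vcategory C" and \<delta>: "\<delta> \<in> el C J Q X" and h: "h \<in> el C \<one> P Q" and \<gamma>: "\<gamma> \<in> el C J P X"
    and e: "gc C P Q X \<delta> h = \<gamma> \<cdot> runit V J" and x: "x \<in> arr V" "tgt V x = vhom C Y P" and Y: "Y \<in> vob C"
  shows "gc C Y Q X \<delta> (lact C Y P Q h x) = gc C Y P X \<gamma> x"
proof -
  define W where "W = src V x"
  have o: "W \<in> obj V" "J \<in> obj V" using x \<delta> W_def by auto
  note xs = x W_def[symmetric]
  have "gc C Y Q X \<delta> (gc C Y P Q h x) = gc C Y P X (gc C P Q X \<delta> h) x \<cdot> ai J \<one> W"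
    using C \<delta> h \<gamma> Y o xs by simp
  also have "\<dots> = gc C Y P X \<gamma> x \<cdot> ((runit V J \<otimes>\<^sub>m idm V W) \<cdot> ai J \<one> W)"
    unfolding e using assms o xs by simp
  also have "(runit V J \<otimes>\<^sub>m idm V W) \<cdot> ai J \<one> W = idm V J \<otimes>\<^sub>m lunit V W"
    using triangle[of J W, symmetric] o by simp
  finally show ?thesis using assms o xs by (simp add: lact_def)
qed

text \<open>Two cotensors of the same object are isomorphic, so it suffices that a functor preserves one.\<close>

lemma preserves_other_cotensor:
  assumes A: "vcategory A" and B: "vcategory B" and F: "vfunctor A B F"
    and \<gamma>: "is_cotensor A J X P \<gamma>" and \<delta>: "is_cotensor A J X Q \<delta>"
    and F\<gamma>: "is_cotensor B J (fobj F X) (fobj F P) (fm F P X \<gamma>)"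
  shows "is_cotensor B J (fobj F X) (fobj F Q) (fm F Q X \<delta>)"
proof -
  note d = is_cotensorD[OF \<gamma>] is_cotensorD[OF \<delta>]
  \<comment> \<open>The comparison arrows between the two cotensors. Only the round trip from Q to P
    and back is needed: h transports factorizations from P to Q, and k reduces uniqueness at Q to
    uniqueness at P.\<close>
  define h where "h = cfac A J X Q \<delta> P \<one> (\<gamma> \<cdot> runit V J)"
  define k where "k = cfac A J X P \<gamma> Q \<one> (\<delta> \<cdot> runit V J)"
  have h: "h \<in> el A \<one> P Q" "gc A P Q X \<delta> h = \<gamma> \<cdot> runit V J"
    using cfac[OF A \<delta>, of P \<one> "\<gamma> \<cdot> runit V J"] d A unfolding h_def by auto
  have k: "k \<in> el A \<one> Q P" "gc A Q P X \<gamma> k = \<delta> \<cdot> runit V J"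
    using cfac[OF A \<gamma>, of Q \<one> "\<delta> \<cdot> runit V J"] d A unfolding k_def by auto
  have hk: "lact A Q P Q h k = vid A Q"
  proof (rule cot_cancel[OF A \<delta>])
    have "gc A Q Q X \<delta> (lact A Q P Q h k) = gc A Q P X \<gamma> k"
      by (rule gc_lact_factor) (use A h k d in auto)
    then show "gc A Q Q X \<delta> (lact A Q P Q h k) = gc A Q Q X \<delta> (vid A Q)" using k d A by simp
  qed (use h k d A in auto)
  have f: "fm F P X \<gamma> \<in> el B J (fobj F P) (fobj F X)" "fm F Q X \<delta> \<in> el B J (fobj F Q) (fobj F X)"
    "fm F P Q h \<in> el B \<one> (fobj F P) (fobj F Q)" "fm F Q P k \<in> el B \<one> (fobj F Q) (fobj F P)"
    using F B d h k by auto
  have Fh: "gc B (fobj F P) (fobj F Q) (fobj F X) (fm F Q X \<delta>) (fm F P Q h) = fm F P X \<gamma> \<cdot> runit V J"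
    using fm_gc[OF A B F, of P Q X \<delta> h] h d F by (simp add: fm_cmp[OF F])
  have Fk: "gc B (fobj F Q) (fobj F P) (fobj F X) (fm F P X \<gamma>) (fm F Q P k) = fm F Q X \<delta> \<cdot> runit V J"
    using fm_gc[OF A B F, of Q P X \<gamma> k] k d F by (simp add: fm_cmp[OF F])
  have hl: "gc B Y (fobj F Q) (fobj F X) (fm F Q X \<delta>) (lact B Y (fobj F P) (fobj F Q) (fm F P Q h) x)
      = gc B Y (fobj F P) (fobj F X) (fm F P X \<gamma>) x" if "x \<in> arr V" "tgt V x = vhom B Y (fobj F P)" "Y \<in> vob B" for x Y
    by (rule gc_lact_factor[OF B f(2,3,1) Fh that])
  have kl: "gc B Y (fobj F P) (fobj F X) (fm F P X \<gamma>) (lact B Y (fobj F Q) (fobj F P) (fm F Q P k) x)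
      = gc B Y (fobj F Q) (fobj F X) (fm F Q X \<delta>) x" if "x \<in> arr V" "tgt V x = vhom B Y (fobj F Q)" "Y \<in> vob B" for x Y
    by (rule gc_lact_factor[OF B f(1,4,2) Fk that])
  have Fhk: "lact B (fobj F Q) (fobj F P) (fobj F Q) (fm F P Q h) (fm F Q P k) = vid B (fobj F Q)"
  proof -
    have "fm F Q Q (lact A Q P Q h k) = lact B (fobj F Q) (fobj F P) (fobj F Q) (fm F P Q h) (fm F Q P k)"
      using h k d A B F by (simp add: lact_def fm_cmp[OF F] fm_gc[OF A B F])
    then show ?thesis unfolding hk using fm_vid[OF F] d by simp
  qed
  show ?thesis
  proof (rule is_cotensorI[OF B])
    fix Y W assume Y: "Y \<in> vob B" and W: "W \<in> obj V"
    show "\<exists>g. g \<in> homs V W (vhom B Y (fobj F Q)) \<and> gc B Y (fobj F Q) (fobj F X) (fm F Q X \<delta>) g = y"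
      if y: "y \<in> homs V (J \<otimes> W) (vhom B Y (fobj F X))" for y
    proof -
      let ?g = "cfac B J (fobj F X) (fobj F P) (fm F P X \<gamma>) Y W y"
      have "?g \<in> homs V W (vhom B Y (fobj F P))" "gc B Y (fobj F P) (fobj F X) (fm F P X \<gamma>) ?g = y"
        using cfac[OF B F\<gamma> Y W] y by auto
      then show ?thesis using hl[of ?g Y] f Y
        by (intro exI[of _ "lact B Y (fobj F P) (fobj F Q) (fm F P Q h) ?g"]) simp
    qed
    show "g = g'" if a: "g \<in> homs V W (vhom B Y (fobj F Q))" "g' \<in> homs V W (vhom B Y (fobj F Q))"
      and e: "gc B Y (fobj F Q) (fobj F X) (fm F Q X \<delta>) g = gc B Y (fobj F Q) (fobj F X) (fm F Q X \<delta>) g'" for g g'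
    proof -
      let ?k = "lact B Y (fobj F Q) (fobj F P) (fm F Q P k)" and ?h = "lact B Y (fobj F P) (fobj F Q) (fm F P Q h)"
      have "?k g = ?k g'"
        by (rule cot_cancel[OF B F\<gamma> Y]) (use a e kl f Y in auto)
      moreover have "?h (?k z) = z" if "z \<in> homs V W (vhom B Y (fobj F Q))" for z
        using lact_lact[of B Y "fobj F Q" "fobj F P" "fobj F Q" "fm F P Q h" "fm F Q P k" z] that f Y
        by (simp add: Fhk)
      ultimately show ?thesis using a by metis
    qed
  qed (use f d in auto)
qed

end

section \<open>Theories and their counits\<close>

context sym_monoidal_closed
begin

text \<open>The transpose \<open>K \<otimes> W \<rightarrow> J\<close> of an arrow \<open>W \<rightarrow> [K,J]\<close>.\<close>

definition unc :: "'o \<Rightarrow> 'o \<Rightarrow> 'm \<Rightarrow> 'm" where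
  "unc K J x = ev V K J \<cdot> ((x \<otimes>\<^sub>m idm V K) \<cdot> symm V K (src V x))"

lemma unc_typing [simp]:
  assumes "K \<in> obj V" "J \<in> obj V" "x \<in> arr V" "tgt V x = ihom V K J"
  shows "unc K J x \<in> arr V" "src V (unc K J x) = K \<otimes> src V x" "tgt V (unc K J x) = J"
  using assms by (auto simp: unc_def)

lemma unc_cmp [simp]:
  assumes "K \<in> obj V" "J \<in> obj V" "x \<in> arr V" "tgt V x = ihom V K J" "u \<in> arr V" "tgt V u = src V x"
  shows "unc K J (x \<cdot> u) = unc K J x \<cdot> (idm V K \<otimes>\<^sub>m u)"
  using assms by (simp add: unc_def symm_nat[of "idm V K" u K "src V u" K "src V x"])

lemma unc_inject:
  assumes "K \<in> obj V" "J \<in> obj V" "x \<in> arr V" "tgt V x = ihom V K J" "y \<in> arr V" "tgt V y = ihom V K J"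
    "src V x = src V y" "unc K J x = unc K J y"
  shows "x = y"
proof (rule curry_eqI[of K J])
  show "ev V K J \<cdot> (x \<otimes>\<^sub>m idm V K) = ev V K J \<cdot> (y \<otimes>\<^sub>m idm V K)"
    by (rule iso_cancel_right[of "symm V K (src V y)"]) (use assms in \<open>auto simp: unc_def\<close>)
qed (use assms in auto)

lemma unc_surject:
  assumes "K \<in> obj V" "J \<in> obj V" "W \<in> obj V" "f \<in> homs V (K \<otimes> W) J"
  shows "\<exists>x \<in> homs V W (ihom V K J). unc K J x = f"
proof
  let ?x = "curry_arr W K J (f \<cdot> symm V W K)"
  note x = curry_arr[of K J W "f \<cdot> symm V W K"]
  show t: "?x \<in> homs V W (ihom V K J)" using x assms by auto
  have "unc K J ?x = (ev V K J \<cdot> (?x \<otimes>\<^sub>m idm V K)) \<cdot> symm V K W" using t assms by (simp add: unc_def)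
  then show "unc K J ?x = f" using x assms by simp
qed

end

section \<open>The opposite of the category of arities and its counits\<close>

context arity_system
begin

lemma arity_obj [simp]: "J \<in> \<J> \<Longrightarrow> J \<in> obj V"
  using arities_subset by auto

declare unit_arity [simp] ten_arity [simp]

lemma arity_op_simps [simp]:
  "vob arity_op = \<J>" "vhom arity_op J K = ihom V K J"
  by (auto simp: arity_op_def op_vcat_def full_subvcat_def self_vcat_def)

lemma unc_vid: "J \<in> \<J> \<Longrightarrow> unc J J (vid arity_op J) = runit V J"
proof -
  assume J: "J \<in> \<J>"
  have v: "vid arity_op J = curry_arr \<one> J J (lunit V J)"
    by (simp add: arity_op_def op_vcat_def full_subvcat_def self_vcat_def)
  note c = curry_arr[of J J \<one> "lunit V J"]
  have "unc J J (vid arity_op J) = (ev V J J \<cdot> (vid arity_op J \<otimes>\<^sub>m idm V J)) \<cdot> symm V J \<one>"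
    using c(1-3) J by (simp add: unc_def v)
  also have "\<dots> = runit V J" using c(4) J symm_unit[of J] by (simp add: v del: cmp_assoc')
  finally show ?thesis .
qed

lemma vid_arity_op_typing:
  assumes "J \<in> \<J>"
  shows "vid arity_op J \<in> arr V" "src V (vid arity_op J) = \<one>" "tgt V (vid arity_op J) = ihom V J J"
  using curry_arr[of J J \<one> "lunit V J"] assms
  by (auto simp: arity_op_def op_vcat_def full_subvcat_def self_vcat_def)

text \<open>Two ways of permuting c, b, a into a, b, c agree, by the hexagons at (c, b, a) and at
  (a, b, c). It is needed because composition in the opposite category contains one symmetry and
  \<open>unc\<close> another.\<close>

lemma hexagon_inverse:
  assumes o: "a \<in> obj V" "b \<in> obj V" "c \<in> obj V"
  shows "assoc V a b c \<cdot> ((symm V b a \<otimes>\<^sub>m idm V c) \<cdot> symm V c (b \<otimes> a)) =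
    symm V (b \<otimes> c) a \<cdot> ((symm V c b \<otimes>\<^sub>m idm V a) \<cdot> ai c b a)"
proof -
  have h1: "assoc V b a c \<cdot> (symm V c (b \<otimes> a) \<cdot> assoc V c b a)
     = (idm V b \<otimes>\<^sub>m symm V c a) \<cdot> (assoc V b c a \<cdot> (symm V c b \<otimes>\<^sub>m idm V a))"
    using hexagon[of c b a] o by simp
  have h2: "assoc V b c a \<cdot> (symm V a (b \<otimes> c) \<cdot> assoc V a b c)
     = (idm V b \<otimes>\<^sub>m symm V a c) \<cdot> (assoc V b a c \<cdot> (symm V a b \<otimes>\<^sub>m idm V c))"
    using hexagon[of a b c] o by simp
  let ?l = "symm V a (b \<otimes> c) \<cdot> (assoc V a b c \<cdot> ((symm V b a \<otimes>\<^sub>m idm V c) \<cdot> (symm V c (b \<otimes> a) \<cdot> assoc V c b a)))"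
  have "assoc V b c a \<cdot> ?l
     = (assoc V b c a \<cdot> (symm V a (b \<otimes> c) \<cdot> assoc V a b c)) \<cdot> ((symm V b a \<otimes>\<^sub>m idm V c) \<cdot> (symm V c (b \<otimes> a) \<cdot> assoc V c b a))"
    using o by simp
  also have "\<dots> = (idm V b \<otimes>\<^sub>m symm V a c) \<cdot> (assoc V b a c \<cdot> (symm V c (b \<otimes> a) \<cdot> assoc V c b a))"
    unfolding h2 using o by simp
  also have "\<dots> = assoc V b c a \<cdot> (symm V c b \<otimes>\<^sub>m idm V a)"
    unfolding h1 using o by simp
  finally have "?l = symm V c b \<otimes>\<^sub>m idm V a"
    by (rule iso_cancel_left[rotated -1]) (use o in auto)
  then have "symm V (b \<otimes> c) a \<cdot> (?l \<cdot> ai c b a) = symm V (b \<otimes> c) a \<cdot> ((symm V c b \<otimes>\<^sub>m idm V a) \<cdot> ai c b a)" by simp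
  then show ?thesis using o by simp
qed

lemma vcomp_arity_op_typing:
  assumes "X \<in> \<J>" "Y \<in> \<J>" "Z \<in> \<J>"
  shows "vcomp arity_op X Y Z \<in> arr V" "src V (vcomp arity_op X Y Z) = ihom V Z Y \<otimes> ihom V Y X"
    "tgt V (vcomp arity_op X Y Z) = ihom V Z X"
  using curry_arr[of Z X "ihom V Y X \<otimes> ihom V Z Y" "ev V Y X \<cdot> (idm V (ihom V Y X) \<otimes>\<^sub>m ev V Z Y) \<cdot> assoc V (ihom V Y X) (ihom V Z Y) Z"] assms
  by (auto simp: arity_op_def op_vcat_def full_subvcat_def self_vcat_def)

text \<open>On transposes, composition in the opposite category is substitution of g into f. The
  symmetries of \<open>op_vcat\<close> and of \<open>unc\<close> combine by
  \<open>hexagon_inverse\<close> and leave a single associator.\<close>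

lemma unc_vcomp:
  assumes o: "X \<in> \<J>" "Y \<in> \<J>" "Z \<in> \<J>"
    and g: "g \<in> arr V" "tgt V g = ihom V Z Y" and f: "f \<in> arr V" "tgt V f = ihom V Y X"
  shows "unc Z X (vcomp arity_op X Y Z \<cdot> (g \<otimes>\<^sub>m f)) =
    unc Y X f \<cdot> ((unc Z Y g \<otimes>\<^sub>m idm V (src V f)) \<cdot> ai Z (src V g) (src V f))"
proof -
  let ?k = "ev V Y X \<cdot> (idm V (ihom V Y X) \<otimes>\<^sub>m ev V Z Y) \<cdot> assoc V (ihom V Y X) (ihom V Z Y) Z"
  let ?c = "curry_arr (ihom V Y X \<otimes> ihom V Z Y) Z X ?k"
  define a where "a = src V f"
  define b where "b = src V g"
  note ab = a_def[symmetric] b_def[symmetric]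
  have ob: "a \<in> obj V" "b \<in> obj V" using f g ab by auto
  note c = curry_arr[of Z X "ihom V Y X \<otimes> ihom V Z Y" ?k]
  have t: "?c \<in> arr V" "src V ?c = ihom V Y X \<otimes> ihom V Z Y" "tgt V ?c = ihom V Z X"
    and e: "ev V Z X \<cdot> (?c \<otimes>\<^sub>m idm V Z) = ?k" using c o by auto
  have v: "vcomp arity_op X Y Z = ?c \<cdot> symm V (ihom V Z Y) (ihom V Y X)"
    by (simp add: arity_op_def op_vcat_def full_subvcat_def self_vcat_def)
  have "unc Z X (vcomp arity_op X Y Z \<cdot> (g \<otimes>\<^sub>m f))
     = (ev V Z X \<cdot> (?c \<otimes>\<^sub>m idm V Z)) \<cdot> (((f \<otimes>\<^sub>m g) \<otimes>\<^sub>m idm V Z) \<cdot> ((symm V b a \<otimes>\<^sub>m idm V Z) \<cdot> symm V Z (b \<otimes> a)))"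
    using t o g f ob ab by (simp add: v unc_def symm_nat[of g f b a])
  also have "\<dots> = ev V Y X \<cdot> ((f \<otimes>\<^sub>m (ev V Z Y \<cdot> (g \<otimes>\<^sub>m idm V Z))) \<cdot> (assoc V a b Z \<cdot> ((symm V b a \<otimes>\<^sub>m idm V Z) \<cdot> symm V Z (b \<otimes> a))))"
  proof -
    have "assoc V (ihom V Y X) (ihom V Z Y) Z \<cdot> (((f \<otimes>\<^sub>m g) \<otimes>\<^sub>m idm V Z) \<cdot> ((symm V b a \<otimes>\<^sub>m idm V Z) \<cdot> symm V Z (b \<otimes> a)))
      = (assoc V (ihom V Y X) (ihom V Z Y) Z \<cdot> ((f \<otimes>\<^sub>m g) \<otimes>\<^sub>m idm V Z)) \<cdot> ((symm V b a \<otimes>\<^sub>m idm V Z) \<cdot> symm V Z (b \<otimes> a))"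
      by (rule cmp_assoc'[symmetric]) (use o g f ob ab in auto)
    also have "\<dots> = (f \<otimes>\<^sub>m (g \<otimes>\<^sub>m idm V Z)) \<cdot> (assoc V a b Z \<cdot> ((symm V b a \<otimes>\<^sub>m idm V Z) \<cdot> symm V Z (b \<otimes> a)))"
      using o g f ob ab assoc_nat[of f g "idm V Z" a b Z "ihom V Y X" "ihom V Z Y" Z] by simp
    finally have 1: "assoc V (ihom V Y X) (ihom V Z Y) Z \<cdot> (((f \<otimes>\<^sub>m g) \<otimes>\<^sub>m idm V Z) \<cdot> ((symm V b a \<otimes>\<^sub>m idm V Z) \<cdot> symm V Z (b \<otimes> a)))
       = (f \<otimes>\<^sub>m (g \<otimes>\<^sub>m idm V Z)) \<cdot> (assoc V a b Z \<cdot> ((symm V b a \<otimes>\<^sub>m idm V Z) \<cdot> symm V Z (b \<otimes> a)))" .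
    have "?k \<cdot> (((f \<otimes>\<^sub>m g) \<otimes>\<^sub>m idm V Z) \<cdot> ((symm V b a \<otimes>\<^sub>m idm V Z) \<cdot> symm V Z (b \<otimes> a)))
      = ev V Y X \<cdot> ((idm V (ihom V Y X) \<otimes>\<^sub>m ev V Z Y) \<cdot> (assoc V (ihom V Y X) (ihom V Z Y) Z \<cdot> (((f \<otimes>\<^sub>m g) \<otimes>\<^sub>m idm V Z) \<cdot> ((symm V b a \<otimes>\<^sub>m idm V Z) \<cdot> symm V Z (b \<otimes> a)))))"
      using o g f ob ab by (simp del: interchange interchange2)
    then show ?thesis unfolding e 1 using o g f ob ab by simp
  qed
  also have "\<dots> = ev V Y X \<cdot> ((f \<otimes>\<^sub>m (ev V Z Y \<cdot> (g \<otimes>\<^sub>m idm V Z))) \<cdot> (symm V (b \<otimes> Z) a \<cdot> ((symm V Z b \<otimes>\<^sub>m idm V a) \<cdot> ai Z b a)))"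
    using hexagon_inverse[of a b Z] ob o by simp
  also have "\<dots> = ev V Y X \<cdot> ((f \<otimes>\<^sub>m idm V Y) \<cdot> ((idm V a \<otimes>\<^sub>m (ev V Z Y \<cdot> (g \<otimes>\<^sub>m idm V Z))) \<cdot> (symm V (b \<otimes> Z) a \<cdot> ((symm V Z b \<otimes>\<^sub>m idm V a) \<cdot> ai Z b a))))"
    using o g f ob ab by simp
  also have "\<dots> = ev V Y X \<cdot> ((f \<otimes>\<^sub>m idm V Y) \<cdot> ((symm V Y a \<cdot> ((ev V Z Y \<cdot> (g \<otimes>\<^sub>m idm V Z)) \<otimes>\<^sub>m idm V a)) \<cdot> ((symm V Z b \<otimes>\<^sub>m idm V a) \<cdot> ai Z b a)))"
    using o g f ob ab symm_nat[of "ev V Z Y \<cdot> (g \<otimes>\<^sub>m idm V Z)" "idm V a" "b \<otimes> Z" a Y a] by simp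
  also have "\<dots> = unc Y X f \<cdot> ((unc Z Y g \<otimes>\<^sub>m idm V a) \<cdot> ai Z b a)"
    using o g f ob ab by (simp add: unc_def)
  finally show ?thesis unfolding ab .
qed

lemma ai_pentagon:
  assumes o: "a \<in> obj V" "b \<in> obj V" "c \<in> obj V" "d \<in> obj V"
  shows "(ai a b c \<otimes>\<^sub>m idm V d) \<cdot> ai a (b \<otimes> c) d =
    ai (a \<otimes> b) c d \<cdot> (ai a b (c \<otimes> d) \<cdot> (idm V a \<otimes>\<^sub>m assoc V b c d))"
proof -
  let ?k = "assoc V a (b \<otimes> c) d \<cdot> (assoc V a b c \<otimes>\<^sub>m idm V d)"
  have "ai (a \<otimes> b) c d \<cdot> (ai a b (c \<otimes> d) \<cdot> ((idm V a \<otimes>\<^sub>m assoc V b c d) \<cdot> ?k)) = idm V (((a \<otimes> b) \<otimes> c) \<otimes> d)"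
    unfolding pentagon0[OF o, symmetric] using o by simp
  then have "(ai (a \<otimes> b) c d \<cdot> (ai a b (c \<otimes> d) \<cdot> (idm V a \<otimes>\<^sub>m assoc V b c d))) \<cdot> ?k = ((ai a b c \<otimes>\<^sub>m idm V d) \<cdot> ai a (b \<otimes> c) d) \<cdot> ?k"
    using o by simp
  then show ?thesis by (rule iso_cancel_right[rotated -1, symmetric]) (use o in auto)
qed

text \<open>Transposition is injective, so each axiom is checked on transposes. Associativity
  becomes the pentagon, the left unit law the triangle, and the right unit law
  \<open>runit_ten\<close>.\<close>

lemma vcategory_arity_op [simp]: "vcategory arity_op"
proof -
  note t = vid_arity_op_typing vcomp_arity_op_typing
  have 1: "vcomp arity_op W X Z \<cdot> (vcomp arity_op X Y Z \<otimes>\<^sub>m idm V (ihom V X W)) =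
     vcomp arity_op W Y Z \<cdot> ((idm V (ihom V Z Y) \<otimes>\<^sub>m vcomp arity_op W X Y) \<cdot> assoc V (ihom V Z Y) (ihom V Y X) (ihom V X W))"
    if o: "W \<in> \<J>" "X \<in> \<J>" "Y \<in> \<J>" "Z \<in> \<J>" for W X Y Z
  proof (rule unc_inject[of Z W])
    let ?h = "ihom V Z Y" and ?g = "ihom V Y X" and ?f = "ihom V X W"
    have ob: "?h \<in> obj V" "?g \<in> obj V" "?f \<in> obj V" using o by auto
    let ?uh = "unc Z Y (idm V ?h)" and ?ug = "unc Y X (idm V ?g)" and ?uf = "unc X W (idm V ?f)"
    have g: "unc Z X (vcomp arity_op X Y Z) = ?ug \<cdot> ((?uh \<otimes>\<^sub>m idm V ?g) \<cdot> ai Z ?h ?g)"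
      using unc_vcomp[OF o(2,3,4), of "idm V ?h" "idm V ?g"] o t by simp
    have f: "unc Y W (vcomp arity_op W X Y) = ?uf \<cdot> ((?ug \<otimes>\<^sub>m idm V ?f) \<cdot> ai Y ?g ?f)"
      using unc_vcomp[OF o(1,2,3), of "idm V ?g" "idm V ?f"] o t by simp
    have "unc Z W (vcomp arity_op W X Z \<cdot> (vcomp arity_op X Y Z \<otimes>\<^sub>m idm V ?f))
      = ?uf \<cdot> (((?ug \<cdot> (?uh \<otimes>\<^sub>m idm V ?g)) \<otimes>\<^sub>m idm V ?f) \<cdot> ((ai Z ?h ?g \<otimes>\<^sub>m idm V ?f) \<cdot> ai Z (?h \<otimes> ?g) ?f))"
      using o t ob by (subst unc_vcomp) (auto simp: g)
    also have "\<dots> = ?uf \<cdot> (((?ug \<cdot> (?uh \<otimes>\<^sub>m idm V ?g)) \<otimes>\<^sub>m idm V ?f) \<cdot> (ai (Z \<otimes> ?h) ?g ?f \<cdot> (ai Z ?h (?g \<otimes> ?f) \<cdot> (idm V Z \<otimes>\<^sub>m assoc V ?h ?g ?f))))"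
      using o ob by (simp only: ai_pentagon arity_obj)
    also have "\<dots> = ?uf \<cdot> ((?ug \<otimes>\<^sub>m idm V ?f) \<cdot> ((((?uh \<otimes>\<^sub>m idm V ?g) \<otimes>\<^sub>m idm V ?f) \<cdot> ai (Z \<otimes> ?h) ?g ?f) \<cdot> (ai Z ?h (?g \<otimes> ?f) \<cdot> (idm V Z \<otimes>\<^sub>m assoc V ?h ?g ?f))))"
      using o ob by simp
    also have "\<dots> = ?uf \<cdot> ((?ug \<otimes>\<^sub>m idm V ?f) \<cdot> ((ai Y ?g ?f \<cdot> (?uh \<otimes>\<^sub>m (idm V ?g \<otimes>\<^sub>m idm V ?f))) \<cdot> (ai Z ?h (?g \<otimes> ?f) \<cdot> (idm V Z \<otimes>\<^sub>m assoc V ?h ?g ?f))))"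
      by (subst ai_nat[of ?uh "idm V ?g" "idm V ?f" "Z \<otimes> ?h" ?g ?f Y ?g ?f, symmetric]) (use o ob in auto)
    also have "\<dots> = unc Z W ((vcomp arity_op W Y Z \<cdot> (idm V ?h \<otimes>\<^sub>m vcomp arity_op W X Y)) \<cdot> assoc V ?h ?g ?f)"
      using o t ob unc_cmp[of Z W "vcomp arity_op W Y Z \<cdot> (idm V ?h \<otimes>\<^sub>m vcomp arity_op W X Y)" "assoc V ?h ?g ?f"]
      by (simp add: unc_vcomp f del: unc_cmp)
    also have "\<dots> = unc Z W (vcomp arity_op W Y Z \<cdot> ((idm V ?h \<otimes>\<^sub>m vcomp arity_op W X Y) \<cdot> assoc V ?h ?g ?f))"
      using o t ob by simp
    finally show "unc Z W (vcomp arity_op W X Z \<cdot> (vcomp arity_op X Y Z \<otimes>\<^sub>m idm V ?f)) =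
      unc Z W (vcomp arity_op W Y Z \<cdot> ((idm V ?h \<otimes>\<^sub>m vcomp arity_op W X Y) \<cdot> assoc V ?h ?g ?f))" .
  qed (use o t in auto)
  have 2: "vcomp arity_op X Y Y \<cdot> (vid arity_op Y \<otimes>\<^sub>m idm V (ihom V Y X)) = lunit V (ihom V Y X)"
    if o: "X \<in> \<J>" "Y \<in> \<J>" for X Y
  proof (rule unc_inject[of Y X])
    let ?h = "ihom V Y X"
    have ob: "?h \<in> obj V" using o by auto
    have "unc Y X (vcomp arity_op X Y Y \<cdot> (vid arity_op Y \<otimes>\<^sub>m idm V ?h)) = unc Y X (idm V ?h) \<cdot> ((runit V Y \<otimes>\<^sub>m idm V ?h) \<cdot> ai Y \<one> ?h)"
      using o t by (subst unc_vcomp) (auto simp: unc_vid)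
    also have "\<dots> = unc Y X (idm V ?h) \<cdot> (idm V Y \<otimes>\<^sub>m lunit V ?h)"
      using triangle[of Y ?h, symmetric] o ob by simp
    also have "\<dots> = unc Y X (idm V ?h \<cdot> lunit V ?h)" by (rule unc_cmp[symmetric]) (use o ob in auto)
    also have "idm V ?h \<cdot> lunit V ?h = lunit V ?h" using ob by simp
    finally show "unc Y X (vcomp arity_op X Y Y \<cdot> (vid arity_op Y \<otimes>\<^sub>m idm V ?h)) = unc Y X (lunit V ?h)" .
  qed (use o t in auto)
  have 3: "vcomp arity_op X X Y \<cdot> (idm V (ihom V Y X) \<otimes>\<^sub>m vid arity_op X) = runit V (ihom V Y X)"
    if o: "X \<in> \<J>" "Y \<in> \<J>" for X Y
  proof (rule unc_inject[of Y X])
    let ?h = "ihom V Y X"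
    have ob: "?h \<in> obj V" using o by auto
    let ?u = "unc Y X (idm V ?h)"
    have "unc Y X (vcomp arity_op X X Y \<cdot> (idm V ?h \<otimes>\<^sub>m vid arity_op X)) = (runit V X \<cdot> (?u \<otimes>\<^sub>m idm V \<one>)) \<cdot> ai Y ?h \<one>"
      using o t by (subst unc_vcomp) (auto simp: unc_vid)
    also have "\<dots> = ?u \<cdot> (runit V (Y \<otimes> ?h) \<cdot> ai Y ?h \<one>)"
      using o ob by (simp add: runit_nat)
    also have "\<dots> = ?u \<cdot> (idm V Y \<otimes>\<^sub>m runit V ?h)"
      using runit_ten[of Y ?h, symmetric] o ob by simp
    also have "\<dots> = unc Y X (idm V ?h \<cdot> runit V ?h)" by (rule unc_cmp[symmetric]) (use o ob in auto)
    also have "idm V ?h \<cdot> runit V ?h = runit V ?h" using ob by simp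
    finally show "unc Y X (vcomp arity_op X X Y \<cdot> (idm V ?h \<otimes>\<^sub>m vid arity_op X)) = unc Y X (runit V ?h)" .
  qed (use o t in auto)
  show ?thesis unfolding vcategory_def using t 1 2 3 by auto
qed

lemma unc_gc:
  assumes "X \<in> \<J>" "Y \<in> \<J>" "Z \<in> \<J>" "g \<in> arr V" "tgt V g = ihom V Z Y" "f \<in> arr V" "tgt V f = ihom V Y X"
  shows "unc Z X (gc arity_op X Y Z g f) = unc Y X f \<cdot> ((unc Z Y g \<otimes>\<^sub>m idm V (src V f)) \<cdot> ai Z (src V g) (src V f))"
  using unc_vcomp[OF assms] by (simp add: gc_def)

text \<open>The canonical arrow J \<rightarrow> [I,J], regarded as an arrow J \<rightarrow> I of
  grade J in the opposite category. Its image under \<open>tau\<close> is the counit of a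
  theory.\<close>

definition op_counit :: "'o \<Rightarrow> 'm" where
  "op_counit J = curry_arr J \<one> J (runit V J)"

lemma op_counit:
  assumes "J \<in> \<J>"
  shows "op_counit J \<in> arr V" "src V (op_counit J) = J" "tgt V (op_counit J) = ihom V \<one> J"
    "unc \<one> J (op_counit J) = lunit V J"
proof -
  note c = curry_arr[of \<one> J J "runit V J", folded op_counit_def]
  show t: "op_counit J \<in> arr V" "src V (op_counit J) = J" "tgt V (op_counit J) = ihom V \<one> J" using c assms by auto
  have "unc \<one> J (op_counit J) = (ev V \<one> J \<cdot> (op_counit J \<otimes>\<^sub>m idm V \<one>)) \<cdot> symm V \<one> J"
    using t assms by (simp add: unc_def)
  also have "\<dots> = (lunit V J \<cdot> symm V J \<one>) \<cdot> symm V \<one> J" using c assms symm_unit[of J] by simp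
  also have "\<dots> = lunit V J" using assms by simp
  finally show "unc \<one> J (op_counit J) = lunit V J" .
qed

text \<open>The basic computation in \<open>arity_op\<close>: the cotensor property of J, and
  through it the values of every structure functor on homs, are read off from this equation.\<close>

lemma gc_op_counit:
  assumes J: "J \<in> \<J>" and K: "K \<in> \<J>" and x: "x \<in> arr V" "tgt V x = ihom V K J"
  shows "gc arity_op J K \<one> (op_counit K) x = op_counit J \<cdot> unc K J x"
proof (rule unc_inject[of \<one> J])
  note c = op_counit[OF J] op_counit[OF K]
  define W where "W = src V x"
  note x = x W_def[symmetric]
  have W: "W \<in> obj V" using x by auto
  have l: "(lunit V K \<otimes>\<^sub>m idm V W) \<cdot> ai \<one> K W = lunit V (K \<otimes> W)"
    using lunit_ten[of K W, symmetric] K W by simp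
  have "unc \<one> J (gc arity_op J K \<one> (op_counit K) x) = unc K J x \<cdot> lunit V (K \<otimes> W)"
    using unc_gc[of J K \<one> "op_counit K" x] c J K x l by simp
  also have "\<dots> = lunit V J \<cdot> (idm V \<one> \<otimes>\<^sub>m unc K J x)" using lunit_nat[of "unc K J x"] J K x by simp
  also have "\<dots> = unc \<one> J (op_counit J \<cdot> unc K J x)" using c J K x by simp
  finally show "unc \<one> J (gc arity_op J K \<one> (op_counit K) x) = unc \<one> J (op_counit J \<cdot> unc K J x)" .
qed (use assms op_counit in auto)

text \<open>By \<open>gc_op_counit\<close> a factorization through the counit has a prescribed
  transpose, up to unitors; its unique existence is therefore the closedness of V.\<close>

lemma op_counit_cotensor:
  assumes J: "J \<in> \<J>"
  shows "is_cotensor arity_op J \<one> J (op_counit J)"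
proof (rule is_cotensorI)
  note c = op_counit[OF J]
  show "J \<in> obj V" "op_counit J \<in> el arity_op J J \<one>" using c J by auto
  fix Y W assume Y: "Y \<in> vob arity_op" and W: "W \<in> obj V"
  then have Y': "Y \<in> \<J>" by simp
  show "\<exists>g. g \<in> homs V W (vhom arity_op Y J) \<and> gc arity_op Y J \<one> (op_counit J) g = f"
    if f: "f \<in> homs V (J \<otimes> W) (vhom arity_op Y \<one>)" for f
  proof -
    have "unc \<one> Y f \<cdot> li (J \<otimes> W) \<in> homs V (J \<otimes> W) Y" using f Y' J W by simp
    then obtain g where g: "g \<in> homs V W (ihom V J Y)" "unc J Y g = unc \<one> Y f \<cdot> li (J \<otimes> W)"
      using unc_surject[of J Y W] J Y' W by fastforce
    have "gc arity_op Y J \<one> (op_counit J) g = f"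
    proof (rule unc_inject[of \<one> Y])
      note cY = op_counit[OF Y']
      have "unc \<one> Y (gc arity_op Y J \<one> (op_counit J) g) = unc \<one> Y (op_counit Y \<cdot> unc J Y g)"
        using gc_op_counit[OF Y' J, of g] g by simp
      also have "\<dots> = lunit V Y \<cdot> (idm V \<one> \<otimes>\<^sub>m unc J Y g)" using cY g(1) J Y' by simp
      also have "\<dots> = unc J Y g \<cdot> lunit V (J \<otimes> W)" using lunit_nat[of "unc J Y g"] g(1) J Y' by simp
      also have "\<dots> = unc \<one> Y f" unfolding g(2) using f J Y' W by simp
      finally show "unc \<one> Y (gc arity_op Y J \<one> (op_counit J) g) = unc \<one> Y f" .
    qed (use f g c J Y' in auto)
    then show ?thesis using g by auto
  qed
  show "g = h" if a: "g \<in> homs V W (vhom arity_op Y J)" "h \<in> homs V W (vhom arity_op Y J)"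
    and e: "gc arity_op Y J \<one> (op_counit J) g = gc arity_op Y J \<one> (op_counit J) h" for g h
  proof (rule unc_inject[of J Y])
    note cY = op_counit[OF Y']
    have "unc \<one> Y (op_counit Y \<cdot> unc J Y g) = unc \<one> Y (op_counit Y \<cdot> unc J Y h)"
      using e gc_op_counit[OF Y' J, of g] gc_op_counit[OF Y' J, of h] a by simp
    then have "unc J Y g \<cdot> lunit V (J \<otimes> W) = unc J Y h \<cdot> lunit V (J \<otimes> W)"
      using cY a J Y' lunit_nat[of "unc J Y g"] lunit_nat[of "unc J Y h"] by simp
    then show "unc J Y g = unc J Y h"
      by (rule iso_cancel_right[rotated -1]) (use a J Y' W in auto)
  qed (use a J Y' in auto)
qed simp

lemma op_counit_unit: "op_counit \<one> = vid arity_op \<one>"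
  by (rule unc_inject[of \<one> \<one>]) (use op_counit[of \<one>] vid_arity_op_typing[of \<one>] unc_vid[of \<one>] lunit_eq_runit in auto)

section \<open>Counits of theories, and functors determined by them\<close>

definition counit :: "('o, 'm) jtheory \<Rightarrow> 'o \<Rightarrow> 'm" where
  "counit T J = fm (tau T) J \<one> (op_counit J)"

lemma theory_okD:
  assumes "theory_ok T"
  shows "vcategory T" "vob T = \<J>" "vfunctor arity_op T (tau T)" "J \<in> \<J> \<Longrightarrow> fobj (tau T) J = J"
  using assms by (auto simp: theory_ok_def)

lemma counit_cotensor: "\<lbrakk>theory_ok T; J \<in> \<J>\<rbrakk> \<Longrightarrow> is_cotensor T J \<one> J (counit T J)"
  using op_counit_cotensor[of J] unfolding theory_ok_def preserves_cotensors_def counit_def fm_def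
  by (metis unit_arity)

lemma counit_unit: "theory_ok T \<Longrightarrow> counit T \<one> = vid T \<one>"
  using theory_okD[of T] fm_vid[of arity_op T "tau T" \<one>] by (simp add: counit_def op_counit_unit)

text \<open>Since K is itself [K,I], a cotensor [J,K] in a theory is [K \<otimes> J, I]. A functor
  preserving the chosen cotensors of I thus preserves every one: \<open>cot_compose\<close> is used
  in the source and \<open>cot_factor\<close> in the target.\<close>

lemma preserves_cotensorsI:
  assumes T: "vcategory T" "vob T = \<J>" and D: "vcategory D" and F: "vfunctor T D F"
    and \<gamma>: "\<And>J. J \<in> \<J> \<Longrightarrow> is_cotensor T J \<one> J (\<gamma> J)"
    and F\<gamma>: "\<And>J. J \<in> \<J> \<Longrightarrow> is_cotensor D J (fobj F \<one>) (fobj F J) (fm F J \<one> (\<gamma> J))"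
  shows "preserves_cotensors \<J> T D F"
  unfolding preserves_cotensors_def fm_def[symmetric]
proof (intro ballI allI impI)
  fix J K P \<delta> assume J: "J \<in> \<J>" and \<delta>: "is_cotensor T J K P \<delta>"
  have K: "K \<in> \<J>" and P: "P \<in> \<J>" using is_cotensorD[OF \<delta>] T by auto
  note d = is_cotensorD[OF \<delta>] is_cotensorD[OF \<gamma>[OF K]]
  have "is_cotensor T (K \<otimes> J) \<one> P (gc T P K \<one> (\<gamma> K) \<delta>)"
    by (rule cot_compose[OF T(1) \<gamma>[OF K] \<delta>])
  then have "is_cotensor D (K \<otimes> J) (fobj F \<one>) (fobj F P) (fm F P \<one> (gc T P K \<one> (\<gamma> K) \<delta>))"
    using preserves_other_cotensor[OF T(1) D F \<gamma> _ F\<gamma>] J K ten_arity by blast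
  then have "is_cotensor D (K \<otimes> J) (fobj F \<one>) (fobj F P) (gc D (fobj F P) (fobj F K) (fobj F \<one>) (fm F K \<one> (\<gamma> K)) (fm F P K \<delta>))"
    using fm_gc[OF T(1) D F, of P K \<one> "\<gamma> K" \<delta>] d by simp
  then show "is_cotensor D J (fobj F K) (fobj F P) (fm F P K \<delta>)"
    by (rule cot_factor[OF D F\<gamma>[OF K], rotated -1]) (use F D d in auto)
qed

text \<open>The image of \<open>gc_op_counit\<close> under \<open>tau\<close>. Because the counit at
  K can be cancelled, the counits alone determine \<open>tau\<close> on homs.\<close>

lemma fm_tau:
  assumes T: "theory_ok T" and J: "J \<in> \<J>" and K: "K \<in> \<J>" and x: "x \<in> arr V" "tgt V x = ihom V K J"
  shows "gc T J K \<one> (counit T K) (fm (tau T) J K x) = counit T J \<cdot> unc K J x"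
proof -
  note t = theory_okD[OF T] op_counit[OF K] op_counit[OF J]
  have "fm (tau T) J \<one> (gc arity_op J K \<one> (op_counit K) x) = gc T J K \<one> (counit T K) (fm (tau T) J K x)"
    using fm_gc[OF _ t(1) t(3), of J K \<one> "op_counit K" x] J K x t by (simp add: counit_def)
  moreover have "fm (tau T) J \<one> (op_counit J \<cdot> unc K J x) = counit T J \<cdot> unc K J x"
    using J K x t fm_cmp[OF t(3), of J \<one> "op_counit J" "unc K J x"] by (simp add: counit_def)
  ultimately show ?thesis using gc_op_counit[OF J K x] by simp
qed

lemma vfunctor_undefined:
  assumes "vfunctor A B F"
  shows "X \<notin> vob A \<Longrightarrow> fobj F X = undefined"
    and "X \<notin> vob A \<or> Y \<notin> vob A \<Longrightarrow> fhom F X Y = undefined"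
  using assms unfolding vfunctor_def by (blast intro: PiE_arb)+

lemma vfun_eqI:
  assumes F: "vfunctor A B F" and G: "vfunctor A B' G"
    and o: "\<And>X. X \<in> vob A \<Longrightarrow> fobj F X = fobj G X"
    and h: "\<And>X Y. \<lbrakk>X \<in> vob A; Y \<in> vob A\<rbrakk> \<Longrightarrow> fhom F X Y = fhom G X Y"
  shows "F = G"
proof -
  have "fobj F X = fobj G X" for X
    using o vfunctor_undefined(1)[OF F] vfunctor_undefined(1)[OF G] by (cases "X \<in> vob A") auto
  moreover have "fhom F X Y = fhom G X Y" for X Y
    using h vfunctor_undefined(2)[OF F] vfunctor_undefined(2)[OF G] by (cases "X \<in> vob A \<and> Y \<in> vob A") auto
  ultimately show ?thesis by (auto intro!: vfun.equality ext)
qed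

lemma vfun_comp_simps [simp]:
  "X \<in> vob A \<Longrightarrow> fobj (vfun_comp A G F) X = fobj G (fobj F X)"
  "\<lbrakk>X \<in> vob A; Y \<in> vob A\<rbrakk> \<Longrightarrow> fhom (vfun_comp A G F) X Y = fm G (fobj F X) (fobj F Y) (fhom F X Y)"
  by (auto simp: vfun_comp_def mk_vfun_def fm_def)

lemma fm_vfun_comp [simp]:
  assumes "vfunctor A B F" "vfunctor B D G" "X \<in> vob A" "Y \<in> vob A" "t \<in> arr V" "tgt V t = vhom A X Y"
  shows "fm (vfun_comp A G F) X Y t = fm G (fobj F X) (fobj F Y) (fm F X Y t)"
proof -
  have "fm (vfun_comp A G F) X Y t = fm G (fobj F X) (fobj F Y) (fhom F X Y) \<cdot> t"
    using assms by (simp add: fm_def[of "vfun_comp A G F"])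
  also have "\<dots> = fm G (fobj F X) (fobj F Y) (fhom F X Y \<cdot> t)"
    by (rule fm_cmp[OF assms(2), symmetric]) (use assms in auto)
  finally show ?thesis by (simp add: fm_def[of F])
qed

lemma vfunctor_vfun_comp [simp]:
  assumes F: "vfunctor A B F" and G: "vfunctor B D G" and A: "vcategory A" and B: "vcategory B" and D: "vcategory D"
  shows "vfunctor A D (vfun_comp A G F)"
proof (rule vfunctorI[OF A D])
  show "fobj (vfun_comp A G F) \<in> vob A \<rightarrow>\<^sub>E vob D"
    using F G by (auto simp: vfun_comp_def mk_vfun_def)
  show "fhom (vfun_comp A G F) X Y = undefined" if "X \<notin> vob A \<or> Y \<notin> vob A" for X Y
    using that by (auto simp: vfun_comp_def mk_vfun_def)
  show "fhom (vfun_comp A G F) X Y \<in> homs V (vhom A X Y) (vhom D (fobj (vfun_comp A G F) X) (fobj (vfun_comp A G F) Y))"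
    if "X \<in> vob A" "Y \<in> vob A" for X Y using F G that by simp
  show "fhom (vfun_comp A G F) X X \<cdot> vid A X = vid D (fobj (vfun_comp A G F) X)" if "X \<in> vob A" for X
    unfolding fm_def[symmetric] using F G that A by (simp add: fm_vid[OF F] fm_vid[OF G])
  show "fm (vfun_comp A G F) X Z (gc A X Y Z g f) = gc D (fobj (vfun_comp A G F) X) (fobj (vfun_comp A G F) Y) (fobj (vfun_comp A G F) Z)
      (fm (vfun_comp A G F) Y Z g) (fm (vfun_comp A G F) X Y f)"
    if "g \<in> el A (vhom A Y Z) Y Z" "f \<in> el A (vhom A X Y) X Y" for X Y Z g f
    using that F G A B D by (simp add: fm_gc[OF A B F] fm_gc[OF B D G])
qed

text \<open>By \<open>fm_tau\<close> the structure functor can be recovered from the counits, so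
  compatibility with it only has to be tested on them. All later work with theory morphisms uses
  this form.\<close>

lemma theory_mor_iff:
  assumes T: "theory_ok T" and U: "theory_ok U"
  shows "theory_mor T U M \<longleftrightarrow> vfunctor T U M \<and> (\<forall>J \<in> \<J>. fobj M J = J \<and> fm M J \<one> (counit T J) = counit U J)"
proof (cases "vfunctor T U M")
  case True
  note t = theory_okD[OF T] and u = theory_okD[OF U]
  note M = True
  have MT: "vfunctor arity_op U (vfun_comp arity_op M (tau T))" using t u M by simp
  show ?thesis
  proof
    assume "theory_mor T U M"
    then have e: "vfun_comp arity_op M (tau T) = tau U" by (simp add: theory_mor_def)
    have "fobj M J = J \<and> fm M J \<one> (counit T J) = counit U J" if J: "J \<in> \<J>" for J
    proof
      show "fobj M J = J" using arg_cong[OF e, of "\<lambda>F. fobj F J"] J t u by simp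
      have "fm (vfun_comp arity_op M (tau T)) J \<one> (op_counit J) = fm M J \<one> (counit T J)"
        using J t M op_counit[OF J] by (simp add: counit_def)
      then show "fm M J \<one> (counit T J) = counit U J" unfolding e by (simp add: counit_def)
    qed
    then show "vfunctor T U M \<and> (\<forall>J \<in> \<J>. fobj M J = J \<and> fm M J \<one> (counit T J) = counit U J)" using M by blast
  next
    assume "vfunctor T U M \<and> (\<forall>J \<in> \<J>. fobj M J = J \<and> fm M J \<one> (counit T J) = counit U J)"
    then have o: "\<And>J. J \<in> \<J> \<Longrightarrow> fobj M J = J" and c: "\<And>J. J \<in> \<J> \<Longrightarrow> fm M J \<one> (counit T J) = counit U J" by auto
    have "vfun_comp arity_op M (tau T) = tau U"
    proof (rule vfun_eqI[OF MT u(3)])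
      show "fobj (vfun_comp arity_op M (tau T)) J = fobj (tau U) J" if "J \<in> vob arity_op" for J
        using that o t u by simp
      show "fhom (vfun_comp arity_op M (tau T)) J K = fhom (tau U) J K" if "J \<in> vob arity_op" "K \<in> vob arity_op" for J K
      proof -
        have J: "J \<in> \<J>" and K: "K \<in> \<J>" using that by auto
        note d = is_cotensorD[OF counit_cotensor[OF T J]] is_cotensorD[OF counit_cotensor[OF T K]]
          is_cotensorD[OF counit_cotensor[OF U J]] is_cotensorD[OF counit_cotensor[OF U K]]
        let ?x = "idm V (ihom V K J)"
        have "fm M J K (fm (tau T) J K ?x) = fm (tau U) J K ?x"
        proof (rule cot_cancel[OF u(1) counit_cotensor[OF U K]])
          have "gc U J K \<one> (counit U K) (fm M J K (fm (tau T) J K ?x)) = fm M J \<one> (gc T J K \<one> (counit T K) (fm (tau T) J K ?x))"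
            using fm_gc[OF t(1) u(1) M, of J K \<one> "counit T K" "fm (tau T) J K ?x"] J K t d o c
              fm_typing[OF t(3), of J K ?x] by simp
          also have "\<dots> = fm M J \<one> (counit T J) \<cdot> unc K J ?x"
            using fm_tau[OF T J K, of ?x] fm_cmp[OF M, of J \<one> "counit T J" "unc K J ?x"] J K d t by simp
          also have "\<dots> = gc U J K \<one> (counit U K) (fm (tau U) J K ?x)"
            using fm_tau[OF U J K, of ?x] c J K by simp
          finally show "gc U J K \<one> (counit U K) (fm M J K (fm (tau T) J K ?x)) = gc U J K \<one> (counit U K) (fm (tau U) J K ?x)" .
        qed (use J K u t o fm_typing[OF M, of J K "fm (tau T) J K ?x"] fm_typing[OF t(3), of J K ?x] fm_typing[OF u(3), of J K ?x] in auto)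
        then show ?thesis using J K t u by (simp add: fm_def)
      qed
    qed
    then show "theory_mor T U M" using M by (simp add: theory_mor_def)
  qed
qed (auto simp: theory_mor_def)

lemma theory_of_counits_simps [simp]:
  "vob (theory_of_counits U \<gamma>) = vob U" "vhom (theory_of_counits U \<gamma>) = vhom U"
  "vid (theory_of_counits U \<gamma>) = vid U" "vcomp (theory_of_counits U \<gamma>) = vcomp U"
  by (auto simp: theory_of_counits_def)

text \<open>Cancelling the counit at K determines \<open>tau\<close> by transposes, and its
  functoriality follows by the same cancellation. The condition on \<gamma> at I makes the counits
  of the resulting theory equal to the given arrows.\<close>

lemma theory_of_counits:
  fixes U :: "('o, 'o, 'm) vcat"
  assumes U: "vcategory U" "vob U = \<J>" and \<gamma>: "\<And>J. J \<in> \<J> \<Longrightarrow> is_cotensor U J \<one> J (\<gamma> J)"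
    and \<gamma>1: "\<gamma> \<one> = vid U \<one>"
  shows "theory_ok (theory_of_counits U \<gamma>)"
    and "J \<in> \<J> \<Longrightarrow> counit (theory_of_counits U \<gamma>) J = \<gamma> J"
proof -
  let ?T = "theory_of_counits U \<gamma>"
  have T: "vcategory ?T" "vob ?T = \<J>"
    using U by (simp_all only: vcategory_def theory_of_counits_simps)
  have gcT: "gc ?T = gc U" by (intro ext) (simp add: gc_def)
  have \<gamma>T: "is_cotensor ?T J \<one> J (\<gamma> J)" if "J \<in> \<J>" for J
    using \<gamma>[OF that] unfolding is_cotensor_iff[OF U(1)] is_cotensor_iff[OF T(1)] gcT using T by simp
  let ?x = "\<lambda>J K. idm V (ihom V K J)"
  have tau: "fobj (tau ?T) J = J" "fhom (tau ?T) J K \<in> homs V (ihom V K J) (vhom U J K)"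
    "gc U J K \<one> (\<gamma> K) (fhom (tau ?T) J K) = \<gamma> J \<cdot> unc K J (?x J K)"
    if J: "J \<in> \<J>" and K: "K \<in> \<J>" for J K
  proof -
    note d = is_cotensorD[OF \<gamma>[OF J]] is_cotensorD[OF \<gamma>[OF K]]
    show "fobj (tau ?T) J = J" using J by (simp add: theory_of_counits_def mk_vfun_def)
    have e: "fhom (tau ?T) J K = cotensor_lift U K \<one> K (\<gamma> K) J (ihom V K J) (\<gamma> J \<cdot> ev V K J)"
      using J K by (simp add: theory_of_counits_def mk_vfun_def)
    note l = cotensor_lift[OF U(1) \<gamma>[OF K], of J "ihom V K J" "\<gamma> J \<cdot> ev V K J", folded e]
    show "fhom (tau ?T) J K \<in> homs V (ihom V K J) (vhom U J K)" using l J K d by auto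
    show "gc U J K \<one> (\<gamma> K) (fhom (tau ?T) J K) = \<gamma> J \<cdot> unc K J (?x J K)"
      using l J K d by (simp add: unc_def)
  qed
  \<comment> \<open>The equation characterizing \<open>tau\<close> passes from the universal element
    to every x. With \<open>\<gamma> K\<close> cancellable it carries the verification of units,
    composition and counits below.\<close>
  have taut: "fm (tau ?T) J K x \<in> arr V" "src V (fm (tau ?T) J K x) = src V x" "tgt V (fm (tau ?T) J K x) = vhom U J K"
    "gc U J K \<one> (\<gamma> K) (fm (tau ?T) J K x) = \<gamma> J \<cdot> unc K J x"
    if J: "J \<in> \<J>" and K: "K \<in> \<J>" and x: "x \<in> arr V" "tgt V x = ihom V K J" for J K x
  proof -
    note d = is_cotensorD[OF \<gamma>[OF J]] is_cotensorD[OF \<gamma>[OF K]]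
    note t = tau[OF J K]
    show "fm (tau ?T) J K x \<in> arr V" "src V (fm (tau ?T) J K x) = src V x" "tgt V (fm (tau ?T) J K x) = vhom U J K"
      using t x by (auto simp: fm_def)
    have "gc U J K \<one> (\<gamma> K) (fm (tau ?T) J K x) = \<gamma> J \<cdot> (unc K J (?x J K) \<cdot> (idm V K \<otimes>\<^sub>m x))"
      using t x d J K U by (simp add: fm_def)
    also have "unc K J (?x J K) \<cdot> (idm V K \<otimes>\<^sub>m x) = unc K J x"
      using unc_cmp[of K J "?x J K" x] J K x by simp
    finally show "gc U J K \<one> (\<gamma> K) (fm (tau ?T) J K x) = \<gamma> J \<cdot> unc K J x" .
  qed
  have F: "vfunctor arity_op ?T (tau ?T)"
  proof (rule vfunctorI[OF vcategory_arity_op T(1)])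
    show "fobj (tau ?T) \<in> vob arity_op \<rightarrow>\<^sub>E vob ?T" using U by (auto simp: theory_of_counits_def mk_vfun_def)
    show "fhom (tau ?T) X Y = undefined" if "X \<notin> vob arity_op \<or> Y \<notin> vob arity_op" for X Y
      using that by (auto simp: theory_of_counits_def mk_vfun_def)
    show "fhom (tau ?T) X Y \<in> homs V (vhom arity_op X Y) (vhom ?T (fobj (tau ?T) X) (fobj (tau ?T) Y))"
      if "X \<in> vob arity_op" "Y \<in> vob arity_op" for X Y
      using that tau by simp
    show "fhom (tau ?T) J J \<cdot> vid arity_op J = vid ?T (fobj (tau ?T) J)" if "J \<in> vob arity_op" for J
      unfolding fm_def[symmetric]
    proof -
      have J: "J \<in> \<J>" using that by simp
      note d = is_cotensorD[OF \<gamma>[OF J]]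
      note t = taut[OF J J, of "vid arity_op J"]
      have "fm (tau ?T) J J (vid arity_op J) = vid U J"
        by (rule cot_cancel[OF U(1) \<gamma>[OF J]]) (use t J U(1) d vid_arity_op_typing[OF J] in \<open>auto simp: unc_vid\<close>)
      then show "fm (tau ?T) J J (vid arity_op J) = vid ?T (fobj (tau ?T) J)" using tau[OF J J] by simp
    qed
    show "fm (tau ?T) X Z (gc arity_op X Y Z g f) =
        gc ?T (fobj (tau ?T) X) (fobj (tau ?T) Y) (fobj (tau ?T) Z) (fm (tau ?T) Y Z g) (fm (tau ?T) X Y f)"
      if g: "g \<in> el arity_op (vhom arity_op Y Z) Y Z" and f: "f \<in> el arity_op (vhom arity_op X Y) X Y" for X Y Z g f
    proof -
      have o: "X \<in> \<J>" "Y \<in> \<J>" "Z \<in> \<J>" using f g by auto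
      have f': "f \<in> arr V" "tgt V f = ihom V Y X" and g': "g \<in> arr V" "tgt V g = ihom V Z Y" using f g by auto
      define a where "a = src V f"
      define b where "b = src V g"
      have ab: "src V f = a" "src V g = b" "a \<in> obj V" "b \<in> obj V" using f' g' by (auto simp: a_def b_def)
      have gf: "gc arity_op X Y Z g f \<in> arr V" "tgt V (gc arity_op X Y Z g f) = ihom V Z X" "src V (gc arity_op X Y Z g f) = b \<otimes> a"
        using f' g' o ab by auto
      note d = is_cotensorD[OF \<gamma>[OF o(1)]] is_cotensorD[OF \<gamma>[OF o(2)]] is_cotensorD[OF \<gamma>[OF o(3)]]
      note t = taut[OF o(1,2) f'] taut[OF o(2,3) g'] taut[OF o(1,3) gf(1,2)]
      have "fm (tau ?T) X Z (gc arity_op X Y Z g f) = gc U X Y Z (fm (tau ?T) Y Z g) (fm (tau ?T) X Y f)"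
      proof (rule cot_cancel[OF U(1) \<gamma>[OF o(3)]])
        let ?g = "fm (tau ?T) Y Z g" and ?f = "fm (tau ?T) X Y f"
        have "gc U X Z \<one> (\<gamma> Z) (gc U X Y Z ?g ?f) = gc U X Y \<one> (gc U Y Z \<one> (\<gamma> Z) ?g) ?f \<cdot> ai Z b a"
          using t(1-3,5-7) U o d ab by simp
        also have "\<dots> = \<gamma> X \<cdot> (unc Y X f \<cdot> ((unc Z Y g \<otimes>\<^sub>m idm V a) \<cdot> ai Z b a))"
          unfolding t(8) using t(1-4) U o d ab f' g' by simp
        also have "\<dots> = gc U X Z \<one> (\<gamma> Z) (fm (tau ?T) X Z (gc arity_op X Y Z g f))"
          unfolding t(12) using unc_gc[OF o g' f'] ab by simp
        finally show "gc U X Z \<one> (\<gamma> Z) (fm (tau ?T) X Z (gc arity_op X Y Z g f)) = gc U X Z \<one> (\<gamma> Z) (gc U X Y Z ?g ?f)" ..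
      qed (use t U o gf ab in auto)
      then show ?thesis using tau(1) o by (simp add: gcT)
    qed
  qed
  have cu: "counit ?T J = \<gamma> J" if J: "J \<in> \<J>" for J
  proof -
    note c = op_counit[OF J] and d = is_cotensorD[OF \<gamma>[OF J]]
    note t = taut[OF J unit_arity, of "op_counit J"]
    have "counit ?T J \<cdot> lunit V J = \<gamma> J \<cdot> lunit V J"
      using t c d J U by (simp add: counit_def \<gamma>1)
    then show ?thesis by (rule iso_cancel_right[rotated -1]) (use t c d J in \<open>auto simp: counit_def\<close>)
  qed
  then show "J \<in> \<J> \<Longrightarrow> counit ?T J = \<gamma> J" .
  have "preserves_cotensors \<J> arity_op ?T (tau ?T)"
    by (rule preserves_cotensorsI[OF vcategory_arity_op _ T(1) F op_counit_cotensor])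
      (use cu \<gamma>T tau in \<open>auto simp: counit_def[symmetric]\<close>)
  then show "theory_ok ?T" unfolding theory_ok_def using T F tau by blast
qed

end

section \<open>Natural families and algebras\<close>

context sym_monoidal_closed
begin

lemma vnat_familyD:
  assumes "vnat_family T C F G E \<alpha>" "X \<in> vob T"
  shows "\<alpha> X \<in> arr V" "src V (\<alpha> X) = E" "tgt V (\<alpha> X) = vhom C (fobj F X) (fobj G X)"
  using assms unfolding vnat_family_def in_homs by blast+

text \<open>The naturality square composed with a test arrow x. The symmetry in the definition
  becomes \<open>swp\<close>, exchanging the grades of the family and of t in front of that of
  x.\<close>

lemma vnat_family_elem:
  assumes T: "vcategory T" and C: "vcategory C" and F: "vfunctor T C F" and G: "vfunctor T C G"
    and n: "vnat_family T C F G E \<alpha>" and X: "X \<in> vob T" and Y: "Y \<in> vob T"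
    and t: "t \<in> arr V" "tgt V t = vhom T X Y"
    and x: "x \<in> arr V" "tgt V x = vhom C Z (fobj F X)" and Z: "Z \<in> vob C"
  shows "gc C Z (fobj F Y) (fobj G Y) (\<alpha> Y) (gc C Z (fobj F X) (fobj F Y) (fm F X Y t) x) =
    gc C Z (fobj G X) (fobj G Y) (fm G X Y t) (gc C Z (fobj F X) (fobj G X) (\<alpha> X) x) \<cdot> swp E (src V t) (src V x)"
proof -
  define W where "W = src V t"
  define Q where "Q = src V x"
  note a = vnat_familyD[OF n X] vnat_familyD[OF n Y]
  have o: "W \<in> obj V" "Q \<in> obj V" "E \<in> obj V" using t x a W_def Q_def by auto
  note tx = t x W_def[symmetric] Q_def[symmetric]
  have e: "vcomp C (fobj F X) (fobj F Y) (fobj G Y) \<cdot> (\<alpha> Y \<otimes>\<^sub>m fhom F X Y) =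
      vcomp C (fobj F X) (fobj G X) (fobj G Y) \<cdot> (fhom G X Y \<otimes>\<^sub>m \<alpha> X) \<cdot> symm V E (vhom T X Y)"
    using n X Y unfolding vnat_family_def by blast
  have "gc C (fobj F X) (fobj F Y) (fobj G Y) (\<alpha> Y) (fm F X Y t)
     = (vcomp C (fobj F X) (fobj F Y) (fobj G Y) \<cdot> (\<alpha> Y \<otimes>\<^sub>m fhom F X Y)) \<cdot> (idm V E \<otimes>\<^sub>m t)"
    using a tx o X Y F G T C by (simp add: gc_def fm_def)
  also have "\<dots> = gc C (fobj F X) (fobj G X) (fobj G Y) (fm G X Y t) (\<alpha> X) \<cdot> symm V E W"
    unfolding e using a tx o X Y F G T C by (simp add: gc_def fm_def symm_nat[of "idm V E" t E W])
  finally have b: "gc C (fobj F X) (fobj F Y) (fobj G Y) (\<alpha> Y) (fm F X Y t) =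
     gc C (fobj F X) (fobj G X) (fobj G Y) (fm G X Y t) (\<alpha> X) \<cdot> symm V E W" .
  have "gc C Z (fobj F Y) (fobj G Y) (\<alpha> Y) (gc C Z (fobj F X) (fobj F Y) (fm F X Y t) x)
    = gc C Z (fobj F X) (fobj G Y) (gc C (fobj F X) (fobj F Y) (fobj G Y) (\<alpha> Y) (fm F X Y t)) x \<cdot> ai E W Q"
    using a tx o X Y F G T C Z by simp
  also have "\<dots> = gc C Z (fobj G X) (fobj G Y) (fm G X Y t) (gc C Z (fobj F X) (fobj G X) (\<alpha> X) x) \<cdot> swp E W Q"
    unfolding b using a tx o X Y F G T C Z by (simp add: swp_def)
  finally show ?thesis by (simp add: W_def Q_def)
qed

text \<open>The converse of \<open>vnat_family_elem\<close>: take t to be the identity of the hom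
  object and x the identity of F X; \<open>swp_symm\<close> then removes the remaining I.\<close>

lemma vnat_familyI:
  assumes T: "vcategory T" and C: "vcategory C" and F: "vfunctor T C F" and G: "vfunctor T C G"
    and E: "E \<in> obj V" and a: "\<And>X. X \<in> vob T \<Longrightarrow> \<alpha> X \<in> homs V E (vhom C (fobj F X) (fobj G X))"
    and n: "\<And>X Y Z W Q t x. \<lbrakk>X \<in> vob T; Y \<in> vob T; Z \<in> vob C; W \<in> obj V; Q \<in> obj V; t \<in> homs V W (vhom T X Y);
      x \<in> homs V Q (vhom C Z (fobj F X))\<rbrakk> \<Longrightarrow>
      gc C Z (fobj F Y) (fobj G Y) (\<alpha> Y) (gc C Z (fobj F X) (fobj F Y) (fm F X Y t) x) =
      gc C Z (fobj G X) (fobj G Y) (fm G X Y t) (gc C Z (fobj F X) (fobj G X) (\<alpha> X) x) \<cdot> swp E W Q"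
  shows "vnat_family T C F G E \<alpha>"
  unfolding vnat_family_def
proof (intro conjI ballI a)
  fix X Y assume X: "X \<in> vob T" and Y: "Y \<in> vob T"
  let ?W = "vhom T X Y"
  have W: "?W \<in> obj V" using T X Y by simp
  have ax: "\<alpha> X \<in> arr V" "src V (\<alpha> X) = E" "tgt V (\<alpha> X) = vhom C (fobj F X) (fobj G X)"
    "\<alpha> Y \<in> arr V" "src V (\<alpha> Y) = E" "tgt V (\<alpha> Y) = vhom C (fobj F Y) (fobj G Y)" using a X Y by auto
  have "gc C (fobj F X) (fobj F Y) (fobj G Y) (\<alpha> Y) (fhom F X Y) \<cdot> (idm V E \<otimes>\<^sub>m runit V ?W) =
    gc C (fobj F X) (fobj G X) (fobj G Y) (fhom G X Y) (\<alpha> X) \<cdot> ((idm V ?W \<otimes>\<^sub>m runit V E) \<cdot> swp E ?W \<one>)"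
    using n[OF X Y _ W unit_obj, of "fobj F X" "idm V ?W" "vid C (fobj F X)"] ax X Y F G T C E W by simp
  also have "\<dots> = (gc C (fobj F X) (fobj G X) (fobj G Y) (fhom G X Y) (\<alpha> X) \<cdot> symm V E ?W) \<cdot> (idm V E \<otimes>\<^sub>m runit V ?W)"
    using ax X Y F G T C E W by (simp add: swp_symm)
  finally have "gc C (fobj F X) (fobj F Y) (fobj G Y) (\<alpha> Y) (fhom F X Y) =
      gc C (fobj F X) (fobj G X) (fobj G Y) (fhom G X Y) (\<alpha> X) \<cdot> symm V E ?W"
    by (rule iso_cancel_right[rotated -1]) (use ax X Y F G T C E W in auto)
  then show "vcomp C (fobj F X) (fobj F Y) (fobj G Y) \<cdot> (\<alpha> Y \<otimes>\<^sub>m fhom F X Y) =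
      vcomp C (fobj F X) (fobj G X) (fobj G Y) \<cdot> (fhom G X Y \<otimes>\<^sub>m \<alpha> X) \<cdot> symm V E ?W"
    by (simp add: gc_def)
qed

lemma vnat_family_cmp:
  assumes T: "vcategory T" and C: "vcategory C" and F: "vfunctor T C F" and G: "vfunctor T C G"
    and n: "vnat_family T C F G E \<alpha>" and u: "u \<in> arr V" "tgt V u = E"
  shows "vnat_family T C F G (src V u) (\<lambda>X. \<alpha> X \<cdot> u)"
proof (rule vnat_familyI[OF T C F G])
  note a = vnat_familyD[OF n]
  show "src V u \<in> obj V" using u by simp
  show "\<alpha> X \<cdot> u \<in> homs V (src V u) (vhom C (fobj F X) (fobj G X))" if "X \<in> vob T" for X
    using a[OF that] u by simp
  fix X Y Z W Q t x assume X: "X \<in> vob T" and Y: "Y \<in> vob T" and Z: "Z \<in> vob C" and o: "W \<in> obj V" "Q \<in> obj V"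
    and t: "t \<in> homs V W (vhom T X Y)" and x: "x \<in> homs V Q (vhom C Z (fobj F X))"
  have E: "E \<in> obj V" using u by auto
  show "gc C Z (fobj F Y) (fobj G Y) (\<alpha> Y \<cdot> u) (gc C Z (fobj F X) (fobj F Y) (fm F X Y t) x) =
      gc C Z (fobj G X) (fobj G Y) (fm G X Y t) (gc C Z (fobj F X) (fobj G X) (\<alpha> X \<cdot> u) x) \<cdot> swp (src V u) W Q"
    using vnat_family_elem[OF T C F G n X Y, of t x Z] a[OF X] a[OF Y] u t x o X Y Z T C F G E
    by (simp add: swp_nat[of u "idm V W" "idm V Q" "src V u" W Q E W Q, symmetric])
qed

text \<open>The form in which arrows into a pointwise construction are compared: behind the counit
  and on the identity of the source.\<close>

lemma cot_eqI:
  assumes C: "vcategory C" and \<gamma>: "is_cotensor C J X P \<gamma>" and f: "f \<in> el C W Y P" and g: "g \<in> el C W Y P"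
    and e: "gc C Y P X \<gamma> (gc C Y Y P f (vid C Y)) = gc C Y P X \<gamma> (gc C Y Y P g (vid C Y))"
  shows "f = g"
proof (rule gc_eqI[OF f g])
  show "gc C Y Y P f (vid C Y) = gc C Y Y P g (vid C Y)"
    by (rule cot_cancel[OF C \<gamma> _ _ _ _ _ _ e]) (use f g in auto)
qed

lemma ai_swp:
  assumes o: "a \<in> obj V" "b \<in> obj V" "d \<in> obj V" "q \<in> obj V"
  shows "swp (b \<otimes> d) a q \<cdot> ai b d (a \<otimes> q) =
    (idm V a \<otimes>\<^sub>m ai b d q) \<cdot> (swp b a (d \<otimes> q) \<cdot> (idm V b \<otimes>\<^sub>m swp d a q))"
proof -
  have "(idm V a \<otimes>\<^sub>m ai b d q) \<cdot> (((idm V a \<otimes>\<^sub>m assoc V b d q) \<cdot> swp (b \<otimes> d) a q) \<cdot> ai b d (a \<otimes> q))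
    = swp (b \<otimes> d) a q \<cdot> ai b d (a \<otimes> q)" using o by simp
  then show ?thesis unfolding swp_ten'[OF o] using o by simp
qed

end

context arity_system
begin

declare theory_okD(1,2) [simp]

lemma algebra_okD: "algebra_ok T C A \<Longrightarrow> vfunctor T C A"
  by (simp add: algebra_ok_def)

lemma algebra_counit:
  assumes "theory_ok T" "algebra_ok T C A" "J \<in> \<J>"
  shows "is_cotensor C J (fobj A \<one>) (fobj A J) (fm A J \<one> (counit T J))"
  using counit_cotensor[of T J] assms unfolding algebra_ok_def preserves_cotensors_def fm_def by blast

lemma counit_typing [simp]:
  assumes "theory_ok T" "J \<in> \<J>"
  shows "counit T J \<in> arr V" "src V (counit T J) = J" "tgt V (counit T J) = vhom T J \<one>"
  using is_cotensorD[OF counit_cotensor[OF assms]] by auto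

text \<open>Naturality along the counit J \<rightarrow> I expresses \<open>\<alpha> J\<close>,
  followed by the counit of G, through the component at I. The counit of G can be cancelled.\<close>

lemma vnat_family_unique:
  assumes T: "theory_ok T" and C: "vcategory C" and F: "vfunctor T C F" and G: "algebra_ok T C G"
    and a: "vnat_family T C F G E \<alpha>" and b: "vnat_family T C F G E \<beta>" and e: "\<alpha> \<one> = \<beta> \<one>" and J: "J \<in> \<J>"
  shows "\<alpha> J = \<beta> J"
proof (rule cot_eqI[OF C algebra_counit[OF T G J]])
  note t = vnat_familyD[OF a, of J] vnat_familyD[OF b, of J]
  have E: "E \<in> obj V" using t J T by auto
  show "\<alpha> J \<in> el C E (fobj F J) (fobj G J)" "\<beta> J \<in> el C E (fobj F J) (fobj G J)"
    using t J T C F algebra_okD[OF G] by auto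
  let ?x = "vid C (fobj F J)"
  let ?g = "gc C (fobj F J) (fobj G J) (fobj G \<one>) (fm G J \<one> (counit T J))"
  have "?g (gc C (fobj F J) (fobj F J) (fobj G J) (\<alpha> J) ?x) \<cdot> swp E J \<one> = ?g (gc C (fobj F J) (fobj F J) (fobj G J) (\<beta> J) ?x) \<cdot> swp E J \<one>"
    using vnat_family_elem[OF _ C F _ a, of J \<one> "counit T J" ?x "fobj F J"]
      vnat_family_elem[OF _ C F _ b, of J \<one> "counit T J" ?x "fobj F J"] e J T C F algebra_okD[OF G]
    by (simp del: gc_vid_right)
  then show "?g (gc C (fobj F J) (fobj F J) (fobj G J) (\<alpha> J) ?x) = ?g (gc C (fobj F J) (fobj F J) (fobj G J) (\<beta> J) ?x)"
    by (rule iso_cancel_right[rotated -1]) (use t J T C F algebra_okD[OF G] E in auto)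
qed

text \<open>A family into an algebra is determined by its component \<open>\<theta>\<close> at \<open>I\<close>, and naturality needs to
  be tested on the operations \<open>t : J \<rightarrow> I\<close> only.\<close>

lemma vnat_family_extend:
  assumes T: "theory_ok T" and C: "vcategory C" and F: "vfunctor T C F" and G: "algebra_ok T C G"
    and E: "E \<in> obj V" and \<theta>: "\<theta> \<in> homs V E (vhom C (fobj F \<one>) (fobj G \<one>))"
    and n: "\<And>J Z W Q t x q. \<lbrakk>J \<in> \<J>; Z \<in> vob C; W \<in> obj V; Q \<in> obj V; t \<in> homs V W (vhom T J \<one>);
      x \<in> homs V Q (vhom C Z (fobj F J)); q \<in> homs V (E \<otimes> Q) (vhom C Z (fobj G J));
      gc C Z (fobj G J) (fobj G \<one>) (fm G J \<one> (counit T J)) q =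
        gc C Z (fobj F \<one>) (fobj G \<one>) \<theta> (gc C Z (fobj F J) (fobj F \<one>) (fm F J \<one> (counit T J)) x) \<cdot> swp J E Q\<rbrakk> \<Longrightarrow>
      gc C Z (fobj F \<one>) (fobj G \<one>) \<theta> (gc C Z (fobj F J) (fobj F \<one>) (fm F J \<one> t) x) =
      gc C Z (fobj G J) (fobj G \<one>) (fm G J \<one> t) q \<cdot> swp E W Q"
  shows "\<exists>\<alpha>. vnat_family T C F G E \<alpha> \<and> \<alpha> \<one> = \<theta>"
proof -
  note G' = algebra_okD[OF G] and T' = theory_okD(1,2)[OF T]
  \<comment> \<open>The only possible choice: naturality along the counit J \<rightarrow> I
    prescribes \<open>\<alpha> J\<close> behind the counit of G.\<close>
  define \<alpha> where "\<alpha> J = cfac C J (fobj G \<one>) (fobj G J) (fm G J \<one> (counit T J)) (fobj F J) E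
    (gc C (fobj F J) (fobj F \<one>) (fobj G \<one>) \<theta> (fm F J \<one> (counit T J)) \<cdot> symm V J E)" for J
  have a: "\<alpha> J \<in> arr V" "src V (\<alpha> J) = E" "tgt V (\<alpha> J) = vhom C (fobj F J) (fobj G J)"
    "gc C (fobj F J) (fobj G J) (fobj G \<one>) (fm G J \<one> (counit T J)) (\<alpha> J) =
      gc C (fobj F J) (fobj F \<one>) (fobj G \<one>) \<theta> (fm F J \<one> (counit T J)) \<cdot> symm V J E" if J: "J \<in> \<J>" for J
    using cfac[OF C algebra_counit[OF T G J], of "fobj F J" E
      "gc C (fobj F J) (fobj F \<one>) (fobj G \<one>) \<theta> (fm F J \<one> (counit T J)) \<cdot> symm V J E"]
      J T T' C F G' E \<theta> by (auto simp: \<alpha>_def)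
  \<comment> \<open>This is the condition on q in the assumption \<open>n\<close>. There q stands
    for the family applied to x, so that the assumption could be stated before the family
    exists.\<close>
  have ax: "gc C Z (fobj G J) (fobj G \<one>) (fm G J \<one> (counit T J)) (gc C Z (fobj F J) (fobj G J) (\<alpha> J) x) =
     gc C Z (fobj F \<one>) (fobj G \<one>) \<theta> (gc C Z (fobj F J) (fobj F \<one>) (fm F J \<one> (counit T J)) x) \<cdot> swp J E Q"
    if J: "J \<in> \<J>" and Z: "Z \<in> vob C" and x: "x \<in> homs V Q (vhom C Z (fobj F J))" for J Z Q x
  proof -
    note aJ = a[OF J]
    have Q: "Q \<in> obj V" using x by auto
    have "gc C Z (fobj G J) (fobj G \<one>) (fm G J \<one> (counit T J)) (gc C Z (fobj F J) (fobj G J) (\<alpha> J) x) =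
       gc C Z (fobj F J) (fobj G \<one>) (gc C (fobj F J) (fobj G J) (fobj G \<one>) (fm G J \<one> (counit T J)) (\<alpha> J)) x \<cdot> ai J E Q"
      using aJ(1-3) J Z x Q T T' C F G' E by simp
    also have "\<dots> = gc C Z (fobj F \<one>) (fobj G \<one>) \<theta> (gc C Z (fobj F J) (fobj F \<one>) (fm F J \<one> (counit T J)) x) \<cdot> swp J E Q"
      unfolding aJ(4) using \<theta> J Z x Q T T' C F G' E by (simp add: swp_def)
    finally show ?thesis .
  qed
  have nat: "gc C Z (fobj F K) (fobj G K) (\<alpha> K) (gc C Z (fobj F J) (fobj F K) (fm F J K t) x) =
      gc C Z (fobj G J) (fobj G K) (fm G J K t) (gc C Z (fobj F J) (fobj G J) (\<alpha> J) x) \<cdot> swp E W Q"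
    if J: "J \<in> \<J>" and K: "K \<in> \<J>" and Z: "Z \<in> vob C" and o: "W \<in> obj V" "Q \<in> obj V"
      and t: "t \<in> homs V W (vhom T J K)" and x: "x \<in> homs V Q (vhom C Z (fobj F J))" for J K Z W Q t x
  proof (rule cot_cancel[OF C algebra_counit[OF T G K] Z])
    note aJ = a(1-3)[OF J] and aK = a(1-3)[OF K]
    note b = J K Z o t x T T' C F G' E aJ aK \<theta>
    \<comment> \<open>Behind the counit of K an operation J \<rightarrow> K of grade W is an
      operation J \<rightarrow> I of grade K \<otimes> W, and the assumption applies to the
      latter.\<close>
    let ?t = "gc T J K \<one> (counit T K) t"
    have tt: "?t \<in> homs V (K \<otimes> W) (vhom T J \<one>)" using b by simp
    have "gc C Z (fobj G K) (fobj G \<one>) (fm G K \<one> (counit T K)) (gc C Z (fobj F K) (fobj G K) (\<alpha> K) (gc C Z (fobj F J) (fobj F K) (fm F J K t) x))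
      = gc C Z (fobj F \<one>) (fobj G \<one>) \<theta> (gc C Z (fobj F K) (fobj F \<one>) (fm F K \<one> (counit T K)) (gc C Z (fobj F J) (fobj F K) (fm F J K t) x)) \<cdot> swp K E (W \<otimes> Q)"
      by (rule ax[OF K Z]) (use b in simp)
    also have "\<dots> = gc C Z (fobj F \<one>) (fobj G \<one>) \<theta> (gc C Z (fobj F J) (fobj F \<one>) (fm F J \<one> ?t) x) \<cdot> ((idm V E \<otimes>\<^sub>m ai K W Q) \<cdot> swp K E (W \<otimes> Q))"
      using b by (simp add: fm_gc[OF T'(1) C F])
    also have "gc C Z (fobj F \<one>) (fobj G \<one>) \<theta> (gc C Z (fobj F J) (fobj F \<one>) (fm F J \<one> ?t) x) =
       gc C Z (fobj G J) (fobj G \<one>) (fm G J \<one> ?t) (gc C Z (fobj F J) (fobj G J) (\<alpha> J) x) \<cdot> swp E (K \<otimes> W) Q"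
      by (rule n[OF J Z _ o(2) tt x _ ax[OF J Z x]]) (use b in auto)
    also have "\<dots> = gc C Z (fobj G K) (fobj G \<one>) (fm G K \<one> (counit T K)) (gc C Z (fobj G J) (fobj G K) (fm G J K t) (gc C Z (fobj F J) (fobj G J) (\<alpha> J) x)) \<cdot>
         (assoc V K W (E \<otimes> Q) \<cdot> swp E (K \<otimes> W) Q)"
      using b by (simp add: fm_gc[OF T'(1) C G'])
    also have "assoc V K W (E \<otimes> Q) \<cdot> swp E (K \<otimes> W) Q = (idm V K \<otimes>\<^sub>m swp E W Q) \<cdot> (swp E K (W \<otimes> Q) \<cdot> (idm V E \<otimes>\<^sub>m assoc V K W Q))"
      by (rule swp_ten) (use b in auto)
    finally show "gc C Z (fobj G K) (fobj G \<one>) (fm G K \<one> (counit T K)) (gc C Z (fobj F K) (fobj G K) (\<alpha> K) (gc C Z (fobj F J) (fobj F K) (fm F J K t) x)) =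
      gc C Z (fobj G K) (fobj G \<one>) (fm G K \<one> (counit T K)) (gc C Z (fobj G J) (fobj G K) (fm G J K t) (gc C Z (fobj F J) (fobj G J) (\<alpha> J) x) \<cdot> swp E W Q)"
      using b by simp
  qed (use a[OF J] a[OF K] that T T' C F G' E in auto)
  have "vnat_family T C F G E \<alpha>"
    by (rule vnat_familyI[OF T'(1) C F G' E]) (use nat a T' in auto)
  moreover have "\<alpha> \<one> = \<theta>"
  proof (rule gc_eqI)
    note a1 = a(1-3)[OF unit_arity]
    show "\<alpha> \<one> \<in> el C E (fobj F \<one>) (fobj G \<one>)" "\<theta> \<in> el C E (fobj F \<one>) (fobj G \<one>)"
      using a1 \<theta> C F G' T T' by auto
    \<comment> \<open>At I the counits are identities, so the prescription defining \<alpha> reduces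
      to \<theta> up to unitors.\<close>
    have c1: "fm F \<one> \<one> (counit T \<one>) = vid C (fobj F \<one>)" "fm G \<one> \<one> (counit T \<one>) = vid C (fobj G \<one>)"
      using counit_unit[OF T] fm_vid[OF F, of \<one>] fm_vid[OF G', of \<one>] T' by auto
    have ro: "runit V \<one> = lunit V \<one>" by (simp add: lunit_eq_runit)
    have "gc C (fobj F \<one>) (fobj F \<one>) (fobj G \<one>) (\<alpha> \<one>) (vid C (fobj F \<one>)) \<cdot> lunit V (E \<otimes> \<one>)
      = gc C (fobj F \<one>) (fobj F \<one>) (fobj G \<one>) \<theta> (vid C (fobj F \<one>)) \<cdot> ((idm V E \<otimes>\<^sub>m lunit V \<one>) \<cdot> swp \<one> E \<one>)"
      using ax[OF unit_arity, of "fobj F \<one>" "vid C (fobj F \<one>)" \<one>] a1 C F G' T T' \<theta> E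
      unfolding c1 by (simp del: gc_vid_right)
    then have "gc C (fobj F \<one>) (fobj F \<one>) (fobj G \<one>) (\<alpha> \<one>) (vid C (fobj F \<one>)) \<cdot> lunit V (E \<otimes> \<one>)
      = gc C (fobj F \<one>) (fobj F \<one>) (fobj G \<one>) \<theta> (vid C (fobj F \<one>)) \<cdot> lunit V (E \<otimes> \<one>)"
      using swp_unit[of E \<one>] E by (simp del: gc_vid_right)
    then show "gc C (fobj F \<one>) (fobj F \<one>) (fobj G \<one>) (\<alpha> \<one>) (vid C (fobj F \<one>)) = gc C (fobj F \<one>) (fobj F \<one>) (fobj G \<one>) \<theta> (vid C (fobj F \<one>))"
      by (rule iso_cancel_right[rotated -1]) (use a1 C F G' T T' \<theta> E in auto)
  qed
  ultimately show ?thesis by blast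
qed

end

section \<open>The enriched category of algebras\<close>

locale admissible_vcat = arity_system V \<J> for V :: "('o, 'm) smc" (structure) and \<J> +
  fixes C :: "('c, 'o, 'm) cvcat"
  assumes admissible: "admissible C"
begin

lemma C_cat [simp]: "vcategory C"
  using admissible by (simp add: admissible_def)

lemma C_cot: "\<lbrakk>J \<in> \<J>; X \<in> vob C\<rbrakk> \<Longrightarrow> is_cotensor C J X (cot C J X) (cotu C J X)"
  using admissible by (simp add: admissible_def has_designated_cotensors_def)

lemma C_cot_typing [simp]:
  assumes "J \<in> \<J>" "X \<in> vob C"
  shows "cot C J X \<in> vob C" "cotu C J X \<in> arr V" "src V (cotu C J X) = J" "tgt V (cotu C J X) = vhom C (cot C J X) X"
  using is_cotensorD[OF C_cot[OF assms]] by auto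

lemma C_cot_unit [simp]: "X \<in> vob C \<Longrightarrow> cot C \<one> X = X" "X \<in> vob C \<Longrightarrow> cotu C \<one> X = vid C X"
  using admissible by (auto simp: admissible_def has_designated_cotensors_def)

text \<open>The last part is naturality of the cotensor counit: reading off a J-indexed entry
  commutes with applying f. The exchange arises because J stands before the grade of f on one side
  and after it on the other.\<close>

lemma cot_hom:
  assumes J: "J \<in> \<J>" and X: "X \<in> vob C" and Y: "Y \<in> vob C"
  shows "cot_hom C J X Y \<in> arr V" "src V (cot_hom C J X Y) = vhom C X Y"
    "tgt V (cot_hom C J X Y) = vhom C (cot C J X) (cot C J Y)"
    "\<lbrakk>f \<in> arr V; tgt V f = vhom C X Y; x \<in> arr V; tgt V x = vhom C Z (cot C J X); Z \<in> vob C\<rbrakk> \<Longrightarrow>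
      gc C Z (cot C J Y) Y (cotu C J Y) (gc C Z (cot C J X) (cot C J Y) (cot_hom C J X Y \<cdot> f) x) =
      gc C Z X Y f (gc C Z (cot C J X) X (cotu C J X) x) \<cdot> swp J (src V f) (src V x)"
proof -
  note l = cotensor_lift[OF C_cat C_cot[OF J Y], of "cot C J X" "vhom C X Y"
      "vcomp C (cot C J X) X Y \<cdot> (idm V (vhom C X Y) \<otimes>\<^sub>m cotu C J X)", folded cot_hom_def]
  show t: "cot_hom C J X Y \<in> arr V" "src V (cot_hom C J X Y) = vhom C X Y"
    "tgt V (cot_hom C J X Y) = vhom C (cot C J X) (cot C J Y)" using l J X Y by auto
  have e: "gc C (cot C J X) (cot C J Y) Y (cotu C J Y) (cot_hom C J X Y) =
    gc C (cot C J X) X Y (idm V (vhom C X Y)) (cotu C J X) \<cdot> symm V J (vhom C X Y)"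
    using l(4) J X Y by (simp add: gc_def)
  assume f: "f \<in> arr V" "tgt V f = vhom C X Y" and x: "x \<in> arr V" "tgt V x = vhom C Z (cot C J X)" and Z: "Z \<in> vob C"
  define W where "W = src V f"
  define Q where "Q = src V x"
  have o: "W \<in> obj V" "Q \<in> obj V" using f x by (auto simp: W_def Q_def)
  note fx = f x W_def[symmetric] Q_def[symmetric]
  have "gc C (cot C J X) (cot C J Y) Y (cotu C J Y) (cot_hom C J X Y \<cdot> f) =
     (gc C (cot C J X) X Y (idm V (vhom C X Y)) (cotu C J X) \<cdot> symm V J (vhom C X Y)) \<cdot> (idm V J \<otimes>\<^sub>m f)"
    unfolding e[symmetric] using t fx o J X Y by simp
  also have "\<dots> = gc C (cot C J X) X Y f (cotu C J X) \<cdot> symm V J W"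
    using fx o J X Y gc_cmp_left[of C "cot C J X" X Y "idm V (vhom C X Y)" "cotu C J X" f]
    by (simp add: symm_nat[of "idm V J" f J W])
  finally have e2: "gc C (cot C J X) (cot C J Y) Y (cotu C J Y) (cot_hom C J X Y \<cdot> f) = gc C (cot C J X) X Y f (cotu C J X) \<cdot> symm V J W" .
  have "gc C Z (cot C J Y) Y (cotu C J Y) (gc C Z (cot C J X) (cot C J Y) (cot_hom C J X Y \<cdot> f) x)
     = gc C Z (cot C J X) Y (gc C (cot C J X) (cot C J Y) Y (cotu C J Y) (cot_hom C J X Y \<cdot> f)) x \<cdot> ai J W Q"
    using t fx o J X Y Z by (simp del: gc_cmp_left gc_cmp_right)
  also have "\<dots> = gc C Z X Y f (gc C Z (cot C J X) X (cotu C J X) x) \<cdot> swp J W Q"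
    unfolding e2 using fx o J X Y Z by (simp add: swp_def)
  finally show "gc C Z (cot C J Y) Y (cotu C J Y) (gc C Z (cot C J X) (cot C J Y) (cot_hom C J X Y \<cdot> f) x) =
      gc C Z X Y f (gc C Z (cot C J X) X (cotu C J X) x) \<cdot> swp J (src V f) (src V x)" by (simp add: W_def Q_def)
qed

section \<open>Pointwise cotensors of algebras\<close>

abbreviation pw :: "('o, 'm) jtheory \<Rightarrow> 'o \<Rightarrow> ('o, 'c, 'm) vfun \<Rightarrow> ('o, 'c, 'm) vfun" where
  "pw T J A \<equiv> cot (alg_vcat T C) J A"

lemma pw_simps:
  assumes "theory_ok T"
  shows "L \<in> \<J> \<Longrightarrow> fobj (pw T J A) L = cot C J (fobj A L)"
    "\<lbrakk>K \<in> \<J>; L \<in> \<J>\<rbrakk> \<Longrightarrow> fhom (pw T J A) K L = cot_hom C J (fobj A K) (fobj A L) \<cdot> fhom A K L"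
    "L \<notin> \<J> \<Longrightarrow> fobj (pw T J A) L = undefined"
    "K \<notin> \<J> \<or> L \<notin> \<J> \<Longrightarrow> fhom (pw T J A) K L = undefined"
  using assms by (auto simp: alg_vcat_def mk_vfun_def)

lemma fm_pw:
  assumes T: "theory_ok T" and A: "vfunctor T C A" and J: "J \<in> \<J>" and K: "K \<in> \<J>" and L: "L \<in> \<J>"
    and t: "t \<in> arr V" "tgt V t = vhom T K L"
  shows "fm (pw T J A) K L t \<in> arr V" "src V (fm (pw T J A) K L t) = src V t"
    "tgt V (fm (pw T J A) K L t) = vhom C (cot C J (fobj A K)) (cot C J (fobj A L))"
    "\<lbrakk>x \<in> arr V; tgt V x = vhom C Z (cot C J (fobj A K)); Z \<in> vob C\<rbrakk> \<Longrightarrow>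
      gc C Z (cot C J (fobj A L)) (fobj A L) (cotu C J (fobj A L))
         (gc C Z (cot C J (fobj A K)) (cot C J (fobj A L)) (fm (pw T J A) K L t) x) =
      gc C Z (fobj A K) (fobj A L) (fm A K L t) (gc C Z (cot C J (fobj A K)) (fobj A K) (cotu C J (fobj A K)) x)
         \<cdot> swp J (src V t) (src V x)"
proof -
  have o: "fobj A K \<in> vob C" "fobj A L \<in> vob C" using A T K L by auto
  note h = cot_hom[OF J o]
  have e: "fm (pw T J A) K L t = cot_hom C J (fobj A K) (fobj A L) \<cdot> fm A K L t"
    using h A T K L t o by (simp add: fm_def pw_simps[OF T])
  show "fm (pw T J A) K L t \<in> arr V" "src V (fm (pw T J A) K L t) = src V t"
    "tgt V (fm (pw T J A) K L t) = vhom C (cot C J (fobj A K)) (cot C J (fobj A L))"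
    unfolding e using h A T K L t o by auto
  assume "x \<in> arr V" "tgt V x = vhom C Z (cot C J (fobj A K))" "Z \<in> vob C"
  then show "gc C Z (cot C J (fobj A L)) (fobj A L) (cotu C J (fobj A L))
         (gc C Z (cot C J (fobj A K)) (cot C J (fobj A L)) (fm (pw T J A) K L t) x) =
      gc C Z (fobj A K) (fobj A L) (fm A K L t) (gc C Z (cot C J (fobj A K)) (fobj A K) (cotu C J (fobj A K)) x)
         \<cdot> swp J (src V t) (src V x)"
    unfolding e using h(4)[of "fm A K L t" x Z] A T K L t o by simp
qed

text \<open>Each axiom is checked behind the counit of the cotensor, where \<open>fm_pw\<close>
  reduces it to the axiom for A. For composites, the exchange of J with a tensor product is split by
  \<open>swp_ten\<close>.\<close>

lemma vfunctor_pw: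
  assumes T: "theory_ok T" and A: "vfunctor T C A" and J: "J \<in> \<J>"
  shows "vfunctor T C (pw T J A)"
proof (rule vfunctorI)
  note T' = theory_okD(1,2)[OF T]
  show "vcategory T" "vcategory C" using T by simp_all
  have Ao: "fobj A L \<in> vob C" if "L \<in> \<J>" for L using A T that by simp
  show "fobj (pw T J A) \<in> vob T \<rightarrow>\<^sub>E vob C"
    using pw_simps[OF T] T' Ao J by auto
  show "fhom (pw T J A) X Y = undefined" if "X \<notin> vob T \<or> Y \<notin> vob T" for X Y
    using pw_simps(4)[OF T] that T' by auto
  show "fhom (pw T J A) X Y \<in> homs V (vhom T X Y) (vhom C (fobj (pw T J A) X) (fobj (pw T J A) Y))"
    if "X \<in> vob T" "Y \<in> vob T" for X Y
    using pw_simps[OF T] that T' Ao J A cot_hom(1-3)[OF J, of "fobj A X" "fobj A Y"] by simp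
  show "fhom (pw T J A) X X \<cdot> vid T X = vid C (fobj (pw T J A) X)" if "X \<in> vob T" for X
    unfolding fm_def[symmetric]
  proof -
    have X: "X \<in> \<J>" using that T' by simp
    let ?P = "cot C J (fobj A X)"
    note f = fm_pw[OF T A J X X, of "vid T X"]
    note b = J X T T' A Ao[OF X] f(1-3)
    have "fm (pw T J A) X X (vid T X) = vid C ?P"
    proof (rule cot_eqI[OF C_cat C_cot[OF J Ao[OF X]]])
      show "fm (pw T J A) X X (vid T X) \<in> el C \<one> ?P ?P" "vid C ?P \<in> el C \<one> ?P ?P" using b by auto
      have "gc C ?P ?P (fobj A X) (cotu C J (fobj A X)) (gc C ?P ?P ?P (fm (pw T J A) X X (vid T X)) (vid C ?P))
         = cotu C J (fobj A X) \<cdot> (runit V J \<cdot> (lunit V (J \<otimes> \<one>) \<cdot> swp J \<one> \<one>))"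
        using f(4)[of "vid C ?P" ?P] b by (simp add: fm_vid[OF A] del: gc_vid_right) simp
      also have "\<dots> = gc C ?P ?P (fobj A X) (cotu C J (fobj A X)) (gc C ?P ?P ?P (vid C ?P) (vid C ?P))"
        using b swp_unit'[of J \<one>] lunit_eq_runit by simp
      finally show "gc C ?P ?P (fobj A X) (cotu C J (fobj A X)) (gc C ?P ?P ?P (fm (pw T J A) X X (vid T X)) (vid C ?P))
        = gc C ?P ?P (fobj A X) (cotu C J (fobj A X)) (gc C ?P ?P ?P (vid C ?P) (vid C ?P))" .
    qed
    then show "fm (pw T J A) X X (vid T X) = vid C (fobj (pw T J A) X)" using pw_simps[OF T] X by simp
  qed
  show "fm (pw T J A) X Z (gc T X Y Z g f) =
      gc C (fobj (pw T J A) X) (fobj (pw T J A) Y) (fobj (pw T J A) Z) (fm (pw T J A) Y Z g) (fm (pw T J A) X Y f)"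
    if g: "g \<in> el T (vhom T Y Z) Y Z" and f: "f \<in> el T (vhom T X Y) X Y" for X Y Z g f
  proof -
    have o: "X \<in> \<J>" "Y \<in> \<J>" "Z \<in> \<J>" using g f T' by auto
    define W where "W = src V f"
    define W' where "W' = src V g"
    have f': "f \<in> arr V" "tgt V f = vhom T X Y" "src V f = W" and g': "g \<in> arr V" "tgt V g = vhom T Y Z" "src V g = W'"
      using f g by (auto simp: W_def W'_def)
    have W: "W \<in> obj V" "W' \<in> obj V" using f' g' by auto
    let ?X = "cot C J (fobj A X)" and ?Y = "cot C J (fobj A Y)" and ?Z = "cot C J (fobj A Z)"
    let ?F = "fm (pw T J A) X Y f" and ?G = "fm (pw T J A) Y Z g" and ?H = "fm (pw T J A) X Z (gc T X Y Z g f)"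
    have h': "gc T X Y Z g f \<in> arr V" "tgt V (gc T X Y Z g f) = vhom T X Z" "src V (gc T X Y Z g f) = W' \<otimes> W"
      using f' g' o T T' by auto
    note F = fm_pw[OF T A J o(1,2) f'(1,2)] and G = fm_pw[OF T A J o(2,3) g'(1,2)] and H = fm_pw[OF T A J o(1,3) h'(1,2)]
    note b = J o T T' A Ao[OF o(1)] Ao[OF o(2)] Ao[OF o(3)] F(1-3) G(1-3) H(1-3) W f' g' h'
    have "?H = gc C ?X ?Y ?Z ?G ?F"
    proof (rule cot_eqI[OF C_cat C_cot[OF J Ao[OF o(3)]]])
      show "?H \<in> el C (W' \<otimes> W) ?X ?Z" "gc C ?X ?Y ?Z ?G ?F \<in> el C (W' \<otimes> W) ?X ?Z"
        using b by auto
      let ?v = "vid C ?X"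
      let ?x = "gc C ?X ?X (fobj A X) (cotu C J (fobj A X)) ?v"
      let ?agf = "gc C ?X (fobj A Y) (fobj A Z) (fm A Y Z g) (gc C ?X (fobj A X) (fobj A Y) (fm A X Y f) ?x)"
      have "gc C ?X ?Z (fobj A Z) (cotu C J (fobj A Z)) (gc C ?X ?X ?Z ?H ?v)
        = ?agf \<cdot> (assoc V W' W (J \<otimes> \<one>) \<cdot> swp J (W' \<otimes> W) \<one>)"
        using H(4)[of ?v ?X] b by (simp add: fm_gc[OF T'(1) C_cat A] del: gc_vid_right)
      also have "assoc V W' W (J \<otimes> \<one>) \<cdot> swp J (W' \<otimes> W) \<one> =
         (idm V W' \<otimes>\<^sub>m swp J W \<one>) \<cdot> (swp J W' (W \<otimes> \<one>) \<cdot> (idm V J \<otimes>\<^sub>m assoc V W' W \<one>))"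
        by (rule swp_ten) (use b in auto)
      also have "?agf \<cdot> ((idm V W' \<otimes>\<^sub>m swp J W \<one>) \<cdot> (swp J W' (W \<otimes> \<one>) \<cdot> (idm V J \<otimes>\<^sub>m assoc V W' W \<one>))) =
         gc C ?X ?Z (fobj A Z) (cotu C J (fobj A Z)) (gc C ?X ?Y ?Z ?G (gc C ?X ?X ?Y ?F ?v)) \<cdot> (idm V J \<otimes>\<^sub>m assoc V W' W \<one>)"
        using F(4)[of ?v ?X] G(4)[of "gc C ?X ?X ?Y ?F ?v" ?X] b by (simp del: gc_vid_right)
      also have "\<dots> = gc C ?X ?Z (fobj A Z) (cotu C J (fobj A Z)) (gc C ?X ?X ?Z (gc C ?X ?Y ?Z ?G ?F) ?v)"
        using b by (simp del: gc_vid_right)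
      finally show "gc C ?X ?Z (fobj A Z) (cotu C J (fobj A Z)) (gc C ?X ?X ?Z ?H ?v)
        = gc C ?X ?Z (fobj A Z) (cotu C J (fobj A Z)) (gc C ?X ?X ?Z (gc C ?X ?Y ?Z ?G ?F) ?v)" .
    qed
    then show ?thesis using pw_simps[OF T] o by simp
  qed
qed

text \<open>Cotensors commute with cotensors. To factor through the image of the counit at L,
  exchange L and J, factor through the L-counit of A, and factor the result through the J-counit of
  C.\<close>

lemma algebra_pw:
  assumes T: "theory_ok T" and A: "algebra_ok T C A" and J: "J \<in> \<J>"
  shows "algebra_ok T C (pw T J A)"
  unfolding algebra_ok_def
proof
  note T' = theory_okD(1,2)[OF T] and A' = algebra_okD[OF A]
  note F = vfunctor_pw[OF T A' J]
  show "vfunctor T C (pw T J A)" by (rule F)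
  show "preserves_cotensors \<J> T C (pw T J A)"
  proof (rule preserves_cotensorsI[OF T' C_cat F counit_cotensor[OF T]])
    fix L assume L: "L \<in> \<J>"
    note \<beta> = algebra_counit[OF T A L]
    note g = counit_typing[OF T L]
    have o: "fobj A \<one> \<in> vob C" "fobj A L \<in> vob C" using A' T L by auto
    note f = fm_pw[OF T A' J L unit_arity g(1,3)]
    let ?X = "cot C J (fobj A \<one>)" and ?P = "cot C J (fobj A L)" and ?f = "fm (pw T J A) L \<one> (counit T L)"
    let ?b = "fm A L \<one> (counit T L)"
    note d = is_cotensorD[OF \<beta>]
    have "is_cotensor C L ?X ?P ?f"
    proof (rule is_cotensorI[OF C_cat])
      show "L \<in> obj V" "?f \<in> el C L ?P ?X" using L f g o J by auto
      fix Y W assume Y: "Y \<in> vob C" and W: "W \<in> obj V"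
      note b = L g f(1-3) o J d Y W
      show "\<exists>x. x \<in> homs V W (vhom C Y ?P) \<and> gc C Y ?P ?X ?f x = y"
        if y: "y \<in> homs V (L \<otimes> W) (vhom C Y ?X)" for y
      proof -
        let ?y = "gc C Y ?X (fobj A \<one>) (cotu C J (fobj A \<one>)) y \<cdot> swp L J W"
        define z where "z = cfac C L (fobj A \<one>) (fobj A L) ?b Y (J \<otimes> W) ?y"
        have z: "z \<in> arr V" "src V z = J \<otimes> W" "tgt V z = vhom C Y (fobj A L)" "gc C Y (fobj A L) (fobj A \<one>) ?b z = ?y"
          using cfac[OF C_cat \<beta> Y, of "J \<otimes> W" ?y] y b by (auto simp: z_def)
        define x where "x = cfac C J (fobj A L) ?P (cotu C J (fobj A L)) Y W z"
        have x: "x \<in> arr V" "src V x = W" "tgt V x = vhom C Y ?P" "gc C Y ?P (fobj A L) (cotu C J (fobj A L)) x = z"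
          using cfac[OF C_cat C_cot[OF J o(2)] Y W, of z] z by (auto simp: x_def)
        have e: "gc C Y ?X (fobj A \<one>) (cotu C J (fobj A \<one>)) (gc C Y ?P ?X ?f x) = gc C Y ?X (fobj A \<one>) (cotu C J (fobj A \<one>)) y"
          unfolding f(4)[OF x(1,3) Y] x(4) z(4) using x(2) y b by simp
        have "gc C Y ?P ?X ?f x = y"
          by (rule cot_cancel[OF C_cat C_cot[OF J o(1)] Y _ _ _ _ _ e]) (use x(1-3) y b in auto)
        then show ?thesis using x by auto
      qed
      show "x = y" if a: "x \<in> homs V W (vhom C Y ?P)" "y \<in> homs V W (vhom C Y ?P)"
        and e: "gc C Y ?P ?X ?f x = gc C Y ?P ?X ?f y" for x y
      proof (rule cot_cancel[OF C_cat C_cot[OF J o(2)] Y])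
        have "gc C Y (fobj A L) (fobj A \<one>) ?b (gc C Y ?P (fobj A L) (cotu C J (fobj A L)) x) \<cdot> swp J L W
           = gc C Y (fobj A L) (fobj A \<one>) ?b (gc C Y ?P (fobj A L) (cotu C J (fobj A L)) y) \<cdot> swp J L W"
          using f(4)[of x Y] f(4)[of y Y] e a b by simp
        then have e': "gc C Y (fobj A L) (fobj A \<one>) ?b (gc C Y ?P (fobj A L) (cotu C J (fobj A L)) x)
           = gc C Y (fobj A L) (fobj A \<one>) ?b (gc C Y ?P (fobj A L) (cotu C J (fobj A L)) y)"
          by (rule iso_cancel_right[rotated -1]) (use a b in auto)
        show "gc C Y ?P (fobj A L) (cotu C J (fobj A L)) x = gc C Y ?P (fobj A L) (cotu C J (fobj A L)) y"
          by (rule cot_cancel[OF C_cat \<beta> Y _ _ _ _ _ e']) (use a b in auto)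
      qed (use a in auto)
    qed
    then show "is_cotensor C L (fobj (pw T J A) \<one>) (fobj (pw T J A) L) (fm (pw T J A) L \<one> (counit T L))"
      using pw_simps[OF T] L by simp
  qed
qed

end

section \<open>Hom objects of algebras as ends, and cotensors of algebras\<close>

context admissible_vcat
begin

lemma is_hom_end_hom_end:
  assumes "theory_ok T" "algebra_ok T C A" "algebra_ok T C B"
  shows "is_hom_end T C A B (end_obj T C A B, end_proj T C A B)"
proof -
  have "\<exists>e. is_hom_end T C A B e" using admissible assms by (simp add: admissible_def)
  then have "is_hom_end T C A B (hom_end T C A B)" unfolding hom_end_def by (rule someI_ex)
  then show ?thesis by (simp add: end_obj_def end_proj_def)
qed

lemma end_obj [simp]:
  assumes "theory_ok T" "algebra_ok T C A" "algebra_ok T C B"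
  shows "end_obj T C A B \<in> obj V"
  using is_hom_end_hom_end[OF assms] by (simp add: is_hom_end_def)

lemma end_proj_family:
  assumes "theory_ok T" "algebra_ok T C A" "algebra_ok T C B"
  shows "vnat_family T C A B (end_obj T C A B) (end_proj T C A B)"
  using is_hom_end_hom_end[OF assms] by (simp add: is_hom_end_def)

lemma end_proj_typing [simp]:
  assumes "theory_ok T" "algebra_ok T C A" "algebra_ok T C B" "L \<in> \<J>"
  shows "end_proj T C A B L \<in> arr V" "src V (end_proj T C A B L) = end_obj T C A B"
    "tgt V (end_proj T C A B L) = vhom C (fobj A L) (fobj B L)"
  using vnat_familyD[OF end_proj_family[OF assms(1-3)], of L] assms by auto

lemma end_lift:
  assumes T: "theory_ok T" and A: "algebra_ok T C A" and B: "algebra_ok T C B"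
    and W: "W \<in> obj V" and \<alpha>: "vnat_family T C A B W \<alpha>"
  shows "end_lift T C A B W \<alpha> \<in> arr V" "src V (end_lift T C A B W \<alpha>) = W"
    "tgt V (end_lift T C A B W \<alpha>) = end_obj T C A B"
    "L \<in> \<J> \<Longrightarrow> end_proj T C A B L \<cdot> end_lift T C A B W \<alpha> = \<alpha> L"
proof -
  have "\<exists>!u. u \<in> homs V W (end_obj T C A B) \<and> (\<forall>X \<in> vob T. end_proj T C A B X \<cdot> u = \<alpha> X)"
    using is_hom_end_hom_end[OF T A B] W \<alpha> by (simp add: is_hom_end_def)
  note e = theI'[OF this, folded end_lift_def]
  show "end_lift T C A B W \<alpha> \<in> arr V" "src V (end_lift T C A B W \<alpha>) = W"
    "tgt V (end_lift T C A B W \<alpha>) = end_obj T C A B" using e by auto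
  show "end_proj T C A B L \<cdot> end_lift T C A B W \<alpha> = \<alpha> L" if "L \<in> \<J>"
    using e that T by simp
qed

lemma end_family_cmp:
  assumes T: "theory_ok T" and A: "algebra_ok T C A" and B: "algebra_ok T C B"
    and f: "f \<in> arr V" "tgt V f = end_obj T C A B"
  shows "vnat_family T C A B (src V f) (\<lambda>L. end_proj T C A B L \<cdot> f)"
  using vnat_family_cmp[OF _ C_cat _ _ end_proj_family[OF T A B] f] T algebra_okD[OF A] algebra_okD[OF B] by simp

lemma end_eqI:
  assumes T: "theory_ok T" and A: "algebra_ok T C A" and B: "algebra_ok T C B"
    and f: "f \<in> arr V" "tgt V f = end_obj T C A B" and g: "g \<in> arr V" "tgt V g = end_obj T C A B" "src V f = src V g"
    and e: "\<And>L. L \<in> \<J> \<Longrightarrow> end_proj T C A B L \<cdot> f = end_proj T C A B L \<cdot> g"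
  shows "f = g"
proof -
  have n: "vnat_family T C A B (src V g) (\<lambda>L. end_proj T C A B L \<cdot> g)" by (rule end_family_cmp[OF T A B g(1,2)])
  have "\<exists>!u. u \<in> homs V (src V g) (end_obj T C A B) \<and> (\<forall>X \<in> vob T. end_proj T C A B X \<cdot> u = end_proj T C A B X \<cdot> g)"
    using is_hom_end_hom_end[OF T A B] n g by (simp add: is_hom_end_def)
  moreover have "f \<in> homs V (src V g) (end_obj T C A B) \<and> (\<forall>X \<in> vob T. end_proj T C A B X \<cdot> f = end_proj T C A B X \<cdot> g)"
    using f g(3) e theory_okD(2)[OF T] by simp
  moreover have "g \<in> homs V (src V g) (end_obj T C A B)" using g by simp
  ultimately show ?thesis by blast
qed

text \<open>Both arrows induce natural families into an algebra, and
  \<open>vnat_family_unique\<close> compares such families at I only.\<close>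

lemma end_unit_eqI:
  assumes T: "theory_ok T" and A: "algebra_ok T C A" and B: "algebra_ok T C B"
    and f: "f \<in> arr V" "tgt V f = end_obj T C A B" and g: "g \<in> arr V" "tgt V g = end_obj T C A B" "src V f = src V g"
    and e: "end_proj T C A B \<one> \<cdot> f = end_proj T C A B \<one> \<cdot> g"
  shows "f = g"
proof (rule end_eqI[OF T A B f g])
  have a: "vnat_family T C A B (src V g) (\<lambda>L. end_proj T C A B L \<cdot> f)"
    using end_family_cmp[OF T A B f] g by simp
  have b: "vnat_family T C A B (src V g) (\<lambda>L. end_proj T C A B L \<cdot> g)" by (rule end_family_cmp[OF T A B g(1,2)])
  show "end_proj T C A B L \<cdot> f = end_proj T C A B L \<cdot> g" if "L \<in> \<J>" for L
    using vnat_family_unique[OF T C_cat algebra_okD[OF A] B a b] e that by simp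
qed

lemma alg_vcat_simps [simp]:
  "vob (alg_vcat T C) = {A. algebra_ok T C A}" "vhom (alg_vcat T C) A B = end_obj T C A B"
  by (auto simp: alg_vcat_def)

lemma alg_vid:
  assumes T: "theory_ok T" and A: "algebra_ok T C A"
  shows "vid (alg_vcat T C) A \<in> arr V" "src V (vid (alg_vcat T C) A) = \<one>"
    "tgt V (vid (alg_vcat T C) A) = end_obj T C A A"
    "L \<in> \<J> \<Longrightarrow> end_proj T C A A L \<cdot> vid (alg_vcat T C) A = vid C (fobj A L)"
proof -
  note T' = theory_okD(1,2)[OF T] and A' = algebra_okD[OF A]
  have "vnat_family T C A A \<one> (\<lambda>L. vid C (fobj A L))"
  proof (rule vnat_familyI[OF T'(1) C_cat A' A'])
    show "vid C (fobj A X) \<in> homs V \<one> (vhom C (fobj A X) (fobj A X))" if "X \<in> vob T" for X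
      using that A' by simp
    fix X Y Z W Q t x assume a: "X \<in> vob T" "Y \<in> vob T" "Z \<in> vob C" "W \<in> obj V" "Q \<in> obj V" "t \<in> homs V W (vhom T X Y)"
      "x \<in> homs V Q (vhom C Z (fobj A X))"
    then show "gc C Z (fobj A Y) (fobj A Y) (vid C (fobj A Y)) (gc C Z (fobj A X) (fobj A Y) (fm A X Y t) x) =
       gc C Z (fobj A X) (fobj A Y) (fm A X Y t) (gc C Z (fobj A X) (fobj A X) (vid C (fobj A X)) x) \<cdot> swp \<one> W Q"
      using A' T T'(1) swp_unit[of W Q] by simp
  qed simp
  note l = end_lift[OF T A A unit_obj this]
  have e: "vid (alg_vcat T C) A = end_lift T C A A \<one> (\<lambda>L. vid C (fobj A L))" by (simp add: alg_vcat_def)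
  show "vid (alg_vcat T C) A \<in> arr V" "src V (vid (alg_vcat T C) A) = \<one>"
    "tgt V (vid (alg_vcat T C) A) = end_obj T C A A"
    "L \<in> \<J> \<Longrightarrow> end_proj T C A A L \<cdot> vid (alg_vcat T C) A = vid C (fobj A L)"
    unfolding e using l by auto
qed

text \<open>The pointwise composite of two natural families is natural: t passes one family after
  the other, and \<open>swp_ten'\<close> merges the two exchanges into one.\<close>

lemma alg_vcomp:
  assumes T: "theory_ok T" and A: "algebra_ok T C A" and B: "algebra_ok T C B" and D: "algebra_ok T C D"
  shows "vcomp (alg_vcat T C) A B D \<in> arr V"
    "src V (vcomp (alg_vcat T C) A B D) = end_obj T C B D \<otimes> end_obj T C A B"
    "tgt V (vcomp (alg_vcat T C) A B D) = end_obj T C A D"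
    "L \<in> \<J> \<Longrightarrow> end_proj T C A D L \<cdot> vcomp (alg_vcat T C) A B D =
       gc C (fobj A L) (fobj B L) (fobj D L) (end_proj T C B D L) (end_proj T C A B L)"
proof -
  note T' = theory_okD(1,2)[OF T] and A' = algebra_okD[OF A] and B' = algebra_okD[OF B] and D' = algebra_okD[OF D]
  let ?E = "end_obj T C A B" and ?E' = "end_obj T C B D"
  let ?p = "end_proj T C A B" and ?q = "end_proj T C B D"
  let ?f = "\<lambda>L. gc C (fobj A L) (fobj B L) (fobj D L) (?q L) (?p L)"
  have o: "?E \<in> obj V" "?E' \<in> obj V" using assms by auto
  have "vnat_family T C A D (?E' \<otimes> ?E) ?f"
  proof (rule vnat_familyI[OF T'(1) C_cat A' D'])
    show "?E' \<otimes> ?E \<in> obj V" using o by simp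
    show "?f X \<in> homs V (?E' \<otimes> ?E) (vhom C (fobj A X) (fobj D X))" if "X \<in> vob T" for X
      using that assms A' B' D' T' by simp
    fix X Y Z W Q t x assume a: "X \<in> vob T" "Y \<in> vob T" "Z \<in> vob C" "W \<in> obj V" "Q \<in> obj V" "t \<in> homs V W (vhom T X Y)"
      "x \<in> homs V Q (vhom C Z (fobj A X))"
    have XY: "X \<in> \<J>" "Y \<in> \<J>" using a T' by auto
    note b = assms A' B' D' T' a XY o
    let ?pX = "gc C Z (fobj A X) (fobj B X) (?p X) x"
    have p: "gc C Z (fobj A Y) (fobj B Y) (?p Y) (gc C Z (fobj A X) (fobj A Y) (fm A X Y t) x) =
       gc C Z (fobj B X) (fobj B Y) (fm B X Y t) ?pX \<cdot> swp ?E W Q"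
      using vnat_family_elem[OF T'(1) C_cat A' B' end_proj_family[OF T A B] a(1,2), of t x Z] b by simp
    have q: "gc C Z (fobj B Y) (fobj D Y) (?q Y) (gc C Z (fobj B X) (fobj B Y) (fm B X Y t) ?pX) =
       gc C Z (fobj D X) (fobj D Y) (fm D X Y t) (gc C Z (fobj B X) (fobj D X) (?q X) ?pX) \<cdot> swp ?E' W (?E \<otimes> Q)"
      using vnat_family_elem[OF T'(1) C_cat B' D' end_proj_family[OF T B D] a(1,2), of t ?pX Z] b by simp
    have "gc C Z (fobj A Y) (fobj D Y) (?f Y) (gc C Z (fobj A X) (fobj A Y) (fm A X Y t) x) =
      gc C Z (fobj D X) (fobj D Y) (fm D X Y t) (gc C Z (fobj B X) (fobj D X) (?q X) ?pX) \<cdot>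
        (swp ?E' W (?E \<otimes> Q) \<cdot> ((idm V ?E' \<otimes>\<^sub>m swp ?E W Q) \<cdot> assoc V ?E' ?E (W \<otimes> Q)))"
      using b p q by simp
    also have "\<dots> = gc C Z (fobj D X) (fobj D Y) (fm D X Y t) (gc C Z (fobj B X) (fobj D X) (?q X) ?pX) \<cdot>
        ((idm V W \<otimes>\<^sub>m assoc V ?E' ?E Q) \<cdot> swp (?E' \<otimes> ?E) W Q)"
      using swp_ten'[of W ?E' ?E Q] b by simp
    also have "\<dots> = gc C Z (fobj D X) (fobj D Y) (fm D X Y t) (gc C Z (fobj A X) (fobj D X) (?f X) x) \<cdot> swp (?E' \<otimes> ?E) W Q"
      using b by simp
    finally show "gc C Z (fobj A Y) (fobj D Y) (?f Y) (gc C Z (fobj A X) (fobj A Y) (fm A X Y t) x) =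
       gc C Z (fobj D X) (fobj D Y) (fm D X Y t) (gc C Z (fobj A X) (fobj D X) (?f X) x) \<cdot> swp (?E' \<otimes> ?E) W Q" .
  qed
  note l = end_lift[OF T A D _ this]
  have e: "vcomp (alg_vcat T C) A B D = end_lift T C A D (?E' \<otimes> ?E) ?f" by (simp add: alg_vcat_def gc_def)
  show "vcomp (alg_vcat T C) A B D \<in> arr V" "src V (vcomp (alg_vcat T C) A B D) = ?E' \<otimes> ?E"
    "tgt V (vcomp (alg_vcat T C) A B D) = end_obj T C A D"
    "L \<in> \<J> \<Longrightarrow> end_proj T C A D L \<cdot> vcomp (alg_vcat T C) A B D = ?f L"
    unfolding e using l o by auto
qed

lemma proj_gc:
  assumes T: "theory_ok T" and A: "algebra_ok T C A" and B: "algebra_ok T C B" and D: "algebra_ok T C D"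
    and g: "g \<in> arr V" "tgt V g = end_obj T C B D" and f: "f \<in> arr V" "tgt V f = end_obj T C A B" and L: "L \<in> \<J>"
  shows "end_proj T C A D L \<cdot> (vcomp (alg_vcat T C) A B D \<cdot> (g \<otimes>\<^sub>m f)) =
    gc C (fobj A L) (fobj B L) (fobj D L) (end_proj T C B D L \<cdot> g) (end_proj T C A B L \<cdot> f)"
proof -
  note c = alg_vcomp[OF T A B D] and A' = algebra_okD[OF A] and B' = algebra_okD[OF B] and D' = algebra_okD[OF D]
  have "end_proj T C A D L \<cdot> (vcomp (alg_vcat T C) A B D \<cdot> (g \<otimes>\<^sub>m f)) =
     (end_proj T C A D L \<cdot> vcomp (alg_vcat T C) A B D) \<cdot> (g \<otimes>\<^sub>m f)"
    by (rule cmp_assoc'[symmetric]) (use assms c in auto)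
  also have "\<dots> = gc C (fobj A L) (fobj B L) (fobj D L) (end_proj T C B D L \<cdot> g) (end_proj T C A B L \<cdot> f)"
    unfolding c(4)[OF L] using assms A' B' D' by simp
  finally show ?thesis .
qed

text \<open>The projections of an end are jointly monic and carry composition to composition in C,
  so the axioms are inherited from C.\<close>

lemma vcategory_alg_vcat:
  assumes T: "theory_ok T"
  shows "vcategory (alg_vcat T C)"
proof -
  let ?Q = "alg_vcat T C"
  note v = alg_vid[OF T] and c = alg_vcomp[OF T]
  have 1: "vcomp ?Q A B E \<cdot> (vcomp ?Q B D E \<otimes>\<^sub>m idm V (end_obj T C A B)) =
        vcomp ?Q A D E \<cdot> (idm V (end_obj T C D E) \<otimes>\<^sub>m vcomp ?Q A B D)
          \<cdot> assoc V (end_obj T C D E) (end_obj T C B D) (end_obj T C A B)"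
    if a: "algebra_ok T C A" "algebra_ok T C B" "algebra_ok T C D" "algebra_ok T C E" for A B D E
  proof (rule end_eqI[OF T a(1,4)])
    fix L assume L: "L \<in> \<J>"
    note b = T a L algebra_okD[OF a(1)] algebra_okD[OF a(2)] algebra_okD[OF a(3)] algebra_okD[OF a(4)]
      c(1-3)[OF a(1,2,3)] c(1-3)[OF a(1,2,4)] c(1-3)[OF a(1,3,4)] c(1-3)[OF a(2,3,4)]
    have o: "end_obj T C D E \<in> obj V" "end_obj T C B D \<in> obj V" "end_obj T C A B \<in> obj V" using b by auto
    have "end_proj T C A E L \<cdot> (vcomp ?Q A B E \<cdot> (vcomp ?Q B D E \<otimes>\<^sub>m idm V (end_obj T C A B)))
      = gc C (fobj A L) (fobj B L) (fobj E L) (gc C (fobj B L) (fobj D L) (fobj E L) (end_proj T C D E L) (end_proj T C B D L)) (end_proj T C A B L)"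
      using proj_gc[OF T a(1,2,4), of "vcomp ?Q B D E" "idm V (end_obj T C A B)" L] c(4)[OF a(2,3,4) L] b o by simp
    also have "\<dots> = gc C (fobj A L) (fobj D L) (fobj E L) (end_proj T C D E L) (gc C (fobj A L) (fobj B L) (fobj D L) (end_proj T C B D L) (end_proj T C A B L))
         \<cdot> assoc V (end_obj T C D E) (end_obj T C B D) (end_obj T C A B)"
      using b by simp
    also have "\<dots> = (end_proj T C A E L \<cdot> (vcomp ?Q A D E \<cdot> (idm V (end_obj T C D E) \<otimes>\<^sub>m vcomp ?Q A B D)))
         \<cdot> assoc V (end_obj T C D E) (end_obj T C B D) (end_obj T C A B)"
      using proj_gc[OF T a(1,3,4), of "idm V (end_obj T C D E)" "vcomp ?Q A B D" L] c(4)[OF a(1,2,3) L] b o by simp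
    also have "\<dots> = end_proj T C A E L \<cdot> (vcomp ?Q A D E \<cdot> (idm V (end_obj T C D E) \<otimes>\<^sub>m vcomp ?Q A B D)
         \<cdot> assoc V (end_obj T C D E) (end_obj T C B D) (end_obj T C A B))"
      using b o by simp
    finally show "end_proj T C A E L \<cdot> (vcomp ?Q A B E \<cdot> (vcomp ?Q B D E \<otimes>\<^sub>m idm V (end_obj T C A B))) = \<dots>" .
  qed (use T a c[OF a(1,2,3)] c[OF a(1,2,4)] c[OF a(1,3,4)] c[OF a(2,3,4)] in auto)
  have 2: "vcomp ?Q A B B \<cdot> (vid ?Q B \<otimes>\<^sub>m idm V (end_obj T C A B)) = lunit V (end_obj T C A B)"
    "vcomp ?Q A A B \<cdot> (idm V (end_obj T C A B) \<otimes>\<^sub>m vid ?Q A) = runit V (end_obj T C A B)"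
    if a: "algebra_ok T C A" "algebra_ok T C B" for A B
  proof -
    note b = T a algebra_okD[OF a(1)] algebra_okD[OF a(2)] v(1-3)[OF a(1)] v(1-3)[OF a(2)]
      c(1-3)[OF a(1,1,2)] c(1-3)[OF a(1,2,2)]
    have o: "end_obj T C A B \<in> obj V" "end_obj T C A A \<in> obj V" "end_obj T C B B \<in> obj V" using b by auto
    show "vcomp ?Q A B B \<cdot> (vid ?Q B \<otimes>\<^sub>m idm V (end_obj T C A B)) = lunit V (end_obj T C A B)"
    proof (rule end_eqI[OF T a])
      show "end_proj T C A B L \<cdot> (vcomp ?Q A B B \<cdot> (vid ?Q B \<otimes>\<^sub>m idm V (end_obj T C A B))) = end_proj T C A B L \<cdot> lunit V (end_obj T C A B)"
        if L: "L \<in> \<J>" for L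
        using proj_gc[OF T a(1,2,2), of "vid ?Q B" "idm V (end_obj T C A B)" L] v(4)[OF a(2) L] b o L by simp
    qed (use b o in simp_all)
    show "vcomp ?Q A A B \<cdot> (idm V (end_obj T C A B) \<otimes>\<^sub>m vid ?Q A) = runit V (end_obj T C A B)"
    proof (rule end_eqI[OF T a])
      show "end_proj T C A B L \<cdot> (vcomp ?Q A A B \<cdot> (idm V (end_obj T C A B) \<otimes>\<^sub>m vid ?Q A)) = end_proj T C A B L \<cdot> runit V (end_obj T C A B)"
        if L: "L \<in> \<J>" for L
        using proj_gc[OF T a(1,1,2), of "idm V (end_obj T C A B)" "vid ?Q A" L] v(4)[OF a(1) L] b o L by simp
    qed (use b o in simp_all)
  qed
  show ?thesis unfolding vcategory_def alg_vcat_simps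
    using v(1-3) c(1-3) 1 2 T by simp
qed

lemma alg_cotu:
  assumes T: "theory_ok T" and A: "algebra_ok T C A" and J: "J \<in> \<J>"
  shows "cotu (alg_vcat T C) J A \<in> arr V" "src V (cotu (alg_vcat T C) J A) = J"
    "tgt V (cotu (alg_vcat T C) J A) = end_obj T C (pw T J A) A"
    "L \<in> \<J> \<Longrightarrow> end_proj T C (pw T J A) A L \<cdot> cotu (alg_vcat T C) J A = cotu C J (fobj A L)"
proof -
  note T' = theory_okD(1,2)[OF T] and A' = algebra_okD[OF A] and P = algebra_pw[OF T A J]
  note P' = algebra_okD[OF P]
  have "vnat_family T C (pw T J A) A J (\<lambda>L. cotu C J (fobj A L))"
  proof (rule vnat_familyI[OF T'(1) C_cat P' A'])
    show "cotu C J (fobj A X) \<in> homs V J (vhom C (fobj (pw T J A) X) (fobj A X))" if "X \<in> vob T" for X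
      using that A' T' J pw_simps[OF T] by simp
    fix X Y Z W Q t x assume a: "X \<in> vob T" "Y \<in> vob T" "Z \<in> vob C" "W \<in> obj V" "Q \<in> obj V" "t \<in> homs V W (vhom T X Y)"
      "x \<in> homs V Q (vhom C Z (fobj (pw T J A) X))"
    have XY: "X \<in> \<J>" "Y \<in> \<J>" using a T' by auto
    show "gc C Z (fobj (pw T J A) Y) (fobj A Y) (cotu C J (fobj A Y)) (gc C Z (fobj (pw T J A) X) (fobj (pw T J A) Y) (fm (pw T J A) X Y t) x) =
       gc C Z (fobj A X) (fobj A Y) (fm A X Y t) (gc C Z (fobj (pw T J A) X) (fobj A X) (cotu C J (fobj A X)) x) \<cdot> swp J W Q"
      using fm_pw(4)[OF T A' J XY, of t x Z] a XY pw_simps(1)[OF T] by simp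
  qed (use J in simp)
  note l = end_lift[OF T P A _ this]
  have e: "cotu (alg_vcat T C) J A = end_lift T C (pw T J A) A J (\<lambda>L. cotu C J (fobj A L))" by (simp add: alg_vcat_def)
  show "cotu (alg_vcat T C) J A \<in> arr V" "src V (cotu (alg_vcat T C) J A) = J"
    "tgt V (cotu (alg_vcat T C) J A) = end_obj T C (pw T J A) A"
    "L \<in> \<J> \<Longrightarrow> end_proj T C (pw T J A) A L \<cdot> cotu (alg_vcat T C) J A = cotu C J (fobj A L)"
    unfolding e using l J by auto
qed

text \<open>An equality, not merely an isomorphism, because the designated cotensors by I are
  trivial in C. It allows the counit from [J,A] to A to serve as an operation J \<rightarrow> I of
  the commutant.\<close>

lemma pw_unit:
  assumes T: "theory_ok T" and A: "algebra_ok T C A"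
  shows "pw T \<one> A = A"
proof (rule vfun_eqI)
  note T' = theory_okD(1,2)[OF T] and A' = algebra_okD[OF A]
  note P' = vfunctor_pw[OF T A' unit_arity]
  show "vfunctor T C (pw T \<one> A)" "vfunctor T C A" using P' A' by auto
  have o: "fobj (pw T \<one> A) X = fobj A X" if "X \<in> \<J>" for X
    using that A' T' pw_simps[OF T] by simp
  then show "\<And>X. X \<in> vob T \<Longrightarrow> fobj (pw T \<one> A) X = fobj A X" using T' by simp
  show "fhom (pw T \<one> A) X Y = fhom A X Y" if "X \<in> vob T" "Y \<in> vob T" for X Y
  proof (rule gc_eqI)
    have XY: "X \<in> \<J>" "Y \<in> \<J>" using that T' by auto
    let ?W = "vhom T X Y" and ?v = "vid C (fobj A X)"
    have W: "?W \<in> obj V" using T' that by simp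
    note b = that XY T T'(1) A' P' o[OF XY(1)] o[OF XY(2)] W
    show "fhom (pw T \<one> A) X Y \<in> el C ?W (fobj A X) (fobj A Y)" "fhom A X Y \<in> el C ?W (fobj A X) (fobj A Y)"
      using b vfunctor_hom[OF P' that] by auto
    have "gc C (fobj A X) (fobj A X) (fobj A Y) (fhom (pw T \<one> A) X Y) ?v \<cdot> lunit V (?W \<otimes> \<one>) =
      gc C (fobj A X) (fobj A X) (fobj A Y) (fhom A X Y) ?v \<cdot> ((idm V ?W \<otimes>\<^sub>m lunit V \<one>) \<cdot> swp \<one> ?W \<one>)"
      using fm_pw(4)[OF T A' unit_arity XY, of "idm V ?W" ?v "fobj A X"] b vfunctor_hom[OF P' that]
      by (simp del: gc_vid_right)
    then have "gc C (fobj A X) (fobj A X) (fobj A Y) (fhom (pw T \<one> A) X Y) ?v \<cdot> lunit V (?W \<otimes> \<one>) =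
      gc C (fobj A X) (fobj A X) (fobj A Y) (fhom A X Y) ?v \<cdot> lunit V (?W \<otimes> \<one>)"
      using swp_unit[of ?W \<one>] W by (simp del: gc_vid_right)
    then show "gc C (fobj A X) (fobj A X) (fobj A Y) (fhom (pw T \<one> A) X Y) ?v = gc C (fobj A X) (fobj A X) (fobj A Y) (fhom A X Y) ?v"
      by (rule iso_cancel_right[rotated -1]) (use b vfunctor_hom[OF P' that] in auto)
  qed
qed

text \<open>The components of f factor through the counits in C. These factors form a natural family
  because the counits can be cancelled, and the end collects them into one arrow.\<close>

lemma alg_cotensor:
  assumes T: "theory_ok T" and A: "algebra_ok T C A" and J: "J \<in> \<J>"
  shows "is_cotensor (alg_vcat T C) J A (pw T J A) (cotu (alg_vcat T C) J A)"
proof (rule is_cotensorI[OF vcategory_alg_vcat[OF T]])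
  note T' = theory_okD(1,2)[OF T] and A' = algebra_okD[OF A] and P = algebra_pw[OF T A J]
  note P' = algebra_okD[OF P] and u = alg_cotu[OF T A J]
  let ?Q = "alg_vcat T C" and ?P = "pw T J A"
  let ?u = "cotu ?Q J A"
  show "J \<in> obj V" "?u \<in> el ?Q J ?P A" using u J P A vcategory_alg_vcat[OF T] by auto
  fix B W assume B: "B \<in> vob ?Q" and W: "W \<in> obj V"
  have B: "algebra_ok T C B" using B by simp
  note B' = algebra_okD[OF B]
  have Ao: "fobj A L \<in> vob C" "fobj B L \<in> vob C" if "L \<in> \<J>" for L using that A' B' T' by auto
  note po = pw_simps(1)[OF T, of _ J A]
  have proj: "end_proj T C B A L \<cdot> gc ?Q B ?P A ?u g =
     gc C (fobj B L) (cot C J (fobj A L)) (fobj A L) (cotu C J (fobj A L)) (end_proj T C B ?P L \<cdot> g)"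
    if "g \<in> homs V W (end_obj T C B ?P)" "L \<in> \<J>" for g L
    using proj_gc[OF T B P A, of ?u g L] that u po by (simp add: gc_def)
  show "\<exists>g. g \<in> homs V W (vhom ?Q B ?P) \<and> gc ?Q B ?P A ?u g = f"
    if f: "f \<in> homs V (J \<otimes> W) (vhom ?Q B A)" for f
  proof -
    let ?\<phi> = "\<lambda>L. end_proj T C B A L \<cdot> f"
    have \<phi>: "?\<phi> L \<in> arr V" "src V (?\<phi> L) = J \<otimes> W" "tgt V (?\<phi> L) = vhom C (fobj B L) (fobj A L)" if "L \<in> \<J>" for L
      using f T A B that by auto
    have n\<phi>: "vnat_family T C B A (J \<otimes> W) ?\<phi>" using end_family_cmp[OF T B A, of f] f by simp
    define \<beta> where "\<beta> L = cfac C J (fobj A L) (cot C J (fobj A L)) (cotu C J (fobj A L)) (fobj B L) W (?\<phi> L)" for L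
    have \<beta>: "\<beta> L \<in> arr V" "src V (\<beta> L) = W" "tgt V (\<beta> L) = vhom C (fobj B L) (cot C J (fobj A L))"
      "gc C (fobj B L) (cot C J (fobj A L)) (fobj A L) (cotu C J (fobj A L)) (\<beta> L) = ?\<phi> L" if "L \<in> \<J>" for L
      using cfac[OF C_cat C_cot[OF J Ao(1)[OF that]] Ao(2)[OF that] W \<phi>[OF that]] by (auto simp: \<beta>_def)
    have "vnat_family T C B ?P W \<beta>"
    proof (rule vnat_familyI[OF T'(1) C_cat B' P' W])
      show "\<beta> X \<in> homs V W (vhom C (fobj B X) (fobj ?P X))" if "X \<in> vob T" for X
        using that \<beta> T' po by simp
      fix X Y Z W1 Q t x assume a: "X \<in> vob T" "Y \<in> vob T" "Z \<in> vob C" "W1 \<in> obj V" "Q \<in> obj V" "t \<in> homs V W1 (vhom T X Y)"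
        "x \<in> homs V Q (vhom C Z (fobj B X))"
      have XY: "X \<in> \<J>" "Y \<in> \<J>" using a T' by auto
      have t: "t \<in> arr V" "tgt V t = vhom T X Y" "src V t = W1" using a by auto
      let ?PX = "cot C J (fobj A X)" and ?PY = "cot C J (fobj A Y)"
      let ?cX = "cotu C J (fobj A X)" and ?cY = "cotu C J (fobj A Y)"
      note bX = \<beta>(1-3)[OF XY(1)] and bY = \<beta>(1-3)[OF XY(2)]
      note fX = \<phi>[OF XY(1)] and fY = \<phi>[OF XY(2)]
      note pt = fm_pw[OF T A' J XY t(1,2)]
      have f': "f \<in> arr V" "tgt V f = end_obj T C B A" "src V f = J \<otimes> W" using f by auto
      note b = T T'(1) A' B' P' J W a(3,4,5,7) t XY a(1,2) Ao[OF XY(1)] Ao[OF XY(2)] bX bY pt(1-3)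
      note b2 = b f' A B
      let ?Bt = "gc C Z (fobj B X) (fobj B Y) (fm B X Y t) x"
      have eX: "gc C Z ?PX (fobj A X) ?cX (gc C Z (fobj B X) ?PX (\<beta> X) x) = gc C Z (fobj B X) (fobj A X) (?\<phi> X) x \<cdot> ai J W Q"
        unfolding \<beta>(4)[OF XY(1), symmetric] using b by simp
      have "gc C Z ?PY (fobj A Y) ?cY (gc C Z (fobj B Y) ?PY (\<beta> Y) ?Bt) = gc C Z (fobj B Y) (fobj A Y) (?\<phi> Y) ?Bt \<cdot> ai J W (W1 \<otimes> Q)"
        unfolding \<beta>(4)[OF XY(2), symmetric] using b by simp
      also have "gc C Z (fobj B Y) (fobj A Y) (?\<phi> Y) ?Bt = gc C Z (fobj A X) (fobj A Y) (fm A X Y t) (gc C Z (fobj B X) (fobj A X) (?\<phi> X) x) \<cdot> swp (J \<otimes> W) W1 Q"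
        using vnat_family_elem[OF T'(1) C_cat B' A' n\<phi> a(1,2), of t x Z] a(3,7) t by (simp del: gc_cmp_left)
      also have "(gc C Z (fobj A X) (fobj A Y) (fm A X Y t) (gc C Z (fobj B X) (fobj A X) (?\<phi> X) x) \<cdot> swp (J \<otimes> W) W1 Q) \<cdot> ai J W (W1 \<otimes> Q)
         = gc C Z (fobj A X) (fobj A Y) (fm A X Y t) (gc C Z (fobj B X) (fobj A X) (?\<phi> X) x) \<cdot> (swp (J \<otimes> W) W1 Q \<cdot> ai J W (W1 \<otimes> Q))"
        by (rule cmp_assoc') (use b fX in \<open>auto simp del: gc_cmp_left\<close>)
      \<comment> \<open>The exchange of t with J \<otimes> W splits into one with J, absorbed by the
        pointwise structure of \<open>?P\<close>, and one with W, which is the naturality wanted of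
        \<beta>.\<close>
      also have "swp (J \<otimes> W) W1 Q \<cdot> ai J W (W1 \<otimes> Q) = (idm V W1 \<otimes>\<^sub>m ai J W Q) \<cdot> (swp J W1 (W \<otimes> Q) \<cdot> (idm V J \<otimes>\<^sub>m swp W W1 Q))"
        by (rule ai_swp) (use b in auto)
      also have "gc C Z (fobj A X) (fobj A Y) (fm A X Y t) (gc C Z (fobj B X) (fobj A X) (?\<phi> X) x) \<cdot> \<dots> =
          gc C Z (fobj A X) (fobj A Y) (fm A X Y t) (gc C Z ?PX (fobj A X) ?cX (gc C Z (fobj B X) ?PX (\<beta> X) x)) \<cdot> (swp J W1 (W \<otimes> Q) \<cdot> (idm V J \<otimes>\<^sub>m swp W W1 Q))"
        unfolding eX using b fX by (simp del: gc_cmp_left)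
      also have "\<dots> = gc C Z ?PY (fobj A Y) ?cY (gc C Z ?PX ?PY (fm ?P X Y t) (gc C Z (fobj B X) ?PX (\<beta> X) x) \<cdot> swp W W1 Q)"
        using pt(4)[of "gc C Z (fobj B X) ?PX (\<beta> X) x" Z] b by simp
      finally have "gc C Z (fobj B Y) ?PY (\<beta> Y) ?Bt = gc C Z ?PX ?PY (fm ?P X Y t) (gc C Z (fobj B X) ?PX (\<beta> X) x) \<cdot> swp W W1 Q"
        by (rule cot_cancel[OF C_cat C_cot[OF J Ao(1)[OF XY(2)]], rotated -1]) (use b in auto)
      then show "gc C Z (fobj B Y) (fobj ?P Y) (\<beta> Y) ?Bt = gc C Z (fobj ?P X) (fobj ?P Y) (fm ?P X Y t) (gc C Z (fobj B X) (fobj ?P X) (\<beta> X) x) \<cdot> swp W W1 Q"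
        using po XY by simp
    qed
    note l = end_lift[OF T B P W this]
    let ?g = "end_lift T C B ?P W \<beta>"
    have g: "?g \<in> homs V W (end_obj T C B ?P)" using l by simp
    have "gc ?Q B ?P A ?u ?g = f"
      by (rule end_eqI[OF T B A])
        (use proj[OF g] l \<beta> f g u B P A vcategory_alg_vcat[OF T] in auto)
    then show ?thesis using g by auto
  qed
  show "g = h" if a: "g \<in> homs V W (vhom ?Q B ?P)" "h \<in> homs V W (vhom ?Q B ?P)"
    and e: "gc ?Q B ?P A ?u g = gc ?Q B ?P A ?u h" for g h
  proof (rule end_eqI[OF T B P])
    have a': "g \<in> homs V W (end_obj T C B ?P)" "h \<in> homs V W (end_obj T C B ?P)" using a by auto
    show "end_proj T C B ?P L \<cdot> g = end_proj T C B ?P L \<cdot> h" if L: "L \<in> \<J>" for L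
      by (rule cot_cancel[OF C_cat C_cot[OF J Ao(1)[OF L]] Ao(2)[OF L]])
        (use proj[OF a'(1) L] proj[OF a'(2) L] e a' T B P L po in auto)
  qed (use a in auto)
qed

section \<open>Commutants\<close>

text \<open>A full image along p, which may identify objects: every axiom is the axiom of Q at the
  objects p J. The commutant has arities, not algebras, as its objects.\<close>

lemma vcategory_restrict:
  assumes Q: "vcategory Q" and p: "\<And>J. J \<in> S \<Longrightarrow> p J \<in> vob Q"
  shows "vcategory \<lparr>vob = S, vhom = (\<lambda>J K. vhom Q (p J) (p K)), vid = (\<lambda>J. vid Q (p J)),
    vcomp = (\<lambda>J K L. vcomp Q (p J) (p K) (p L))\<rparr>"
  using Q p unfolding vcategory_def by simp

lemma commutant_vcat_simps:
  "vob (commutant_vcat C (T, A)) = \<J>"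
  "vhom (commutant_vcat C (T, A)) J K = end_obj T C (pw T J A) (pw T K A)"
  "vid (commutant_vcat C (T, A)) J = vid (alg_vcat T C) (pw T J A)"
  "vcomp (commutant_vcat C (T, A)) J K L = vcomp (alg_vcat T C) (pw T J A) (pw T K A) (pw T L A)"
  by (simp_all add: commutant_vcat_def Let_def)

lemma vcategory_commutant_vcat:
  assumes T: "theory_ok T" and A: "algebra_ok T C A"
  shows "vcategory (commutant_vcat C (T, A))"
  using vcategory_restrict[OF vcategory_alg_vcat[OF T], of \<J> "\<lambda>J. pw T J A"] algebra_pw[OF T A]
  by (simp add: commutant_vcat_def Let_def)

text \<open>The test objects of the commutant are only the algebras [Y,A], so the factorizations
  required are instances of \<open>alg_cotensor\<close>; \<open>pw_unit\<close> identifies the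
  object I with A.\<close>

lemma commutant_vcat_cotensor:
  assumes T: "theory_ok T" and A: "algebra_ok T C A" and J: "J \<in> \<J>"
  shows "is_cotensor (commutant_vcat C (T, A)) J \<one> J (cotu (alg_vcat T C) J A)"
proof -
  let ?U = "commutant_vcat C (T, A)" and ?Q = "alg_vcat T C"
  let ?u = "cotu ?Q J A"
  note U = vcategory_commutant_vcat[OF T A]
  have gcU: "gc ?U X Y Z = gc ?Q (pw T X A) (pw T Y A) (pw T Z A)" for X Y Z
    by (intro ext) (simp add: gc_def commutant_vcat_simps)
  have c: "J \<in> obj V \<and> ?u \<in> el ?Q J (pw T J A) A \<and>
    (\<forall>Y \<in> vob ?Q. \<forall>W \<in> obj V. \<forall>f \<in> homs V (J \<otimes> W) (vhom ?Q Y A).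
       \<exists>!g. g \<in> homs V W (vhom ?Q Y (pw T J A)) \<and> gc ?Q Y (pw T J A) A ?u g = f)"
    using alg_cotensor[OF T A J] is_cotensor_iff[OF vcategory_alg_vcat[OF T]] by blast
  show ?thesis
    unfolding is_cotensor_iff[OF U] gcU commutant_vcat_simps pw_unit[OF T A]
  proof (intro conjI ballI)
    show "J \<in> obj V" "?u \<in> el ?U J J \<one>"
      using c J U by (auto simp: commutant_vcat_simps pw_unit[OF T A])
    fix Y W f assume "Y \<in> \<J>" "W \<in> obj V" "f \<in> homs V (J \<otimes> W) (end_obj T C (pw T Y A) A)"
    moreover from this have "pw T Y A \<in> vob ?Q" using algebra_pw[OF T A] by simp
    ultimately show "\<exists>!g. g \<in> homs V W (end_obj T C (pw T Y A) (pw T J A)) \<and> gc ?Q (pw T Y A) (pw T J A) A ?u g = f"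
      using c unfolding alg_vcat_simps(2) by blast
  qed
qed

lemma commutant_theory:
  assumes T: "theory_ok T" and A: "algebra_ok T C A"
  shows "theory_ok (commutant_theory C (T, A))"
    and "J \<in> \<J> \<Longrightarrow> counit (commutant_theory C (T, A)) J = cotu (alg_vcat T C) J A"
proof -
  \<comment> \<open>The normalization at I demanded by \<open>theory_of_counits\<close>; both arrows
    have the identities of C as components.\<close>
  have 1: "cotu (alg_vcat T C) \<one> A = vid (commutant_vcat C (T, A)) \<one>"
  proof (rule end_eqI[OF T A A])
    note u = alg_cotu[OF T A unit_arity, unfolded pw_unit[OF T A]]
    note v = alg_vid[OF T A]
    note e = commutant_vcat_simps(3)[of T A \<one>, unfolded pw_unit[OF T A]]
    show "end_proj T C A A L \<cdot> cotu (alg_vcat T C) \<one> A = end_proj T C A A L \<cdot> vid (commutant_vcat C (T, A)) \<one>"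
      if L: "L \<in> \<J>" for L
      using u(4)[OF L] v(4)[OF L] e L algebra_okD[OF A] T by simp
    show "cotu (alg_vcat T C) \<one> A \<in> arr V" "tgt V (cotu (alg_vcat T C) \<one> A) = end_obj T C A A" using u by auto
    show "vid (commutant_vcat C (T, A)) \<one> \<in> arr V" "tgt V (vid (commutant_vcat C (T, A)) \<one>) = end_obj T C A A"
      "src V (cotu (alg_vcat T C) \<one> A) = src V (vid (commutant_vcat C (T, A)) \<one>)" using u v e by auto
  qed
  note r = theory_of_counits[OF vcategory_commutant_vcat[OF T A] commutant_vcat_simps(1) commutant_vcat_cotensor[OF T A] 1]
  show "theory_ok (commutant_theory C (T, A))" using r by (simp add: commutant_theory_def)
  show "J \<in> \<J> \<Longrightarrow> counit (commutant_theory C (T, A)) J = cotu (alg_vcat T C) J A" using r by (simp add: commutant_theory_def)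
qed

lemma commutant_theory_simps:
  "vhom (commutant_theory C (T, A)) J K = end_obj T C (pw T J A) (pw T K A)"
  "vid (commutant_theory C (T, A)) J = vid (alg_vcat T C) (pw T J A)"
  "vcomp (commutant_theory C (T, A)) J K L = vcomp (alg_vcat T C) (pw T J A) (pw T K A) (pw T L A)"
  by (simp_all add: commutant_theory_def commutant_vcat_simps)

definition commutant_fun :: "('o, 'c, 'm) alg \<Rightarrow> ('o, 'c, 'm) vfun" where
  "commutant_fun \<A> = snd (commutant C \<A>)"

lemma commutant_eq: "commutant C (T, A) = (commutant_theory C (T, A), commutant_fun (T, A))"
  by (simp add: commutant_fun_def commutant_def)

lemma commutant_fun_simps:
  "J \<in> \<J> \<Longrightarrow> fobj (commutant_fun (T, A)) J = cot C J (fobj A \<one>)"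
  "\<lbrakk>J \<in> \<J>; K \<in> \<J>\<rbrakk> \<Longrightarrow> fm (commutant_fun (T, A)) J K f = end_proj T C (pw T J A) (pw T K A) \<one> \<cdot> f"
  by (simp_all add: commutant_fun_def commutant_def mk_vfun_def fm_def)

lemma commutant_fun_counit:
  assumes T: "theory_ok T" and A: "algebra_ok T C A" and J: "J \<in> \<J>"
  shows "fm (commutant_fun (T, A)) J \<one> (counit (commutant_theory C (T, A)) J) = cotu C J (fobj A \<one>)"
  using alg_cotu(4)[OF T A J unit_arity] J
  by (simp add: commutant_fun_simps commutant_theory(2)[OF T A] pw_unit[OF T A])

text \<open>Evaluation at I respects composition since ends are composed pointwise. Preservation of
  cotensors is tested on the counits, which evaluate to the designated counits of C.\<close>

lemma commutant_algebra:
  assumes T: "theory_ok T" and A: "algebra_ok T C A"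
  shows "algebra_ok (commutant_theory C (T, A)) C (commutant_fun (T, A))"
proof -
  let ?S = "commutant_theory C (T, A)" and ?D = "commutant_fun (T, A)"
  note S = commutant_theory[OF T A]
  note S' = theory_okD(1,2)[OF S(1)]
  have P: "algebra_ok T C (pw T J A)" if "J \<in> \<J>" for J using algebra_pw[OF T A that] .
  have X: "fobj A \<one> \<in> vob C" using algebra_okD[OF A] T by simp
  have po: "fobj (pw T J A) \<one> = cot C J (fobj A \<one>)" for J using pw_simps(1)[OF T] by simp
  have ph: "fhom ?D J K = end_proj T C (pw T J A) (pw T K A) \<one>" if "J \<in> \<J>" "K \<in> \<J>" for J K
    using that by (simp add: commutant_fun_def commutant_def mk_vfun_def)
  have D: "vfunctor ?S C ?D"
  proof (rule vfunctorI[OF S'(1) C_cat])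
    show "fobj ?D \<in> vob ?S \<rightarrow>\<^sub>E vob C"
      using X unfolding S'(2) by (auto simp: commutant_fun_def commutant_def mk_vfun_def)
    show "fhom ?D Y Z = undefined" if "Y \<notin> vob ?S \<or> Z \<notin> vob ?S" for Y Z
      using that unfolding S'(2) by (auto simp: commutant_fun_def commutant_def mk_vfun_def)
    show "fhom ?D J K \<in> homs V (vhom ?S J K) (vhom C (fobj ?D J) (fobj ?D K))" if "J \<in> vob ?S" "K \<in> vob ?S" for J K
      using that P T unfolding S'(2) by (simp add: ph commutant_theory_simps commutant_fun_simps po)
    show "fhom ?D J J \<cdot> vid ?S J = vid C (fobj ?D J)" if "J \<in> vob ?S" for J
      using that alg_vid(4)[OF T P unit_arity] unfolding S'(2)
      by (simp add: ph commutant_theory_simps commutant_fun_simps po)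
    show "fm ?D J L (gc ?S J K L g f) = gc C (fobj ?D J) (fobj ?D K) (fobj ?D L) (fm ?D K L g) (fm ?D J K f)"
      if g: "g \<in> el ?S (vhom ?S K L) K L" and f: "f \<in> el ?S (vhom ?S J K) J K" for J K L g f
    proof -
      have o: "J \<in> \<J>" "K \<in> \<J>" "L \<in> \<J>" using g f S' by auto
      show ?thesis using proj_gc[OF T P[OF o(1)] P[OF o(2)] P[OF o(3)], of g f \<one>] g f o
        by (simp add: gc_def commutant_theory_simps commutant_fun_simps po)
    qed
  qed
  have "preserves_cotensors \<J> ?S C ?D"
  proof (rule preserves_cotensorsI[OF S' C_cat D counit_cotensor[OF S(1)]])
    show "is_cotensor C J (fobj ?D \<one>) (fobj ?D J) (fm ?D J \<one> (counit ?S J))" if J: "J \<in> \<J>" for J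
      using C_cot[OF J X] J X by (simp add: commutant_fun_counit[OF T A J] commutant_fun_simps)
  qed
  then show ?thesis using D by (simp add: algebra_ok_def)
qed

lemma commutant_is_algebra:
  assumes "is_algebra C \<A>"
  shows "is_algebra C (commutant C \<A>)" "carrier_obj (commutant C \<A>) = carrier_obj \<A>"
proof -
  obtain T A where \<A>: "\<A> = (T, A)" by (cases \<A>)
  then have T: "theory_ok T" and A: "algebra_ok T C A" using assms by (auto simp: is_algebra_def)
  show "is_algebra C (commutant C \<A>)"
    unfolding \<A> commutant_eq using commutant_theory[OF T A] commutant_algebra[OF T A] by (simp add: is_algebra_def)
  show "carrier_obj (commutant C \<A>) = carrier_obj \<A>"
    unfolding \<A> commutant_eq using algebra_okD[OF A] T by (simp add: carrier_obj_def commutant_fun_simps)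
qed

end

section \<open>Algebra morphisms over a fixed carrier\<close>

context sym_monoidal_closed
begin

text \<open>Once the unit is removed from the grade, an exchange with it leaves no trace. Naturality
  of families of grade I can therefore be stated with \<open>lact\<close> and without any
  exchange.\<close>

lemma swp_li:
  assumes o: "w \<in> obj V" "q \<in> obj V"
  shows "swp \<one> w q \<cdot> li (w \<otimes> q) = idm V w \<otimes>\<^sub>m li q"
proof -
  have "(idm V w \<otimes>\<^sub>m lunit V q) \<cdot> (swp \<one> w q \<cdot> li (w \<otimes> q)) = ((idm V w \<otimes>\<^sub>m lunit V q) \<cdot> swp \<one> w q) \<cdot> li (w \<otimes> q)"
    by (rule cmp_assoc'[symmetric]) (use o in auto)
  also have "\<dots> = (idm V w \<otimes>\<^sub>m lunit V q) \<cdot> (idm V w \<otimes>\<^sub>m li q)"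
    unfolding swp_unit[OF o] using o by simp
  finally show ?thesis by (rule iso_cancel_left[rotated -1]) (use o in auto)
qed

lemma vnat_lact:
  assumes T: "vcategory T" and C: "vcategory C" and F: "vfunctor T C F" and G: "vfunctor T C G"
    and n: "vnat_family T C F G \<one> \<alpha>" and X: "X \<in> vob T" and Y: "Y \<in> vob T"
    and t: "t \<in> arr V" "tgt V t = vhom T X Y"
    and x: "x \<in> arr V" "tgt V x = vhom C Z (fobj F X)" and Z: "Z \<in> vob C"
  shows "lact C Z (fobj F Y) (fobj G Y) (\<alpha> Y) (gc C Z (fobj F X) (fobj F Y) (fm F X Y t) x) =
    gc C Z (fobj G X) (fobj G Y) (fm G X Y t) (lact C Z (fobj F X) (fobj G X) (\<alpha> X) x)"
  unfolding lact_def vnat_family_elem[OF assms]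
  using assms vnat_familyD[OF n X] vnat_familyD[OF n Y] by (simp add: swp_li)

lemma vnat_lactI:
  assumes T: "vcategory T" and C: "vcategory C" and F: "vfunctor T C F" and G: "vfunctor T C G"
    and a: "\<And>X. X \<in> vob T \<Longrightarrow> \<alpha> X \<in> homs V \<one> (vhom C (fobj F X) (fobj G X))"
    and n: "\<And>X Y Z t x. \<lbrakk>X \<in> vob T; Y \<in> vob T; Z \<in> vob C; t \<in> arr V; tgt V t = vhom T X Y;
      x \<in> arr V; tgt V x = vhom C Z (fobj F X)\<rbrakk> \<Longrightarrow>
      lact C Z (fobj F Y) (fobj G Y) (\<alpha> Y) (gc C Z (fobj F X) (fobj F Y) (fm F X Y t) x) =
      gc C Z (fobj G X) (fobj G Y) (fm G X Y t) (lact C Z (fobj F X) (fobj G X) (\<alpha> X) x)"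
  shows "vnat_family T C F G \<one> \<alpha>"
proof (rule vnat_familyI[OF T C F G unit_obj a])
  fix X Y Z W Q t x assume X: "X \<in> vob T" and Y: "Y \<in> vob T" and Z: "Z \<in> vob C" and W: "W \<in> obj V" and Q: "Q \<in> obj V"
    and t: "t \<in> homs V W (vhom T X Y)" and x: "x \<in> homs V Q (vhom C Z (fobj F X))"
  note b = T C F G X Y Z W Q t x a[OF X, simplified] a[OF Y, simplified]
  have "gc C Z (fobj F Y) (fobj G Y) (\<alpha> Y) (gc C Z (fobj F X) (fobj F Y) (fm F X Y t) x) \<cdot> li (W \<otimes> Q) =
     (gc C Z (fobj G X) (fobj G Y) (fm G X Y t) (gc C Z (fobj F X) (fobj G X) (\<alpha> X) x) \<cdot> swp \<one> W Q) \<cdot> li (W \<otimes> Q)"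
    using n[OF X Y Z, of t x] b by (simp add: lact_def swp_li)
  then show "gc C Z (fobj F Y) (fobj G Y) (\<alpha> Y) (gc C Z (fobj F X) (fobj F Y) (fm F X Y t) x) =
      gc C Z (fobj G X) (fobj G Y) (fm G X Y t) (gc C Z (fobj F X) (fobj G X) (\<alpha> X) x) \<cdot> swp \<one> W Q"
    by (rule iso_cancel_right[rotated -1]) (use b in auto)
qed

text \<open>Componentwise inverses are automatically natural: insert \<alpha> after its inverse,
  apply naturality of \<alpha>, and cancel \<alpha>.\<close>

lemma vnat_isoI:
  assumes T: "vcategory T" and C: "vcategory C" and F: "vfunctor T C F" and G: "vfunctor T C G"
    and n: "vnat_trans T C F G \<alpha>"
    and inv: "\<And>X. X \<in> vob T \<Longrightarrow> \<exists>b \<in> homs V \<one> (vhom C (fobj G X) (fobj F X)).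
      lact C (fobj F X) (fobj G X) (fobj F X) b (\<alpha> X) = vid C (fobj F X) \<and>
      lact C (fobj G X) (fobj F X) (fobj G X) (\<alpha> X) b = vid C (fobj G X)"
  shows "vnat_iso T C F G \<alpha>"
proof -
  have nf: "vnat_family T C F G \<one> \<alpha>" using n by (simp add: vnat_trans_def)
  obtain b where b: "\<And>X. X \<in> vob T \<Longrightarrow> b X \<in> homs V \<one> (vhom C (fobj G X) (fobj F X)) \<and>
      lact C (fobj F X) (fobj G X) (fobj F X) (b X) (\<alpha> X) = vid C (fobj F X) \<and>
      lact C (fobj G X) (fobj F X) (fobj G X) (\<alpha> X) (b X) = vid C (fobj G X)"
    using inv by metis
  \<comment> \<open>Transformations are extensional by definition, so the chosen inverses are
    restricted to the objects of T.\<close>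
  define \<beta> where "\<beta> = restrict b (vob T)"
  have \<beta>: "\<beta> X \<in> arr V" "src V (\<beta> X) = \<one>" "tgt V (\<beta> X) = vhom C (fobj G X) (fobj F X)"
    "lact C (fobj F X) (fobj G X) (fobj F X) (\<beta> X) (\<alpha> X) = vid C (fobj F X)"
    "lact C (fobj G X) (fobj F X) (fobj G X) (\<alpha> X) (\<beta> X) = vid C (fobj G X)" if "X \<in> vob T" for X
    using b[OF that] that by (auto simp: \<beta>_def)
  have inv1: "lact C Z (fobj G X) (fobj F X) (\<beta> X) (lact C Z (fobj F X) (fobj G X) (\<alpha> X) x) = x"
    if "X \<in> vob T" "Z \<in> vob C" "x \<in> arr V" "tgt V x = vhom C Z (fobj F X)" for X Z x
    using lact_lact[of C Z "fobj F X" "fobj G X" "fobj F X" "\<beta> X" "\<alpha> X" x] that \<beta>[of X] vnat_familyD[OF nf, of X] C F G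
    by simp
  have inv2: "lact C Z (fobj F X) (fobj G X) (\<alpha> X) (lact C Z (fobj G X) (fobj F X) (\<beta> X) x) = x"
    if "X \<in> vob T" "Z \<in> vob C" "x \<in> arr V" "tgt V x = vhom C Z (fobj G X)" for X Z x
    using lact_lact[of C Z "fobj G X" "fobj F X" "fobj G X" "\<alpha> X" "\<beta> X" x] that \<beta>[of X] vnat_familyD[OF nf, of X] C F G
    by simp
  have "vnat_family T C G F \<one> \<beta>"
  proof (rule vnat_lactI[OF T C G F])
    fix X Y Z t x assume X: "X \<in> vob T" and Y: "Y \<in> vob T" and Z: "Z \<in> vob C" and t: "t \<in> arr V" "tgt V t = vhom T X Y"
      and x: "x \<in> arr V" "tgt V x = vhom C Z (fobj G X)"
    let ?y = "lact C Z (fobj G X) (fobj F X) (\<beta> X) x"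
    note d = X Y Z t x \<beta>(1-3)[OF X] \<beta>(1-3)[OF Y] T C F G
    have "gc C Z (fobj G X) (fobj G Y) (fm G X Y t) x = lact C Z (fobj F Y) (fobj G Y) (\<alpha> Y) (gc C Z (fobj F X) (fobj F Y) (fm F X Y t) ?y)"
      using vnat_lact[OF T C F G nf X Y t _ _ Z, of ?y] inv2[OF X Z x] d by simp
    then show "lact C Z (fobj G Y) (fobj F Y) (\<beta> Y) (gc C Z (fobj G X) (fobj G Y) (fm G X Y t) x) = gc C Z (fobj F X) (fobj F Y) (fm F X Y t) ?y"
      using inv1[OF Y Z] d by simp
  qed (use \<beta> in auto)
  then have "vnat_trans T C G F \<beta>" by (simp add: vnat_trans_def \<beta>_def)
  moreover have "ucomp C (fobj F X) (fobj G X) (fobj F X) (\<beta> X) (\<alpha> X) = vid C (fobj F X) \<and>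
       ucomp C (fobj G X) (fobj F X) (fobj G X) (\<alpha> X) (\<beta> X) = vid C (fobj G X)" if "X \<in> vob T" for X
    using \<beta>[OF that] vnat_familyD[OF nf that] that C F G by (simp add: ucomp_lact)
  ultimately show ?thesis using n unfolding vnat_iso_def by blast
qed

lemma vfunctor_vfun_id:
  assumes T: "vcategory T"
  shows "vfunctor T T (vfun_id T)"
proof (rule vfunctorI[OF T T])
  have h: "fhom (vfun_id T) X Y = idm V (vhom T X Y)" if "X \<in> vob T" "Y \<in> vob T" for X Y
    using that by (simp add: vfun_id_def mk_vfun_def)
  show "fobj (vfun_id T) \<in> vob T \<rightarrow>\<^sub>E vob T" by (auto simp: vfun_id_def mk_vfun_def)
  show "fhom (vfun_id T) X Y = undefined" if "X \<notin> vob T \<or> Y \<notin> vob T" for X Y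
    using that by (auto simp: vfun_id_def mk_vfun_def)
  have o: "fobj (vfun_id T) X = X" if "X \<in> vob T" for X using that by (simp add: vfun_id_def mk_vfun_def)
  show "fhom (vfun_id T) X Y \<in> homs V (vhom T X Y) (vhom T (fobj (vfun_id T) X) (fobj (vfun_id T) Y))"
    if "X \<in> vob T" "Y \<in> vob T" for X Y using that h o T by simp
  show "fhom (vfun_id T) X X \<cdot> vid T X = vid T (fobj (vfun_id T) X)" if "X \<in> vob T" for X
    using that h o T by simp
  show "fm (vfun_id T) X Z (gc T X Y Z g f) = gc T (fobj (vfun_id T) X) (fobj (vfun_id T) Y) (fobj (vfun_id T) Z)
      (fm (vfun_id T) Y Z g) (fm (vfun_id T) X Y f)"
    if "g \<in> el T (vhom T Y Z) Y Z" "f \<in> el T (vhom T X Y) X Y" for X Y Z g f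
    using that h o T by (simp add: fm_def)
qed

lemma vfun_id_simps:
  "X \<in> vob T \<Longrightarrow> fobj (vfun_id T) X = X"
  "\<lbrakk>X \<in> vob T; Y \<in> vob T; t \<in> arr V; tgt V t = vhom T X Y\<rbrakk> \<Longrightarrow> fm (vfun_id T) X Y t = t"
  by (simp_all add: vfun_id_def mk_vfun_def fm_def)

end

context admissible_vcat
begin

text \<open>Arrows of \<open>Alg(X)\<close> on generalized elements.  Invertibility of \<open>f\<close> is left out: it follows from
  \<open>f \<one>\<close> being an identity, since \<open>A J\<close> and \<open>B J\<close> are cotensors of the same object.\<close>

definition amor :: "('o, 'm) jtheory \<Rightarrow> ('o, 'c, 'm) vfun \<Rightarrow> ('o, 'm) jtheory \<Rightarrow> ('o, 'c, 'm) vfun \<Rightarrow>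
    ('o, 'o, 'm) vfun \<Rightarrow> ('o \<Rightarrow> 'm) \<Rightarrow> bool" where
  "amor T A U B M f \<longleftrightarrow> theory_mor T U M \<and> f \<in> extensional \<J> \<and> f \<one> = vid C (fobj A \<one>) \<and>
    (\<forall>J \<in> \<J>. f J \<in> homs V \<one> (vhom C (fobj A J) (fobj B J))) \<and>
    (\<forall>J \<in> \<J>. \<forall>K \<in> \<J>. \<forall>Z \<in> vob C. \<forall>t x. t \<in> arr V \<longrightarrow> tgt V t = vhom T J K \<longrightarrow>
      x \<in> arr V \<longrightarrow> tgt V x = vhom C Z (fobj A J) \<longrightarrow>
      lact C Z (fobj A K) (fobj B K) (f K) (gc C Z (fobj A J) (fobj A K) (fm A J K t) x) =
      gc C Z (fobj B J) (fobj B K) (fm B J K (fm M J K t)) (lact C Z (fobj A J) (fobj B J) (f J) x))"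

lemma amorD:
  assumes "amor T A U B M f" "J \<in> \<J>"
  shows "f J \<in> arr V" "src V (f J) = \<one>" "tgt V (f J) = vhom C (fobj A J) (fobj B J)"
  using assms unfolding amor_def in_homs by blast+

lemma amor_nat:
  assumes "amor T A U B M f" "J \<in> \<J>" "K \<in> \<J>" "Z \<in> vob C" "t \<in> arr V" "tgt V t = vhom T J K"
    "x \<in> arr V" "tgt V x = vhom C Z (fobj A J)"
  shows "lact C Z (fobj A K) (fobj B K) (f K) (gc C Z (fobj A J) (fobj A K) (fm A J K t) x) =
      gc C Z (fobj B J) (fobj B K) (fm B J K (fm M J K t)) (lact C Z (fobj A J) (fobj B J) (f J) x)"
  using assms unfolding amor_def by blast

lemma theory_morD:
  assumes T: "theory_ok T" and U: "theory_ok U" and M: "theory_mor T U M"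
  shows "vfunctor T U M" "J \<in> \<J> \<Longrightarrow> fobj M J = J" "J \<in> \<J> \<Longrightarrow> fm M J \<one> (counit T J) = counit U J"
  using M theory_mor_iff[OF T U] by auto

text \<open>Naturality along the counit J \<rightarrow> I, where f is an identity at I. It exhibits
  f J as the comparison of two cotensors of the carrier, whence both its uniqueness and its
  invertibility.\<close>

lemma amor_counit:
  assumes T: "theory_ok T" and A: "algebra_ok T C A" and U: "theory_ok U" and B: "algebra_ok U C B"
    and m: "amor T A U B M f" and J: "J \<in> \<J>" and Z: "Z \<in> vob C"
    and x: "x \<in> arr V" "tgt V x = vhom C Z (fobj A J)" and c: "fobj A \<one> = fobj B \<one>"
  shows "gc C Z (fobj B J) (fobj B \<one>) (fm B J \<one> (counit U J)) (lact C Z (fobj A J) (fobj B J) (f J) x) =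
    gc C Z (fobj A J) (fobj A \<one>) (fm A J \<one> (counit T J)) x"
proof -
  have M: "theory_mor T U M" and f1: "f \<one> = vid C (fobj A \<one>)" using m by (auto simp: amor_def)
  note A' = algebra_okD[OF A] and B' = algebra_okD[OF B]
  have "gc C Z (fobj B J) (fobj B \<one>) (fm B J \<one> (fm M J \<one> (counit T J))) (lact C Z (fobj A J) (fobj B J) (f J) x) =
     lact C Z (fobj A \<one>) (fobj B \<one>) (f \<one>) (gc C Z (fobj A J) (fobj A \<one>) (fm A J \<one> (counit T J)) x)"
    by (rule amor_nat[OF m J unit_arity Z, symmetric]) (use T J x in auto)
  also have "\<dots> = gc C Z (fobj A J) (fobj A \<one>) (fm A J \<one> (counit T J)) x"
    using f1 c[symmetric] A' T J x Z by simp
  finally show ?thesis using theory_morD(3)[OF T U M J] by simp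
qed

lemma amor_inverse:
  assumes T: "theory_ok T" and A: "algebra_ok T C A" and U: "theory_ok U" and B: "algebra_ok U C B"
    and m: "amor T A U B M f" and J: "J \<in> \<J>" and c: "fobj A \<one> = fobj B \<one>"
  shows "\<exists>b \<in> homs V \<one> (vhom C (fobj B J) (fobj A J)).
      lact C (fobj A J) (fobj B J) (fobj A J) b (f J) = vid C (fobj A J) \<and>
      lact C (fobj B J) (fobj A J) (fobj B J) (f J) b = vid C (fobj B J)"
proof -
  note A' = algebra_okD[OF A] and B' = algebra_okD[OF B] and f = amorD[OF m J]
  note \<alpha> = algebra_counit[OF T A J] and \<beta> = algebra_counit[OF U B J]
  let ?a = "fm A J \<one> (counit T J)" and ?b = "fm B J \<one> (counit U J)"
  note da = is_cotensorD[OF \<alpha>] and db = is_cotensorD[OF \<beta>]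
  define b where "b = cfac C J (fobj A \<one>) (fobj A J) ?a (fobj B J) \<one> (?b \<cdot> runit V J)"
  have b: "b \<in> arr V" "src V b = \<one>" "tgt V b = vhom C (fobj B J) (fobj A J)"
    "gc C (fobj B J) (fobj A J) (fobj A \<one>) ?a b = ?b \<cdot> runit V J"
    using cfac[OF C_cat \<alpha> _ unit_obj, of "fobj B J" "?b \<cdot> runit V J"] db c by (auto simp: b_def)
  have 1: "gc C (fobj A J) (fobj A J) (fobj A \<one>) ?a (lact C (fobj A J) (fobj B J) (fobj A J) b (f J)) = gc C (fobj A J) (fobj B J) (fobj A \<one>) ?b (f J)"
    by (rule gc_lact_factor[OF C_cat, where J = J and ?\<gamma> = ?b]) (use b da db f c in auto)
  have 2: "gc C (fobj A J) (fobj B J) (fobj A \<one>) ?b (f J) = gc C (fobj A J) (fobj A J) (fobj A \<one>) ?a (vid C (fobj A J))"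
    using amor_counit[OF T A U B m J _ _ _ c, of "fobj A J" "vid C (fobj A J)"] da db f c[symmetric] by simp
  have "lact C (fobj A J) (fobj B J) (fobj A J) b (f J) = vid C (fobj A J)"
    by (rule cot_cancel[OF C_cat \<alpha> _ _ _ _ _ _ trans[OF 1 2]]) (use b f da db in auto)
  moreover have 3: "gc C (fobj B J) (fobj B J) (fobj B \<one>) ?b (lact C (fobj B J) (fobj A J) (fobj B J) (f J) b)
     = gc C (fobj B J) (fobj B J) (fobj B \<one>) ?b (vid C (fobj B J))"
    using amor_counit[OF T A U B m J _ _ _ c, of "fobj B J" b] b da db by simp
  have "lact C (fobj B J) (fobj A J) (fobj B J) (f J) b = vid C (fobj B J)"
    by (rule cot_cancel[OF C_cat \<beta> _ _ _ _ _ _ 3]) (use b f da db in auto)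
  ultimately show ?thesis using b by auto
qed

text \<open>For the direction from \<open>amor\<close>, the inverses come componentwise from
  \<open>amor_inverse\<close>, and \<open>vnat_isoI\<close> makes them a natural
  transformation.\<close>

lemma arr_Alg_iff:
  assumes T: "theory_ok T" and A: "algebra_ok T C A" and U: "theory_ok U" and B: "algebra_ok U C B"
    and c: "fobj A \<one> = X" "fobj B \<one> = X"
  shows "((T, A), (U, B), M, f) \<in> arr (Alg C X) \<longleftrightarrow> amor T A U B M f"
proof (cases "theory_mor T U M")
  case True
  note M = theory_morD[OF T U True]
  note A' = algebra_okD[OF A] and B' = algebra_okD[OF B] and T' = theory_okD(1,2)[OF T] and U' = theory_okD(1,2)[OF U]
  let ?G = "vfun_comp T B M"
  have G: "vfunctor T C ?G" using M B' T U by simp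
  have Go: "fobj ?G J = fobj B J" if "J \<in> \<J>" for J using that M T' by simp
  have Gm: "fm ?G J K t = fm B J K (fm M J K t)" if "J \<in> \<J>" "K \<in> \<J>" "t \<in> arr V" "tgt V t = vhom T J K" for J K t
    using fm_vfun_comp[OF M(1) B', of J K t] that M T' by simp
  have "((T, A), (U, B), M, f) \<in> arr (Alg C X) \<longleftrightarrow> vnat_iso T C A ?G f \<and> f \<one> = vid C X"
    using assms True by (auto simp: Alg_def is_algebra_def carrier_obj_def)
  also have "\<dots> \<longleftrightarrow> amor T A U B M f"
  proof
    assume a: "vnat_iso T C A ?G f \<and> f \<one> = vid C X"
    then have n: "vnat_family T C A ?G \<one> f" and e: "f \<in> extensional \<J>"
      using T' by (auto simp: vnat_iso_def vnat_trans_def)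
    show "amor T A U B M f"
      unfolding amor_def
    proof (intro conjI ballI allI impI)
      show "theory_mor T U M" "f \<in> extensional \<J>" "f \<one> = vid C (fobj A \<one>)" using True e a c by auto
      show "f J \<in> homs V \<one> (vhom C (fobj A J) (fobj B J))" if "J \<in> \<J>" for J
        using vnat_familyD[OF n, of J] that T' Go by simp
      fix J K Z t x assume h: "J \<in> \<J>" "K \<in> \<J>" "Z \<in> vob C" "t \<in> arr V" "tgt V t = vhom T J K" "x \<in> arr V" "tgt V x = vhom C Z (fobj A J)"
      show "lact C Z (fobj A K) (fobj B K) (f K) (gc C Z (fobj A J) (fobj A K) (fm A J K t) x) =
        gc C Z (fobj B J) (fobj B K) (fm B J K (fm M J K t)) (lact C Z (fobj A J) (fobj B J) (f J) x)"
        using vnat_lact[OF T'(1) C_cat A' G n _ _ h(4-7,3)] h T' Go Gm by simp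
    qed
  next
    assume a: "amor T A U B M f"
    have "vnat_iso T C A ?G f"
    proof (rule vnat_isoI[OF T'(1) C_cat A' G])
      have "vnat_family T C A ?G \<one> f"
        by (rule vnat_lactI[OF T'(1) C_cat A' G]) (use amorD[OF a] amor_nat[OF a] T' Go Gm in auto)
      then show "vnat_trans T C A ?G f" using a T' by (simp add: vnat_trans_def amor_def)
      show "\<exists>b \<in> homs V \<one> (vhom C (fobj ?G J) (fobj A J)).
          lact C (fobj A J) (fobj ?G J) (fobj A J) b (f J) = vid C (fobj A J) \<and>
          lact C (fobj ?G J) (fobj A J) (fobj ?G J) (f J) b = vid C (fobj ?G J)" if "J \<in> vob T" for J
        using amor_inverse[OF T A U B a, of J] that T' Go c by simp
    qed
    then show "vnat_iso T C A ?G f \<and> f \<one> = vid C X" using a c by (simp add: amor_def)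
  qed
  finally show ?thesis .
qed (auto simp: Alg_def amor_def)

section \<open>Algebras on a fixed carrier form an ordinary category\<close>

lemma homs_Alg:
  "m \<in> homs (Alg C X) (T, A) (U, B) \<longleftrightarrow> theory_ok T \<and> algebra_ok T C A \<and> fobj A \<one> = X \<and>
     theory_ok U \<and> algebra_ok U C B \<and> fobj B \<one> = X \<and> (\<exists>M f. m = ((T, A), (U, B), M, f) \<and> amor T A U B M f)"
proof -
  have "m \<in> homs (Alg C X) (T, A) (U, B) \<longleftrightarrow> (\<exists>M f. m = ((T, A), (U, B), M, f) \<and> m \<in> arr (Alg C X))"
    by (auto simp: Alg_def)
  also have "\<dots> \<longleftrightarrow> theory_ok T \<and> algebra_ok T C A \<and> fobj A \<one> = X \<and>
     theory_ok U \<and> algebra_ok U C B \<and> fobj B \<one> = X \<and> (\<exists>M f. m = ((T, A), (U, B), M, f) \<and> m \<in> arr (Alg C X))"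
    by (auto simp: Alg_def is_algebra_def carrier_obj_def)
  also have "\<dots> \<longleftrightarrow> theory_ok T \<and> algebra_ok T C A \<and> fobj A \<one> = X \<and>
     theory_ok U \<and> algebra_ok U C B \<and> fobj B \<one> = X \<and> (\<exists>M f. m = ((T, A), (U, B), M, f) \<and> amor T A U B M f)"
    using arr_Alg_iff by blast
  finally show ?thesis .
qed

lemma amor_cmp:
  assumes T: "theory_ok T" and A: "algebra_ok T C A" and U: "theory_ok U" and B: "algebra_ok U C B"
    and W: "theory_ok W" and D: "algebra_ok W C D" and c: "fobj A \<one> = fobj B \<one>" "fobj B \<one> = fobj D \<one>"
    and m: "amor T A U B M f" and n: "amor U B W D N g"
  shows "amor T A W D (vfun_comp T N M) (\<lambda>J \<in> \<J>. lact C (fobj A J) (fobj B J) (fobj D J) (g J) (f J))"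
proof -
  have M': "theory_mor T U M" and N': "theory_mor U W N" using m n by (auto simp: amor_def)
  note M = theory_morD[OF T U M'] and N = theory_morD[OF U W N']
  note A' = algebra_okD[OF A] and B' = algebra_okD[OF B] and D' = algebra_okD[OF D]
  note T' = theory_okD(1,2)[OF T] and U' = theory_okD(1,2)[OF U] and W' = theory_okD(1,2)[OF W]
  note f = amorD[OF m] and g = amorD[OF n]
  have NM: "fm (vfun_comp T N M) J K t = fm N J K (fm M J K t)" if "J \<in> \<J>" "K \<in> \<J>" "t \<in> arr V" "tgt V t = vhom T J K" for J K t
    using fm_vfun_comp[OF M(1) N(1), of J K t] that M T' by simp
  have "theory_mor T W (vfun_comp T N M)"
    unfolding theory_mor_iff[OF T W] using M N T U W T' NM by simp
  moreover have "lact C (fobj A \<one>) (fobj B \<one>) (fobj D \<one>) (g \<one>) (f \<one>) = vid C (fobj A \<one>)"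
    using m n c D' W by (simp add: amor_def)
  ultimately show ?thesis unfolding amor_def
  proof (intro conjI ballI allI impI)
    let ?h = "\<lambda>J \<in> \<J>. lact C (fobj A J) (fobj B J) (fobj D J) (g J) (f J)"
    show "?h J \<in> homs V \<one> (vhom C (fobj A J) (fobj D J))" if "J \<in> \<J>" for J
      using that f[OF that] g[OF that] A' B' D' T U W by simp
    fix J K Z t x assume h: "J \<in> \<J>" "K \<in> \<J>" "Z \<in> vob C" "t \<in> arr V" "tgt V t = vhom T J K" "x \<in> arr V" "tgt V x = vhom C Z (fobj A J)"
    have Mt: "fm M J K t \<in> arr V" "tgt V (fm M J K t) = vhom U J K" using h M T' by auto
    note b = h f[OF h(1)] f[OF h(2)] g[OF h(1)] g[OF h(2)] A' B' D' T U W
    show "lact C Z (fobj A K) (fobj D K) (?h K) (gc C Z (fobj A J) (fobj A K) (fm A J K t) x) =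
      gc C Z (fobj D J) (fobj D K) (fm D J K (fm (vfun_comp T N M) J K t)) (lact C Z (fobj A J) (fobj D J) (?h J) x)"
      using amor_nat[OF m h] amor_nat[OF n h(1-3) Mt, of "lact C Z (fobj A J) (fobj B J) (f J) x"] NM[OF h(1,2,4,5)] b by simp
  qed auto
qed

lemma amor_id:
  assumes T: "theory_ok T" and A: "algebra_ok T C A"
  shows "amor T A T A (vfun_id T) (\<lambda>J \<in> \<J>. vid C (fobj A J))"
  unfolding amor_def theory_mor_iff[OF T T]
  using vfunctor_vfun_id[of T] algebra_okD[OF A] T by (simp add: vfun_id_simps)

lemma cmp_Alg:
  assumes "theory_ok T" "algebra_ok T C A" "theory_ok U" "algebra_ok U C B" "theory_ok W" "algebra_ok W C D"
    and m: "amor T A U B M f" and n: "amor U B W D N g"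
  shows "cmp (Alg C X) ((U, B), (W, D), N, g) ((T, A), (U, B), M, f) =
    ((T, A), (W, D), vfun_comp T N M, (\<lambda>J \<in> \<J>. lact C (fobj A J) (fobj B J) (fobj D J) (g J) (f J)))"
proof -
  have "theory_mor T U M" "theory_mor U W N" using m n by (auto simp: amor_def)
  note M = theory_morD[OF assms(1,3) this(1)] and N = theory_morD[OF assms(3,5) this(2)]
  have "ucomp C (fobj A J) (fobj B (fobj M J)) (fobj D (fobj N (fobj M J))) (g (fobj M J)) (f J)
     = lact C (fobj A J) (fobj B J) (fobj D J) (g J) (f J)" if "J \<in> \<J>" for J
    using that assms M N amorD[OF m that] amorD[OF n that] algebra_okD[OF assms(2)] algebra_okD[OF assms(4)] algebra_okD[OF assms(6)]
    by (simp add: ucomp_lact)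
  then show ?thesis by (auto simp: Alg_def intro!: restrict_ext)
qed

text \<open>The laws are equalities of tuples, so functor parts and transformation parts must agree
  on the nose. They do because functors and families are extensional and \<open>lact\<close> is
  strictly associative and unital.\<close>

lemma category_Alg: "category (Alg C X)"
proof
  fix m assume "m \<in> arr (Alg C X)"
  then show "src (Alg C X) m \<in> obj (Alg C X)" "tgt (Alg C X) m \<in> obj (Alg C X)"
    by (auto simp: Alg_def)
next
  fix \<A> assume "\<A> \<in> obj (Alg C X)"
  then obtain T A where \<A>: "\<A> = (T, A)" and T: "theory_ok T" and A: "algebra_ok T C A" and c: "fobj A \<one> = X"
    by (auto simp: Alg_def is_algebra_def carrier_obj_def)
  have "idm (Alg C X) (T, A) = ((T, A), (T, A), vfun_id T, (\<lambda>J \<in> \<J>. vid C (fobj A J)))"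
    by (simp add: Alg_def)
  then show "idm (Alg C X) \<A> \<in> homs (Alg C X) \<A> \<A>" unfolding \<A> homs_Alg using amor_id[OF T A] T A c by simp
next
  fix m \<A> \<B> n \<D> assume m: "m \<in> homs (Alg C X) \<A> \<B>" and n: "n \<in> homs (Alg C X) \<B> \<D>"
  obtain T A U B W D where e: "\<A> = (T, A)" "\<B> = (U, B)" "\<D> = (W, D)" by (cases \<A>, cases \<B>, cases \<D>)
  obtain M f where m': "m = ((T, A), (U, B), M, f)" "amor T A U B M f" and T: "theory_ok T" "algebra_ok T C A" "fobj A \<one> = X"
    and U: "theory_ok U" "algebra_ok U C B" "fobj B \<one> = X" using m unfolding e homs_Alg by blast
  obtain N g where n': "n = ((U, B), (W, D), N, g)" "amor U B W D N g" and W: "theory_ok W" "algebra_ok W C D" "fobj D \<one> = X"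
    using n unfolding e homs_Alg by blast
  show "cmp (Alg C X) n m \<in> homs (Alg C X) \<A> \<D>"
    unfolding e homs_Alg m'(1) n'(1) cmp_Alg[OF T(1,2) U(1,2) W(1,2) m'(2) n'(2)]
    using amor_cmp[OF T(1,2) U(1,2) W(1,2) _ _ m'(2) n'(2)] T U W by simp
  fix p \<F> assume p: "p \<in> homs (Alg C X) \<D> \<F>"
  obtain Y E where eF: "\<F> = (Y, E)" by (cases \<F>)
  obtain P h where p': "p = ((W, D), (Y, E), P, h)" "amor W D Y E P h" and Y: "theory_ok Y" "algebra_ok Y C E" "fobj E \<one> = X"
    using p unfolding e eF homs_Alg by blast
  have "theory_mor T U M" "theory_mor U W N" "theory_mor W Y P" using m'(2) n'(2) p'(2) by (auto simp: amor_def)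
  note M = theory_morD[OF T(1) U(1) this(1)] and N = theory_morD[OF U(1) W(1) this(2)] and P = theory_morD[OF W(1) Y(1) this(3)]
  have nm: "amor T A W D (vfun_comp T N M) (\<lambda>J \<in> \<J>. lact C (fobj A J) (fobj B J) (fobj D J) (g J) (f J))"
    by (rule amor_cmp[OF T(1,2) U(1,2) W(1,2) _ _ m'(2) n'(2)]) (use T U W in auto)
  have pn: "amor U B Y E (vfun_comp U P N) (\<lambda>J \<in> \<J>. lact C (fobj B J) (fobj D J) (fobj E J) (h J) (g J))"
    by (rule amor_cmp[OF U(1,2) W(1,2) Y(1,2) _ _ n'(2) p'(2)]) (use U W Y in auto)
  have fun_assoc: "vfun_comp T (vfun_comp U P N) M = vfun_comp T P (vfun_comp T N M)"
  proof (rule vfun_eqI[where A = T])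
    show "vfunctor T Y (vfun_comp T (vfun_comp U P N) M)" "vfunctor T Y (vfun_comp T P (vfun_comp T N M))"
      using vfunctor_vfun_comp[OF M(1) vfunctor_vfun_comp[OF N(1) P(1)]]
        vfunctor_vfun_comp[OF vfunctor_vfun_comp[OF M(1) N(1)] P(1)] T U W Y by simp_all
    show "fhom (vfun_comp T (vfun_comp U P N) M) J K = fhom (vfun_comp T P (vfun_comp T N M)) J K" if "J \<in> vob T" "K \<in> vob T" for J K
    proof -
      have JK: "J \<in> \<J>" "K \<in> \<J>" using that T by auto
      have "fm (vfun_comp U P N) J K (fhom M J K) = fm P J K (fm N J K (fhom M J K))"
        using fm_vfun_comp[OF N(1) P(1), of J K "fhom M J K"] vfunctor_hom[OF M(1), of J K] M(2) N(2) JK T U by simp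
      then show ?thesis using M(2) N(2) JK T U by simp
    qed
  qed (use M N P T U W Y in auto)
  show "cmp (Alg C X) (cmp (Alg C X) p n) m = cmp (Alg C X) p (cmp (Alg C X) n m)"
    unfolding m'(1) n'(1) p'(1) cmp_Alg[OF T(1,2) U(1,2) W(1,2) m'(2) n'(2)] cmp_Alg[OF U(1,2) W(1,2) Y(1,2) n'(2) p'(2)]
      cmp_Alg[OF T(1,2) U(1,2) Y(1,2) m'(2) pn] cmp_Alg[OF T(1,2) W(1,2) Y(1,2) nm p'(2)] fun_assoc
  proof -
    have "lact C (fobj A J) (fobj B J) (fobj E J) (lact C (fobj B J) (fobj D J) (fobj E J) (h J) (g J)) (f J) =
       lact C (fobj A J) (fobj D J) (fobj E J) (h J) (lact C (fobj A J) (fobj B J) (fobj D J) (g J) (f J))" if "J \<in> \<J>" for J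
      by (rule lact_lact) (use that amorD[OF m'(2) that] amorD[OF n'(2) that] amorD[OF p'(2) that] T U W Y
          algebra_okD[OF T(2)] algebra_okD[OF U(2)] algebra_okD[OF W(2)] algebra_okD[OF Y(2)] in auto)
    then show "((T, A), (Y, E), vfun_comp T P (vfun_comp T N M), \<lambda>J \<in> \<J>. lact C (fobj A J) (fobj B J) (fobj E J)
         ((\<lambda>J \<in> \<J>. lact C (fobj B J) (fobj D J) (fobj E J) (h J) (g J)) J) (f J)) =
       ((T, A), (Y, E), vfun_comp T P (vfun_comp T N M), \<lambda>J \<in> \<J>. lact C (fobj A J) (fobj D J) (fobj E J) (h J)
         ((\<lambda>J \<in> \<J>. lact C (fobj A J) (fobj B J) (fobj D J) (g J) (f J)) J))"
      by (auto intro!: restrict_ext)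
  qed
next
  fix m \<A> \<B> assume m: "m \<in> homs (Alg C X) \<A> \<B>"
  obtain T A U B where e: "\<A> = (T, A)" "\<B> = (U, B)" by (cases \<A>, cases \<B>)
  obtain M f where m': "m = ((T, A), (U, B), M, f)" "amor T A U B M f" and T: "theory_ok T" "algebra_ok T C A" "fobj A \<one> = X"
    and U: "theory_ok U" "algebra_ok U C B" "fobj B \<one> = X" using m unfolding e homs_Alg by blast
  have "theory_mor T U M" using m'(2) by (auto simp: amor_def)
  note M = theory_morD[OF T(1) U(1) this]
  note A' = algebra_okD[OF T(2)] and B' = algebra_okD[OF U(2)] and f = amorD[OF m'(2)]
  have i: "idm (Alg C X) (T, A) = ((T, A), (T, A), vfun_id T, (\<lambda>J \<in> \<J>. vid C (fobj A J)))" for T A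
    by (simp add: Alg_def)
  \<comment> \<open>Composites carry families restricted to the arities; f equals its own
    restriction because it is extensional.\<close>
  have fx: "f = (\<lambda>J \<in> \<J>. f J)" using m'(2) by (auto simp: amor_def extensional_restrict)
  have l: "vfun_comp T (vfun_id U) M = M"
  proof (rule vfun_eqI[where A = T])
    show "vfunctor T U (vfun_comp T (vfun_id U) M)" "vfunctor T U M"
      using M T U vfunctor_vfun_id[of U] by simp_all
    show "fhom (vfun_comp T (vfun_id U) M) J K = fhom M J K" if "J \<in> vob T" "K \<in> vob T" for J K
      using that M T U vfunctor_hom[OF M(1), of J K] by (simp add: vfun_id_simps)
  qed (use M T U in \<open>auto simp: vfun_id_simps\<close>)
  have r: "vfun_comp T M (vfun_id T) = M"
  proof (rule vfun_eqI[where A = T])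
    show "vfunctor T U (vfun_comp T M (vfun_id T))" "vfunctor T U M"
      using M T U vfunctor_vfun_id[of T] by simp_all
    show "fhom (vfun_comp T M (vfun_id T)) J K = fhom M J K" if "J \<in> vob T" "K \<in> vob T" for J K
    proof -
      have "fhom (vfun_id T) J K = idm V (vhom T J K)" using that by (simp add: vfun_id_def mk_vfun_def)
      then show ?thesis using that M T U by (simp add: vfun_id_simps)
    qed
  qed (use M T U in \<open>auto simp: vfun_id_simps\<close>)
  show "cmp (Alg C X) (idm (Alg C X) \<B>) m = m"
    unfolding e m'(1) i cmp_Alg[OF T(1,2) U(1,2) U(1,2) m'(2) amor_id[OF U(1,2)]] l
    by (subst (2) fx) (use f A' B' T U in \<open>auto intro!: restrict_ext\<close>)
  show "cmp (Alg C X) m (idm (Alg C X) \<A>) = m"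
    unfolding e m'(1) i cmp_Alg[OF T(1,2) T(1,2) U(1,2) amor_id[OF T(1,2)] m'(2)] r
    by (subst (2) fx) (use f A' B' T U in \<open>auto intro!: restrict_ext\<close>)
qed

end

section \<open>Commuting algebras\<close>

context admissible_vcat
begin

text \<open>\<open>end_unit_eqI\<close> read as faithfulness: equations between operations of the
  commutant may be checked in C.\<close>

lemma commutant_fun_faithful:
  assumes T: "theory_ok T" and A: "algebra_ok T C A" and J: "J \<in> \<J>" and K: "K \<in> \<J>"
    and g: "g \<in> arr V" "tgt V g = vhom (commutant_theory C (T, A)) J K"
    and h: "h \<in> arr V" "tgt V h = vhom (commutant_theory C (T, A)) J K" "src V g = src V h"
    and e: "fm (commutant_fun (T, A)) J K g = fm (commutant_fun (T, A)) J K h"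
  shows "g = h"
  using end_unit_eqI[OF T algebra_pw[OF T A J] algebra_pw[OF T A K], of g h] g h e J K
  by (simp add: commutant_theory_simps commutant_fun_simps)

text \<open>The counits force f without reference to M. As f is invertible, naturality then forces
  the action of M in C, and \<open>commutant_fun_faithful\<close> lifts the equality to the
  commutant.\<close>

lemma amor_commutant_unique:
  assumes T: "theory_ok T" and A: "algebra_ok T C A" and U: "theory_ok U" and B: "algebra_ok U C B"
    and c: "fobj B \<one> = fobj A \<one>"
    and m: "amor U B (commutant_theory C (T, A)) (commutant_fun (T, A)) M f"
    and n: "amor U B (commutant_theory C (T, A)) (commutant_fun (T, A)) N g"
  shows "M = N \<and> f = g"
proof
  let ?S = "commutant_theory C (T, A)" and ?D = "commutant_fun (T, A)"
  note S = commutant_theory[OF T A] and D = commutant_algebra[OF T A]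
  note S' = theory_okD(1,2)[OF S(1)] and D' = algebra_okD[OF D] and B' = algebra_okD[OF B] and U' = theory_okD(1,2)[OF U]
  have X: "fobj A \<one> \<in> vob C" using algebra_okD[OF A] T by simp
  have c': "fobj B \<one> = fobj ?D \<one>" using c X by (simp add: commutant_fun_simps)
  have M': "theory_mor U ?S M" "theory_mor U ?S N" using m n by (auto simp: amor_def)
  note M = theory_morD[OF U S(1) M'(1)] and N = theory_morD[OF U S(1) M'(2)]
  have fg: "f J = g J" if J: "J \<in> \<J>" for J
  proof -
    note f = amorD[OF m J] and g = amorD[OF n J]
    have Bo: "fobj B J \<in> vob C" using B' U' J by simp
    let ?v = "vid C (fobj B J)"
    have "gc C (fobj B J) (fobj ?D J) (fobj ?D \<one>) (fm ?D J \<one> (counit ?S J)) (lact C (fobj B J) (fobj B J) (fobj ?D J) (f J) ?v) =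
      gc C (fobj B J) (fobj ?D J) (fobj ?D \<one>) (fm ?D J \<one> (counit ?S J)) (lact C (fobj B J) (fobj B J) (fobj ?D J) (g J) ?v)"
      using amor_counit[OF U B S(1) D m J Bo _ _ c', of ?v] amor_counit[OF U B S(1) D n J Bo _ _ c', of ?v] Bo by simp
    then have e: "gc C (fobj B J) (fobj ?D J) (fobj ?D \<one>) (fm ?D J \<one> (counit ?S J)) (f J) =
      gc C (fobj B J) (fobj ?D J) (fobj ?D \<one>) (fm ?D J \<one> (counit ?S J)) (g J)"
      using f g Bo D' S' J by simp
    show ?thesis by (rule cot_cancel[OF C_cat algebra_counit[OF S(1) D J] Bo _ _ _ _ _ e]) (use f g in auto)
  qed
  show "f = g" using fg m n by (intro extensionalityI[of _ \<J>]) (auto simp: amor_def)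
  show "M = N"
  proof (rule vfun_eqI[OF M(1) N(1)])
    show "fobj M J = fobj N J" if "J \<in> vob U" for J using that M N U' by simp
    show "fhom M J K = fhom N J K" if "J \<in> vob U" "K \<in> vob U" for J K
    proof -
      have J: "J \<in> \<J>" and K: "K \<in> \<J>" using that U' by auto
      note h = vfunctor_hom[OF M(1) that, unfolded M(2)[OF J] M(2)[OF K]] vfunctor_hom[OF N(1) that, unfolded N(2)[OF J] N(2)[OF K]]
      have o: "fobj B J \<in> vob C" "fobj B K \<in> vob C" "fobj ?D J \<in> vob C" "fobj ?D K \<in> vob C" using B' U' D' S' J K by auto
      let ?W = "vhom U J K"
      have W: "?W \<in> obj V" using U' that by simp
      \<comment> \<open>Naturality at the inverse of f J expresses the actions of M and of N on an
        identity by one and the same composite, in which neither M nor N occurs.\<close>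
      obtain b where b: "b \<in> homs V \<one> (vhom C (fobj ?D J) (fobj B J))"
        "lact C (fobj ?D J) (fobj B J) (fobj ?D J) (f J) b = vid C (fobj ?D J)"
        using amor_inverse[OF U B S(1) D m J c'] by auto
      let ?v = "vid C (fobj ?D J)"
      have Mv: "gc C (fobj ?D J) (fobj ?D J) (fobj ?D K) (fm ?D J K (fhom M J K)) ?v =
         lact C (fobj ?D J) (fobj B K) (fobj ?D K) (f K) (gc C (fobj ?D J) (fobj B J) (fobj B K) (fhom B J K) b)"
        using amor_nat[OF m J K o(3), of "idm V ?W" b] b W M J K B' U' that by simp
      have Nv: "gc C (fobj ?D J) (fobj ?D J) (fobj ?D K) (fm ?D J K (fhom N J K)) ?v =
         lact C (fobj ?D J) (fobj B K) (fobj ?D K) (f K) (gc C (fobj ?D J) (fobj B J) (fobj B K) (fhom B J K) b)"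
        using amor_nat[OF n J K o(3), of "idm V ?W" b] b W N J K B' U' that fg by simp
      have "fm ?D J K (fhom M J K) = fm ?D J K (fhom N J K)"
        by (rule gc_eqI[where C = C and W = ?W and X = "fobj ?D J" and Y = "fobj ?D K"])
          (use Mv Nv o h D' S' J K in auto)
      then show ?thesis by (rule commutant_fun_faithful[OF T A J K, rotated -1]) (use h in auto)
    qed
  qed
qed

text \<open>Every operation \<open>t : J \<rightarrow> I\<close> of \<open>T\<close> commutes with every operation \<open>u : L \<rightarrow> I\<close> of \<open>U\<close>.
  The generalized elements \<open>m\<close> and \<open>n\<close> present the same \<open>J\<close>-by-\<open>L\<close> matrix of elements of the
  carrier, \<open>p\<close> and \<open>q\<close> arise by applying \<open>t\<close> resp. \<open>u\<close> along one of its directions.\<close>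

definition operations_commute ::
    "('o, 'm) jtheory \<Rightarrow> ('o, 'c, 'm) vfun \<Rightarrow> ('o, 'm) jtheory \<Rightarrow> ('o, 'c, 'm) vfun \<Rightarrow> bool" where
  "operations_commute T A U B \<longleftrightarrow>
    (\<forall>J \<in> \<J>. \<forall>L \<in> \<J>. \<forall>Z \<in> vob C. \<forall>W \<in> obj V. \<forall>W' \<in> obj V. \<forall>Q \<in> obj V.
     \<forall>t \<in> homs V W (vhom T J \<one>). \<forall>u \<in> homs V W' (vhom U L \<one>).
     \<forall>m \<in> homs V (L \<otimes> Q) (vhom C Z (fobj A J)). \<forall>n \<in> homs V (J \<otimes> Q) (vhom C Z (fobj B L)).
     \<forall>p \<in> homs V (W \<otimes> Q) (vhom C Z (fobj B L)). \<forall>q \<in> homs V (W' \<otimes> Q) (vhom C Z (fobj A J)).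
       gc C Z (fobj A J) (fobj A \<one>) (fm A J \<one> (counit T J)) m =
         gc C Z (fobj B L) (fobj B \<one>) (fm B L \<one> (counit U L)) n \<cdot> swp J L Q \<longrightarrow>
       gc C Z (fobj B L) (fobj B \<one>) (fm B L \<one> (counit U L)) p =
         gc C Z (fobj A J) (fobj A \<one>) (fm A J \<one> t) m \<cdot> swp L W Q \<longrightarrow>
       gc C Z (fobj A J) (fobj A \<one>) (fm A J \<one> (counit T J)) q =
         gc C Z (fobj B L) (fobj B \<one>) (fm B L \<one> u) n \<cdot> swp J W' Q \<longrightarrow>
       gc C Z (fobj B L) (fobj B \<one>) (fm B L \<one> u) p =
         gc C Z (fobj A J) (fobj A \<one>) (fm A J \<one> t) q \<cdot> swp W' W Q)"

lemma operations_commuteD: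
  assumes "operations_commute T A U B" "J \<in> \<J>" "L \<in> \<J>" "Z \<in> vob C" "W \<in> obj V" "W' \<in> obj V" "Q \<in> obj V"
    "t \<in> homs V W (vhom T J \<one>)" "u \<in> homs V W' (vhom U L \<one>)"
    "m \<in> homs V (L \<otimes> Q) (vhom C Z (fobj A J))" "n \<in> homs V (J \<otimes> Q) (vhom C Z (fobj B L))"
    "p \<in> homs V (W \<otimes> Q) (vhom C Z (fobj B L))" "q \<in> homs V (W' \<otimes> Q) (vhom C Z (fobj A J))"
    "gc C Z (fobj A J) (fobj A \<one>) (fm A J \<one> (counit T J)) m =
       gc C Z (fobj B L) (fobj B \<one>) (fm B L \<one> (counit U L)) n \<cdot> swp J L Q"
    "gc C Z (fobj B L) (fobj B \<one>) (fm B L \<one> (counit U L)) p =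
       gc C Z (fobj A J) (fobj A \<one>) (fm A J \<one> t) m \<cdot> swp L W Q"
    "gc C Z (fobj A J) (fobj A \<one>) (fm A J \<one> (counit T J)) q =
       gc C Z (fobj B L) (fobj B \<one>) (fm B L \<one> u) n \<cdot> swp J W' Q"
  shows "gc C Z (fobj B L) (fobj B \<one>) (fm B L \<one> u) p =
       gc C Z (fobj A J) (fobj A \<one>) (fm A J \<one> t) q \<cdot> swp W' W Q"
  using assms(1)[unfolded operations_commute_def, rule_format, OF assms(2-16)] .

text \<open>Exchange m with n and p with q. The second and third conditions trade places verbatim;
  the first condition and the conclusion are turned round by the inverse exchange.\<close>

lemma operations_commute_sym:
  assumes T: "theory_ok T" and A: "algebra_ok T C A" and U: "theory_ok U" and B: "algebra_ok U C B"
    and c: "operations_commute T A U B"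
  shows "operations_commute U B T A"
  unfolding operations_commute_def
proof (intro ballI impI)
  fix L J Z W' W Q u t n m q p
  assume a: "L \<in> \<J>" "J \<in> \<J>" "Z \<in> vob C" "W' \<in> obj V" "W \<in> obj V" "Q \<in> obj V"
    "u \<in> homs V W' (vhom U L \<one>)" "t \<in> homs V W (vhom T J \<one>)"
    "n \<in> homs V (J \<otimes> Q) (vhom C Z (fobj B L))" "m \<in> homs V (L \<otimes> Q) (vhom C Z (fobj A J))"
    "q \<in> homs V (W' \<otimes> Q) (vhom C Z (fobj A J))" "p \<in> homs V (W \<otimes> Q) (vhom C Z (fobj B L))"
    and e: "gc C Z (fobj B L) (fobj B \<one>) (fm B L \<one> (counit U L)) n =
       gc C Z (fobj A J) (fobj A \<one>) (fm A J \<one> (counit T J)) m \<cdot> swp L J Q"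
    "gc C Z (fobj A J) (fobj A \<one>) (fm A J \<one> (counit T J)) q =
       gc C Z (fobj B L) (fobj B \<one>) (fm B L \<one> u) n \<cdot> swp J W' Q"
    "gc C Z (fobj B L) (fobj B \<one>) (fm B L \<one> (counit U L)) p =
       gc C Z (fobj A J) (fobj A \<one>) (fm A J \<one> t) m \<cdot> swp L W Q"
  note b = a T U algebra_okD[OF A] algebra_okD[OF B]
  have "gc C Z (fobj A J) (fobj A \<one>) (fm A J \<one> (counit T J)) m =
       gc C Z (fobj B L) (fobj B \<one>) (fm B L \<one> (counit U L)) n \<cdot> swp J L Q"
    unfolding e(1) using b by simp
  then have "gc C Z (fobj B L) (fobj B \<one>) (fm B L \<one> u) p =
       gc C Z (fobj A J) (fobj A \<one>) (fm A J \<one> t) q \<cdot> swp W' W Q"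
    using operations_commuteD[OF c a(2,1,3,5,4,6,8,7,10,9,12,11) _ e(3,2)] by blast
  then show "gc C Z (fobj A J) (fobj A \<one>) (fm A J \<one> t) q =
       gc C Z (fobj B L) (fobj B \<one>) (fm B L \<one> u) p \<cdot> swp W W' Q"
    using b by simp
qed

text \<open>Under M an operation u : L \<rightarrow> I becomes a natural family from [L,A] to A, and
  its naturality at t is the commutation of t and u. The isomorphism f L translates between B L and
  the designated cotensor [L,X].\<close>

lemma amor_commutant_imp:
  assumes T: "theory_ok T" and A: "algebra_ok T C A" and U: "theory_ok U" and B: "algebra_ok U C B"
    and c: "fobj B \<one> = fobj A \<one>"
    and mor: "amor U B (commutant_theory C (T, A)) (commutant_fun (T, A)) M f"
  shows "operations_commute T A U B"
  unfolding operations_commute_def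
proof (intro ballI impI)
  let ?S = "commutant_theory C (T, A)" and ?D = "commutant_fun (T, A)"
  let ?X = "fobj A \<one>"
  fix J L Z W W' Q t u m n p q
  assume a: "J \<in> \<J>" "L \<in> \<J>" "Z \<in> vob C" "W \<in> obj V" "W' \<in> obj V" "Q \<in> obj V"
    "t \<in> homs V W (vhom T J \<one>)" "u \<in> homs V W' (vhom U L \<one>)"
    "m \<in> homs V (L \<otimes> Q) (vhom C Z (fobj A J))" "n \<in> homs V (J \<otimes> Q) (vhom C Z (fobj B L))"
    "p \<in> homs V (W \<otimes> Q) (vhom C Z (fobj B L))" "q \<in> homs V (W' \<otimes> Q) (vhom C Z (fobj A J))"
    and e0: "gc C Z (fobj A J) ?X (fm A J \<one> (counit T J)) m =
       gc C Z (fobj B L) (fobj B \<one>) (fm B L \<one> (counit U L)) n \<cdot> swp J L Q"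
    "gc C Z (fobj B L) (fobj B \<one>) (fm B L \<one> (counit U L)) p =
       gc C Z (fobj A J) ?X (fm A J \<one> t) m \<cdot> swp L W Q"
    "gc C Z (fobj A J) ?X (fm A J \<one> (counit T J)) q =
       gc C Z (fobj B L) (fobj B \<one>) (fm B L \<one> u) n \<cdot> swp J W' Q"
  note e = e0[unfolded c]
  note J = a(1) and L = a(2) and Z = a(3)
  note S = commutant_theory[OF T A] and D = commutant_algebra[OF T A]
  note S' = theory_okD(1,2)[OF S(1)] and D' = algebra_okD[OF D] and A' = algebra_okD[OF A] and B' = algebra_okD[OF B]
  note T' = theory_okD(1,2)[OF T] and U' = theory_okD(1,2)[OF U]
  have M': "theory_mor U ?S M" and f1: "f \<one> = vid C (fobj B \<one>)" using mor by (auto simp: amor_def)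
  note M = theory_morD[OF U S(1) M']
  note f = amorD[OF mor L]
  have X: "?X \<in> vob C" "fobj A J \<in> vob C" "fobj B L \<in> vob C" using A' B' T U J L by auto
  have Do: "fobj ?D L = cot C L ?X" "fobj ?D \<one> = ?X" using L X by (auto simp: commutant_fun_simps)
  have c': "fobj B \<one> = fobj ?D \<one>" using c Do by simp
  let ?P = "cot C L ?X" and ?PJ = "cot C L (fobj A J)"
  note P = algebra_pw[OF T A L] and po = pw_simps(1)[OF T, of _ L A]
  note P' = algebra_okD[OF P]
  note C1 = C_cot[OF L X(1)] and CJ = C_cot[OF L X(2)]
  \<comment> \<open>The operation u as an arrow into the hom object of algebras from [L,A] to A; its
    components are the family \<open>?\<mu>\<close>.\<close>
  define w where "w = fm M L \<one> u"
  have w: "w \<in> arr V" "src V w = W'" "tgt V w = end_obj T C (pw T L A) A"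
    using fm_typing[OF M(1), of L \<one> u] a U' L M(2)[OF L] M(2)[OF unit_arity]
    by (auto simp: w_def commutant_theory_simps pw_unit[OF T A])
  let ?\<mu> = "\<lambda>K. end_proj T C (pw T L A) A K \<cdot> w"
  have nat: "vnat_family T C (pw T L A) A W' ?\<mu>" using end_family_cmp[OF T P A w(1,3)] w by simp
  have mu: "?\<mu> K \<in> arr V" "src V (?\<mu> K) = W'" "tgt V (?\<mu> K) = vhom C (cot C L (fobj A K)) (fobj A K)" if "K \<in> \<J>" for K
    using vnat_familyD[OF nat, of K] that T' po by auto
  have D1: "fm ?D L \<one> (fm M L \<one> u) = ?\<mu> \<one>"
    using L by (simp add: commutant_fun_simps w_def pw_unit[OF T A])
  have Bu: "gc C Z (fobj B L) ?X (fm B L \<one> u) x = gc C Z ?P ?X (?\<mu> \<one>) (lact C Z (fobj B L) ?P (f L) x)"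
    if x: "x \<in> arr V" "tgt V x = vhom C Z (fobj B L)" for x
    using amor_nat[OF mor L unit_arity Z, of u x, unfolded D1] f1 c' Do x a U' B' X by simp
  have fc: "gc C Z ?P ?X (cotu C L ?X) (lact C Z (fobj B L) ?P (f L) x) = gc C Z (fobj B L) ?X (fm B L \<one> (counit U L)) x"
    if x: "x \<in> arr V" "tgt V x = vhom C Z (fobj B L)" for x
    using amor_counit[OF U B S(1) D mor L Z x c'] commutant_fun_counit[OF T A L] Do c by simp
  have pt: "gc C Z ?P ?X (cotu C L ?X) (gc C Z ?PJ ?P (fm (pw T L A) J \<one> r) x) =
      gc C Z (fobj A J) ?X (fm A J \<one> r) (gc C Z ?PJ (fobj A J) (cotu C L (fobj A J)) x) \<cdot> swp L (src V r) (src V x)"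
    "fm (pw T L A) J \<one> r \<in> arr V" "src V (fm (pw T L A) J \<one> r) = src V r" "tgt V (fm (pw T L A) J \<one> r) = vhom C ?PJ ?P"
    if "r \<in> arr V" "tgt V r = vhom T J \<one>" "x \<in> arr V" "tgt V x = vhom C Z ?PJ" for r x
    using fm_pw[OF T A' L J unit_arity that(1,2)] that Z by auto
  have munat: "gc C Z ?P ?X (?\<mu> \<one>) (gc C Z ?PJ ?P (fm (pw T L A) J \<one> r) x) =
      gc C Z (fobj A J) ?X (fm A J \<one> r) (gc C Z ?PJ (fobj A J) (?\<mu> J) x) \<cdot> swp W' (src V r) (src V x)"
    if "r \<in> arr V" "tgt V r = vhom T J \<one>" "x \<in> arr V" "tgt V x = vhom C Z ?PJ" for r x
    using vnat_family_elem[OF T'(1) C_cat P' A' nat, of J \<one> r x Z] that Z T' J po by (simp del: gc_cmp_left)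
  \<comment> \<open>The matrix m, whose L-indexed rows lie in A J, gathered into one element of the
    cotensor [L, A J].\<close>
  define m' where "m' = cfac C L (fobj A J) ?PJ (cotu C L (fobj A J)) Z Q m"
  have m': "m' \<in> arr V" "src V m' = Q" "tgt V m' = vhom C Z ?PJ" "gc C Z ?PJ (fobj A J) (cotu C L (fobj A J)) m' = m"
    using cfac[OF C_cat CJ Z a(6), of m] a by (auto simp: m'_def)
  note tJ = counit_typing[OF T J] counit_typing[OF U L]
  note b = a X T U A' B' f m'(1-3) tJ C_cot_typing[OF L X(1)] C_cot_typing[OF L X(2)] mu[OF J] mu[OF unit_arity]
  \<comment> \<open>The facts \<open>1\<close>, \<open>2\<close> and \<open>3\<close> identify the
    other data up to \<open>f L\<close>: p is t applied pointwise to m', n is the counit of J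
    applied pointwise to m', and q is the family at J applied to m'. Naturality at t then gives the
    claim.\<close>
  have 1: "lact C Z (fobj B L) ?P (f L) p = gc C Z ?PJ ?P (fm (pw T L A) J \<one> t) m'"
  proof (rule cot_cancel[OF C_cat C1 Z])
    show "gc C Z ?P ?X (cotu C L ?X) (lact C Z (fobj B L) ?P (f L) p) =
       gc C Z ?P ?X (cotu C L ?X) (gc C Z ?PJ ?P (fm (pw T L A) J \<one> t) m')"
      using fc[of p] pt(1)[of t m'] m' e(2) c a by simp
  qed (use b pt[of t m'] Do in auto)
  have 2: "gc C Z ?PJ ?P (fm (pw T L A) J \<one> (counit T J)) m' = lact C Z (fobj B L) ?P (f L) n"
  proof (rule cot_cancel[OF C_cat C1 Z])
    have "gc C Z ?P ?X (cotu C L ?X) (gc C Z ?PJ ?P (fm (pw T L A) J \<one> (counit T J)) m') =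
       (gc C Z (fobj B L) ?X (fm B L \<one> (counit U L)) n \<cdot> swp J L Q) \<cdot> swp L J Q"
      using pt(1)[of "counit T J" m'] m' e(1) c tJ by simp
    also have "\<dots> = gc C Z ?P ?X (cotu C L ?X) (lact C Z (fobj B L) ?P (f L) n)"
      using fc[of n] b c by simp
    finally show "gc C Z ?P ?X (cotu C L ?X) (gc C Z ?PJ ?P (fm (pw T L A) J \<one> (counit T J)) m') =
       gc C Z ?P ?X (cotu C L ?X) (lact C Z (fobj B L) ?P (f L) n)" .
  qed (use b pt[of "counit T J" m'] Do in auto)
  have 3: "gc C Z ?PJ (fobj A J) (?\<mu> J) m' = q"
  proof (rule cot_cancel[OF C_cat algebra_counit[OF T A J] Z])
    have "gc C Z (fobj B L) ?X (fm B L \<one> u) n = gc C Z (fobj A J) ?X (fm A J \<one> (counit T J)) (gc C Z ?PJ (fobj A J) (?\<mu> J) m') \<cdot> swp W' J Q"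
      using Bu[of n] munat[of "counit T J" m'] 2 a m' tJ by (simp del: gc_cmp_left)
    then have "gc C Z (fobj A J) ?X (fm A J \<one> (counit T J)) q =
      (gc C Z (fobj A J) ?X (fm A J \<one> (counit T J)) (gc C Z ?PJ (fobj A J) (?\<mu> J) m') \<cdot> swp W' J Q) \<cdot> swp J W' Q"
      using e0(3) c by simp
    also have "\<dots> = gc C Z (fobj A J) ?X (fm A J \<one> (counit T J)) (gc C Z ?PJ (fobj A J) (?\<mu> J) m')"
      using b by (simp del: gc_cmp_left)
    finally show "gc C Z (fobj A J) ?X (fm A J \<one> (counit T J)) (gc C Z ?PJ (fobj A J) (?\<mu> J) m') =
      gc C Z (fobj A J) ?X (fm A J \<one> (counit T J)) q" ..
  qed (use b in \<open>auto simp del: gc_cmp_left\<close>)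
  show "gc C Z (fobj B L) (fobj B \<one>) (fm B L \<one> u) p = gc C Z (fobj A J) ?X (fm A J \<one> t) q \<cdot> swp W' W Q"
    using Bu[of p] munat[of t m'] 1 3 a m' c by (simp del: gc_cmp_left)
qed

text \<open>For each L, commutation makes the operations L \<rightarrow> I of B a natural family
  from [L,A] to A, via \<open>vnat_family_extend\<close>. This gives M on homs into I; the other
  homs follow because K is the cotensor [K,I] in the commutant.\<close>

lemma amor_commutant_exists:
  assumes T: "theory_ok T" and A: "algebra_ok T C A" and U: "theory_ok U" and B: "algebra_ok U C B"
    and c: "fobj B \<one> = fobj A \<one>" and comm: "operations_commute T A U B"
  shows "\<exists>M f. amor U B (commutant_theory C (T, A)) (commutant_fun (T, A)) M f"
proof -
  let ?S = "commutant_theory C (T, A)" and ?D = "commutant_fun (T, A)"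
  let ?X = "fobj A \<one>"
  note S = commutant_theory[OF T A] and D = commutant_algebra[OF T A]
  note S' = theory_okD(1,2)[OF S(1)] and D' = algebra_okD[OF D] and A' = algebra_okD[OF A] and B' = algebra_okD[OF B]
  note T' = theory_okD(1,2)[OF T] and U' = theory_okD(1,2)[OF U]
  have X: "?X \<in> vob C" using A' T by simp
  have Bo: "fobj B L \<in> vob C" if "L \<in> \<J>" for L using that B' U by simp
  let ?P = "\<lambda>L. cot C L ?X"
  let ?c = "\<lambda>L. cotu C L ?X"
  let ?g = "\<lambda>L. fm B L \<one> (counit U L)"
  have P: "?P L \<in> vob C" "?c L \<in> arr V" "src V (?c L) = L" "tgt V (?c L) = vhom C (?P L) ?X" if "L \<in> \<J>" for L
    using that X by auto
  have g: "?g L \<in> arr V" "src V (?g L) = L" "tgt V (?g L) = vhom C (fobj B L) ?X" if "L \<in> \<J>" for L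
    using that B' U c by auto
  have gcot: "is_cotensor C L ?X (fobj B L) (?g L)" if "L \<in> \<J>" for L
    using algebra_counit[OF U B that] c by simp
  have ccot: "is_cotensor C L ?X (?P L) (?c L)" if "L \<in> \<J>" for L
    using C_cot[OF that X] .
  \<comment> \<open>Two cotensors of X by L are in play, B L and the designated one; f and b are the
    comparison arrows between them, mutually inverse by \<open>bf\<close> and
    \<open>fb\<close>.\<close>
  define f where "f = (\<lambda>L \<in> \<J>. cfac C L ?X (?P L) (?c L) (fobj B L) \<one> (?g L \<cdot> runit V L))"
  define b where "b L = cfac C L ?X (fobj B L) (?g L) (?P L) \<one> (?c L \<cdot> runit V L)" for L
  have f: "f L \<in> arr V" "src V (f L) = \<one>" "tgt V (f L) = vhom C (fobj B L) (?P L)"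
    "gc C (fobj B L) (?P L) ?X (?c L) (f L) = ?g L \<cdot> runit V L" if L: "L \<in> \<J>" for L
    using cfac[OF C_cat ccot[OF L] Bo[OF L] unit_obj, of "?g L \<cdot> runit V L"] g[OF L] L by (auto simp: f_def)
  have b: "b L \<in> arr V" "src V (b L) = \<one>" "tgt V (b L) = vhom C (?P L) (fobj B L)"
    "gc C (?P L) (fobj B L) ?X (?g L) (b L) = ?c L \<cdot> runit V L" if L: "L \<in> \<J>" for L
    using cfac[OF C_cat gcot[OF L] P(1)[OF L] unit_obj, of "?c L \<cdot> runit V L"] P[OF L] L by (auto simp: b_def)
  let ?f = "\<lambda>Z L x. lact C Z (fobj B L) (?P L) (f L) x"
  let ?b = "\<lambda>Z L x. lact C Z (?P L) (fobj B L) (b L) x"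
  have cf: "gc C Z (?P L) ?X (?c L) (?f Z L x) = gc C Z (fobj B L) ?X (?g L) x"
    if "L \<in> \<J>" "Z \<in> vob C" "x \<in> arr V" "tgt V x = vhom C Z (fobj B L)" for L Z x
    by (rule gc_lact_factor[OF C_cat _ _ _ f(4)]) (use that f[OF that(1)] g[OF that(1)] P[OF that(1)] Bo[OF that(1)] X in auto)
  have gb: "gc C Z (fobj B L) ?X (?g L) (?b Z L x) = gc C Z (?P L) ?X (?c L) x"
    if "L \<in> \<J>" "Z \<in> vob C" "x \<in> arr V" "tgt V x = vhom C Z (?P L)" for L Z x
    by (rule gc_lact_factor[OF C_cat _ _ _ b(4)]) (use that b[OF that(1)] g[OF that(1)] P[OF that(1)] Bo[OF that(1)] X in auto)
  have ft: "?f Z L x \<in> arr V" "src V (?f Z L x) = src V x" "tgt V (?f Z L x) = vhom C Z (?P L)"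
    if "L \<in> \<J>" "Z \<in> vob C" "x \<in> arr V" "tgt V x = vhom C Z (fobj B L)" for L Z x
    using that f[OF that(1)] P[OF that(1)] Bo[OF that(1)] by auto
  have bt: "?b Z L x \<in> arr V" "src V (?b Z L x) = src V x" "tgt V (?b Z L x) = vhom C Z (fobj B L)"
    if "L \<in> \<J>" "Z \<in> vob C" "x \<in> arr V" "tgt V x = vhom C Z (?P L)" for L Z x
    using that b[OF that(1)] P[OF that(1)] Bo[OF that(1)] by auto
  have bf: "?b Z L (?f Z L x) = x"
    if h: "L \<in> \<J>" "Z \<in> vob C" "x \<in> arr V" "tgt V x = vhom C Z (fobj B L)" for L Z x
  proof -
    note t = ft[OF h] note t' = bt[OF h(1,2) t(1,3)]
    show ?thesis
      by (rule cot_cancel[OF C_cat gcot[OF h(1)] h(2) t'(1,3) h(3,4)]) (use gb[OF h(1,2) t(1,3)] cf[OF h] t t' in auto)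
  qed
  have fb: "?f Z L (?b Z L x) = x"
    if h: "L \<in> \<J>" "Z \<in> vob C" "x \<in> arr V" "tgt V x = vhom C Z (?P L)" for L Z x
  proof -
    note t = bt[OF h] note t' = ft[OF h(1,2) t(1,3)]
    show ?thesis
      by (rule cot_cancel[OF C_cat ccot[OF h(1)] h(2) t'(1,3) h(3,4)]) (use cf[OF h(1,2) t(1,3)] gb[OF h] t t' in auto)
  qed
  \<comment> \<open>Taking the whole hom object U(L,I) as grade and its identity as operation
    handles all operations L \<rightarrow> I at once.\<close>
  have "\<exists>N. N \<in> homs V (vhom U L \<one>) (vhom ?S L \<one>) \<and>
      (\<forall>Z y. Z \<in> vob C \<longrightarrow> y \<in> arr V \<longrightarrow> tgt V y = vhom C Z (?P L) \<longrightarrow>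
        gc C Z (?P L) ?X (fm ?D L \<one> N) y = gc C Z (fobj B L) ?X (fhom B L \<one>) (?b Z L y))" if L: "L \<in> \<J>" for L
  proof -
    let ?E = "vhom U L \<one>"
    note bL = b[OF L]
    have E: "?E \<in> obj V" using U' L by simp
    have h: "fhom B L \<one> \<in> arr V" "src V (fhom B L \<one>) = ?E" "tgt V (fhom B L \<one>) = vhom C (fobj B L) ?X"
      using vfunctor_hom[OF B', of L \<one>] U' L c by auto
    \<comment> \<open>The component at I: pass from the designated [L,X] to B L by b and act by the
      universal operation of B. The inverse unitor removes the grade I of b.\<close>
    define \<theta> where "\<theta> = gc C (?P L) (fobj B L) ?X (fhom B L \<one>) (b L) \<cdot> ri ?E"
    have \<theta>: "\<theta> \<in> arr V" "src V \<theta> = ?E" "tgt V \<theta> = vhom C (?P L) ?X"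
      using h bL Bo[OF L] P[OF L] X E by (auto simp: \<theta>_def)
    have \<theta>y: "gc C Z (?P L) ?X \<theta> y = gc C Z (fobj B L) ?X (fhom B L \<one>) (?b Z L y)"
      if Z: "Z \<in> vob C" and y: "y \<in> arr V" "tgt V y = vhom C Z (?P L)" for Z y
    proof -
      define Q where "Q = src V y"
      have Q: "Q \<in> obj V" using y by (simp add: Q_def)
      note y = y Q_def[symmetric]
      have "(idm V ?E \<otimes>\<^sub>m lunit V Q) \<cdot> (assoc V ?E \<one> Q \<cdot> (ri ?E \<otimes>\<^sub>m idm V Q)) =
        ((idm V ?E \<otimes>\<^sub>m lunit V Q) \<cdot> assoc V ?E \<one> Q) \<cdot> (ri ?E \<otimes>\<^sub>m idm V Q)"
        by (rule cmp_assoc'[symmetric]) (use E Q in auto)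
      also have "\<dots> = (idm V ?E \<otimes>\<^sub>m lunit V Q) \<cdot> (idm V ?E \<otimes>\<^sub>m li Q)"
        using E Q by (simp add: triangle)
      finally have "assoc V ?E \<one> Q \<cdot> (ri ?E \<otimes>\<^sub>m idm V Q) = idm V ?E \<otimes>\<^sub>m li Q"
        by (rule iso_cancel_left[rotated -1]) (use E Q in auto)
      then show ?thesis using h bL(1-3) Bo[OF L] P[OF L] X E Q Z y by (simp add: \<theta>_def lact_def)
    qed
    note PA = algebra_pw[OF T A L] and po = pw_simps(1)[OF T, of _ L A]
    note PA' = algebra_okD[OF PA]
    have "\<exists>\<alpha>. vnat_family T C (pw T L A) A ?E \<alpha> \<and> \<alpha> \<one> = \<theta>"
    proof (rule vnat_family_extend[OF T C_cat PA' A E])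
      show "\<theta> \<in> homs V ?E (vhom C (fobj (pw T L A) \<one>) ?X)" using \<theta> po by simp
      fix J Z W Q t x q
      assume J: "J \<in> \<J>" and Z: "Z \<in> vob C" and W: "W \<in> obj V" and Q: "Q \<in> obj V" and t0: "t \<in> homs V W (vhom T J \<one>)"
        and x0: "x \<in> homs V Q (vhom C Z (fobj (pw T L A) J))" and q: "q \<in> homs V (?E \<otimes> Q) (vhom C Z (fobj A J))"
        and e0: "gc C Z (fobj A J) ?X (fm A J \<one> (counit T J)) q =
          gc C Z (fobj (pw T L A) \<one>) ?X \<theta> (gc C Z (fobj (pw T L A) J) (fobj (pw T L A) \<one>) (fm (pw T L A) J \<one> (counit T J)) x) \<cdot> swp J ?E Q"
      let ?PJ = "cot C L (fobj A J)" and ?cJ = "cotu C L (fobj A J)"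
      have Ao: "fobj A J \<in> vob C" using A' T J by simp
      have t: "t \<in> arr V" "tgt V t = vhom T J \<one>" "src V t = W" and x: "x \<in> arr V" "tgt V x = vhom C Z ?PJ" "src V x = Q"
        using t0 x0 po J by auto
      note e = e0[unfolded po[OF J] po[OF unit_arity]]
      note k = counit_typing[OF T J]
      note pt = fm_pw[OF T A' L J unit_arity t(1,2)] and pk = fm_pw[OF T A' L J unit_arity k(1,3)]
      note cJ = C_cot_typing[OF L Ao]
      \<comment> \<open>The data for \<open>operations_commute\<close>: the entries of x along L
        give m, while the counit and t applied pointwise to x give, through \<open>?b\<close>, the
        elements n and p. The remaining q is the one supplied by
        \<open>vnat_family_extend\<close>.\<close>
      let ?m = "gc C Z ?PJ (fobj A J) ?cJ x"
      let ?pk = "gc C Z ?PJ (?P L) (fm (pw T L A) J \<one> (counit T J)) x"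
      let ?pt = "gc C Z ?PJ (?P L) (fm (pw T L A) J \<one> t) x"
      note d = J L Z W Q t x k pt(1-3) pk(1-3) cJ Ao P[OF L] X A' T
      have pkt: "?pk \<in> arr V" "tgt V ?pk = vhom C Z (?P L)" "src V ?pk = J \<otimes> Q" using d by auto
      have ptt: "?pt \<in> arr V" "tgt V ?pt = vhom C Z (?P L)" "src V ?pt = W \<otimes> Q" using d by auto
      note n = bt[OF L Z pkt(1,2)] and p = bt[OF L Z ptt(1,2)]
      have "gc C Z (fobj B L) (fobj B \<one>) (fm B L \<one> (idm V ?E)) (?b Z L ?pt) = gc C Z (fobj A J) ?X (fm A J \<one> t) q \<cdot> swp ?E W Q"
      proof (rule operations_commuteD[OF comm J L Z W E Q t0 _ _ _ _ q])
        show "idm V ?E \<in> homs V ?E (vhom U L \<one>)" using E by simp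
        show "?m \<in> homs V (L \<otimes> Q) (vhom C Z (fobj A J))" using d by auto
        show "?b Z L ?pk \<in> homs V (J \<otimes> Q) (vhom C Z (fobj B L))" using n pkt by simp
        show "?b Z L ?pt \<in> homs V (W \<otimes> Q) (vhom C Z (fobj B L))" using p ptt by simp
        have "gc C Z (fobj B L) ?X (?g L) (?b Z L ?pk) = gc C Z (fobj A J) ?X (fm A J \<one> (counit T J)) ?m \<cdot> swp L J Q"
          using gb[OF L Z pkt(1,2)] pk(4)[OF x(1,2) Z] x k by simp
        then have "gc C Z (fobj B L) ?X (?g L) (?b Z L ?pk) \<cdot> swp J L Q = (gc C Z (fobj A J) ?X (fm A J \<one> (counit T J)) ?m \<cdot> swp L J Q) \<cdot> swp J L Q"
          by simp
        also have "\<dots> = gc C Z (fobj A J) ?X (fm A J \<one> (counit T J)) ?m" using d by simp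
        finally show "gc C Z (fobj A J) ?X (fm A J \<one> (counit T J)) ?m = gc C Z (fobj B L) (fobj B \<one>) (?g L) (?b Z L ?pk) \<cdot> swp J L Q"
          unfolding c ..
        show "gc C Z (fobj B L) (fobj B \<one>) (?g L) (?b Z L ?pt) = gc C Z (fobj A J) ?X (fm A J \<one> t) ?m \<cdot> swp L W Q"
          unfolding c using gb[OF L Z ptt(1,2)] pt(4)[OF x(1,2) Z] x t by simp
        show "gc C Z (fobj A J) ?X (fm A J \<one> (counit T J)) q = gc C Z (fobj B L) (fobj B \<one>) (fm B L \<one> (idm V ?E)) (?b Z L ?pk) \<cdot> swp J ?E Q"
          unfolding c e \<theta>y[OF Z pkt(1,2)] using h by (simp add: fm_def)
      qed
      then show "gc C Z (fobj (pw T L A) \<one>) ?X \<theta> (gc C Z (fobj (pw T L A) J) (fobj (pw T L A) \<one>) (fm (pw T L A) J \<one> t) x) =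
          gc C Z (fobj A J) ?X (fm A J \<one> t) q \<cdot> swp ?E W Q"
        unfolding po[OF J] po[OF unit_arity] \<theta>y[OF Z ptt(1,2)] c using h by (simp add: fm_def)
    qed
    then obtain \<alpha> where \<alpha>: "vnat_family T C (pw T L A) A ?E \<alpha>" "\<alpha> \<one> = \<theta>" by blast
    note l = end_lift[OF T PA A E \<alpha>(1)]
    let ?N = "end_lift T C (pw T L A) A ?E \<alpha>"
    have "fm ?D L \<one> ?N = \<theta>" using l(4)[OF unit_arity] \<alpha>(2) L by (simp add: commutant_fun_simps pw_unit[OF T A])
    then show ?thesis using l(1-3) \<theta>y L by (intro exI[of _ ?N]) (simp add: commutant_theory_simps pw_unit[OF T A])
  qed
  then obtain N where N: "\<And>L. L \<in> \<J> \<Longrightarrow> N L \<in> homs V (vhom U L \<one>) (vhom ?S L \<one>)"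
    and Ny: "\<And>L Z y. \<lbrakk>L \<in> \<J>; Z \<in> vob C; y \<in> arr V; tgt V y = vhom C Z (?P L)\<rbrakk> \<Longrightarrow>
        gc C Z (?P L) ?X (fm ?D L \<one> (N L)) y = gc C Z (fobj B L) ?X (fhom B L \<one>) (?b Z L y)"
    by metis
  have Do: "fobj ?D L = ?P L" if "L \<in> \<J>" for L using that by (simp add: commutant_fun_simps)
  have D1: "?P \<one> = ?X" using X by simp
  \<comment> \<open>Behind the counit of K, the universal operation L \<rightarrow> K is an
    operation L \<rightarrow> I of grade K \<otimes> U(L,K), to which N applies. Factoring through
    the counit of K in the commutant brings the result back to homs into K.\<close>
  define h where "h L K = cfac ?S K \<one> K (counit ?S K) L (vhom U L K) (N L \<cdot> gc U L K \<one> (counit U K) (idm V (vhom U L K)))" for L K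
  have h: "h L K \<in> arr V" "src V (h L K) = vhom U L K" "tgt V (h L K) = vhom ?S L K"
    "gc ?S L K \<one> (counit ?S K) (h L K) = N L \<cdot> gc U L K \<one> (counit U K) (idm V (vhom U L K))"
    if L: "L \<in> \<J>" and K: "K \<in> \<J>" for L K
    using cfac[OF S'(1) counit_cotensor[OF S(1) K], of L "vhom U L K" "N L \<cdot> gc U L K \<one> (counit U K) (idm V (vhom U L K))"]
      N[OF L] L K U U' S' by (auto simp: h_def)
  \<comment> \<open>Naturality of f at the universal operation L \<rightarrow> K. It is proved
    behind the counit of the designated cotensor [K,X], where the property \<open>Ny\<close> of N
    applies.\<close>
  have key: "gc C Z (?P L) (?P K) (fm ?D L K (h L K)) (?f Z L x) = ?f Z K (gc C Z (fobj B L) (fobj B K) (fhom B L K) x)"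
    if L: "L \<in> \<J>" and K: "K \<in> \<J>" and Z: "Z \<in> vob C" and x: "x \<in> arr V" "tgt V x = vhom C Z (fobj B L)" for L K Z x
  proof -
    define Q where "Q = src V x"
    let ?E = "vhom U L K"
    have Q: "Q \<in> obj V" using x by (simp add: Q_def)
    have E: "?E \<in> obj V" using U' L K by simp
    note x' = x Q_def[symmetric]
    note y = ft[OF L Z x, folded Q_def]
    let ?y = "?f Z L x"
    note hLK = h[OF L K]
    have Dh: "fm ?D L K (h L K) \<in> arr V" "src V (fm ?D L K (h L K)) = ?E" "tgt V (fm ?D L K (h L K)) = vhom C (?P L) (?P K)"
      using fm_typing[OF D', of L K "h L K"] hLK S' L K Do by auto
    have Bh: "fhom B L K \<in> arr V" "src V (fhom B L K) = ?E" "tgt V (fhom B L K) = vhom C (fobj B L) (fobj B K)"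
      using vfunctor_hom[OF B', of L K] U' L K by auto
    have kU: "counit U K \<in> arr V" "src V (counit U K) = K" "tgt V (counit U K) = vhom U K \<one>"
      using counit_typing[OF U K] by auto
    have kS: "counit ?S K \<in> arr V" "src V (counit ?S K) = K" "tgt V (counit ?S K) = vhom ?S K \<one>"
      using counit_typing[OF S(1) K] by auto
    let ?k = "gc U L K \<one> (counit U K) (idm V ?E)"
    have k: "?k \<in> arr V" "src V ?k = K \<otimes> ?E" "tgt V ?k = vhom U L \<one>" using kU U' L K E by auto
    note NL = N[OF L, simplified]
    have DN: "fm ?D L \<one> (N L) \<in> arr V" "src V (fm ?D L \<one> (N L)) = vhom U L \<one>" "tgt V (fm ?D L \<one> (N L)) = vhom C (?P L) ?X"
      using fm_typing[OF D', of L \<one> "N L"] NL S' L Do D1 by auto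
    have ck: "fm ?D K \<one> (counit ?S K) = ?c K" by (rule commutant_fun_counit[OF T A K])
    have B1: "fhom B L \<one> \<in> arr V" "src V (fhom B L \<one>) = vhom U L \<one>" "tgt V (fhom B L \<one>) = vhom C (fobj B L) ?X"
      using vfunctor_hom[OF B', of L \<one>] U' L c by auto
    note o = P[OF L] P[OF K] Bo[OF L] Bo[OF K] X Z Q E L K
    have "gc C (?P L) (?P K) ?X (?c K) (fm ?D L K (h L K)) = fm ?D L \<one> (gc ?S L K \<one> (counit ?S K) (h L K))"
      using fm_gc[OF S'(1) C_cat D', of L K \<one> "counit ?S K" "h L K"] kS hLK(1-3) S' L K Do D1 ck by simp
    also have "\<dots> = fm ?D L \<one> (N L) \<cdot> ?k"
      unfolding hLK(4) using fm_cmp[OF D', of L \<one> "N L" ?k] NL k S' L by simp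
    finally have Dk: "gc C (?P L) (?P K) ?X (?c K) (fm ?D L K (h L K)) = fm ?D L \<one> (N L) \<cdot> ?k" .
    have Bk: "gc C (fobj B L) (fobj B K) ?X (?g K) (fhom B L K) = fhom B L \<one> \<cdot> ?k"
      using fm_gc[OF U'(1) C_cat B', of L K \<one> "counit U K" "idm V ?E"] kU U' L K E c B' by (simp add: fm_def)
      have kl: "gc C Z (?P L) ?X (fm ?D L \<one> (N L) \<cdot> ?k) ?y = gc C Z (?P L) ?X (fm ?D L \<one> (N L)) ?y \<cdot> (?k \<otimes>\<^sub>m idm V (src V ?y))"
      by (rule gc_cmp_left[OF C_cat Z P(1)[OF L] X DN(1,3) y(1,3) k(1)]) (simp only: k(3) DN(2))
    have kt: "?k \<otimes>\<^sub>m idm V Q \<in> arr V" "src V (?k \<otimes>\<^sub>m idm V Q) = (K \<otimes> ?E) \<otimes> Q" "tgt V (?k \<otimes>\<^sub>m idm V Q) = vhom U L \<one> \<otimes> Q"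
      using k Q by simp_all
    have yt: "gc C Z (?P L) ?X (fm ?D L \<one> (N L)) ?y \<in> arr V" "src V (gc C Z (?P L) ?X (fm ?D L \<one> (N L)) ?y) = vhom U L \<one> \<otimes> Q"
      using gc_typing[OF C_cat Z P(1)[OF L] X DN(1,3) y(1,3)] unfolding DN(2) y(2) by auto
    have "gc C Z (?P K) ?X (?c K) (gc C Z (?P L) (?P K) (fm ?D L K (h L K)) ?y) =
         gc C Z (?P L) ?X (gc C (?P L) (?P K) ?X (?c K) (fm ?D L K (h L K))) ?y \<cdot> ai K ?E Q"
      using gc_assoc_left[OF C_cat Z P(1)[OF L] P(1)[OF K] X P(2)[OF K] P(4)[OF K] Dh(1,3) y(1,3)]
      unfolding P(3)[OF K] Dh(2) y(2) .
    also have "\<dots> = gc C Z (?P L) ?X (fm ?D L \<one> (N L)) ?y \<cdot> ((?k \<otimes>\<^sub>m idm V Q) \<cdot> ai K ?E Q)"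
        unfolding Dk kl y(2) by (rule cmp_assoc') (use kt yt L K E Q in simp_all)
    also have "gc C Z (?P L) ?X (fm ?D L \<one> (N L)) ?y = gc C Z (fobj B L) ?X (fhom B L \<one>) x"
        using Ny[OF L Z y(1,3)] bf[OF L Z x] by simp
    also have "gc C Z (fobj B L) ?X (fhom B L \<one>) x \<cdot> ((?k \<otimes>\<^sub>m idm V Q) \<cdot> ai K ?E Q) =
         gc C Z (fobj B L) ?X (gc C (fobj B L) (fobj B K) ?X (?g K) (fhom B L K)) x \<cdot> ai K ?E Q"
        unfolding Bk using B1 k x' o by simp
    also have "\<dots> = gc C Z (fobj B K) ?X (?g K) (gc C Z (fobj B L) (fobj B K) (fhom B L K) x)"
        using g[OF K] Bh x' o by simp
    also have "\<dots> = gc C Z (?P K) ?X (?c K) (?f Z K (gc C Z (fobj B L) (fobj B K) (fhom B L K) x))"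
        by (rule cf[OF K Z, symmetric]) (use Bh x' o in auto)
    finally have e: "gc C Z (?P K) ?X (?c K) (gc C Z (?P L) (?P K) (fm ?D L K (h L K)) ?y) =
         gc C Z (?P K) ?X (?c K) (?f Z K (gc C Z (fobj B L) (fobj B K) (fhom B L K) x))" .
    have z: "gc C Z (fobj B L) (fobj B K) (fhom B L K) x \<in> arr V"
      "tgt V (gc C Z (fobj B L) (fobj B K) (fhom B L K) x) = vhom C Z (fobj B K)"
      "src V (gc C Z (fobj B L) (fobj B K) (fhom B L K) x) = ?E \<otimes> Q"
      using Bh x' o by auto
    note fz = ft[OF K Z z(1,2)]
    show ?thesis
    proof (rule cot_cancel[OF C_cat ccot[OF K] Z _ _ fz(1,3) _ e])
      note dt = gc_typing[OF C_cat Z P(1)[OF L] P(1)[OF K] Dh(1,3) y(1,3)]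
      show "gc C Z (?P L) (?P K) (fm ?D L K (h L K)) ?y \<in> arr V"
        "tgt V (gc C Z (?P L) (?P K) (fm ?D L K (h L K)) ?y) = vhom C Z (?P K)" by (rule dt(1), rule dt(3))
      show "src V (gc C Z (?P L) (?P K) (fm ?D L K (h L K)) ?y) = src V (?f Z K (gc C Z (fobj B L) (fobj B K) (fhom B L K) x))"
        unfolding dt(2) fz(2) z(3) Dh(2) y(2) ..
    qed
  qed
  define M where "M = mk_vfun \<J> (\<lambda>L. L) h"
  have Mo: "fobj M L = L" if "L \<in> \<J>" for L using that by (simp add: M_def mk_vfun_def)
  have Mt: "fm M L K t \<in> arr V" "src V (fm M L K t) = src V t" "tgt V (fm M L K t) = vhom ?S L K"
    if "L \<in> \<J>" "K \<in> \<J>" "t \<in> arr V" "tgt V t = vhom U L K" for L K t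
    using that h[of L K] by (auto simp: M_def mk_vfun_def fm_def)
  have DM: "gc C Z (?P L) (?P K) (fm ?D L K (fm M L K t)) (?f Z L x) = ?f Z K (gc C Z (fobj B L) (fobj B K) (fm B L K t) x)"
    if L: "L \<in> \<J>" and K: "K \<in> \<J>" and Z: "Z \<in> vob C" and t: "t \<in> arr V" "tgt V t = vhom U L K"
      and x: "x \<in> arr V" "tgt V x = vhom C Z (fobj B L)" for L K Z t x
  proof -
    note hLK = h(1-3)[OF L K] and y = ft[OF L Z x]
    have Dh: "fm ?D L K (h L K) \<in> arr V" "src V (fm ?D L K (h L K)) = vhom U L K" "tgt V (fm ?D L K (h L K)) = vhom C (?P L) (?P K)"
      using fm_typing[OF D', of L K "h L K"] hLK S' L K Do by auto
    have Bh: "fhom B L K \<in> arr V" "src V (fhom B L K) = vhom U L K" "tgt V (fhom B L K) = vhom C (fobj B L) (fobj B K)"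
      using vfunctor_hom[OF B', of L K] U' L K by auto
    note o = P[OF L] P[OF K] Bo[OF L] Bo[OF K] Z f(1-3)[OF K]
    have "fm ?D L K (fm M L K t) = fm ?D L K (h L K) \<cdot> t"
      using fm_cmp[OF D', of L K "h L K" t] hLK t L K S' by (simp add: M_def mk_vfun_def fm_def[of "\<lparr>fobj = _, fhom = _\<rparr>"])
    then have "gc C Z (?P L) (?P K) (fm ?D L K (fm M L K t)) (?f Z L x) =
       gc C Z (?P L) (?P K) (fm ?D L K (h L K)) (?f Z L x) \<cdot> (t \<otimes>\<^sub>m idm V (src V x))"
      using Dh y t o by simp
    also have "\<dots> = ?f Z K (gc C Z (fobj B L) (fobj B K) (fhom B L K) x) \<cdot> (t \<otimes>\<^sub>m idm V (src V x))"
      using key[OF L K Z x] by simp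
    also have "\<dots> = ?f Z K (gc C Z (fobj B L) (fobj B K) (fm B L K t) x)"
      using Bh t x o by (simp add: fm_def)
    finally show ?thesis .
  qed
  \<comment> \<open>Operations of the commutant may be compared in C on elements of the form
    \<open>?f Z L x\<close>, since the identity is among these by \<open>fb\<close>. Functoriality
    of M and preservation of counits are thereby reduced to facts about B.\<close>
  have Deq: "g1 = g2"
    if L: "L \<in> \<J>" and K: "K \<in> \<J>" and g1: "g1 \<in> arr V" "tgt V g1 = vhom ?S L K" and g2: "g2 \<in> arr V" "tgt V g2 = vhom ?S L K" "src V g1 = src V g2"
      and e: "\<And>Z x. \<lbrakk>Z \<in> vob C; x \<in> arr V; tgt V x = vhom C Z (fobj B L)\<rbrakk> \<Longrightarrow>
        gc C Z (?P L) (?P K) (fm ?D L K g1) (?f Z L x) = gc C Z (?P L) (?P K) (fm ?D L K g2) (?f Z L x)" for L K g1 g2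
  proof (rule commutant_fun_faithful[OF T A L K g1 g2])
    let ?v = "vid C (?P L)"
    have v: "?v \<in> arr V" "tgt V ?v = vhom C (?P L) (?P L)" using P[OF L] by auto
    note bv = bt[OF L P(1)[OF L] v]
    have "gc C (?P L) (?P L) (?P K) (fm ?D L K g1) ?v = gc C (?P L) (?P L) (?P K) (fm ?D L K g2) ?v"
      using e[OF P(1)[OF L] bv(1,3)] fb[OF L P(1)[OF L] v] by simp
    then show "fm ?D L K g1 = fm ?D L K g2"
      by (rule gc_eqI[where C = C and W = "src V g2" and X = "?P L" and Y = "?P K", rotated -1])
        (use fm_typing[OF D', of L K g1] fm_typing[OF D', of L K g2] g1 g2 S' L K Do P[OF L] P[OF K] in auto)
  qed
  have f1: "f \<one> = vid C ?X"
  proof -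
    have "gc C (fobj B \<one>) ?X ?X (vid C ?X) (f \<one>) = vid C ?X \<cdot> runit V \<one>"
      using f(4)[OF unit_arity] counit_unit[OF U] fm_vid[OF B', of \<one>] X c U' by simp
    then have "f \<one> \<cdot> runit V \<one> = vid C ?X \<cdot> runit V \<one>"
      using f(1-3)[OF unit_arity] X c by (simp add: lunit_eq_runit)
    then show ?thesis by (rule iso_cancel_right[rotated -1]) (use f(1-3)[OF unit_arity] X in auto)
  qed
  have Mf: "vfunctor U ?S M"
  proof (rule vfunctorI[OF U'(1) S'(1)])
    show "fobj M \<in> vob U \<rightarrow>\<^sub>E vob ?S" using U' S' by (auto simp: M_def mk_vfun_def)
    show "fhom M L K = undefined" if "L \<notin> vob U \<or> K \<notin> vob U" for L K using that U' by (auto simp: M_def mk_vfun_def)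
    show "fhom M L K \<in> homs V (vhom U L K) (vhom ?S (fobj M L) (fobj M K))" if "L \<in> vob U" "K \<in> vob U" for L K
      using that U' h[of L K] by (simp add: M_def mk_vfun_def)
    show "fhom M L L \<cdot> vid U L = vid ?S (fobj M L)" if "L \<in> vob U" for L
      unfolding fm_def[symmetric]
    proof -
      have L: "L \<in> \<J>" using that U' by simp
      note o = P[OF L] Bo[OF L] f(1-3)[OF L]
      have vS: "vid ?S L \<in> arr V" "src V (vid ?S L) = \<one>" "tgt V (vid ?S L) = vhom ?S L L" using S' L by auto
      have "fm M L L (vid U L) = vid ?S L"
      proof (rule Deq[OF L L])
        fix Z x assume Z: "Z \<in> vob C" and x: "x \<in> arr V" "tgt V x = vhom C Z (fobj B L)"
        have "gc C Z (?P L) (?P L) (fm ?D L L (fm M L L (vid U L))) (?f Z L x) = ?f Z L (gc C Z (fobj B L) (fobj B L) (vid C (fobj B L)) x)"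
          using DM[OF L L Z _ _ x, of "vid U L"] fm_vid[OF B', of L] U' L by simp
        also have "\<dots> = gc C Z (?P L) (?P L) (fm ?D L L (vid ?S L)) (?f Z L x)"
          using fm_vid[OF D', of L] S' L Do o Z x by simp
        finally show "gc C Z (?P L) (?P L) (fm ?D L L (fm M L L (vid U L))) (?f Z L x) = gc C Z (?P L) (?P L) (fm ?D L L (vid ?S L)) (?f Z L x)" .
      qed (use Mt[OF L L, of "vid U L"] U' L vS in auto)
      then show "fm M L L (vid U L) = vid ?S (fobj M L)" using Mo L by simp
    qed
    show "fm M J L (gc U J K L w v) = gc ?S (fobj M J) (fobj M K) (fobj M L) (fm M K L w) (fm M J K v)"
      if w0: "w \<in> el U (vhom U K L) K L" and v0: "v \<in> el U (vhom U J K) J K" for J K L w v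
    proof -
      have J: "J \<in> \<J>" and K: "K \<in> \<J>" and L: "L \<in> \<J>" using w0 v0 U' by auto
      have w: "w \<in> arr V" "tgt V w = vhom U K L" and v: "v \<in> arr V" "tgt V v = vhom U J K" using w0 v0 by auto
      have wv: "gc U J K L w v \<in> arr V" "tgt V (gc U J K L w v) = vhom U J L" "src V (gc U J K L w v) = src V w \<otimes> src V v"
        using w v U' J K L by auto
      note Mw = Mt[OF K L w] and Mv = Mt[OF J K v] and Mwv = Mt[OF J L wv(1,2)]
      note o = P[OF J] P[OF K] P[OF L] Bo[OF J] Bo[OF K] Bo[OF L] f(1-3)[OF J] f(1-3)[OF K] f(1-3)[OF L]
      have gS: "gc ?S J K L (fm M K L w) (fm M J K v) \<in> arr V" "tgt V (gc ?S J K L (fm M K L w) (fm M J K v)) = vhom ?S J L"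
        "src V (gc ?S J K L (fm M K L w) (fm M J K v)) = src V w \<otimes> src V v"
        using Mw Mv S' J K L by auto
      have Dw: "fm ?D K L (fm M K L w) \<in> arr V" "src V (fm ?D K L (fm M K L w)) = src V w" "tgt V (fm ?D K L (fm M K L w)) = vhom C (?P K) (?P L)"
        using fm_typing[OF D', of K L "fm M K L w"] Mw S' K L Do by auto
      have Dv: "fm ?D J K (fm M J K v) \<in> arr V" "src V (fm ?D J K (fm M J K v)) = src V v" "tgt V (fm ?D J K (fm M J K v)) = vhom C (?P J) (?P K)"
        using fm_typing[OF D', of J K "fm M J K v"] Mv S' J K Do by auto
      have Bw: "fm B K L w \<in> arr V" "src V (fm B K L w) = src V w" "tgt V (fm B K L w) = vhom C (fobj B K) (fobj B L)"
        using fm_typing[OF B', of K L w] w U' K L by auto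
      have Bv: "fm B J K v \<in> arr V" "src V (fm B J K v) = src V v" "tgt V (fm B J K v) = vhom C (fobj B J) (fobj B K)"
        using fm_typing[OF B', of J K v] v U' J K by auto
      have "fm M J L (gc U J K L w v) = gc ?S J K L (fm M K L w) (fm M J K v)"
      proof (rule Deq[OF J L Mwv(1,3) gS(1,2)])
        show "src V (fm M J L (gc U J K L w v)) = src V (gc ?S J K L (fm M K L w) (fm M J K v))" using Mwv gS wv by simp
        fix Z x assume Z: "Z \<in> vob C" and x: "x \<in> arr V" "tgt V x = vhom C Z (fobj B J)"
        let ?z = "gc C Z (fobj B J) (fobj B K) (fm B J K v) x"
        have z: "?z \<in> arr V" "tgt V ?z = vhom C Z (fobj B K)" "src V ?z = src V v \<otimes> src V x" using Bv x o Z by auto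
        let ?a = "assoc V (src V w) (src V v) (src V x)"
        have oo: "src V w \<in> obj V" "src V v \<in> obj V" "src V x \<in> obj V" using w v x by auto
        note y = ft[OF J Z x]
        have "gc C Z (?P J) (?P L) (fm ?D J L (fm M J L (gc U J K L w v))) (?f Z J x) =
          ?f Z L (gc C Z (fobj B J) (fobj B L) (fm B J L (gc U J K L w v)) x)"
          by (rule DM[OF J L Z wv(1,2) x])
        also have "fm B J L (gc U J K L w v) = gc C (fobj B J) (fobj B K) (fobj B L) (fm B K L w) (fm B J K v)"
          by (rule fm_gc[OF U'(1) C_cat B']) (use U' J K L w v in auto)
        also have "?f Z L (gc C Z (fobj B J) (fobj B L) (gc C (fobj B J) (fobj B K) (fobj B L) (fm B K L w) (fm B J K v)) x) =
          ?f Z L (gc C Z (fobj B K) (fobj B L) (fm B K L w) ?z) \<cdot> ?a"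
          using Bw Bv x o Z oo by simp
        also have "?f Z L (gc C Z (fobj B K) (fobj B L) (fm B K L w) ?z) = gc C Z (?P K) (?P L) (fm ?D K L (fm M K L w)) (?f Z K ?z)"
          by (rule DM[OF K L Z w z(1,2), symmetric])
        also have "?f Z K ?z = gc C Z (?P J) (?P K) (fm ?D J K (fm M J K v)) (?f Z J x)"
          by (rule DM[OF J K Z v x, symmetric])
        also have "gc C Z (?P K) (?P L) (fm ?D K L (fm M K L w)) (gc C Z (?P J) (?P K) (fm ?D J K (fm M J K v)) (?f Z J x)) \<cdot> ?a =
          gc C Z (?P J) (?P L) (gc C (?P J) (?P K) (?P L) (fm ?D K L (fm M K L w)) (fm ?D J K (fm M J K v))) (?f Z J x)"
          using Dw Dv y o Z by simp
        also have "gc C (?P J) (?P K) (?P L) (fm ?D K L (fm M K L w)) (fm ?D J K (fm M J K v)) = fm ?D J L (gc ?S J K L (fm M K L w) (fm M J K v))"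
          using fm_gc[OF S'(1) C_cat D', of J K L "fm M K L w" "fm M J K v"] Mw Mv S' J K L Do by simp
        finally show "gc C Z (?P J) (?P L) (fm ?D J L (fm M J L (gc U J K L w v))) (?f Z J x) =
          gc C Z (?P J) (?P L) (fm ?D J L (gc ?S J K L (fm M K L w) (fm M J K v))) (?f Z J x)" .
      qed
      then show ?thesis using Mo J K L by simp
    qed
  qed
  have Mc: "fm M J \<one> (counit U J) = counit ?S J" if J: "J \<in> \<J>" for J
  proof (rule Deq[OF J unit_arity])
    note kU = counit_typing[OF U J] and kS = counit_typing[OF S(1) J]
    fix Z x assume Z: "Z \<in> vob C" and x: "x \<in> arr V" "tgt V x = vhom C Z (fobj B J)"
    have "gc C Z (?P J) (?P \<one>) (fm ?D J \<one> (fm M J \<one> (counit U J))) (?f Z J x) = ?f Z \<one> (gc C Z (fobj B J) (fobj B \<one>) (?g J) x)"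
      by (rule DM[OF J unit_arity Z kU(1,3) x])
    also have "\<dots> = gc C Z (fobj B J) ?X (?g J) x"
      using f1 D1 c x g[OF J] X Bo[OF J] Z by simp
    also have "\<dots> = gc C Z (?P J) (?P \<one>) (?c J) (?f Z J x)" using cf[OF J Z x] D1 by simp
    finally show "gc C Z (?P J) (?P \<one>) (fm ?D J \<one> (fm M J \<one> (counit U J))) (?f Z J x) =
      gc C Z (?P J) (?P \<one>) (fm ?D J \<one> (counit ?S J)) (?f Z J x)"
      unfolding commutant_fun_counit[OF T A J] .
  qed (use Mt[OF J unit_arity, of "counit U J"] counit_typing[OF U J] counit_typing[OF S(1) J] in auto)
  have "theory_mor U ?S M" unfolding theory_mor_iff[OF U S(1)] using Mf Mo Mc by blast
  moreover have "f \<in> extensional \<J>" by (simp add: f_def)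
  moreover have "f \<one> = vid C (fobj B \<one>)" using f1 c by simp
  ultimately have "amor U B ?S ?D M f"
    unfolding amor_def using f DM Do by auto
  then show ?thesis by blast
qed

lemma commutes_sym:
  assumes a: "is_algebra C \<A>" and b: "is_algebra C \<B>" and c: "carrier_obj \<A> = X" "carrier_obj \<B> = X"
    and h: "homs (Alg C X) \<B> (commutant C \<A>) \<noteq> {}"
  shows "homs (Alg C X) \<A> (commutant C \<B>) \<noteq> {}"
proof -
  obtain T A U B where e: "\<A> = (T, A)" "\<B> = (U, B)" by (cases \<A>, cases \<B>)
  have T: "theory_ok T" "algebra_ok T C A" "fobj A \<one> = X" and U: "theory_ok U" "algebra_ok U C B" "fobj B \<one> = X"
    using a b c by (auto simp: e is_algebra_def carrier_obj_def)
  have X: "X \<in> vob C" using algebra_okD[OF T(2)] T by auto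
  obtain M f where "amor U B (commutant_theory C (T, A)) (commutant_fun (T, A)) M f"
    using h unfolding e commutant_eq ex_in_conv[symmetric] homs_Alg by blast
  then have "operations_commute T A U B" using amor_commutant_imp T U by metis
  then have "operations_commute U B T A" by (rule operations_commute_sym[OF T(1,2) U(1,2)])
  then obtain N g where n: "amor T A (commutant_theory C (U, B)) (commutant_fun (U, B)) N g"
    using amor_commutant_exists[OF U(1,2) T(1,2)] T U by metis
  have "fobj (commutant_fun (U, B)) \<one> = X" using U X by (simp add: commutant_fun_simps)
  then show ?thesis
    unfolding e commutant_eq ex_in_conv[symmetric] homs_Alg
    using n T commutant_theory(1)[OF U(1,2)] commutant_algebra[OF U(1,2)] by blast
qed

lemma hom_commutant_unique:
  assumes a: "is_algebra C \<A>" "carrier_obj \<A> = X"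
    and m: "m \<in> homs (Alg C X) \<B> (commutant C \<A>)" and n: "n \<in> homs (Alg C X) \<B> (commutant C \<A>)"
  shows "m = n"
proof -
  obtain T A U B where e: "\<A> = (T, A)" "\<B> = (U, B)" by (cases \<A>, cases \<B>)
  have T: "theory_ok T" "algebra_ok T C A" "fobj A \<one> = X"
    using a by (auto simp: e is_algebra_def carrier_obj_def)
  show ?thesis using m n amor_commutant_unique[OF T(1,2), of U B] T(3)
    unfolding e commutant_eq homs_Alg by metis
qed

end

section \<open>The formal argument in an ordinary category\<close>

context category
begin

text \<open>Where endomorphisms are unique, both composites are forced to be identities; arrows in
  the two directions suffice.\<close>

lemma iso_uniqueI:
  assumes "f \<in> homs V a b" "g \<in> homs V b a" "\<And>h k. \<lbrakk>h \<in> homs V a a; k \<in> homs V a a\<rbrakk> \<Longrightarrow> h = k"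
    "\<And>h k. \<lbrakk>h \<in> homs V b b; k \<in> homs V b b\<rbrakk> \<Longrightarrow> h = k"
  shows "iso_arrow V f"
proof (rule iso_arrowI[OF assms(1,2)])
  have o: "a \<in> obj V" "b \<in> obj V" using assms(1) by auto
  show "g \<cdot> f = idm V a" by (rule assms(3)) (use assms(1,2) o in auto)
  show "f \<cdot> g = idm V b" by (rule assms(4)) (use assms(1,2) o in auto)
qed

text \<open>Uniqueness is available for arrows into values of P only. An isomorphism from a to such
  a value carries it over to the endomorphisms of a.\<close>

lemma iso_endo_unique:
  assumes i: "iso_arrow V i" and t: "i \<in> homs V a b"
    and u: "\<And>h k. \<lbrakk>h \<in> homs V a b; k \<in> homs V a b\<rbrakk> \<Longrightarrow> h = k" and h: "h \<in> homs V a a" and k: "k \<in> homs V a a"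
  shows "h = k"
proof -
  have e: "i \<cdot> h = i \<cdot> k" by (rule u) (use t h k in auto)
  show ?thesis by (rule iso_cancel_left[OF i _ _ _ _ e]) (use t h k in auto)
qed

text \<open>The assumptions make \<open>P\<close> a symmetric Galois connection up to isomorphism.\<close>

lemma galois_isomorphic_iff:
  assumes P: "\<And>a. a \<in> obj V \<Longrightarrow> P a \<in> obj V"
    and un: "\<And>a b m n. \<lbrakk>a \<in> obj V; m \<in> homs V b (P a); n \<in> homs V b (P a)\<rbrakk> \<Longrightarrow> m = n"
    and sym: "\<And>a b. \<lbrakk>a \<in> obj V; b \<in> obj V; homs V b (P a) \<noteq> {}\<rbrakk> \<Longrightarrow> homs V a (P b) \<noteq> {}"
    and a: "a \<in> obj V"
  shows "isomorphic V a (P a) \<longleftrightarrow> homs V a (P a) \<noteq> {} \<and> homs V (P a) (P (P a)) \<noteq> {} \<and>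
      (\<exists>m. homs V a (P (P a)) = {m} \<and> iso_arrow V m)"
    and "isomorphic V (P a) (P (P a)) \<longleftrightarrow> homs V a (P a) \<noteq> {} \<and> homs V (P a) (P (P a)) \<noteq> {}"
proof -
  have Pa: "P a \<in> obj V" "P (P a) \<in> obj V" using P a by auto
  have cmp: "homs V x z \<noteq> {}" if h: "homs V x y \<noteq> {}" "homs V y z \<noteq> {}" for x y z
  proof -
    obtain f g where "f \<in> homs V x y" "g \<in> homs V y z" using h by blast
    then have "g \<cdot> f \<in> homs V x z" by auto
    then show ?thesis by blast
  qed
  \<comment> \<open>The unit of the connection: symmetry applied to the identity of
    \<open>P b\<close>.\<close>
  have unit: "homs V b (P (P b)) \<noteq> {}" if b: "b \<in> obj V" for b
  proof (rule sym[OF b P[OF b]])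
    have "idm V (P b) \<in> homs V (P b) (P b)" using P[OF b] by simp
    then show "homs V (P b) (P b) \<noteq> {}" by blast
  qed
  \<comment> \<open>P reverses arrows: b \<rightarrow> c continues to \<open>P (P c)\<close> by the
    unit, and symmetry turns this into \<open>P c\<close> \<rightarrow> \<open>P b\<close>.\<close>
  have anti: "homs V (P c) (P b) \<noteq> {}" if b: "b \<in> obj V" and c: "c \<in> obj V" and h: "homs V b c \<noteq> {}" for b c
    by (rule sym[OF P[OF c] b cmp[OF h unit[OF c]]])
  have unA: "m = n" if "m \<in> homs V b (P a)" "n \<in> homs V b (P a)" for b m n using un[OF a that] .
  have unP: "m = n" if "m \<in> homs V b (P (P a))" "n \<in> homs V b (P (P a))" for b m n using un[OF Pa(1) that] .
  have isoD: "\<exists>f g. iso_arrow V f \<and> f \<in> homs V x y \<and> g \<in> homs V y x" if "isomorphic V x y" for x y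
  proof -
    obtain f where f: "f \<in> homs V x y" "iso_arrow V f" using \<open>isomorphic V x y\<close> unfolding isomorphic_def by blast
    then have "inv_arrow V f \<in> homs V y x" by auto
    then show ?thesis using f by blast
  qed
  show "isomorphic V a (P a) \<longleftrightarrow> homs V a (P a) \<noteq> {} \<and> homs V (P a) (P (P a)) \<noteq> {} \<and>
      (\<exists>m. homs V a (P (P a)) = {m} \<and> iso_arrow V m)"
  proof
    assume "isomorphic V a (P a)"
    then obtain f g where f: "iso_arrow V f" "f \<in> homs V a (P a)" and g: "g \<in> homs V (P a) a" using isoD by blast
    have 1: "homs V a (P a) \<noteq> {}" "homs V (P a) a \<noteq> {}" using f g by blast+
    \<comment> \<open>P applied to a \<rightarrow> P a; continued from \<open>P a\<close> to a, this
      gives the arrow back that makes the unit at a invertible.\<close>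
    have 2: "homs V (P (P a)) (P a) \<noteq> {}" by (rule anti[OF a Pa(1) 1(1)])
    obtain m where m: "m \<in> homs V a (P (P a))" using unit[OF a] by blast
    obtain k where k: "k \<in> homs V (P (P a)) a" using cmp[OF 2 1(2)] by blast
    have "iso_arrow V m"
      by (rule iso_uniqueI[OF m k iso_endo_unique[OF f(1,2) unA] unP])
    moreover have "homs V a (P (P a)) = {m}" using m unP by blast
    ultimately show "homs V a (P a) \<noteq> {} \<and> homs V (P a) (P (P a)) \<noteq> {} \<and> (\<exists>m. homs V a (P (P a)) = {m} \<and> iso_arrow V m)"
      using 1 cmp[OF 1(2) unit[OF a]] by blast
  next
    assume h: "homs V a (P a) \<noteq> {} \<and> homs V (P a) (P (P a)) \<noteq> {} \<and> (\<exists>m. homs V a (P (P a)) = {m} \<and> iso_arrow V m)"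
    then obtain m where m: "m \<in> homs V a (P (P a))" "iso_arrow V m" by blast
    \<comment> \<open>Saturation allows the arrow from \<open>P a\<close> to \<open>P (P a)\<close>
      given by contracommutativity to be continued to a.\<close>
    then have "inv_arrow V m \<in> homs V (P (P a)) a" by auto
    then obtain g where g: "g \<in> homs V (P a) a" using h cmp[of "P a" "P (P a)" a] by blast
    obtain f where f: "f \<in> homs V a (P a)" using h by blast
    have "iso_arrow V f"
      by (rule iso_uniqueI[OF f g iso_endo_unique[OF m(2,1) unP] unA])
    then show "isomorphic V a (P a)" using f unfolding isomorphic_def by blast
  qed
  show "isomorphic V (P a) (P (P a)) \<longleftrightarrow> homs V a (P a) \<noteq> {} \<and> homs V (P a) (P (P a)) \<noteq> {}"
  proof
    assume "isomorphic V (P a) (P (P a))"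
    then obtain f g where "f \<in> homs V (P a) (P (P a))" "g \<in> homs V (P (P a)) (P a)" using isoD by blast
    then show "homs V a (P a) \<noteq> {} \<and> homs V (P a) (P (P a)) \<noteq> {}" using cmp[OF unit[OF a]] by blast
  next
    assume h: "homs V a (P a) \<noteq> {} \<and> homs V (P a) (P (P a)) \<noteq> {}"
    then obtain f where f: "f \<in> homs V (P a) (P (P a))" by blast
    \<comment> \<open>Commutativity of a, reversed by P, is the arrow back from
      \<open>P (P a)\<close>.\<close>
    obtain g where g: "g \<in> homs V (P (P a)) (P a)" using anti[OF a Pa(1)] h by blast
    have "iso_arrow V f" by (rule iso_uniqueI[OF f g unA unP])
    then show "isomorphic V (P a) (P (P a))" using f unfolding isomorphic_def by blast
  qed
qed

end

theorem proposition13p12: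
  fixes V :: "('o, 'm) smc" and \<J> :: "'o set"
    and C :: "('c, 'o, 'm) cvcat" and A :: "('o, 'c, 'm) alg"
  assumes "arity_system V \<J>"
    and "has_pullbacks V"
    and "arity_system.admissible V \<J> C"
    and "arity_system.is_algebra V \<J> C A"
  shows "(arity_system.balanced V \<J> C A \<longleftrightarrow>
            arity_system.commutative V \<J> C A \<and>
            arity_system.contracommutative V \<J> C A \<and>
            arity_system.saturated V \<J> C A) \<and>
         (arity_system.balanced V \<J> C (arity_system.commutant V \<J> C A) \<longleftrightarrow>
            arity_system.commutative V \<J> C A \<and>
            arity_system.contracommutative V \<J> C A)"
proof -
  interpret arity_system V \<J> by (rule assms(1))
  interpret admissible_vcat V \<J> C by unfold_locales (rule assms(3))
  define X where "X = carrier_obj A"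
  interpret algebras: category "Alg C X" by (rule category_Alg)
  have obj: "\<A> \<in> obj (Alg C X) \<longleftrightarrow> is_algebra C \<A> \<and> carrier_obj \<A> = X" for \<A>
    by (simp add: Alg_def)
  have A: "A \<in> obj (Alg C X)" unfolding obj using assms(4) by (simp add: X_def)
  have P: "commutant C \<A> \<in> obj (Alg C X)" if "\<A> \<in> obj (Alg C X)" for \<A>
    using that commutant_is_algebra by (simp add: obj)
  \<comment> \<open>The definitions applied to the commutant refer to its own carrier, which must be
    recognized as X for all homs to lie in the same category.\<close>
  note carrier = A[unfolded obj] P[OF A, unfolded obj]
  have un: "m = n" if "\<A> \<in> obj (Alg C X)" "m \<in> homs (Alg C X) \<B> (commutant C \<A>)"
    "n \<in> homs (Alg C X) \<B> (commutant C \<A>)" for \<A> \<B> m n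
    using hom_commutant_unique[OF _ _ that(2,3)] that(1) obj by blast
  have sym: "homs (Alg C X) \<A> (commutant C \<B>) \<noteq> {}" if "\<A> \<in> obj (Alg C X)" "\<B> \<in> obj (Alg C X)"
    "homs (Alg C X) \<B> (commutant C \<A>) \<noteq> {}" for \<A> \<B>
    using commutes_sym[OF _ _ _ _ that(3)] that(1,2) obj by blast
  note iff = algebras.galois_isomorphic_iff[where P = "commutant C", OF P un sym A]
  show ?thesis
    unfolding balanced_def commutative_def contracommutative_def commutes_def saturated_def
    using iff carrier by simp
qed

end
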